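(* Let $f$ and $g$ be topologically conjugate $C^3$ critical circle maps with common irrational rotation number $\rho$, and let $h:S^1\to S^1$ be the conjugacy between $f$ and $g$ ($h\circ f=g\circ h$) which maps the critical point of $f$ to the critical point of $g$. Suppose that the partial quotients of $\rho$ are bounded, and that the renormalizations of $f$ and $g$ converge together exponentially fast in the $C^0$-topology, i.e. there are constants $C>0$ and $0<\lambda<1$ such that $d_0(\mathbf f_n,\mathbf g_n)\le C\lambda^n$ for all $n\ge 1$, where $\mathbf f_n$ and $\mathbf g_n$ are the $n$-th renormalizations of $f$ and $g$. Then $h$ is $C^{1+\alpha}$ for some $\alpha>0$.
   Context: $S^1=\mathbb R/\mathbb Z$. A $C^r$ critical circle map is a $C^r$ (orientation-preserving) homeomorphism $f:S^1\to S^1$ with a unique point $c$ (the critical point) such that $f'(c)=0$, $f'(x)\ne 0$ for $x\neq c$, and which in a suitable $C^r$ coordinate system around $c$ has the form $x\mapsto x|x|^{p-1}+a$ for some real $p>1$ (the power-law exponent). The rotation number is written as a continued fraction $\rho=[a_0,a_1,\dots]=1/(a_0+1/(a_1+\cdots))$; the positive integers $a_n$ are its partial quotients. Return times: $q_0=1$, $q_1=a_0$, $q_{n+1}=a_nq_n+q_{n-1}$. $I_n$ denotes the closed arc with endpoints $c$ and $f^{q_n}(c)$ which contains $f^{q_{n+2}}(c)$; $|\cdot|$ is arc length. Renormalization. For $n\ge1$ let $A_{n-1}:\mathbb R\to\mathbb R/\mathbb Z$ be the affine covering map with $A_{n-1}([0,1])=I_{n-1}$, $A_{n-1}(0)=c$,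 $A_{n-1}(1)=f^{q_{n-1}}(c)$, and let $\lambda_n=-|I_n|/|I_{n-1}|$, so $A_{n-1}([\lambda_n,0])=I_n$. The $n$-th renormalization $\mathbf f_n$ of $f$ is the pair of maps $\mathbf f_{n,-}=A_{n-1}^{-1}\circ f^{q_{n-1}}\circ A_{n-1}$ on $[\lambda_n,0]$ and $\mathbf f_{n,+}=A_{n-1}^{-1}\circ f^{q_n}\circ A_{n-1}$ on $[0,1]$ (using the inverse branch mapping $I_n\cup I_{n-1}$ onto $[\lambda_n,1]$). Metric. For pairs $\mathbf f=(\mathbf f_-:[\lambda,0]\to\mathbb R,\ \mathbf f_+:[0,1]\to\mathbb R)$ and $\mathbf g=(\mathbf g_-:[\mu,0]\to\mathbb R,\ \mathbf g_+:[0,1]\to\mathbb R)$ with $\lambda,\mu<0$, let $A_\lambda$ be the fractional linear map sending $\lambda,0,1$ to $0,\tfrac12,1$, and $A_\mu$ likewise. Then $d_k(\mathbf f,\mathbf g)$ is the maximum of $|\lambda-\mu|$, the $C^k$ norm of $A_\lambda\mathbf f_-A_\lambda^{-1}-A_\mu\mathbf g_-A_\mu^{-1}$ on $[0,\frac12]$, and the $C^k$ norm of $A_\lambda\mathbf f_+A_\lambda^{-1}-A_\mu\mathbf g_+A_\mu^{-1}$ on $[\frac12,1]$. *)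

theory Defs
  imports "HOL-Analysis.Analysis"
begin

section \<open>The circle\<close>

quotient_type circle = real / "\<lambda>x y :: real. x - y \<in> \<int>"
  morphisms rep_circle proj
proof (rule equivpI)
  show "reflp (\<lambda>x y :: real. x - y \<in> \<int>)"
    by (simp add: reflp_def)
  show "symp (\<lambda>x y :: real. x - y \<in> \<int>)"
  proof (rule sympI)
    fix x y :: real
    assume "x - y \<in> \<int>"
    then have "- (x - y) \<in> \<int>" by (rule Ints_minus)
    then show "y - x \<in> \<int>" by simp
  qed
  show "transp (\<lambda>x y :: real. x - y \<in> \<int>)"
  proof (rule transpI)
    fix x y z :: real
    assume "x - y \<in> \<int>" "y - z \<in> \<int>"
    then have "(x - y) + (y - z) \<in> \<int>" by (rule Ints_add)
    then show "x - z \<in> \<int>" by simp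
  qed
qed

lemma proj_eq_iff: "proj x = proj y \<longleftrightarrow> x - y \<in> \<int>"
  by (rule circle.abs_eq_iff)

lemma surj_proj: "surj proj"
proof (rule surjI)
  show "proj (rep_circle u) = u" for u
    by (rule Quotient_abs_rep [OF Quotient_circle])
qed

text \<open>The quotient topology.\<close>

instantiation circle :: topological_space
begin

definition open_circle :: "circle set \<Rightarrow> bool"
  where "open_circle U \<longleftrightarrow> open (proj -` U)"

instance
  by standard (auto simp: open_circle_def vimage_Union)

end

definition is_lift :: "(real \<Rightarrow> real) \<Rightarrow> (circle \<Rightarrow> circle) \<Rightarrow> bool"
  where "is_lift F f \<longleftrightarrow> continuous_on UNIV F \<and> (\<forall>x. proj (F x) = f (proj x))"

definition homeo :: "(circle \<Rightarrow> circle) \<Rightarrow> bool"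
  where "homeo f \<longleftrightarrow> (\<exists>k. homeomorphism UNIV UNIV f k)"

definition orientation_preserving :: "(circle \<Rightarrow> circle) \<Rightarrow> bool"
  where "orientation_preserving f \<longleftrightarrow> (\<exists>F. is_lift F f \<and> strict_mono F)"

text \<open>The rotation number lives in \<open>\<real>/\<int>\<close>; its representative in \<open>[0,1)\<close> is used.\<close>

definition has_rotation_number :: "(circle \<Rightarrow> circle) \<Rightarrow> real \<Rightarrow> bool"
  where "has_rotation_number f \<rho> \<longleftrightarrow> 0 \<le> \<rho> \<and> \<rho> < 1 \<and>
    (\<exists>F. is_lift F f \<and> (\<forall>x. (\<lambda>n. ((F ^^ n) x - x) / real n) \<longlonglongrightarrow> \<rho>))"

section \<open>Smoothness\<close>

text \<open>Intended for open \<open>S\<close>, on which all derivatives are two-sided.\<close>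

definition C_diff_on :: "nat \<Rightarrow> (real \<Rightarrow> real) \<Rightarrow> real set \<Rightarrow> bool"
  where "C_diff_on r F S \<longleftrightarrow>
    (\<forall>j<r. \<forall>x\<in>S. (deriv ^^ j) F field_differentiable at x) \<and>
    continuous_on S ((deriv ^^ r) F)"

definition C1_Holder :: "real \<Rightarrow> (circle \<Rightarrow> circle) \<Rightarrow> bool"
  where "C1_Holder \<alpha> h \<longleftrightarrow>
    (\<exists>H. is_lift H h \<and> C_diff_on 1 H UNIV \<and>
      (\<exists>K. \<forall>x y. \<bar>deriv H x - deriv H y\<bar> \<le> K * \<bar>x - y\<bar> powr \<alpha>))"

text \<open>In the last clause \<open>\<phi>\<close> is the \<open>C\<^sup>r\<close> coordinate around the critical point: being
  \<open>C\<^sup>r\<close> with nowhere vanishing derivative on an interval, it is a diffeomorphism onto its image.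
  Only the source is reparametrised.\<close>

definition critical_circle_map :: "nat \<Rightarrow> (circle \<Rightarrow> circle) \<Rightarrow> circle \<Rightarrow> bool"
  where "critical_circle_map r f c \<longleftrightarrow> homeo f \<and> orientation_preserving f \<and>
    (\<exists>F. is_lift F f \<and> C_diff_on r F UNIV \<and>
      (\<forall>x. deriv F x = 0 \<longleftrightarrow> proj x = c) \<and>
      (\<forall>x\<^sub>0. proj x\<^sub>0 = c \<longrightarrow>
        (\<exists>p a \<phi> \<delta>. p > 1 \<and> \<delta> > 0 \<and>
          C_diff_on r \<phi> {x\<^sub>0 - \<delta><..<x\<^sub>0 + \<delta>} \<and> \<phi> x\<^sub>0 = 0 \<and>
          (\<forall>x\<in>{x\<^sub>0 - \<delta><..<x\<^sub>0 + \<delta>}. deriv \<phi> x \<noteq> 0 \<and>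
             F x = \<phi> x * \<bar>\<phi> x\<bar> powr (p - 1) + a))))"

section \<open>Continued fractions and return times\<close>

fun convergent_cf :: "(nat \<Rightarrow> nat) \<Rightarrow> nat \<Rightarrow> real" where
  "convergent_cf a 0 = 1 / real (a 0)"
| "convergent_cf a (Suc n) = 1 / (real (a 0) + convergent_cf (\<lambda>k. a (Suc k)) n)"

definition is_continued_fraction :: "(nat \<Rightarrow> nat) \<Rightarrow> real \<Rightarrow> bool"
  where "is_continued_fraction a \<rho> \<longleftrightarrow> (\<forall>n. a n > 0) \<and> convergent_cf a \<longlonglongrightarrow> \<rho>"

fun return_time :: "(nat \<Rightarrow> nat) \<Rightarrow> nat \<Rightarrow> nat" where
  "return_time a 0 = 1"
| "return_time a (Suc 0) = a 0"
| "return_time a (Suc (Suc n)) = a (Suc n) * return_time a (Suc n) + return_time a n"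

section \<open>Arcs and renormalization\<close>

definition closed_arc :: "circle \<Rightarrow> circle \<Rightarrow> circle set \<Rightarrow> bool"
  where "closed_arc u v S \<longleftrightarrow>
    (\<exists>x y. x < y \<and> y < x + 1 \<and> {proj x, proj y} = {u, v} \<and> S = proj ` {x..y})"

definition arc_length :: "circle set \<Rightarrow> real"
  where "arc_length S = measure lebesgue {x \<in> {0..<1}. proj x \<in> S}"

definition dyn_arc :: "(circle \<Rightarrow> circle) \<Rightarrow> circle \<Rightarrow> (nat \<Rightarrow> nat) \<Rightarrow> nat \<Rightarrow> circle set"
  where "dyn_arc f c a n = (THE S. closed_arc c ((f ^^ return_time a n) c) S \<and>
    (f ^^ return_time a (n + 2)) c \<in> S)"

definition affine_cover :: "(circle \<Rightarrow> circle) \<Rightarrow> circle \<Rightarrow> (nat \<Rightarrow> nat) \<Rightarrow> nat \<Rightarrow> real \<Rightarrow> circle"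
  where "affine_cover f c a n = (THE A. (\<exists>x s. s \<noteq> 0 \<and> A = (\<lambda>t. proj (x + s * t))) \<and>
    A ` {0..1} = dyn_arc f c a n \<and> A 0 = c \<and> A 1 = (f ^^ return_time a n) c)"

definition ren_ratio :: "(circle \<Rightarrow> circle) \<Rightarrow> circle \<Rightarrow> (nat \<Rightarrow> nat) \<Rightarrow> nat \<Rightarrow> real"
  where "ren_ratio f c a n =
    - (arc_length (dyn_arc f c a n) / arc_length (dyn_arc f c a (n - 1)))"

text \<open>The inverse branch of the covering takes values in \<open>[\<lambda>\<^sub>n, 1]\<close>. For \<open>n = 1\<close> and \<open>a\<^sub>0 = 1\<close> the
  two arcs fill the circle and both endpoints of this interval lie over the same point. The left
  map has values in \<open>[0, 1]\<close> and the right map never takes the value \<open>1\<close>, so dropping the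
  unused endpoint makes the branch single-valued without changing it otherwise.\<close>

definition ren_left :: "(circle \<Rightarrow> circle) \<Rightarrow> circle \<Rightarrow> (nat \<Rightarrow> nat) \<Rightarrow> nat \<Rightarrow> real \<Rightarrow> real"
  where "ren_left f c a n x = the_inv_into {ren_ratio f c a n<..1} (affine_cover f c a (n - 1))
    ((f ^^ return_time a (n - 1)) (affine_cover f c a (n - 1) x))"

definition ren_right :: "(circle \<Rightarrow> circle) \<Rightarrow> circle \<Rightarrow> (nat \<Rightarrow> nat) \<Rightarrow> nat \<Rightarrow> real \<Rightarrow> real"
  where "ren_right f c a n x = the_inv_into {ren_ratio f c a n..<1} (affine_cover f c a (n - 1))
    ((f ^^ return_time a n) (affine_cover f c a (n - 1) x))"

text \<open>A pair of maps \<open>[\<lambda>, 0] \<rightarrow> \<real>\<close>, \<open>[0, 1] \<rightarrow> \<real>\<close> is encoded with the endpoint \<open>\<lambda>\<close> as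
  a triple; values of the maps outside these intervals are irrelevant.\<close>

type_synonym map_pair = "real \<times> (real \<Rightarrow> real) \<times> (real \<Rightarrow> real)"

text \<open>Meaningful for \<open>n \<ge> 1\<close> only.\<close>

definition renormalization ::
    "(circle \<Rightarrow> circle) \<Rightarrow> circle \<Rightarrow> (nat \<Rightarrow> nat) \<Rightarrow> nat \<Rightarrow> map_pair"
  where "renormalization f c a n = (ren_ratio f c a n, ren_left f c a n, ren_right f c a n)"

section \<open>The distance between pairs\<close>

definition frac_lin :: "real \<Rightarrow> real \<Rightarrow> real"
  where "frac_lin l x = (x - l) / ((1 + l) * x - 2 * l)"

lemma frac_lin_normalized:
  assumes "l < 0"
  shows "frac_lin l l = 0" "frac_lin l 0 = 1 / 2" "frac_lin l 1 = 1"
  using assms by (auto simp: frac_lin_def field_simps)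

lemma frac_lin_denom_pos:
  fixes l x :: real
  assumes "l < 0" "x \<in> {l..1}"
  shows "(1 + l) * x - 2 * l > 0"
proof (cases "x = l")
  case True
  have "(1 + l) * x - 2 * l = (- l) * (1 - l)"
    unfolding True by (simp add: algebra_simps)
  also have "\<dots> > 0"
    using assms(1) by (intro mult_pos_pos) linarith+
  finally show ?thesis .
next
  case False
  have "(1 + l) * x - 2 * l = (x - l) + (- l) * (1 - x)"
    by (simp add: algebra_simps)
  moreover have "(- l) * (1 - x) \<ge> 0"
    using assms by (intro mult_nonneg_nonneg) simp_all
  moreover have "x - l > 0"
    using assms(2) False by simp
  ultimately show ?thesis by linarith
qed

definition frac_lin_inv :: "real \<Rightarrow> real \<Rightarrow> real"
  where "frac_lin_inv l = the_inv_into {l..1} (frac_lin l)"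

text \<open>The distance \<open>d\<^sub>k\<close> for \<open>k = 0\<close>, i.e. with supremum norms.\<close>

fun dist0 :: "map_pair \<Rightarrow> map_pair \<Rightarrow> real" where
  "dist0 (l, fl, fr) (m, gl, gr) = Max {\<bar>l - m\<bar>,
     SUP x\<in>{0..1/2}. \<bar>frac_lin l (fl (frac_lin_inv l x)) - frac_lin m (gl (frac_lin_inv m x))\<bar>,
     SUP x\<in>{1/2..1}. \<bar>frac_lin l (fr (frac_lin_inv l x)) - frac_lin m (gr (frac_lin_inv m x))\<bar>}"

end

theory Submission
  imports Defs
begin

text \<open>
  A homeomorphism of the line is \<open>C\<^sup>1\<^sup>+\<^sup>\<alpha>\<close> as soon as its mean slopes over neighbouring intervals
  of size \<open>r\<close> and of comparable lengths agree up to a factor \<open>1 + O(r\<^sup>\<alpha>)\<close> (\<open>holder_derivative\<close>). The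
  proof establishes this for the lift \<open>H\<close> of the conjugacy, by comparing the geometry of the two
  maps first near their critical points and then everywhere.

  Real bounds. Let \<open>r n x\<close> be the length of the arc from \<open>x\<close> to its \<open>n\<close>-th closest return. A
  critical circle map distorts a cross-ratio on a short interval \<open>T\<close> without critical point by at
  most \<open>exp (K |T|)\<close> in one of the two directions: this is clear for diffeomorphisms, and the
  power law has a definite sign. Along an orbit segment up to a return time the arcs are
  disjoint, so the sum of their lengths is at most one and only boundedly many of them are
  exceptional; hence the cross-ratio of three adjacent return arcs stays bounded below under
  pull-back. Starting from a shortest arc, whose neighbours are longer, adjacent return arcs are
  comparable everywhere (\<open>cr_min_le\<close>). Bounded partial quotients then make arcs of consecutive
  levels comparable, so \<open>r n\<close> decays exponentially, neither too fast nor too slowly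
  (\<open>r_decay\<close>, \<open>r_le_power\<close>). The same cross-ratio estimate shows that the renormalized
  maps are uniformly Lipschitz (\<open>iterate_lipschitz\<close>).

  Near the critical point. In the renormalization coordinates of level \<open>n\<close>, the conjugacy is
  exponentially close to the identity (\<open>mismatch_decay\<close>). Every point of an arc around the
  critical point comes from an arc of the next level by boundedly many applications of a
  renormalized map, and each such application multiplies the error by a bounded factor. After
  \<open>m\<close> levels one controls a set of points that is \<open>\<mu>\<^sup>m\<close>-dense for some \<open>\<mu> < 1\<close>, with an error at most
  \<open>A\<^sup>m \<theta>\<^sup>n\<close>; taking \<open>m\<close> a small multiple of \<open>n\<close> makes both quantities exponentially small.

  Transport. An arc of level \<open>N\<close> anywhere on the circle is iterated until it enters the arcs of
  level \<open>n < N\<close> around the critical point. Each step distorts ratios of lengths by at most a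
  constant times the length of the arc divided by its distance to the critical point. Compared
  with the integral of \<open>1 / |x - c|\<close> over the disjoint arcs of level \<open>n + 1\<close>, these quotients
  add up to at most \<open>O(n \<mu>\<^sup>N\<^sup>-\<^sup>n)\<close> (\<open>entry_distortion\<close>).
  With \<open>N - n\<close> a small multiple of \<open>N\<close>, both this distortion and the error at the critical
  point, relative to the size of the arc, are exponentially small in \<open>N\<close>. So mean slopes of \<open>H\<close> over
  comparable parts of one arc of level \<open>N\<close> agree up to an exponentially small error
  (\<open>slope_decay\<close>), which is a power of the length of the arc.
\<close>

section \<open>Continued fractions\<close>

text \<open>The numerators of the convergents; the denominators are the return times.\<close>

fun cf_num :: "(nat \<Rightarrow> nat) \<Rightarrow> nat \<Rightarrow> nat" where
  "cf_num a 0 = 0"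
| "cf_num a (Suc 0) = 1"
| "cf_num a (Suc (Suc n)) = a (Suc n) * cf_num a (Suc n) + cf_num a n"

text \<open>The tails of the continued fraction, as the orbit of \<open>\<rho>\<close> under the Gauss map.\<close>

fun gauss_orbit :: "(nat \<Rightarrow> nat) \<Rightarrow> real \<Rightarrow> nat \<Rightarrow> real" where
  "gauss_orbit a \<rho> 0 = \<rho>"
| "gauss_orbit a \<rho> (Suc n) = 1 / gauss_orbit a \<rho> n - real (a n)"

lemma convergent_cf_bounds:
  assumes "\<And>n. a n > 0"
  shows "0 < convergent_cf a n \<and> convergent_cf a n \<le> 1"
  using assms
proof (induction n arbitrary: a)
  case 0
  then show ?case by (simp add: Suc_leI)
next
  case (Suc n)
  have "0 < convergent_cf (\<lambda>k. a (Suc k)) n"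
    using Suc.IH[of "\<lambda>k. a (Suc k)"] Suc.prems by simp
  moreover have "real (a 0) \<ge> 1"
    using Suc.prems[of 0] by linarith
  ultimately show ?case by simp
qed

lemma continued_fraction_bounds:
  assumes "is_continued_fraction a \<rho>" "\<rho> \<notin> \<rat>"
  shows "0 < \<rho>" "\<rho> < 1"
proof -
  have "0 \<le> \<rho>" "\<rho> \<le> 1"
    using assms(1) convergent_cf_bounds[of a] unfolding is_continued_fraction_def
    by (meson LIMSEQ_le_const LIMSEQ_le_const2 less_imp_le)+
  moreover have "\<rho> \<noteq> 0" "\<rho> \<noteq> 1"
    using assms(2) by auto
  ultimately show "0 < \<rho>" "\<rho> < 1" by auto
qed

lemma continued_fraction_shift:
  assumes "is_continued_fraction a \<rho>" "\<rho> \<notin> \<rat>"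
  shows "is_continued_fraction (\<lambda>k. a (Suc k)) (1 / \<rho> - real (a 0))"
    and "1 / \<rho> - real (a 0) \<notin> \<rat>"
proof -
  have pos: "\<And>n. a n > 0" and lim: "convergent_cf a \<longlonglongrightarrow> \<rho>"
    using assms(1) by (auto simp: is_continued_fraction_def)
  have "\<rho> \<noteq> 0" using assms(2) by auto
  have "(\<lambda>n. 1 / convergent_cf a (Suc n) - real (a 0)) \<longlonglongrightarrow> 1 / \<rho> - real (a 0)"
    by (intro tendsto_intros LIMSEQ_Suc[OF lim] \<open>\<rho> \<noteq> 0\<close>)
  moreover have "1 / convergent_cf a (Suc n) - real (a 0) = convergent_cf (\<lambda>k. a (Suc k)) n" for n
    by simp
  ultimately show "is_continued_fraction (\<lambda>k. a (Suc k)) (1 / \<rho> - real (a 0))"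
    using pos by (simp add: is_continued_fraction_def)
  show "1 / \<rho> - real (a 0) \<notin> \<rat>"
  proof
    assume "1 / \<rho> - real (a 0) \<in> \<rat>"
    then have "1 / ((1 / \<rho> - real (a 0)) + real (a 0)) \<in> \<rat>"
      by (intro Rats_divide Rats_add) auto
    with assms(2) show False by simp
  qed
qed

lemma gauss_orbit_shift:
  "gauss_orbit a \<rho> (Suc n) = gauss_orbit (\<lambda>k. a (Suc k)) (1 / \<rho> - real (a 0)) n"
  by (induction n) simp_all

lemma gauss_orbit_bounds:
  assumes "is_continued_fraction a \<rho>" "\<rho> \<notin> \<rat>"
  shows "0 < gauss_orbit a \<rho> n \<and> gauss_orbit a \<rho> n < 1"
  using assms
proof (induction n arbitrary: a \<rho>)
  case 0
  then show ?case using continued_fraction_bounds by simp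
next
  case (Suc n)
  show ?case
    unfolding gauss_orbit_shift by (rule Suc.IH) (use continued_fraction_shift[OF Suc.prems] in auto)
qed

locale rotation =
  fixes a :: "nat \<Rightarrow> nat" and \<rho> :: real
  assumes irrational: "\<rho> \<notin> \<rat>" and cf: "is_continued_fraction a \<rho>"
begin

abbreviation q :: "nat \<Rightarrow> nat" where "q \<equiv> return_time a"

definition sgap :: "nat \<Rightarrow> real" where "sgap n = real (q n) * \<rho> - real (cf_num a n)"

definition gap :: "nat \<Rightarrow> real" where "gap n = (\<Prod>i\<le>n. gauss_orbit a \<rho> i)"

lemma a_pos: "a n > 0"
  using cf by (simp add: is_continued_fraction_def)

lemma rho_bounds: "0 < \<rho>" "\<rho> < 1"
  using continued_fraction_bounds[OF cf irrational] by auto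

lemma gap_pos: "0 < gap n"
  unfolding gap_def by (rule prod_pos) (use gauss_orbit_bounds[OF cf irrational] in auto)

lemma gap_Suc_less: "gap (Suc n) < gap n"
  using gap_pos[of n] gauss_orbit_bounds[OF cf irrational, of "Suc n"] by (simp add: gap_def)

lemma gap_rec: "gap n = real (a (Suc n)) * gap (Suc n) + gap (Suc (Suc n))"
proof -
  define x where "x = gauss_orbit a \<rho> (Suc n)"
  define y where "y = gauss_orbit a \<rho> (Suc (Suc n))"
  have "x > 0"
    using gauss_orbit_bounds[OF cf irrational] unfolding x_def by blast
  have "y = 1 / x - real (a (Suc n))" unfolding x_def y_def by (rule gauss_orbit.simps(2))
  then have "real (a (Suc n)) * x + x * y = 1" using \<open>x > 0\<close> by (simp add: field_simps)
  then have "gap n * (real (a (Suc n)) * x + x * y) = gap n" by simp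
  moreover have "gap (Suc n) = gap n * x" "gap (Suc (Suc n)) = gap n * (x * y)"
    unfolding x_def y_def by (simp_all add: gap_def del: gauss_orbit.simps)
  ultimately show ?thesis by (simp add: algebra_simps)
qed

lemma sgap_rec: "sgap (Suc (Suc n)) = real (a (Suc n)) * sgap (Suc n) + sgap n"
  by (simp add: sgap_def algebra_simps)

lemma sgap_eq_gap: "sgap n = (-1) ^ n * gap n"
proof (induction n rule: induct_nat_012)
  case 0
  then show ?case by (simp add: sgap_def gap_def)
next
  case 1
  then show ?case using rho_bounds by (simp add: sgap_def gap_def field_simps)
next
  case (ge2 n)
  then show ?case
    unfolding sgap_rec using gap_rec[of n] by (simp add: algebra_simps)
qed

lemma gap_mono: "m \<le> n \<Longrightarrow> gap n \<le> gap m"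
  by (rule lift_Suc_antimono_le) (use gap_Suc_less less_imp_le in auto)

lemma gap_add_le: "gap (Suc n) + gap (Suc (Suc n)) \<le> gap n"
  using gap_rec[of n] a_pos[of "Suc n"] gap_pos[of "Suc n"]
  by (simp add: mult_le_cancel_right1)

lemma gap_0_1: "gap 0 + gap 1 \<le> 1"
proof -
  have "gap 0 = \<rho>" "gap 1 = 1 - real (a 0) * \<rho>"
    using rho_bounds by (simp_all add: gap_def field_simps)
  moreover have "real (a 0) \<ge> 1" using a_pos[of 0] by linarith
  then have "real (a 0) * \<rho> \<ge> \<rho>" using rho_bounds by simp
  ultimately show ?thesis by linarith
qed

lemma gap_lt_1: "gap n < 1"
  using gap_mono[of 0 n] gap_0_1 gap_pos[of 1] by simp

lemma q_pos: "q n > 0"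
  by (induction n rule: induct_nat_012) (auto simp: a_pos)

lemma q_mono_Suc: "q n \<le> q (Suc n)"
proof (cases n)
  case 0
  then show ?thesis using a_pos[of 0] by simp
next
  case (Suc m)
  have "1 * q n \<le> a n * q n" by (rule mult_le_mono1) (use a_pos[of n] in simp)
  then show ?thesis unfolding Suc return_time.simps(3)[of a m] by linarith
qed

lemma q_mono: "m \<le> n \<Longrightarrow> q m \<le> q n"
  by (rule lift_Suc_mono_le) (use q_mono_Suc in auto)

lemma cf_det:
  "int (q n) * int (cf_num a (Suc n)) - int (q (Suc n)) * int (cf_num a n) = (-1) ^ n"
  by (induction n) (auto simp: algebra_simps)

text \<open>Two consecutive convergents form a basis of the integer lattice. A pair with small
  first entry has coefficients of opposite signs in this basis; since the signs of \<open>sgap\<close> alternate,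
  the two contributions add up instead of cancelling.\<close>

lemma best_approximation:
  fixes j m :: int
  assumes "0 < j" "j < int (q (Suc n))"
  shows "gap n \<le> \<bar>of_int j * \<rho> - of_int m\<bar>"
proof -
  define D :: int where "D = (-1) ^ n"
  have DD: "D * D = 1" by (simp add: D_def flip: power_mult_distrib)
  define x where "x = D * (j * int (cf_num a (Suc n)) - m * int (q (Suc n)))"
  define y where "y = D * (m * int (q n) - j * int (cf_num a n))"
  have det: "int (q n) * int (cf_num a (Suc n)) - int (q (Suc n)) * int (cf_num a n) = D"
    unfolding D_def by (rule cf_det)
  have "x * int (q n) + y * int (q (Suc n)) =
      D * j * (int (q n) * int (cf_num a (Suc n)) - int (q (Suc n)) * int (cf_num a n))"
    unfolding x_def y_def by (simp add: algebra_simps)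
  also have "\<dots> = j" unfolding det using DD by (simp add: algebra_simps)
  finally have j: "x * int (q n) + y * int (q (Suc n)) = j" .
  have "x * int (cf_num a n) + y * int (cf_num a (Suc n)) =
      D * m * (int (q n) * int (cf_num a (Suc n)) - int (q (Suc n)) * int (cf_num a n))"
    unfolding x_def y_def by (simp add: algebra_simps)
  also have "\<dots> = m" unfolding det using DD by (simp add: algebra_simps)
  finally have m: "x * int (cf_num a n) + y * int (cf_num a (Suc n)) = m" .
  have "of_int j * \<rho> - of_int m = of_int x * sgap n + of_int y * sgap (Suc n)"
    unfolding j[symmetric] m[symmetric] sgap_def by (simp add: algebra_simps)
  also have "\<dots> = (-1) ^ n * (of_int x * gap n - of_int y * gap (Suc n))"
    unfolding sgap_eq_gap by (simp add: algebra_simps)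
  finally have eq: "\<bar>of_int j * \<rho> - of_int m\<bar> = \<bar>of_int x * gap n - of_int y * gap (Suc n)\<bar>"
    by (simp add: abs_mult power_abs)
  have qp: "int (q n) > 0" "int (q (Suc n)) > 0" using q_pos by auto
  consider "y = 0" | "y > 0" | "y < 0" by linarith
  then show ?thesis
  proof cases
    case 1
    then have "x \<noteq> 0" using j assms by auto
    then have "1 \<le> \<bar>of_int x :: real\<bar>" by linarith
    then have "gap n \<le> \<bar>of_int x\<bar> * gap n" using gap_pos[of n] by (simp add: mult_le_cancel_right1)
    then show ?thesis unfolding eq using 1 gap_pos[of n] by (simp add: abs_mult)
  next
    case 2
    then have "1 * int (q (Suc n)) \<le> y * int (q (Suc n))"
      using qp by (intro mult_right_mono) auto
    then have "x * int (q n) < 0" using j assms by linarith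
    then have "x \<le> -1" using qp by (simp add: mult_less_0_iff)
    then have "of_int x * gap n \<le> (-1) * gap n" "0 \<le> of_int y * gap (Suc n)"
      using gap_pos[of n] gap_pos[of "Suc n"] 2 by (intro mult_right_mono, auto)
    then show ?thesis unfolding eq by linarith
  next
    case 3
    then have "y * int (q (Suc n)) \<le> 0"
      using qp by (simp add: mult_le_0_iff)
    then have "x * int (q n) > 0" using j assms by linarith
    then have "x \<ge> 1" using qp by (simp add: zero_less_mult_iff)
    then have "1 * gap n \<le> of_int x * gap n" "of_int y * gap (Suc n) \<le> 0"
      using gap_pos[of n] gap_pos[of "Suc n"] 3 by (intro mult_right_mono, auto simp: mult_le_0_iff)
    then show ?thesis unfolding eq by linarith
  qed
qed

end

section \<open>Lifts of circle homeomorphisms with irrational rotation number\<close>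

lemma integer_shift:
  fixes F :: "real \<Rightarrow> real"
  assumes "\<And>x. F (x + 1) = F x + 1"
  shows "F (x + of_int k) = F x + of_int k"
proof (induction k rule: int_induct[where k = 0])
  case (step1 i)
  then show ?case using assms[of "x + of_int i"] by (simp add: algebra_simps)
next
  case (step2 i)
  then show ?case using assms[of "x + of_int (i - 1)"] by (simp add: algebra_simps)
qed simp

text \<open>With the identity for \<open>G\<close> this bounds total lengths; with a logarithm it bounds the
  total distortion of an orbit segment that stays away from the critical point.\<close>

lemma disjoint_increments:
  fixes G :: "real \<Rightarrow> real" and l u :: "'a \<Rightarrow> real"
  assumes "finite I"
    and "\<And>i. i \<in> I \<Longrightarrow> A \<le> l i \<and> l i < u i \<and> u i \<le> B"
    and "\<And>i j. i \<in> I \<Longrightarrow> j \<in> I \<Longrightarrow> i \<noteq> j \<Longrightarrow> u i \<le> l j \<or> u j \<le> l i"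
    and "mono_on {A..B} G" and "A \<le> B"
  shows "(\<Sum>i\<in>I. G (u i) - G (l i)) \<le> G B - G A"
  using assms
proof (induction "card I" arbitrary: I B)
  case 0
  then show ?case using monotone_onD[of "{A..B}" "(\<le>)" "(\<le>)" G A B] by simp
next
  case (Suc n)
  then have "I \<noteq> {}" by auto
  then obtain i where i: "i \<in> I" "\<And>j. j \<in> I \<Longrightarrow> l j \<le> l i"
    using Suc.prems(1) Max_in[of "l ` I"] Max_ge[of "l ` I"] by (metis (no_types, lifting) finite_imageI imageE imageI image_is_empty)
  have below: "u j \<le> l i" if "j \<in> I - {i}" for j
    using that Suc.prems(2)[of i] Suc.prems(2)[of j] Suc.prems(3)[of i j] i by fastforce
  have "(\<Sum>j\<in>I - {i}. G (u j) - G (l j)) \<le> G (l i) - G A"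
  proof (rule Suc.hyps(1))
    show "n = card (I - {i})" using Suc.hyps(2) i(1) Suc.prems(1) by simp
    show "mono_on {A..l i} G"
      using Suc.prems(2)[OF i(1)] by (intro mono_on_subset[OF Suc.prems(4)]) auto
  qed (use Suc.prems i below in auto)
  moreover have "G (u i) \<le> G B"
    using Suc.prems(2)[OF i(1)] by (intro monotone_onD[OF Suc.prems(4)]) auto
  moreover have "(\<Sum>j\<in>I. G (u j) - G (l j)) = (G (u i) - G (l i)) + (\<Sum>j\<in>I - {i}. G (u j) - G (l j))"
    by (rule sum.remove) (use Suc.prems(1) i in auto)
  ultimately show ?case by linarith
qed

text \<open>The rotation number enters only through the order of orbits.\<close>

locale circle_lift = rotation a \<rho> for a :: "nat \<Rightarrow> nat" and \<rho> :: real +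
  fixes F :: "real \<Rightarrow> real"
  assumes F_cont: "continuous_on UNIV F" and F_strict_mono: "strict_mono F"
    and F_plus_1: "F (x + 1) = F x + 1"
    and F_order: "(F ^^ k) x < x + of_int m \<longleftrightarrow> real k * \<rho> < of_int m"
      "(F ^^ k) x > x + of_int m \<longleftrightarrow> real k * \<rho> > of_int m"
begin

lemma F_less: "F x < F y \<longleftrightarrow> x < y"
  using F_strict_mono strict_mono_less by blast

lemma F_plus_int: "F (x + of_int k) = F x + of_int k"
  by (rule integer_shift[of F, OF F_plus_1])

lemma F_surj: "surj F"
proof -
  have "\<exists>x. F x = y" for y
  proof -
    define k where "k = \<lfloor>y - F 0\<rfloor>"
    have "F (of_int k) \<le> y" "y \<le> F (of_int k + 1)"
      using F_plus_int[of 0 k] F_plus_1[of "of_int k"] unfolding k_def by (auto, linarith+)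
    then show ?thesis
      using IVT'[of F "of_int k" y "of_int k + 1"] continuous_on_subset[OF F_cont] by auto
  qed
  then show ?thesis by (metis surj_def)
qed

lemma F_bij: "bij F"
  using F_surj F_strict_mono strict_mono_imp_inj_on bij_def by blast

definition iter :: "int \<Rightarrow> real \<Rightarrow> real"
  where "iter i x = (if 0 \<le> i then (F ^^ nat i) x else (inv F ^^ nat (- i)) x)"

lemma F_inv: "F (inv F x) = x" "inv F (F x) = x"
  using F_bij by (simp_all add: bij_is_surj surj_f_inv_f bij_is_inj)

lemma iter_succ: "iter (i + 1) x = F (iter i x)"
proof (cases "0 \<le> i")
  case True
  then show ?thesis by (simp add: iter_def nat_add_distrib)
next
  case False
  then have "nat (- i) = Suc (nat (- (i + 1)))" by simp
  then have "iter i x = inv F ((inv F ^^ nat (- (i + 1))) x)"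
    using False by (simp add: iter_def)
  then show ?thesis using False F_inv by (auto simp: iter_def)
qed

lemma iter_pred: "iter (i - 1) x = inv F (iter i x)"
  using iter_succ[of "i - 1" x] F_inv by simp

lemma iter_0: "iter 0 x = x"
  by (simp add: iter_def)

lemma iter_add: "iter (i + j) x = iter i (iter j x)"
proof (induction i rule: int_induct[where k = 0])
  case base
  then show ?case by (simp add: iter_0)
next
  case (step1 i)
  then show ?case using iter_succ[of "i + j" x] iter_succ[of i] by (simp add: algebra_simps)
next
  case (step2 i)
  have eq: "i - 1 + j = i + j - 1" by simp
  show ?case unfolding eq iter_pred step2 ..
qed

lemma inv_F_plus_int: "inv F (x + of_int m) = inv F x + of_int m"
  using F_plus_int[of "inv F x" m] F_inv by metis

lemma iter_plus_int: "iter i (x + of_int m) = iter i x + of_int m"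
proof (induction i rule: int_induct[where k = 0])
  case base
  then show ?case by (simp add: iter_0)
next
  case (step1 i)
  then show ?case by (simp add: iter_succ F_plus_int)
next
  case (step2 i)
  then show ?case by (simp add: iter_pred inv_F_plus_int)
qed

lemma iter_less: "iter i x < iter i y \<longleftrightarrow> x < y"
proof (induction i rule: int_induct[where k = 0])
  case base
  then show ?case by (simp add: iter_0)
next
  case (step1 i)
  then show ?case by (simp add: iter_succ F_less)
next
  case (step2 i)
  then show ?case by (metis F_inv(1) F_less iter_pred)
qed

lemma iter_order: "x < iter i x + of_int m \<longleftrightarrow> 0 < of_int i * \<rho> + of_int m"
proof (cases "0 \<le> i")
  case True
  then have "x < iter i x + of_int m \<longleftrightarrow> (F ^^ nat i) x > x + of_int (- m)"
    by (auto simp: iter_def)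
  also have "\<dots> \<longleftrightarrow> real (nat i) * \<rho> > of_int (- m)" by (rule F_order)
  finally show ?thesis using True by auto
next
  case False
  define y where "y = iter i x"
  have "(F ^^ nat (- i)) y = x"
    using iter_add[of "-i" i x] False unfolding y_def by (simp add: iter_0 iter_def)
  then have "x < iter i x + of_int m \<longleftrightarrow> (F ^^ nat (- i)) y < y + of_int m"
    unfolding y_def by simp
  also have "\<dots> \<longleftrightarrow> real (nat (- i)) * \<rho> < of_int m" by (rule F_order)
  finally show ?thesis using False by auto
qed

definition Gam :: "real set" where "Gam = {of_int i * \<rho> + of_int m | i m :: int. True}"

lemma GamI: "of_int i * \<rho> + of_int m \<in> Gam"
  by (auto simp: Gam_def)

lemma GamE: assumes "u \<in> Gam" obtains i m :: int where "u = of_int i * \<rho> + of_int m"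
  using assms by (auto simp: Gam_def)

lemma Gam_minus [simp]: assumes "u \<in> Gam" shows "- u \<in> Gam"
proof -
  obtain i m :: int where "u = of_int i * \<rho> + of_int m" using assms by (rule GamE)
  then show ?thesis using GamI[of "- i" "- m"] by simp
qed

lemma Gam_add [simp]: assumes "u \<in> Gam" "v \<in> Gam" shows "u + v \<in> Gam"
proof -
  obtain i m :: int where "u = of_int i * \<rho> + of_int m" using assms(1) by (rule GamE)
  moreover obtain j l :: int where "v = of_int j * \<rho> + of_int l" using assms(2) by (rule GamE)
  ultimately show ?thesis using GamI[of "i + j" "m + l"] by (simp add: algebra_simps)
qed

lemma Gam_diff [simp]: "u \<in> Gam \<Longrightarrow> v \<in> Gam \<Longrightarrow> u - v \<in> Gam"
  using Gam_add[of u "- v"] by simp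

lemma Gam_int [simp]: "of_int m \<in> Gam" using GamI[of 0 m] by simp

lemma Gam_0 [simp]: "0 \<in> Gam" using Gam_int[of 0] by simp

lemma Gam_rho [simp]: "\<rho> \<in> Gam" using GamI[of 1 0] by simp

lemma Gam_nat_mult [simp]: assumes "u \<in> Gam" shows "real k * u \<in> Gam"
  by (induction k) (use assms in \<open>auto simp: algebra_simps\<close>)

lemma Gam_double [simp]: "u \<in> Gam \<Longrightarrow> 2 * u \<in> Gam"
  using Gam_nat_mult[of u 2] by simp

lemma Gam_sgap [simp]: "sgap n \<in> Gam"
  using GamI[of "int (q n)" "- int (cf_num a n)"] by (simp add: sgap_def)

lemma Gam_gap [simp]: "gap n \<in> Gam"
proof (cases "even n")
  case True
  then show ?thesis using Gam_sgap[of n] by (simp add: sgap_eq_gap)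
next
  case False
  then show ?thesis using Gam_minus[OF Gam_sgap[of n]] by (simp add: sgap_eq_gap)
qed

lemma rep_unique:
  assumes "of_int i * \<rho> + of_int m = of_int j * \<rho> + (of_int l :: real)"
  shows "i = j" "m = l"
proof -
  show "i = j"
  proof (rule ccontr)
    assume "i \<noteq> j"
    then have "\<rho> = of_int (l - m) / of_int (i - j)"
      using assms by (simp add: field_simps)
    then have "\<rho> \<in> \<rat>" by (metis Rats_divide Rats_of_int)
    then show False using irrational by simp
  qed
  then show "m = l" using assms by simp
qed

text \<open>Iterates and integer translations together are an action of the group \<open>\<int> + \<rho> \<int>\<close>, in
  which an element moves every point to the right exactly if it is positive. Indexing the action
  by this real number reduces all questions about the order of points in an orbit to
  linear arithmetic.\<close>

definition Phi :: "real \<Rightarrow> real \<Rightarrow> real"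
  where "Phi u x = (THE y. \<exists>i m. u = of_int i * \<rho> + of_int m \<and> y = iter i x + of_int m)"

lemma Phi_eq: "Phi (of_int i * \<rho> + of_int m) x = iter i x + of_int m"
  unfolding Phi_def by (rule the_equality) (auto dest: rep_unique)

lemma Phi_add:
  assumes "u \<in> Gam" "v \<in> Gam" shows "Phi (u + v) x = Phi u (Phi v x)"
proof -
  obtain i m :: int where u: "u = of_int i * \<rho> + of_int m" using assms(1) by (rule GamE)
  obtain j l :: int where v: "v = of_int j * \<rho> + of_int l" using assms(2) by (rule GamE)
  have "u + v = of_int (i + j) * \<rho> + of_int (m + l)" by (simp add: u v algebra_simps)
  then show ?thesis
    unfolding u v Phi_eq by (simp only: Phi_eq) (simp add: iter_add iter_plus_int)
qed

lemma Phi_double: "u \<in> Gam \<Longrightarrow> Phi (2 * u) x = Phi u (Phi u x)"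
  using Phi_add[of u u x] by simp

lemma Phi_int: "Phi (of_int m) x = x + of_int m"
  using Phi_eq[of 0 m x] by (simp add: iter_0)

lemma Phi_0 [simp]: "Phi 0 x = x" using Phi_int[of 0] by simp

lemma Phi_iter: "Phi (real k * \<rho>) x = (F ^^ k) x"
  using Phi_eq[of "int k" 0 x] by (simp add: iter_def)

lemma Phi_mono_iff: assumes "u \<in> Gam" shows "Phi u x < Phi u y \<longleftrightarrow> x < y"
  using assms by (elim GamE) (simp add: Phi_eq iter_less)

lemma Phi_mono_le_iff: assumes "u \<in> Gam" shows "Phi u x \<le> Phi u y \<longleftrightarrow> x \<le> y"
  using Phi_mono_iff[OF assms, of y x] by auto

lemma Phi_plus_int: assumes "u \<in> Gam" shows "Phi u (x + of_int m) = Phi u x + of_int m"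
  using assms by (elim GamE) (simp add: Phi_eq iter_plus_int)

lemma Phi_pos: assumes "u \<in> Gam" shows "x < Phi u x \<longleftrightarrow> 0 < u"
  using assms by (elim GamE) (simp add: Phi_eq iter_order)

lemma Phi_less_iff:
  assumes "u \<in> Gam" "v \<in> Gam" shows "Phi u x < Phi v x \<longleftrightarrow> u < v"
proof -
  have "Phi v x = Phi (v - u) (Phi u x)"
    using Phi_add[of "v - u" u x] assms by simp
  then show ?thesis using Phi_pos[of "v - u" "Phi u x"] assms by simp
qed

lemma Phi_le_iff:
  assumes "u \<in> Gam" "v \<in> Gam" shows "Phi u x \<le> Phi v x \<longleftrightarrow> u \<le> v"
  using Phi_less_iff[of v u x] assms by auto

lemma Phi_commute: "u \<in> Gam \<Longrightarrow> v \<in> Gam \<Longrightarrow> Phi u (Phi v x) = Phi v (Phi u x)"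
  by (metis Phi_add add.commute)

lemma Phi_cancel [simp]:
  assumes "u \<in> Gam" shows "Phi (- u) (Phi u x) = x" "Phi u (Phi (- u) x) = x"
  using Phi_add[of "- u" u x] Phi_add[of u "- u" x] assms by auto

lemma Phi_F: "u \<in> Gam \<Longrightarrow> Phi u ((F ^^ k) x) = (F ^^ k) (Phi u x)"
  using Phi_commute[of u "real k * \<rho>" x] by (simp add: Phi_iter)

lemma Phi_cont: assumes "u \<in> Gam" shows "continuous_on UNIV (Phi u)"
proof (rule continuous_onI_mono)
  have "surj (Phi u)" using Phi_cancel(2)[OF assms] by (metis surjI)
  then show "open (Phi u ` UNIV)" by simp
qed (use Phi_mono_le_iff[OF assms] in auto)

lemma iterate_less: "(F ^^ k) x < (F ^^ k) y \<longleftrightarrow> x < y"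
  using Phi_mono_iff[of "real k * \<rho>" x y] by (simp add: Phi_iter)

lemma iterate_le: "(F ^^ k) x \<le> (F ^^ k) y \<longleftrightarrow> x \<le> y"
  using iterate_less[of k y x] by auto

text \<open>The \<open>n\<close>-th closest return is always taken to the right of \<open>x\<close>; for odd \<open>n\<close> it is a
  return under the inverse map. This makes the estimates below independent of the parity of \<open>n\<close>.\<close>

definition r :: "nat \<Rightarrow> real \<Rightarrow> real" where "r n x = Phi (gap n) x - x"

lemma r_pos: "0 < r n x"
  using Phi_pos[OF Gam_gap, of x n] gap_pos[of n] by (simp add: r_def)

lemma r_plus_int: "r n (x + of_int m) = r n x"
  by (simp add: r_def Phi_plus_int)

lemma r_antimono: "m \<le> n \<Longrightarrow> r n x \<le> r m x"
  using gap_mono Phi_le_iff[OF Gam_gap Gam_gap] by (simp add: r_def)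

lemma r_less_1: "r n x < 1"
  using Phi_less_iff[OF Gam_gap Gam_int, of n x 1] gap_lt_1[of n] Phi_int[of 1 x] by (simp add: r_def)

lemma separated:
  assumes "j < q (Suc n)" "j' < q (Suc n)" "j \<noteq> j'"
  shows "gap n \<le> \<bar>(real j * \<rho> + of_int m) - (real j' * \<rho> + of_int m')\<bar>"
proof -
  have "gap n \<le> \<bar>(real j * \<rho> + of_int m) - (real j' * \<rho> + of_int m')\<bar>"
    if "j < q (Suc n)" "j' < q (Suc n)" "j' < j" for j j' m m'
    using best_approximation[of "int j - int j'" n "m' - m"] that by (simp add: algebra_simps)
  then show ?thesis
    using assms by (metis abs_minus_commute nat_neq_iff)
qed

lemma arcs_disjoint:
  assumes "j < q (Suc n)" "j' < q (Suc n)" "j \<noteq> j'"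
  shows "Phi (gap n) ((F ^^ j) x + of_int m) \<le> (F ^^ j') x + of_int m' \<or>
    Phi (gap n) ((F ^^ j') x + of_int m') \<le> (F ^^ j) x + of_int m"
proof -
  have eq: "(F ^^ j) x + of_int m = Phi (real j * \<rho> + of_int m) x" for j m
    using Phi_add[of "of_int m" "real j * \<rho>" x] by (simp add: Phi_int Phi_iter add.commute)
  have "gap n + (real j * \<rho> + of_int m) \<le> real j' * \<rho> + of_int m' \<or>
      gap n + (real j' * \<rho> + of_int m') \<le> real j * \<rho> + of_int m"
    using separated[OF assms, of m m'] by linarith
  then show ?thesis
    unfolding eq Phi_add[OF Gam_gap Gam_add[OF Gam_nat_mult[OF Gam_rho] Gam_int], symmetric]
    by (simp add: Phi_le_iff)
qed

lemma arcs_increments: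
  fixes G :: "real \<Rightarrow> real"
  assumes "k \<le> q (Suc n)" and "mono_on {A..B} G" and "A \<le> B"
    and "\<And>j. j < k \<Longrightarrow> A \<le> (F ^^ j) x + of_int (l j) \<and> Phi (gap n) ((F ^^ j) x + of_int (l j)) \<le> B"
  shows "(\<Sum>j<k. G (Phi (gap n) ((F ^^ j) x + of_int (l j))) - G ((F ^^ j) x + of_int (l j))) \<le> G B - G A"
proof (rule disjoint_increments[where I = "{..<k}" and G = G and A = A and B = B
    and l = "\<lambda>j. (F ^^ j) x + of_int (l j)" and u = "\<lambda>j. Phi (gap n) ((F ^^ j) x + of_int (l j))"])
  fix j assume "j \<in> {..<k}"
  then show "A \<le> (F ^^ j) x + of_int (l j) \<and>
      (F ^^ j) x + of_int (l j) < Phi (gap n) ((F ^^ j) x + of_int (l j)) \<and>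
      Phi (gap n) ((F ^^ j) x + of_int (l j)) \<le> B"
    using assms(4)[of j] Phi_pos[OF Gam_gap] gap_pos by auto
next
  fix i j assume "i \<in> {..<k}" "j \<in> {..<k}" "i \<noteq> j"
  then show "Phi (gap n) ((F ^^ i) x + of_int (l i)) \<le> (F ^^ j) x + of_int (l j) \<or>
      Phi (gap n) ((F ^^ j) x + of_int (l j)) \<le> (F ^^ i) x + of_int (l i)"
    using assms(1) by (intro arcs_disjoint) auto
qed (use assms in auto)

lemma arc_lengths_sum_le_1:
  assumes "k \<le> q (Suc n)" shows "(\<Sum>j<k. r n ((F ^^ j) x)) \<le> 1"
proof -
  define l where "l j = - \<lfloor>(F ^^ j) x - x\<rfloor>" for j
  have qp: "0 < q (Suc n)" by (rule q_pos)
  have "(\<Sum>j<k. Phi (gap n) ((F ^^ j) x + of_int (l j)) - ((F ^^ j) x + of_int (l j))) \<le> (x + 1) - x"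
  proof (rule arcs_increments[OF assms, where G = "\<lambda>x. x"])
    fix j assume j: "j < k"
    have 1: "x \<le> (F ^^ j) x + of_int (l j)" "(F ^^ j) x + of_int (l j) < x + 1"
      unfolding l_def by linarith+
    have "Phi (gap n) ((F ^^ j) x + of_int (l j)) \<le> x + 1"
    proof (cases "j = 0")
      case True
      then show ?thesis using r_less_1[of n x] by (simp add: l_def r_def)
    next
      case False
      then show ?thesis
        using arcs_disjoint[of j n 0 x "l j" 1] j assms qp 1 Phi_pos[OF Gam_gap, of "x + 1" n] gap_pos[of n]
        by auto
    qed
    with 1 show "x \<le> (F ^^ j) x + of_int (l j) \<and> Phi (gap n) ((F ^^ j) x + of_int (l j)) \<le> x + 1" by simp
  qed (auto intro!: monotone_onI)
  then show ?thesis by (simp add: r_def Phi_plus_int)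
qed

lemma arc_hits_le_1:
  assumes "k \<le> q (Suc n)"
  shows "card {j. j < k \<and> (\<exists>m::int. (F ^^ j) x \<le> c + of_int m \<and> c + of_int m < Phi (gap n) ((F ^^ j) x))} \<le> 1"
    (is "card ?S \<le> 1")
proof -
  have "i = j" if ij: "i \<in> ?S" "j \<in> ?S" for i j
  proof (rule ccontr)
    assume "i \<noteq> j"
    obtain m m' :: int where
      m: "(F ^^ i) x \<le> c + of_int m" "c + of_int m < Phi (gap n) ((F ^^ i) x)" and
      m': "(F ^^ j) x \<le> c + of_int m'" "c + of_int m' < Phi (gap n) ((F ^^ j) x)"
      using ij by blast
    have "i < q (Suc n)" "j < q (Suc n)" using ij assms by auto
    from arcs_disjoint[OF this \<open>i \<noteq> j\<close>, of x "- m" "- m'"] show False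
      using m m' Phi_plus_int[OF Gam_gap, of n "(F ^^ i) x" "- m"]
        Phi_plus_int[OF Gam_gap, of n "(F ^^ j) x" "- m'"] unfolding of_int_minus
      by (elim disjE) linarith+
  qed
  moreover have "finite ?S" by simp
  ultimately show ?thesis unfolding One_nat_def by (subst card_le_Suc0_iff_eq) blast+
qed

lemma block_sum:
  assumes "k \<le> M * q (Suc n)" shows "(\<Sum>j<k. r n ((F ^^ j) x)) \<le> real M"
proof -
  have "(\<Sum>j<k. r n ((F ^^ j) x)) \<le> (\<Sum>j<M * q (Suc n). r n ((F ^^ j) x))"
    by (rule sum_mono2) (use assms r_pos less_imp_le in auto)
  also have "\<dots> = (\<Sum>m<M. \<Sum>j\<in>{m * q (Suc n)..<m * q (Suc n) + q (Suc n)}. r n ((F ^^ j) x))"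
    by (rule sum.nat_group[symmetric])
  also have "\<dots> \<le> (\<Sum>m<M. 1)"
  proof (rule sum_mono)
    fix m
    have "(\<Sum>j\<in>{m * q (Suc n)..<m * q (Suc n) + q (Suc n)}. r n ((F ^^ j) x)) =
        (\<Sum>j<q (Suc n). r n ((F ^^ j) ((F ^^ (m * q (Suc n))) x)))"
      using sum.shift_bounds_nat_ivl[of "\<lambda>j. r n ((F ^^ j) x)" 0 "m * q (Suc n)" "q (Suc n)"]
      by (simp add: funpow_add lessThan_atLeast0 add.commute)
    then show "(\<Sum>j\<in>{m * q (Suc n)..<m * q (Suc n) + q (Suc n)}. r n ((F ^^ j) x)) \<le> 1"
      using arc_lengths_sum_le_1 by simp
  qed
  finally show ?thesis by simp
qed

lemma block_hits:
  assumes "k \<le> M * q (Suc n)"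
  shows "card {j. j < k \<and> (\<exists>m::int. (F ^^ j) x \<le> c + of_int m \<and> c + of_int m < Phi (gap n) ((F ^^ j) x))} \<le> M"
    (is "card {j. j < k \<and> ?P j} \<le> M")
proof -
  define N where "N = q (Suc n)"
  have "card {j. j < M' * N \<and> ?P j} \<le> M'" for M'
  proof (induction M')
    case (Suc M')
    have "{j. j < Suc M' * N \<and> ?P j} \<subseteq> {j. j < M' * N \<and> ?P j} \<union>
        (\<lambda>j. j + M' * N) ` {j. j < N \<and> (\<exists>m::int. (F ^^ j) ((F ^^ (M' * N)) x) \<le> c + of_int m
          \<and> c + of_int m < Phi (gap n) ((F ^^ j) ((F ^^ (M' * N)) x)))}" (is "_ \<subseteq> ?A \<union> ?f ` ?B")
    proof
      fix j assume j: "j \<in> {j. j < Suc M' * N \<and> ?P j}"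
      show "j \<in> ?A \<union> ?f ` ?B"
      proof (cases "j < M' * N")
        case False
        then have eq: "(F ^^ (j - M' * N)) ((F ^^ (M' * N)) x) = (F ^^ j) x"
          by (metis comp_apply funpow_add le_add_diff_inverse2 not_less)
        have "j - M' * N \<in> ?B" "j = ?f (j - M' * N)"
          using False j eq by auto
        then show ?thesis by blast
      qed (use j in auto)
    qed
    then have "card {j. j < Suc M' * N \<and> ?P j} \<le> card (?A \<union> ?f ` ?B)"
      by (intro card_mono) auto
    also have "\<dots> \<le> card ?A + card (?f ` ?B)" by (rule card_Un_le)
    also have "\<dots> \<le> M' + 1"
      using Suc arc_hits_le_1[of N n "(F ^^ (M' * N)) x" c] card_image_le[of ?B ?f]
      by (intro add_mono) (auto simp: N_def intro: order_trans)
    finally show ?case by simp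
  qed simp
  then have "card {j. j < M * N \<and> ?P j} \<le> M" .
  moreover have "card {j. j < k \<and> ?P j} \<le> card {j. j < M * N \<and> ?P j}"
    using assms by (intro card_mono) (auto simp: N_def)
  ultimately show ?thesis by linarith
qed

text \<open>The orbit segment of length \<open>q n + q (Suc n)\<close> meets every return arc of level \<open>n\<close>: if its
  last point to the left of the right endpoint were also to the left of \<open>w\<close>, a step by one of the
  two gaps would lead to a later point of the segment.\<close>

lemma covering:
  obtains k m where "k < q n + q (Suc n)"
    "w \<le> (F ^^ k) z + of_int m" "(F ^^ k) z + of_int m < Phi (gap n) w"
proof -
  define e where "e = Phi (gap n) w"
  define l where "l k = \<lceil>e - (F ^^ k) z\<rceil> - 1" for k
  define y where "y k = (F ^^ k) z + of_int (l k)" for k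
  have y_less: "y k < e" for k unfolding y_def l_def by linarith
  have y_max: "(F ^^ k) z + of_int m \<le> y k" if "(F ^^ k) z + of_int m < e" for k m
  proof -
    have "m < \<lceil>e - (F ^^ k) z\<rceil>" using that by linarith
    then have "m \<le> l k" unfolding l_def by simp
    then show ?thesis unfolding y_def by simp
  qed
  have y_eq: "y k = Phi (real k * \<rho> + of_int (l k)) z" for k
    using Phi_add[of "of_int (l k)" "real k * \<rho>" z] by (simp add: y_def Phi_int Phi_iter add.commute)
  define I where "I = {..<q n + q (Suc n)}"
  have "finite (y ` I)" "y ` I \<noteq> {}" using q_pos[of n] unfolding I_def by auto
  then have "Max (y ` I) \<in> y ` I" by (rule Max_in)
  then obtain k where k0: "k \<in> I" "Max (y ` I) = y k" by blast
  have k: "k \<in> I" "\<And>j. j \<in> I \<Longrightarrow> y j \<le> y k"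
    using k0 Max_ge[OF \<open>finite (y ` I)\<close>] by auto
  have no_bigger: False if "j \<in> I" "y k < Phi (real j * \<rho> + of_int m) z" "Phi (real j * \<rho> + of_int m) z < e" for j m
  proof -
    have "Phi (real j * \<rho> + of_int m) z = (F ^^ j) z + of_int m"
      using Phi_add[of "of_int m" "real j * \<rho>" z] by (simp add: Phi_int Phi_iter add.commute)
    then show False using y_max[of j m] that k(2)[of j] by simp
  qed
  have "w \<le> y k"
  proof (rule ccontr)
    assume "\<not> w \<le> y k"
    then have less: "Phi (gap n) (y k) < e" unfolding e_def using Phi_mono_iff[OF Gam_gap] by simp
    have G: "real j * \<rho> + of_int m \<in> Gam" for j and m :: int by simp
    \<comment> \<open>for every index below \<open>q n + q (Suc n)\<close> one of the two gaps leads to another such index\<close>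
    obtain j m i where j: "j \<in> I" "i \<in> {n, Suc n}"
      "real j * \<rho> + of_int m = gap i + (real k * \<rho> + of_int (l k))"
    proof (cases "even n")
      case True
      show ?thesis
      proof (cases "k < q (Suc n)")
        case k: True
        show ?thesis
          by (rule that[of "k + q n" n "l k - int (cf_num a n)"])
             (use k True sgap_eq_gap[of n] in \<open>auto simp: I_def sgap_def algebra_simps\<close>)
      next
        case False
        show ?thesis
          by (rule that[of "k - q (Suc n)" "Suc n" "l k + int (cf_num a (Suc n))"])
             (use k False True sgap_eq_gap[of "Suc n"] in \<open>auto simp: I_def sgap_def algebra_simps of_nat_diff\<close>)
      qed
    next
      case False
      show ?thesis
      proof (cases "k < q n")
        case k: True
        show ?thesis
          by (rule that[of "k + q (Suc n)" "Suc n" "l k - int (cf_num a (Suc n))"])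
             (use k False sgap_eq_gap[of "Suc n"] in \<open>auto simp: I_def sgap_def algebra_simps\<close>)
      next
        case k': False
        show ?thesis
          by (rule that[of "k - q n" n "l k + int (cf_num a n)"])
             (use k k' False sgap_eq_gap[of n] in \<open>auto simp: I_def sgap_def algebra_simps of_nat_diff\<close>)
      qed
    qed
    have eq: "Phi (real j * \<rho> + of_int m) z = Phi (gap i) (y k)"
      unfolding j(3) y_eq by (rule Phi_add) auto
    have "y k < Phi (gap i) (y k)" using Phi_pos[OF Gam_gap] gap_pos by blast
    moreover have "Phi (gap i) (y k) \<le> Phi (gap n) (y k)"
      using j(2) gap_Suc_less[of n] by (auto simp: Phi_le_iff)
    ultimately show False using no_bigger[OF j(1), of m] less eq by auto
  qed
  then show ?thesis
    using that[of k "l k"] k(1) y_less[of k] unfolding I_def y_def e_def by auto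
qed

end

section \<open>Cross-ratios\<close>

text \<open>With consecutive intervals of lengths \<open>L\<close>, \<open>M\<close>, \<open>R\<close>, \<open>cr\<close> is close to one if \<open>M\<close> is short. The
  second cross-ratio is \<open>1 / cr - 1\<close>; it remains sensitive when one of the intervals is tiny.\<close>

definition cr :: "real \<Rightarrow> real \<Rightarrow> real \<Rightarrow> real \<Rightarrow> real"
  where "cr x1 x2 x3 x4 = ((x2 - x1) * (x4 - x3)) / ((x3 - x1) * (x4 - x2))"

definition crp :: "real \<Rightarrow> real \<Rightarrow> real \<Rightarrow> real \<Rightarrow> real"
  where "crp x1 x2 x3 x4 = ((x3 - x2) * (x4 - x1)) / ((x2 - x1) * (x4 - x3))"

lemma cr_pos: "x1 < x2 \<Longrightarrow> x2 < x3 \<Longrightarrow> x3 < x4 \<Longrightarrow> 0 < cr x1 x2 x3 x4"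
  by (simp add: cr_def)

lemma crp_pos: "x1 < x2 \<Longrightarrow> x2 < x3 \<Longrightarrow> x3 < x4 \<Longrightarrow> 0 < crp x1 x2 x3 x4"
  by (simp add: crp_def)

lemma cr_shift: "cr (x1 + m) (x2 + m) (x3 + m) (x4 + m) = cr x1 x2 x3 x4"
  by (simp add: cr_def)

lemma cr_le_ratios:
  assumes "x1 < x2" "x2 < x3" "x3 < x4" "0 < \<epsilon>" "\<epsilon> \<le> cr x1 x2 x3 x4"
  shows "\<epsilon> * (x3 - x2) \<le> x2 - x1" "\<epsilon> * (x3 - x2) \<le> x4 - x3"
proof -
  define L M R where "L = x2 - x1" and "M = x3 - x2" and "R = x4 - x3"
  have pos: "L > 0" "M > 0" "R > 0" using assms by (auto simp: L_def M_def R_def)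
  have "cr x1 x2 x3 x4 = (L / (L + M)) * (R / (M + R))"
    by (simp add: cr_def L_def M_def R_def)
  moreover have "L / (L + M) \<le> 1" "R / (M + R) \<le> 1" "0 \<le> L / (L + M)" "0 \<le> R / (M + R)"
    using pos by (auto simp: divide_simps)
  ultimately have "\<epsilon> \<le> L / (L + M)" "\<epsilon> \<le> R / (M + R)"
    using assms(5) mult_left_le[of "R / (M + R)" "L / (L + M)"] mult_left_le_one_le[of "R / (M + R)" "L / (L + M)"]
    by linarith+
  then have "\<epsilon> * (L + M) \<le> L" "\<epsilon> * (M + R) \<le> R"
    using pos by (simp_all add: pos_le_divide_eq)
  moreover have "\<epsilon> * L \<ge> 0" "\<epsilon> * R \<ge> 0" using pos assms by auto
  ultimately show "\<epsilon> * (x3 - x2) \<le> x2 - x1" "\<epsilon> * (x3 - x2) \<le> x4 - x3"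
    unfolding L_def M_def R_def by (simp_all add: algebra_simps)
qed

lemma cr_ge:
  assumes "0 < m" "m \<le> x2 - x1" "m \<le> x4 - x3" "x2 < x3" "x3 - x2 \<le> A * m" "0 < A"
  shows "(1 / (1 + A))\<^sup>2 \<le> cr x1 x2 x3 x4"
proof -
  have 1: "1 / (1 + A) \<le> L / (L + (x3 - x2))" if "m \<le> L" for L
  proof -
    have "x3 - x2 \<le> A * L" using assms that by (meson mult_left_mono less_imp_le order_trans)
    then have "L + (x3 - x2) \<le> (1 + A) * L" by (simp add: algebra_simps)
    moreover have "L + (x3 - x2) > 0" using assms that by linarith
    ultimately show ?thesis using assms by (simp add: field_simps)
  qed
  have "(1 / (1 + A))\<^sup>2 = 1 / (1 + A) * (1 / (1 + A))" by (simp add: power2_eq_square)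
  also have "\<dots> \<le> ((x2 - x1) / ((x2 - x1) + (x3 - x2))) * ((x4 - x3) / ((x4 - x3) + (x3 - x2)))"
    using assms by (intro mult_mono 1) auto
  also have "\<dots> = cr x1 x2 x3 x4" by (simp add: cr_def)
  finally show ?thesis .
qed

section \<open>Distance to the critical orbit modulo one\<close>

definition cdist :: "real \<Rightarrow> real \<Rightarrow> real"
  where "cdist c x = \<bar>x - c - of_int (round (x - c))\<bar>"

lemma cdist_le: "cdist c x \<le> \<bar>x - c - of_int k\<bar>"
  unfolding cdist_def using round_diff_minimal[of "x - c" k] by simp

lemma cdist_eq: obtains k :: int where "cdist c x = \<bar>x - (c + of_int k)\<bar>"
  using that[of "round (x - c)"] unfolding cdist_def by (simp add: algebra_simps)

lemma cdist_nonneg: "0 \<le> cdist c x"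
  by (simp add: cdist_def)

lemma cdist_le_half: "cdist c x \<le> 1 / 2"
  unfolding cdist_def using of_int_round_abs_le[of "x - c"] by (simp add: abs_minus_commute)

lemma cdist_lipschitz: "cdist c x \<le> cdist c y + \<bar>x - y\<bar>"
proof -
  obtain k :: int where "cdist c y = \<bar>y - (c + of_int k)\<bar>" by (rule cdist_eq)
  then show ?thesis using cdist_le[of c x k] by linarith
qed

lemma cdist_near:
  assumes "\<bar>x - (c + of_int k)\<bar> \<le> 1 / 2"
  shows "cdist c x = \<bar>x - (c + of_int k)\<bar>"
proof -
  obtain l :: int where l: "cdist c x = \<bar>x - (c + of_int l)\<bar>" by (rule cdist_eq)
  show ?thesis
  proof (cases "l = k")
    case False
    then have "\<bar>of_int l - of_int k :: real\<bar> \<ge> 1" by linarith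
    then show ?thesis using assms l cdist_le[of c x k] by linarith
  qed (use l in simp)
qed

definition crit_free :: "real \<Rightarrow> real \<Rightarrow> real \<Rightarrow> bool"
  where "crit_free c x y \<longleftrightarrow> (\<forall>k::int. c + of_int k \<notin> {x..y})"

section \<open>Real bounds\<close>

text \<open>All that is used of the smoothness: the derivative has a power law, and on short
  intervals \<open>T\<close> without critical points cross-ratios change in one direction only, up to a factor
  \<open>exp (K |T|)\<close>, while the distortion of the derivative is inversely proportional to the
  distance to the critical points.\<close>

locale critical_lift = circle_lift a \<rho> F for a \<rho> F +
  fixes F' :: "real \<Rightarrow> real" and c K e \<delta> :: real and B :: nat
  assumes F_deriv: "(F has_real_derivative F' x) (at x)"
    and K_ge_1: "1 \<le> K" and e_pos: "0 < e" and \<delta>_pos: "0 < \<delta>"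
    and F'_lower: "cdist c x powr e \<le> K * F' x" and F'_upper: "F' x \<le> K * cdist c x powr e"
    and cr_good: "x1 < x2 \<Longrightarrow> x2 < x3 \<Longrightarrow> x3 < x4 \<Longrightarrow> x4 - x1 \<le> \<delta> \<Longrightarrow> crit_free c x1 x4 \<Longrightarrow>
      cr (F x1) (F x2) (F x3) (F x4) \<le> exp (K * (x4 - x1)) * cr x1 x2 x3 x4"
    and crp_good: "x1 < x2 \<Longrightarrow> x2 < x3 \<Longrightarrow> x3 < x4 \<Longrightarrow> x4 - x1 \<le> \<delta> \<Longrightarrow> crit_free c x1 x4 \<Longrightarrow>
      crp x1 x2 x3 x4 \<le> exp (K * (x4 - x1)) * crp (F x1) (F x2) (F x3) (F x4)"
    and F'_distortion: "x \<le> y \<Longrightarrow> y - x \<le> \<delta> \<Longrightarrow> crit_free c x y \<Longrightarrow> 0 < m \<Longrightarrow> m \<le> cdist c x \<Longrightarrow>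
      m \<le> cdist c y \<Longrightarrow> \<bar>ln (F' x) - ln (F' y)\<bar> \<le> K * (y - x) / m"
    and bounded_type: "a n \<le> B"
begin

lemma F_MVT:
  assumes "x < y" obtains \<xi> where "x < \<xi>" "\<xi> < y" "F y - F x = (y - x) * F' \<xi>"
  using MVT2[OF assms, of F F'] F_deriv by (metis mult.commute)

text \<open>The weight \<open>cdist\<^sup>e\<close> cannot be small on most of an interval compared with its value at
  one point: either that value is large on the scale of the interval, and the weight is comparable
  to it nearby, or the critical point is close by and the interval soon leads away from it.\<close>

lemma half_average:
  assumes "0 < h" "h \<le> 4" "\<sigma> = 1 \<or> \<sigma> = -1"
  shows "h * cdist c \<xi> powr e \<le> K * 64 * 2 powr e * \<bar>F (\<xi> + \<sigma> * h) - F \<xi>\<bar>"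
proof -
  define D where "D = cdist c \<xi>"
  have D0: "0 \<le> D" "D \<le> 1 / 2" unfolding D_def by (rule cdist_nonneg, rule cdist_le_half)
  have *: ?thesis if AB: "0 \<le> \<alpha>" "\<alpha> < \<beta>" "\<beta> \<le> h" "h / 64 \<le> \<beta> - \<alpha>"
    and far: "\<And>y. \<alpha> \<le> y \<Longrightarrow> y \<le> \<beta> \<Longrightarrow> D / 2 \<le> cdist c (\<xi> + \<sigma> * y)" for \<alpha> \<beta>
  proof -
    define x y where "x = min (\<xi> + \<sigma> * \<alpha>) (\<xi> + \<sigma> * \<beta>)" and "y = max (\<xi> + \<sigma> * \<alpha>) (\<xi> + \<sigma> * \<beta>)"
    have xy: "x < y" "y - x = \<beta> - \<alpha>" using AB assms(3) unfolding x_def y_def by auto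
    obtain \<eta> where \<eta>: "x < \<eta>" "\<eta> < y" "F y - F x = (y - x) * F' \<eta>" using F_MVT[OF xy(1)] by blast
    define z where "z = \<sigma> * (\<eta> - \<xi>)"
    have "\<alpha> \<le> z" "z \<le> \<beta>" "\<xi> + \<sigma> * z = \<eta>"
      using \<eta> assms(3) AB unfolding x_def y_def z_def by auto
    then have "D / 2 \<le> cdist c \<eta>" using far[of z] by simp
    then have "(D / 2) powr e \<le> cdist c \<eta> powr e" using D0 e_pos by (intro powr_mono2) auto
    then have "(D / 2) powr e \<le> K * F' \<eta>" using F'_lower[of \<eta>] by linarith
    then have "D powr e \<le> 2 powr e * (K * F' \<eta>)"
      using D0 by (simp add: powr_divide pos_divide_le_eq mult.commute)
    moreover have "F' \<eta> \<ge> 0" using F'_lower[of \<eta>] K_ge_1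
      by (metis less_le_trans mult_pos_neg not_le powr_ge_zero zero_less_one)
    ultimately have "h * D powr e \<le> (64 * (\<beta> - \<alpha>)) * (2 powr e * (K * F' \<eta>))"
      using AB K_ge_1 by (intro mult_mono) auto
    also have "\<dots> = K * 64 * 2 powr e * (F y - F x)" using \<eta>(3) xy(2) by simp
    also have "\<dots> \<le> K * 64 * 2 powr e * \<bar>F (\<xi> + \<sigma> * h) - F \<xi>\<bar>"
    proof (intro mult_left_mono)
      have Fle: "F u \<le> F v" if "u \<le> v" for u v using that F_less[of v u] by auto
      show "F y - F x \<le> \<bar>F (\<xi> + \<sigma> * h) - F \<xi>\<bar>"
        using assms(3)
      proof
        assume "\<sigma> = 1"
        then show ?thesis using Fle[of \<xi> x] Fle[of y "\<xi> + h"] AB unfolding x_def y_def by auto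
      next
        assume "\<sigma> = -1"
        then show ?thesis using Fle[of y \<xi>] Fle[of "\<xi> - h" x] AB unfolding x_def y_def by auto
      qed
    qed (use K_ge_1 in auto)
    finally show ?thesis unfolding D_def .
  qed
  obtain k :: int where k: "D = \<bar>\<xi> - (c + of_int k)\<bar>" unfolding D_def by (rule cdist_eq)
  show ?thesis
  proof (cases "h \<le> 32 * D")
    case True
    show ?thesis
    proof (rule *[of 0 "min h (D / 2)"])
      fix y assume "0 \<le> y" "y \<le> min h (D / 2)"
      then show "D / 2 \<le> cdist c (\<xi> + \<sigma> * y)"
        using cdist_lipschitz[of c \<xi> "\<xi> + \<sigma> * y"] assms(3) unfolding D_def by auto
    qed (use True assms D0 in auto)
  next
    case False
    show ?thesis
    proof (rule *[of "h / 16" "h / 12"])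
      fix y assume y: "h / 16 \<le> y" "y \<le> h / 12"
      have near: "y - D \<le> \<bar>\<xi> + \<sigma> * y - (c + of_int k)\<bar>" "\<bar>\<xi> + \<sigma> * y - (c + of_int k)\<bar> \<le> y + D"
        using k assms y by auto
      then have "cdist c (\<xi> + \<sigma> * y) = \<bar>\<xi> + \<sigma> * y - (c + of_int k)\<bar>"
        using False y assms by (intro cdist_near) linarith
      then show "D / 2 \<le> cdist c (\<xi> + \<sigma> * y)" using near False y D0 by linarith
    qed (use assms in auto)
  qed
qed

definition slope_const :: real where "slope_const = K * (K * 64 * 2 powr e * 2)"

lemma slope_const_ge_1: "1 \<le> slope_const"
proof -
  have "1 \<le> (2::real) powr e" using e_pos by (simp add: ge_one_powr_ge_zero)
  then have "1 * 1 \<le> K * (K * 64 * 2 powr e * 2)"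
    using K_ge_1 by (intro mult_mono) (auto intro!: mult_ge1_I)
  then show ?thesis by (simp add: slope_const_def)
qed

lemma slope_sub:
  assumes "u \<le> u'" "u' < v'" "v' \<le> v" "v - u \<le> 4"
  shows "(F v' - F u') * (v - u) \<le> slope_const * ((F v - F u) * (v' - u'))"
proof -
  obtain \<xi> where \<xi>: "u' < \<xi>" "\<xi> < v'" "F v' - F u' = (v' - u') * F' \<xi>"
    using F_MVT[OF assms(2)] by blast
  have Fle: "F u \<le> F v" if "u \<le> v" for u v using that F_less[of v u] by auto
  have "(v - u) / 2 * cdist c \<xi> powr e \<le> K * 64 * 2 powr e * (F v - F u)"
  proof (cases "(v - u) / 2 \<le> v - \<xi>")
    case True
    have "(v - u) / 2 * cdist c \<xi> powr e \<le> K * 64 * 2 powr e * \<bar>F (\<xi> + 1 * ((v - u) / 2)) - F \<xi>\<bar>"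
      using assms by (intro half_average) auto
    also have "\<dots> \<le> K * 64 * 2 powr e * (F v - F u)"
      using Fle[of \<xi> "\<xi> + (v - u) / 2"] Fle[of "\<xi> + (v - u) / 2" v] Fle[of u \<xi>] True assms \<xi> K_ge_1
      by (intro mult_left_mono) auto
    finally show ?thesis .
  next
    case False
    have "(v - u) / 2 * cdist c \<xi> powr e \<le> K * 64 * 2 powr e * \<bar>F (\<xi> + (-1) * ((v - u) / 2)) - F \<xi>\<bar>"
      using assms by (intro half_average) auto
    also have "\<dots> \<le> K * 64 * 2 powr e * (F v - F u)"
      using Fle[of "\<xi> - (v - u) / 2" \<xi>] Fle[of u "\<xi> - (v - u) / 2"] Fle[of \<xi> v] False assms \<xi> K_ge_1
      by (intro mult_left_mono) (auto simp: field_simps)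
    finally show ?thesis .
  qed
  then have "(v - u) * cdist c \<xi> powr e \<le> K * 64 * 2 powr e * 2 * (F v - F u)" by simp
  moreover have "F' \<xi> * (v - u) \<le> K * cdist c \<xi> powr e * (v - u)"
    using F'_upper[of \<xi>] assms by (intro mult_right_mono) auto
  ultimately have "F' \<xi> * (v - u) \<le> K * (K * 64 * 2 powr e * 2 * (F v - F u))"
    using K_ge_1 mult_left_mono[of "(v - u) * cdist c \<xi> powr e" "K * 64 * 2 powr e * 2 * (F v - F u)" K]
    by (simp add: algebra_simps)
  then have "F' \<xi> * (v - u) \<le> slope_const * (F v - F u)" by (simp add: slope_const_def algebra_simps)
  then have "(v' - u') * (F' \<xi> * (v - u)) \<le> (v' - u') * (slope_const * (F v - F u))"
    using assms by (intro mult_left_mono) auto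
  then show ?thesis unfolding \<xi>(3) by (simp add: algebra_simps)
qed

text \<open>For intervals that are long or contain a critical point. There are boundedly many such
  steps in an orbit segment, so that losing a constant factor is harmless.\<close>

lemma cr_bad:
  assumes "x1 < x2" "x2 < x3" "x3 < x4" "x4 - x1 \<le> 4"
  shows "cr (F x1) (F x2) (F x3) (F x4) \<le> slope_const\<^sup>2 * cr x1 x2 x3 x4"
proof -
  have F: "F x1 < F x2" "F x2 < F x3" "F x3 < F x4" using assms by (auto simp: F_less)
  have "(F x2 - F x1) * (x3 - x1) \<le> slope_const * ((F x3 - F x1) * (x2 - x1))"
    "(F x4 - F x3) * (x4 - x2) \<le> slope_const * ((F x4 - F x2) * (x4 - x3))"
    using assms by (auto intro!: slope_sub)
  then have "(F x2 - F x1) / (F x3 - F x1) \<le> slope_const * ((x2 - x1) / (x3 - x1))"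
    "(F x4 - F x3) / (F x4 - F x2) \<le> slope_const * ((x4 - x3) / (x4 - x2))"
    using F assms by (auto simp: field_simps)
  then have "(F x2 - F x1) / (F x3 - F x1) * ((F x4 - F x3) / (F x4 - F x2)) \<le>
      slope_const * ((x2 - x1) / (x3 - x1)) * (slope_const * ((x4 - x3) / (x4 - x2)))"
    using F assms slope_const_ge_1 by (intro mult_mono) auto
  then show ?thesis by (simp add: cr_def power2_eq_square mult_ac)
qed

text \<open>If the middle interval is tiny and the critical point lies in it, no inequality of this
  form holds; the last assumption excludes this case.\<close>

lemma crp_bad:
  assumes "x1 < x2" "x2 < x3" "x3 < x4" "x4 - x1 \<le> 4" "F x4 - F x1 \<le> A * (F x3 - F x2)"
  shows "crp x1 x2 x3 x4 \<le> A * slope_const\<^sup>2 * crp (F x1) (F x2) (F x3) (F x4)"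
proof -
  have F: "F x1 < F x2" "F x2 < F x3" "F x3 < F x4" using assms by (auto simp: F_less)
  have A: "A > 0"
  proof (rule ccontr)
    assume "\<not> A > 0"
    then have "A * (F x3 - F x2) \<le> 0" using F by (intro mult_nonpos_nonneg) auto
    then show False using assms(5) F by linarith
  qed
  have 1: "(F x2 - F x1) * (x4 - x1) \<le> slope_const * ((F x4 - F x1) * (x2 - x1))"
    and 2: "(F x4 - F x3) * (x4 - x1) \<le> slope_const * ((F x4 - F x1) * (x4 - x3))"
    using assms by (auto intro!: slope_sub)
  have "(x3 - x2) * (F x2 - F x1) \<le> (x4 - x1) * (F x2 - F x1)"
    using assms F by (intro mult_right_mono) auto
  also have "\<dots> \<le> slope_const * ((F x4 - F x1) * (x2 - x1))" using 1 by (simp add: mult.commute)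
  also have "\<dots> \<le> slope_const * (A * (F x3 - F x2) * (x2 - x1))"
    using assms slope_const_ge_1 by (intro mult_left_mono mult_right_mono) auto
  finally have "(x3 - x2) / (x2 - x1) \<le> A * slope_const * ((F x3 - F x2) / (F x2 - F x1))"
    using assms F by (simp add: field_simps)
  moreover have "(x4 - x1) / (x4 - x3) \<le> slope_const * ((F x4 - F x1) / (F x4 - F x3))"
    using 2 assms F by (simp add: field_simps)
  ultimately have "(x3 - x2) / (x2 - x1) * ((x4 - x1) / (x4 - x3)) \<le>
     A * slope_const * ((F x3 - F x2) / (F x2 - F x1)) * (slope_const * ((F x4 - F x1) / (F x4 - F x3)))"
    using assms F A slope_const_ge_1 by (intro mult_mono) auto
  then show ?thesis by (simp add: crp_def power2_eq_square mult_ac)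
qed

definition hull_len :: "nat \<Rightarrow> real \<Rightarrow> real"
  where "hull_len n x = Phi (2 * gap n) x - Phi (- gap n) x"

lemma hull_len_eq: "hull_len n x = r n (Phi (- gap n) x) + r n x + r n (Phi (gap n) x)"
  by (simp add: hull_len_def r_def Phi_double)

definition bad :: "nat \<Rightarrow> real \<Rightarrow> bool"
  where "bad n x \<longleftrightarrow> hull_len n x > \<delta> \<or> \<not> crit_free c (Phi (- gap n) x) (Phi (2 * gap n) x)"

definition bad_count :: "nat \<Rightarrow> nat"
  where "bad_count M = nat \<lceil>3 * real M / \<delta>\<rceil> + 4 * M"

lemma hull_len_sum:
  assumes "k \<le> M * q (Suc n)" shows "(\<Sum>j<k. hull_len n ((F ^^ j) x)) \<le> 3 * real M"
  using block_sum[OF assms, of x] block_sum[OF assms, of "Phi (gap n) x"]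
    block_sum[OF assms, of "Phi (- gap n) x"]
  by (simp add: hull_len_eq Phi_F sum.distrib)

text \<open>The total length of the hulls bounds the number of long ones, and disjointness of the
  return arcs bounds how often the four arcs that cover a hull contain a critical point.\<close>

lemma card_bad:
  assumes "k \<le> M * q (Suc n)" shows "card {j. j < k \<and> bad n ((F ^^ j) x)} \<le> bad_count M"
proof -
  define S where "S = {j. j < k \<and> hull_len n ((F ^^ j) x) > \<delta>}"
  define H where "H y = {j. j < k \<and> (\<exists>m::int. (F ^^ j) y \<le> c + of_int m \<and> c + of_int m < Phi (gap n) ((F ^^ j) y))}" for y
  have fin: "finite S" "finite (H y)" for y by (auto simp: S_def H_def)
  have "\<delta> * real (card S) = (\<Sum>j\<in>S. \<delta>)" by simp
  also have "\<dots> \<le> (\<Sum>j\<in>S. hull_len n ((F ^^ j) x))"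
    by (rule sum_mono) (auto simp: S_def)
  also have "\<dots> \<le> (\<Sum>j<k. hull_len n ((F ^^ j) x))"
    by (rule sum_mono2) (auto simp: S_def hull_len_eq intro!: add_nonneg_nonneg less_imp_le[OF r_pos])
  also have "\<dots> \<le> 3 * real M" by (rule hull_len_sum[OF assms])
  finally have "real (card S) \<le> 3 * real M / \<delta>" using \<delta>_pos by (simp add: field_simps)
  then have cS: "card S \<le> nat \<lceil>3 * real M / \<delta>\<rceil>" by linarith
  have cH: "card (H y) \<le> M" for y unfolding H_def by (rule block_hits[OF assms])
  define g where "g = gap n"
  have Gg: "g \<in> Gam" by (simp add: g_def)
  have "{j. j < k \<and> bad n ((F ^^ j) x)} \<subseteq>
      S \<union> (H (Phi (- g) x) \<union> H x \<union> H (Phi g x) \<union> H (Phi (2 * g) x))"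
  proof
    fix j assume "j \<in> {j. j < k \<and> bad n ((F ^^ j) x)}"
    then have j: "j < k" "bad n ((F ^^ j) x)" by auto
    show "j \<in> S \<union> (H (Phi (- g) x) \<union> H x \<union> H (Phi g x) \<union> H (Phi (2 * g) x))"
    proof (cases "j \<in> S")
      case False
      then obtain m :: int where m: "Phi (- g) ((F ^^ j) x) \<le> c + of_int m" "c + of_int m \<le> Phi (2 * g) ((F ^^ j) x)"
        using j unfolding bad_def S_def crit_free_def g_def by auto
      define y where "y = (F ^^ j) x"
      have 2: "Phi g (Phi g y) = Phi (2 * g) y" using Gg by (simp add: Phi_double)
      have 3: "Phi (2 * g) y < Phi g (Phi (2 * g) y)"
        using Phi_pos[OF Gg] gap_pos[of n] by (simp add: g_def)
      consider "c + of_int m < y" | "y \<le> c + of_int m" "c + of_int m < Phi g y"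
        | "Phi g y \<le> c + of_int m" "c + of_int m < Phi (2 * g) y" | "c + of_int m = Phi (2 * g) y"
        using m unfolding y_def by linarith
      then have "j \<in> H (Phi (- g) x) \<union> H x \<union> H (Phi g x) \<union> H (Phi (2 * g) x)"
      proof cases
        case 1
        then have "j \<in> H (Phi (- g) x)"
          using j(1) m(1) Gg unfolding H_def y_def g_def[symmetric] by (auto simp flip: Phi_F)
        then show ?thesis by blast
      next
        case 2
        then have "j \<in> H x"
          using j(1) unfolding H_def y_def g_def[symmetric] by auto
        then show ?thesis by blast
      next
        case 3
        then have "j \<in> H (Phi g x)"
          using j(1) Gg 2 unfolding H_def y_def g_def[symmetric] by (auto simp flip: Phi_F)
        then show ?thesis by blast
      next
        case 4
        then have "j \<in> H (Phi (2 * g) x)"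
          using j(1) Gg 3 unfolding H_def y_def g_def[symmetric] by (auto simp flip: Phi_F intro!: exI[of _ m])
        then show ?thesis by blast
      qed
      then show ?thesis by blast
    qed auto
  qed
  then have "card {j. j < k \<and> bad n ((F ^^ j) x)} \<le>
      card (S \<union> (H (Phi (- g) x) \<union> H x \<union> H (Phi g x) \<union> H (Phi (2 * g) x)))"
    by (rule card_mono[rotated]) (use fin in auto)
  also have "\<dots> \<le> card S + (card (H (Phi (- g) x)) + card (H x) + card (H (Phi g x)) + card (H (Phi (2 * g) x)))"
    by (meson add_mono card_Un_le order_refl order_trans)
  also have "\<dots> \<le> bad_count M"
    unfolding bad_count_def using cS cH[of "Phi (- g) x"] cH[of x] cH[of "Phi g x"] cH[of "Phi (2 * g) x"]
    by linarith
  finally show ?thesis .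
qed

lemma chain:
  fixes X w :: "nat \<Rightarrow> real"
  assumes "1 \<le> C" and "\<And>j. j \<le> k \<Longrightarrow> 0 \<le> X j"
    and "\<And>j. j < k \<Longrightarrow> X (Suc j) \<le> exp (w j) * (if P j then C else 1) * X j"
  shows "X k \<le> exp (\<Sum>j<k. w j) * C ^ card {j. j < k \<and> P j} * X 0"
  using assms
proof (induction k)
  case (Suc k)
  have IH: "X k \<le> exp (\<Sum>j<k. w j) * C ^ card {j. j < k \<and> P j} * X 0"
    by (rule Suc.IH) (use Suc.prems in auto)
  have eq: "{j. j < Suc k \<and> P j} = (if P k then insert k {j. j < k \<and> P j} else {j. j < k \<and> P j})"
    by (auto simp: less_Suc_eq)
  have card: "C ^ card {j. j < Suc k \<and> P j} = (if P k then C else 1) * C ^ card {j. j < k \<and> P j}"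
    unfolding eq by simp
  have "X (Suc k) \<le> exp (w k) * (if P k then C else 1) * X k" using Suc.prems by simp
  also have "\<dots> \<le> exp (w k) * (if P k then C else 1) * (exp (\<Sum>j<k. w j) * C ^ card {j. j < k \<and> P j} * X 0)"
    using IH Suc.prems(1) by (intro mult_left_mono) auto
  also have "\<dots> = exp (\<Sum>j<Suc k. w j) * C ^ card {j. j < Suc k \<and> P j} * X 0"
    unfolding card by (simp add: exp_add mult_ac)
  finally show ?case .
qed simp

definition push_const :: "nat \<Rightarrow> real \<Rightarrow> real"
  where "push_const M A = exp (K * (3 * real M)) * (A * slope_const\<^sup>2) ^ bad_count M"

lemma push_const_ge_1: "1 \<le> A \<Longrightarrow> 1 \<le> push_const M A"
  unfolding push_const_def using K_ge_1 slope_const_ge_1 by (intro mult_ge1_I one_le_power) auto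

lemma push_chain:
  fixes X :: "nat \<Rightarrow> real"
  assumes "k \<le> M * q (Suc n)" "1 \<le> A"
    and "\<And>j. j \<le> k \<Longrightarrow> 0 \<le> X j"
    and good: "\<And>j. j < k \<Longrightarrow> \<not> bad n ((F ^^ j) x) \<Longrightarrow> X (Suc j) \<le> exp (K * hull_len n ((F ^^ j) x)) * X j"
    and bad: "\<And>j. j < k \<Longrightarrow> bad n ((F ^^ j) x) \<Longrightarrow> X (Suc j) \<le> A * slope_const\<^sup>2 * X j"
  shows "X k \<le> push_const M A * X 0"
proof -
  have AQ: "1 \<le> A * slope_const\<^sup>2" using assms(2) slope_const_ge_1 by (intro mult_ge1_I one_le_power) auto
  have h0: "0 \<le> K * hull_len n y" for y
    using K_ge_1 r_pos less_imp_le by (auto simp: hull_len_eq intro!: mult_nonneg_nonneg add_nonneg_nonneg)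
  have "X k \<le> exp (\<Sum>j<k. K * hull_len n ((F ^^ j) x)) * (A * slope_const\<^sup>2) ^ card {j. j < k \<and> bad n ((F ^^ j) x)} * X 0"
  proof (rule chain)
    fix j assume j: "j < k"
    show "X (Suc j) \<le> exp (K * hull_len n ((F ^^ j) x)) * (if bad n ((F ^^ j) x) then A * slope_const\<^sup>2 else 1) * X j"
    proof (cases "bad n ((F ^^ j) x)")
      case True
      have "X (Suc j) \<le> 1 * (A * slope_const\<^sup>2 * X j)" using bad[OF j True] by simp
      also have "\<dots> \<le> exp (K * hull_len n ((F ^^ j) x)) * (A * slope_const\<^sup>2 * X j)"
        using h0 AQ assms(3)[of j] j by (intro mult_right_mono) auto
      finally show ?thesis using True by (simp add: mult_ac)
    qed (use good[OF j] in simp)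
  qed (use assms AQ in auto)
  also have "\<dots> \<le> push_const M A * X 0"
    unfolding push_const_def
  proof (intro mult_right_mono mult_mono)
    show "exp (\<Sum>j<k. K * hull_len n ((F ^^ j) x)) \<le> exp (K * (3 * real M))"
      using hull_len_sum[OF assms(1), of x] K_ge_1 by (simp flip: sum_distrib_left)
    show "(A * slope_const\<^sup>2) ^ card {j. j < k \<and> bad n ((F ^^ j) x)} \<le> (A * slope_const\<^sup>2) ^ bad_count M"
      by (rule power_increasing[OF card_bad[OF assms(1)] AQ])
  qed (use assms(3)[of 0] AQ in auto)
  finally show ?thesis .
qed

lemma hull_len_le: "hull_len n x \<le> 4"
  using r_less_1[of n x] r_less_1[of n "Phi (gap n) x"] r_less_1[of n "Phi (- gap n) x"]
  unfolding hull_len_eq by linarith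

lemma hull_iterate:
  assumes "Phi (- gap n) x \<le> y" "y \<le> Phi (2 * gap n) x"
  shows "Phi (- gap n) ((F ^^ j) x) \<le> (F ^^ j) y" "(F ^^ j) y \<le> Phi (2 * gap n) ((F ^^ j) x)"
  using assms by (simp_all add: Phi_F iterate_le)

lemma crit_free_subset: "crit_free c x y \<Longrightarrow> x \<le> x' \<Longrightarrow> y' \<le> y \<Longrightarrow> crit_free c x' y'"
  unfolding crit_free_def atLeastAtMost_iff by (meson order_trans)

lemma cr_push:
  assumes "k \<le> M * q (Suc n)" "x1 < x2" "x2 < x3" "x3 < x4"
    "Phi (- gap n) x \<le> x1" "x4 \<le> Phi (2 * gap n) x"
  shows "cr ((F ^^ k) x1) ((F ^^ k) x2) ((F ^^ k) x3) ((F ^^ k) x4) \<le> push_const M 1 * cr x1 x2 x3 x4"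
proof -
  define X where "X j = cr ((F ^^ j) x1) ((F ^^ j) x2) ((F ^^ j) x3) ((F ^^ j) x4)" for j
  have le: "(F ^^ j) x4 - (F ^^ j) x1 \<le> hull_len n ((F ^^ j) x)" for j
    using hull_iterate[of n x x1 j] hull_iterate[of n x x4 j] assms unfolding hull_len_def by auto
  have "X k \<le> push_const M 1 * X 0"
  proof (rule push_chain[OF assms(1)])
    fix j assume "\<not> bad n ((F ^^ j) x)"
    then have free: "hull_len n ((F ^^ j) x) \<le> \<delta>" "crit_free c (Phi (- gap n) ((F ^^ j) x)) (Phi (2 * gap n) ((F ^^ j) x))"
      by (auto simp: bad_def)
    have "X (Suc j) \<le> exp (K * ((F ^^ j) x4 - (F ^^ j) x1)) * X j"
      unfolding X_def funpow.simps comp_apply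
    proof (rule cr_good)
      show "crit_free c ((F ^^ j) x1) ((F ^^ j) x4)"
        using hull_iterate[of n x x1 j] hull_iterate[of n x x4 j] assms
        by (intro crit_free_subset[OF free(2)]) auto
    qed (use assms le[of j] free in \<open>auto simp: iterate_less\<close>)
    also have "\<dots> \<le> exp (K * hull_len n ((F ^^ j) x)) * X j"
      using le[of j] K_ge_1 assms unfolding X_def
      by (intro mult_right_mono less_imp_le[OF cr_pos]) (auto simp: iterate_less)
    finally show "X (Suc j) \<le> exp (K * hull_len n ((F ^^ j) x)) * X j" .
  next
    fix j
    show "X (Suc j) \<le> 1 * slope_const\<^sup>2 * X j"
      unfolding X_def funpow.simps comp_apply
      using cr_bad[of "(F ^^ j) x1" "(F ^^ j) x2" "(F ^^ j) x3" "(F ^^ j) x4"] assms le[of j] hull_len_le[of n "(F ^^ j) x"]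
      by (simp add: iterate_less)
  qed (use assms in \<open>auto simp: X_def iterate_less intro!: less_imp_le[OF cr_pos]\<close>)
  then show ?thesis by (simp add: X_def)
qed

lemma crp_push:
  assumes "k \<le> M * q (Suc n)" "x1 < x2" "x2 < x3" "x3 < x4" "1 \<le> A"
    "Phi (- gap n) x \<le> x1" "x4 \<le> Phi (2 * gap n) x"
    and A: "\<And>j. (F ^^ j) x4 - (F ^^ j) x1 \<le> A * ((F ^^ j) x3 - (F ^^ j) x2)"
  shows "crp x1 x2 x3 x4 \<le> push_const M A * crp ((F ^^ k) x1) ((F ^^ k) x2) ((F ^^ k) x3) ((F ^^ k) x4)"
proof -
  define Z where "Z j = crp ((F ^^ j) x1) ((F ^^ j) x2) ((F ^^ j) x3) ((F ^^ j) x4)" for j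
  define X where "X j = 1 / Z j" for j
  have Z_pos: "Z j > 0" for j unfolding Z_def using assms by (intro crp_pos) (auto simp: iterate_less)
  have le: "(F ^^ j) x4 - (F ^^ j) x1 \<le> hull_len n ((F ^^ j) x)" for j
    using hull_iterate[of n x x1 j] hull_iterate[of n x x4 j] assms unfolding hull_len_def by auto
  have step: "X (Suc j) \<le> C * X j" if "Z j \<le> C * Z (Suc j)" for C j
    using that Z_pos[of j] Z_pos[of "Suc j"] unfolding X_def by (simp add: field_simps)
  have "X k \<le> push_const M A * X 0"
  proof (rule push_chain[OF assms(1,5)])
    fix j assume "\<not> bad n ((F ^^ j) x)"
    then have free: "hull_len n ((F ^^ j) x) \<le> \<delta>" "crit_free c (Phi (- gap n) ((F ^^ j) x)) (Phi (2 * gap n) ((F ^^ j) x))"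
      by (auto simp: bad_def)
    have "Z j \<le> exp (K * ((F ^^ j) x4 - (F ^^ j) x1)) * Z (Suc j)"
      unfolding Z_def funpow.simps comp_apply
    proof (rule crp_good)
      show "crit_free c ((F ^^ j) x1) ((F ^^ j) x4)"
        using hull_iterate[of n x x1 j] hull_iterate[of n x x4 j] assms
        by (intro crit_free_subset[OF free(2)]) auto
    qed (use assms le[of j] free in \<open>auto simp: iterate_less\<close>)
    also have "\<dots> \<le> exp (K * hull_len n ((F ^^ j) x)) * Z (Suc j)"
      using le[of j] K_ge_1 Z_pos[of "Suc j"] by (intro mult_right_mono) auto
    finally show "X (Suc j) \<le> exp (K * hull_len n ((F ^^ j) x)) * X j" by (rule step)
  next
    fix j
    have "Z j \<le> A * slope_const\<^sup>2 * Z (Suc j)"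
      unfolding Z_def funpow.simps comp_apply
      using crp_bad[of "(F ^^ j) x1" "(F ^^ j) x2" "(F ^^ j) x3" "(F ^^ j) x4" A] assms(2-4) A[of "Suc j"] le[of j] hull_len_le[of n "(F ^^ j) x"]
      by (simp add: iterate_less)
    then show "X (Suc j) \<le> A * slope_const\<^sup>2 * X j" by (rule step)
  qed (use Z_pos less_imp_le in \<open>auto simp: X_def\<close>)
  then have "Z 0 \<le> push_const M A * Z k"
    using Z_pos[of 0] Z_pos[of k] unfolding X_def by (simp add: field_simps)
  then show ?thesis by (simp add: Z_def)
qed

end

section \<open>Bounded geometry\<close>

locale bounded_geometry = circle_lift a \<rho> F for a \<rho> F +
  fixes C :: real and B :: nat
  assumes C_ge_1: "1 \<le> C"
    and r_le_right: "r n x \<le> C * r n (Phi (gap n) x)"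
    and r_le_left: "r n x \<le> C * r n (Phi (- gap n) x)"
    and a_le_B: "a n \<le> B"
begin

lemma r_right_le: "r n (Phi (gap n) x) \<le> C * r n x"
  using r_le_left[of n "Phi (gap n) x"] by simp

lemma r_left_le: "r n (Phi (- gap n) x) \<le> C * r n x"
  using r_le_right[of n "Phi (- gap n) x"] by simp

lemma r_iterate_le: "r n (Phi (real j * gap n) x) \<le> C ^ j * r n x"
proof (induction j)
  case (Suc j)
  have "Phi (real (Suc j) * gap n) x = Phi (gap n) (Phi (real j * gap n) x)"
    using Phi_add[of "gap n" "real j * gap n" x] by (simp add: algebra_simps)
  then have "r n (Phi (real (Suc j) * gap n) x) \<le> C * r n (Phi (real j * gap n) x)"
    using r_right_le by simp
  also have "\<dots> \<le> C * (C ^ j * r n x)" using Suc C_ge_1 by (intro mult_left_mono) auto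
  finally show ?case by (simp add: mult_ac)
qed simp

lemma Phi_multiple: "Phi (real j * gap n) x - x \<le> real j * C ^ j * r n x"
proof (induction j)
  case (Suc j)
  have "Phi (real (Suc j) * gap n) x = Phi (gap n) (Phi (real j * gap n) x)"
    using Phi_add[of "gap n" "real j * gap n" x] by (simp add: algebra_simps)
  then have "Phi (real (Suc j) * gap n) x - x = r n (Phi (real j * gap n) x) + (Phi (real j * gap n) x - x)"
    by (simp add: r_def)
  also have "\<dots> \<le> C ^ j * r n x + real j * C ^ j * r n x"
    using Suc r_iterate_le by (intro add_mono)
  also have "\<dots> = real (Suc j) * (C ^ j * r n x)" by (simp add: algebra_simps)
  also have "\<dots> \<le> real (Suc j) * (C ^ Suc j * r n x)"
    using C_ge_1 r_pos[of n x] by (intro mult_left_mono mult_right_mono power_increasing) auto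
  finally show ?case by (simp add: mult_ac)
qed simp

definition level_const :: real where "level_const = real (B + 1) * C ^ (B + 1)"

lemma level_const_ge_1: "1 \<le> level_const"
  unfolding level_const_def using C_ge_1 by (intro mult_ge1_I one_le_power) auto

lemma r_le_Suc: "r n x \<le> level_const * r (Suc n) x"
proof -
  define k where "k = a (Suc n) + 1"
  have "gap n \<le> real k * gap (Suc n)"
    using gap_rec[of n] gap_Suc_less[of "Suc n"] by (simp add: k_def algebra_simps)
  then have "Phi (gap n) x \<le> Phi (real k * gap (Suc n)) x" by (simp add: Phi_le_iff)
  then have "r n x \<le> real k * C ^ k * r (Suc n) x"
    using Phi_multiple[of k "Suc n" x] by (simp add: r_def)
  also have "\<dots> \<le> level_const * r (Suc n) x"
    unfolding level_const_def using C_ge_1 r_pos[of "Suc n" x] a_le_B[of "Suc n"]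
    by (intro mult_right_mono mult_mono power_increasing) (auto simp: k_def)
  finally show ?thesis .
qed

lemma r_le_power: "r n x \<le> level_const ^ m * r (n + m) x"
proof (induction m)
  case (Suc m)
  have "r n x \<le> level_const ^ m * r (n + m) x" by (rule Suc)
  also have "\<dots> \<le> level_const ^ m * (level_const * r (Suc (n + m)) x)"
    using level_const_ge_1 by (intro mult_left_mono r_le_Suc) auto
  finally show ?case by (simp add: mult_ac)
qed simp

definition \<kappa> :: real where "\<kappa> = C / (C + 1)"

definition \<mu> :: real where "\<mu> = sqrt \<kappa>"

lemma \<kappa>_bounds: "0 < \<kappa>" "\<kappa> < 1" "1 - \<kappa> = 1 / (C + 1)"
  using C_ge_1 by (auto simp: \<kappa>_def field_simps)

lemma \<mu>_bounds: "0 < \<mu>" "\<mu> < 1" "\<mu> * \<mu> = \<kappa>"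
  using \<kappa>_bounds by (auto simp: \<mu>_def)

text \<open>Two adjacent arcs of level \<open>n + 2\<close>, which are comparable, fit into one arc of
  level \<open>n\<close>.\<close>

lemma r_add_2: "r (Suc (Suc n)) x \<le> \<kappa> * r n x"
proof -
  define g where "g = gap (Suc (Suc n))"
  have "2 * g \<le> gap n"
    using gap_add_le[of n] gap_Suc_less[of "Suc n"] by (simp add: g_def)
  then have "Phi (2 * g) x \<le> Phi (gap n) x" by (simp add: Phi_le_iff g_def)
  then have "r (Suc (Suc n)) x + r (Suc (Suc n)) (Phi g x) \<le> r n x"
    by (simp add: r_def g_def Phi_double)
  moreover have "r (Suc (Suc n)) x \<le> C * r (Suc (Suc n)) (Phi g x)"
    unfolding g_def by (rule r_le_right)
  then have "r (Suc (Suc n)) x / C \<le> r (Suc (Suc n)) (Phi g x)"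
    using C_ge_1 by (simp add: field_simps)
  ultimately have "r (Suc (Suc n)) x + r (Suc (Suc n)) x / C \<le> r n x" by linarith
  then have "r (Suc (Suc n)) x * (C + 1) \<le> C * r n x" using C_ge_1 by (simp add: field_simps)
  then show ?thesis using C_ge_1 by (simp add: \<kappa>_def field_simps)
qed

lemma r_decay: "r (n + m) x \<le> \<mu> ^ m / \<mu> * r n x"
proof (induction m rule: induct_nat_012)
  case 0
  have "1 \<le> 1 / \<mu>" using \<mu>_bounds by simp
  then show ?case using r_pos[of n x] mult_right_mono[of 1 "1 / \<mu>" "r n x"] by simp
next
  case 1
  then show ?case using r_antimono[of n "Suc n" x] \<mu>_bounds by simp
next
  case (ge2 m)
  have "r (Suc (Suc (n + m))) x \<le> \<kappa> * r (n + m) x" by (rule r_add_2)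
  also have "\<dots> \<le> \<kappa> * (\<mu> ^ m / \<mu> * r n x)" using ge2 \<kappa>_bounds by (intro mult_left_mono) auto
  finally show ?case using \<mu>_bounds(1) unfolding \<mu>_bounds(3)[symmetric] by (simp add: mult_ac)
qed

lemma r_upper: "r n x \<le> \<mu> ^ n / \<mu>"
proof -
  have "r n x \<le> \<mu> ^ n / \<mu> * r 0 x" using r_decay[of 0 n x] by simp
  also have "\<dots> \<le> \<mu> ^ n / \<mu> * 1" using r_less_1[of 0 x] \<mu>_bounds by (intro mult_left_mono) auto
  finally show ?thesis by simp
qed

lemma r_comparable_right:
  assumes "x \<le> y" "y \<le> Phi (gap n) x"
  shows "r n y \<le> (C + 1) * r n x" "r n x \<le> (C + 1) * r n y"
proof -
  have "Phi (gap n) y \<le> Phi (gap n) (Phi (gap n) x)" using assms by (simp add: Phi_mono_le_iff)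
  then have "r n y \<le> r n x + r n (Phi (gap n) x)" using assms by (simp add: r_def)
  then show "r n y \<le> (C + 1) * r n x" using r_right_le[of n x] by (simp add: algebra_simps)
  have "Phi (- gap n) y \<le> x" using assms(2) Phi_mono_le_iff[of "gap n" "Phi (- gap n) y" x] by simp
  moreover have "Phi (gap n) x \<le> Phi (gap n) y" using assms by (simp add: Phi_mono_le_iff)
  ultimately have "r n x \<le> r n y + r n (Phi (- gap n) y)" by (simp add: r_def)
  then show "r n x \<le> (C + 1) * r n y" using r_left_le[of n y] by (simp add: algebra_simps)
qed

lemma r_comparable:
  assumes "Phi (- gap n) x \<le> y" "y \<le> Phi (gap n) x"
  shows "r n y \<le> (C + 1) * r n x" "r n x \<le> (C + 1) * r n y"
proof -
  have "x \<le> Phi (gap n) y"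
    using assms(1) Phi_mono_le_iff[of "gap n" "Phi (- gap n) x" y] by simp
  then show "r n y \<le> (C + 1) * r n x" "r n x \<le> (C + 1) * r n y"
    using r_comparable_right[of x y n] r_comparable_right[of y x n] assms by (cases "x \<le> y"; simp)+
qed

end

lemma (in circle_lift) r_cont: "continuous_on S (r n)"
  unfolding r_def[abs_def]
  by (intro continuous_intros continuous_on_subset[OF Phi_cont[OF Gam_gap]]) auto

lemma (in circle_lift) r_attains_min: obtains x0 where "\<And>x. r n x0 \<le> r n x"
proof -
  obtain x0 where x0: "x0 \<in> {0..1}" "\<And>x. x \<in> {0..1} \<Longrightarrow> r n x0 \<le> r n x"
    using continuous_attains_inf[of "{0..1::real}" "r n"] r_cont by fastforce
  have "r n x0 \<le> r n x" for x
  proof -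
    have "r n x = r n (x + of_int (- \<lfloor>x\<rfloor>))" by (simp only: r_plus_int)
    moreover have "x + of_int (- \<lfloor>x\<rfloor>) \<in> {0..1}" by simp linarith
    ultimately show ?thesis using x0(2) by metis
  qed
  then show ?thesis using that by blast
qed

lemma (in bounded_geometry) r_lower: obtains m where "0 < m" "\<And>n x. m / level_const ^ n \<le> r n x"
proof -
  obtain x0 where x0: "\<And>x. r 0 x0 \<le> r 0 x" using r_attains_min by blast
  have "r 0 x0 / level_const ^ n \<le> r n x" for n x
    using r_le_power[of 0 x n] x0[of x] level_const_ge_1 by (simp add: divide_le_eq mult.commute)
  then show ?thesis using that[of "r 0 x0"] r_pos by blast
qed

context critical_lift
begin

definition arc_cr :: "nat \<Rightarrow> real \<Rightarrow> real"
  where "arc_cr n x = cr (Phi (- gap n) x) x (Phi (gap n) x) (Phi (2 * gap n) x)"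

lemma arc_order: "Phi (- gap n) x < x" "x < Phi (gap n) x" "Phi (gap n) x < Phi (2 * gap n) x"
  using gap_pos[of n] Phi_less_iff[of "- gap n" 0 x] Phi_less_iff[of 0 "gap n" x]
    Phi_less_iff[of "gap n" "2 * gap n" x] by auto

lemma arc_cr_push:
  assumes "k \<le> 2 * q (Suc n)"
  shows "arc_cr n ((F ^^ k) x) \<le> push_const 2 1 * arc_cr n x"
  unfolding arc_cr_def using cr_push[OF assms, of _ _ _ _ x] arc_order[where n = n and x = x]
  by (simp add: Phi_F)

lemma arc_cr_plus_int: "arc_cr n (x + of_int m) = arc_cr n x"
  unfolding arc_cr_def by (simp add: Phi_plus_int cr_shift)

lemma arc_cr_ratios:
  assumes "0 < \<epsilon>" "\<epsilon> \<le> arc_cr n x"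
  shows "\<epsilon> * r n x \<le> r n (Phi (- gap n) x)" "\<epsilon> * r n x \<le> r n (Phi (gap n) x)"
  using cr_le_ratios[of "Phi (- gap n) x" x "Phi (gap n) x" "Phi (2 * gap n) x" \<epsilon>] arc_order[where n = n and x = x] assms
  by (simp_all add: arc_cr_def r_def Phi_double)

definition pull_const :: real where "pull_const = push_const 2 1"

definition cr_min :: real where "cr_min = (1 / (1 + (4 * pull_const + 1)))\<^sup>2 / pull_const"

lemma pull_const_ge_1: "1 \<le> pull_const" unfolding pull_const_def by (rule push_const_ge_1) simp

lemma cr_min_bounds: "0 < cr_min" "cr_min \<le> 1"
proof -
  show "0 < cr_min" using pull_const_ge_1 by (auto simp: cr_min_def intro!: divide_pos_pos zero_less_power)
  have "(1 / (1 + (4 * pull_const + 1)))\<^sup>2 \<le> 1"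
    using pull_const_ge_1 by (intro power_le_one) auto
  then show "cr_min \<le> 1" unfolding cr_min_def using pull_const_ge_1 by (simp add: divide_le_eq)
qed

text \<open>The neighbours of a shortest arc are at least as long as this arc, and one of them has
  comparable length because it is a preimage. So the cross-ratio is bounded below at every point of
  a whole return arc, and each point of the circle is pulled back from there.\<close>

lemma cr_min_le: "cr_min \<le> arc_cr n z"
proof -
  define g where "g = gap n"
  have Gg: "g \<in> Gam" "0 < g" by (simp_all add: g_def gap_pos)
  obtain x0 where x0: "\<And>x. r n x0 \<le> r n x" using r_attains_min by blast
  have m_pos: "0 < r n x0" by (rule r_pos)
  have "(1 / (1 + 1))\<^sup>2 \<le> arc_cr n x0"
    unfolding arc_cr_def
    by (rule cr_ge[of "r n x0"]) (use x0[of "Phi (- g) x0"] x0[of "Phi g x0"] m_pos arc_order[where n = n and x = x0] in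
      \<open>auto simp: r_def g_def Phi_double\<close>)
  then have quarter: "1 / 4 \<le> arc_cr n x0" by (simp add: power2_eq_square)
  have pull: "1 / (4 * pull_const) \<le> arc_cr n w" if "(F ^^ q n) w = x0 + of_int p" for w p
  proof -
    have "arc_cr n x0 \<le> pull_const * arc_cr n w"
      using arc_cr_push[of "q n" n w] q_mono_Suc[of n] that by (simp add: arc_cr_plus_int pull_const_def)
    then have "1 / 4 \<le> pull_const * arc_cr n w" using quarter by linarith
    then show ?thesis using pull_const_ge_1 by (simp add: field_simps)
  qed
  have sgap_iter: "Phi (sgap n) w = (F ^^ q n) w - of_int (int (cf_num a n))" for w
    using Phi_eq[of "int (q n)" "- int (cf_num a n)" w] by (simp add: sgap_def iter_def)
  have eps: "0 < 1 / (4 * pull_const)" using pull_const_ge_1 by simp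
  \<comment> \<open>one of the two neighbours of the shortest arc is a preimage, hence comparable to it\<close>
  obtain w where w: "\<And>z0. w \<le> z0 \<Longrightarrow> z0 \<le> Phi g w \<Longrightarrow> r n z0 \<le> (4 * pull_const + 1) * r n x0"
  proof (cases "even n")
    case True
    define w where "w = Phi (- g) x0"
    have "Phi (sgap n) w = x0" using True by (simp add: sgap_eq_gap w_def g_def)
    then have "(F ^^ q n) w = x0 + of_int (int (cf_num a n))" using sgap_iter[of w] by simp
    from pull[OF this] have "1 / (4 * pull_const) * r n w \<le> r n (Phi (gap n) w)"
      using arc_cr_ratios(2)[OF eps] by blast
    then have rw: "r n w \<le> 4 * pull_const * r n x0"
      using pull_const_ge_1 by (simp add: w_def g_def field_simps)
    have "r n z0 \<le> (4 * pull_const + 1) * r n x0" if "w \<le> z0" "z0 \<le> Phi g w" for z0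
    proof -
      have "Phi g z0 \<le> Phi g (Phi g w)" using that Gg by (simp add: Phi_mono_le_iff)
      then have "r n z0 \<le> r n w + r n (Phi g w)" using that by (simp add: r_def g_def)
      also have "Phi g w = x0" by (simp add: w_def Gg)
      finally show ?thesis using rw by (simp add: algebra_simps)
    qed
    then show ?thesis using that by blast
  next
    case False
    define w where "w = Phi g x0"
    have "Phi (sgap n) w = x0" using False by (simp add: sgap_eq_gap w_def g_def)
    then have "(F ^^ q n) w = x0 + of_int (int (cf_num a n))" using sgap_iter[of w] by simp
    from pull[OF this] have "1 / (4 * pull_const) * r n w \<le> r n (Phi (- gap n) w)"
      using arc_cr_ratios(1)[OF eps] by blast
    then have rw: "r n w \<le> 4 * pull_const * r n x0"
      using pull_const_ge_1 by (simp add: w_def g_def field_simps)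
    have "r n z0 \<le> (4 * pull_const + 1) * r n x0" if "x0 \<le> z0" "z0 \<le> Phi g x0" for z0
    proof -
      have "Phi g z0 \<le> Phi g (Phi g x0)" using that Gg by (simp add: Phi_mono_le_iff)
      then have "r n z0 \<le> r n x0 + r n w" using that by (simp add: r_def g_def w_def)
      then show ?thesis using rw by (simp add: algebra_simps)
    qed
    then show ?thesis using that by blast
  qed
  obtain k m where k: "k < q n + q (Suc n)" "w \<le> (F ^^ k) z + of_int m" "(F ^^ k) z + of_int m < Phi g w"
    using covering[of n w z] unfolding g_def by blast
  define z0 where "z0 = (F ^^ k) z + of_int m"
  have "(1 / (1 + (4 * pull_const + 1)))\<^sup>2 \<le> arc_cr n z0"
    unfolding arc_cr_def
  proof (rule cr_ge[of "r n x0"])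
    show "Phi (gap n) z0 - z0 \<le> (4 * pull_const + 1) * r n x0"
      using w[of z0] k unfolding z0_def[symmetric] r_def by auto
  qed (use x0[of "Phi (- g) z0"] x0[of "Phi g z0"] m_pos arc_order[where n = n and x = z0] pull_const_ge_1 in
      \<open>auto simp: r_def g_def Phi_double\<close>)
  also have "arc_cr n z0 = arc_cr n ((F ^^ k) z)" by (simp add: z0_def arc_cr_plus_int)
  also have "\<dots> \<le> pull_const * arc_cr n z"
    unfolding pull_const_def by (rule arc_cr_push) (use k(1) q_mono_Suc[of n] in linarith)
  finally show ?thesis
    unfolding cr_min_def using pull_const_ge_1 by (simp add: divide_le_eq mult.commute)
qed

definition real_bound :: real where "real_bound = 1 / cr_min"

lemma real_bound_ge_1: "1 \<le> real_bound"
  using cr_min_bounds by (simp add: real_bound_def)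

sublocale bounded_geometry a \<rho> F real_bound B
proof
  show "1 \<le> real_bound" by (rule real_bound_ge_1)
  show "r n x \<le> real_bound * r n (Phi (gap n) x)" "r n x \<le> real_bound * r n (Phi (- gap n) x)" for n x
    using arc_cr_ratios[OF cr_min_bounds(1) cr_min_le, of n x] cr_min_bounds
    by (simp_all add: real_bound_def field_simps)
qed (rule bounded_type)

definition lip_const :: real where "lip_const = push_const 1 (2 * real_bound + 1) * (real_bound * (2 * real_bound + 1))"

lemma lip_const_ge_1: "1 \<le> lip_const"
  unfolding lip_const_def using real_bound_ge_1 by (intro mult_ge1_I push_const_ge_1) auto

lemma hull_len_le_r: "hull_len n x \<le> (2 * real_bound + 1) * r n x"
  unfolding hull_len_eq using r_left_le[of n x] r_right_le[of n x] by (simp add: algebra_simps)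

text \<open>A one-sided Koebe estimate: in the second cross-ratio of \<open>[v, u]\<close> and the two return
  arcs to its right, all lengths except that of \<open>[v, u]\<close> are comparable, before and after the
  iteration.\<close>

lemma iterate_lipschitz:
  assumes "Phi (- gap n) u \<le> v" "v \<le> u" "k \<le> q (Suc n)"
  shows "((F ^^ k) u - (F ^^ k) v) * r n u \<le> lip_const * (u - v) * r n ((F ^^ k) u)"
proof (cases "v = u")
  case False
  define g where "g = gap n"
  have Gg: "g \<in> Gam" by (simp add: g_def)
  define y where "y = (F ^^ k) u"
  define P where "P = push_const 1 (2 * real_bound + 1)"
  have P: "1 \<le> P" unfolding P_def using real_bound_ge_1 by (intro push_const_ge_1) auto
  have ord: "v < u" "u < Phi g u" "Phi g u < Phi (2 * g) u"
    using False assms arc_order[where n = n and x = u] by (auto simp: g_def)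
  have crp: "crp v u (Phi g u) (Phi (2 * g) u) \<le>
      P * crp ((F ^^ k) v) ((F ^^ k) u) ((F ^^ k) (Phi g u)) ((F ^^ k) (Phi (2 * g) u))"
    unfolding P_def
  proof (rule crp_push[of k 1 n _ _ _ _ _ u])
    fix j
    have "(F ^^ j) (Phi (2 * g) u) - (F ^^ j) v \<le> hull_len n ((F ^^ j) u)"
      using hull_iterate(1)[of n u v j] assms ord unfolding hull_len_def g_def by (simp add: Phi_F)
    also have "\<dots> \<le> (2 * real_bound + 1) * r n ((F ^^ j) u)" by (rule hull_len_le_r)
    finally show "(F ^^ j) (Phi (2 * g) u) - (F ^^ j) v \<le> (2 * real_bound + 1) * ((F ^^ j) (Phi g u) - (F ^^ j) u)"
      by (simp add: r_def g_def Phi_F)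
  qed (use ord assms real_bound_ge_1 in \<open>auto simp: g_def\<close>)
  define M T J R where "M = r n u" and "T = Phi (2 * g) u - v" and "J = u - v" and "R = r n (Phi g u)"
  define M' T' J' R' where "M' = r n y" and "T' = Phi (2 * g) y - (F ^^ k) v"
    and "J' = y - (F ^^ k) v" and "R' = r n (Phi g y)"
  have "hull_len n y \<ge> T'"
    using hull_iterate(1)[of n u v k] assms ord unfolding hull_len_def g_def T'_def y_def by simp
  then have T': "T' \<le> (2 * real_bound + 1) * M'" unfolding M'_def using hull_len_le_r[of n y] by linarith
  have R': "M' \<le> real_bound * R'" unfolding M'_def R'_def g_def by (rule r_le_right)
  have RT: "R \<le> T" unfolding R_def T_def r_def g_def using ord by (simp add: Phi_double g_def)
  have J'pos: "J' > 0" unfolding J'_def y_def using ord by (simp add: iterate_less)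
  have pos: "M > 0" "J > 0" "R > 0" "M' > 0" "R' > 0" "T > 0"
    using ord r_pos unfolding M_def T_def J_def R_def M'_def R'_def by auto
  have T'pos: "T' > 0"
    using J'pos arc_order[where n = n and x = y] unfolding T'_def J'_def g_def by linarith
  have "(M * T) / (J * R) \<le> P * ((M' * T') / (J' * R'))"
    using crp unfolding crp_def M_def T_def J_def R_def M'_def T'_def J'_def R'_def y_def
    by (simp add: Phi_F r_def g_def Phi_double)
  then have "(M * T) * (J' * R') \<le> P * (M' * T') * (J * R)"
    using pos J'pos by (simp add: divide_simps mult_ac split: if_splits)
  also have "\<dots> \<le> P * (real_bound * R' * ((2 * real_bound + 1) * M')) * (J * T)"
    using pos P real_bound_ge_1 R' T' T'pos RT by (intro mult_mono mult_left_mono) auto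
  finally have "(R' * T) * (J' * M) \<le> (R' * T) * (lip_const * J * M')"
    by (simp add: lip_const_def P_def mult_ac)
  then have "J' * M \<le> lip_const * J * M'"
    using pos by (subst (asm) mult_le_cancel_left_pos) auto
  then show ?thesis by (simp add: J'_def M_def J_def M'_def y_def)
qed simp

end

section \<open>Distortion of long compositions\<close>

lemma ln_increment_ge:
  fixes u v :: real
  assumes "0 < u" "u \<le> v" shows "(v - u) / v \<le> ln v - ln u"
proof -
  have "ln (u / v) \<le> u / v - 1" using assms by (intro ln_le_minus_one) auto
  then show ?thesis using assms by (simp add: ln_div diff_divide_distrib)
qed

context critical_lift
begin

lemma F'_pos: "0 < cdist c x \<Longrightarrow> 0 < F' x"
proof -
  assume "0 < cdist c x"
  then have "0 < cdist c x powr e" by simp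
  then have "0 < K * F' x" using F'_lower[of x] by linarith
  then show "0 < F' x" using K_ge_1 by (simp add: zero_less_mult_iff)
qed

lemma slope_distortion_step:
  assumes "x1 \<le> u" "u < v" "v \<le> x2" "x1 \<le> u'" "u' < v'" "v' \<le> x2"
    and "x2 - x1 \<le> \<delta>" "crit_free c x1 x2" "0 < m" "\<And>z. x1 \<le> z \<Longrightarrow> z \<le> x2 \<Longrightarrow> m \<le> cdist c z"
  shows "\<bar>ln ((F v - F u) / (v - u)) - ln ((F v' - F u') / (v' - u'))\<bar> \<le> K * (x2 - x1) / m"
proof -
  obtain \<xi> where \<xi>: "u < \<xi>" "\<xi> < v" "F v - F u = (v - u) * F' \<xi>" using F_MVT[OF assms(2)] by blast
  obtain \<eta> where \<eta>: "u' < \<eta>" "\<eta> < v'" "F v' - F u' = (v' - u') * F' \<eta>" using F_MVT[OF assms(5)] by blast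
  have *: "\<bar>ln (F' x) - ln (F' y)\<bar> \<le> K * (x2 - x1) / m" if "x1 \<le> x" "x \<le> y" "y \<le> x2" for x y
  proof -
    have "\<bar>ln (F' x) - ln (F' y)\<bar> \<le> K * (y - x) / m"
      using assms that by (intro F'_distortion crit_free_subset[OF assms(8)]) auto
    also have "\<dots> \<le> K * (x2 - x1) / m"
      using assms that K_ge_1 by (intro divide_right_mono mult_left_mono) auto
    finally show ?thesis .
  qed
  have "\<bar>ln (F' \<xi>) - ln (F' \<eta>)\<bar> \<le> K * (x2 - x1) / m"
    using *[of \<xi> \<eta>] *[of \<eta> \<xi>] assms \<xi> \<eta> by (cases "\<xi> \<le> \<eta>") (auto simp: abs_minus_commute)
  then show ?thesis using assms \<xi> \<eta> by simp
qed

lemma slope_distortion: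
  assumes "x1 \<le> u" "u < v" "v \<le> x2" "x1 \<le> u'" "u' < v'" "v' \<le> x2"
    and "\<And>j. j < k \<Longrightarrow> (F ^^ j) x2 - (F ^^ j) x1 \<le> \<delta>"
    and "\<And>j. j < k \<Longrightarrow> crit_free c ((F ^^ j) x1) ((F ^^ j) x2)"
    and "\<And>j. j < k \<Longrightarrow> 0 < m j"
    and "\<And>j z. j < k \<Longrightarrow> (F ^^ j) x1 \<le> z \<Longrightarrow> z \<le> (F ^^ j) x2 \<Longrightarrow> m j \<le> cdist c z"
  shows "\<bar>ln (((F ^^ k) v - (F ^^ k) u) / (v - u)) - ln (((F ^^ k) v' - (F ^^ k) u') / (v' - u'))\<bar>
    \<le> (\<Sum>j<k. K * ((F ^^ j) x2 - (F ^^ j) x1) / m j)"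
  using assms(7-10)
proof (induction k)
  case (Suc k)
  have split: "ln (((F ^^ Suc k) v - (F ^^ Suc k) u) / (v - u)) =
      ln ((F ((F ^^ k) v) - F ((F ^^ k) u)) / ((F ^^ k) v - (F ^^ k) u)) + ln (((F ^^ k) v - (F ^^ k) u) / (v - u))"
    if "u < v" for u v
    using that iterate_less[of k u v] F_less[of "(F ^^ k) u" "(F ^^ k) v"] by (simp add: ln_div)
  have "\<bar>ln (((F ^^ k) v - (F ^^ k) u) / (v - u)) - ln (((F ^^ k) v' - (F ^^ k) u') / (v' - u'))\<bar>
      \<le> (\<Sum>j<k. K * ((F ^^ j) x2 - (F ^^ j) x1) / m j)"
    by (rule Suc.IH) (use Suc.prems in auto)
  moreover have "\<bar>ln ((F ((F ^^ k) v) - F ((F ^^ k) u)) / ((F ^^ k) v - (F ^^ k) u)) -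
      ln ((F ((F ^^ k) v') - F ((F ^^ k) u')) / ((F ^^ k) v' - (F ^^ k) u'))\<bar>
      \<le> K * ((F ^^ k) x2 - (F ^^ k) x1) / m k"
    by (rule slope_distortion_step) (use assms(1-6) Suc.prems in \<open>auto simp: iterate_less iterate_le\<close>)
  ultimately show ?case
    unfolding split[OF assms(2)] split[OF assms(5)] sum.lessThan_Suc by linarith
qed simp

definition away :: "nat \<Rightarrow> real \<Rightarrow> bool"
  where "away n y \<longleftrightarrow> (\<forall>l::int. \<not> (Phi (- gap n) c \<le> y + of_int l \<and> y + of_int l < Phi (gap n) c))"

text \<open>The logarithmic weight: its increment over an arc bounds the ratio of the length of the
  arc to its distance from the critical points.\<close>

definition log_weight :: "real \<Rightarrow> real" where "log_weight z = ln (z - c) - ln (c + 1 - z)"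

definition far_dist :: "nat \<Rightarrow> real \<Rightarrow> real"
  where "far_dist N y = min (y - \<lfloor>y - c\<rfloor> - c) (c + 1 - (Phi (gap N) y - \<lfloor>y - c\<rfloor>))"

text \<open>On either side, the distance to the critical point is at least a fixed fraction of the
  return arc at \<open>y\<close>. So it changes only by a bounded factor along this arc, and the quotient of
  length and distance is bounded by the increment of the logarithmic weight.\<close>

lemma away_bounds:
  fixes y N n
  defines "z \<equiv> y + of_int (- \<lfloor>y - c\<rfloor>)"
  assumes "away n y" "n + 3 \<le> N"
  shows "Phi (gap n) c \<le> z" "Phi (gap (Suc n)) z \<le> Phi (gap (Suc n) - gap n) c + 1"
    and "0 < far_dist N y"
    and "\<And>x. y \<le> x \<Longrightarrow> x \<le> Phi (gap N) y \<Longrightarrow> far_dist N y \<le> cdist c x"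
    and "crit_free c y (Phi (gap N) y)"
    and "r (Suc n) y / far_dist N y \<le> (real_bound + 2) * (log_weight (Phi (gap (Suc n)) z) - log_weight z)"
proof -
  define g' where "g' = gap (Suc n)"
  define R where "R = r (Suc n) y"
  define D where "D = far_dist N y"
  have zc: "c \<le> z" "z < c + 1" unfolding z_def by linarith+
  have "\<not> (Phi (- gap n) c \<le> z \<and> z < Phi (gap n) c)"
    using assms(2) unfolding away_def z_def by blast
  moreover have "Phi (- gap n) c < c" using arc_order by blast
  ultimately show z1: "Phi (gap n) c \<le> z" using zc by auto
  have "\<not> (Phi (- gap n) c \<le> z + of_int (-1) \<and> z + of_int (-1) < Phi (gap n) c)"
    using assms(2) unfolding away_def z_def by (metis add.assoc of_int_add)
  moreover have "z + of_int (-1) < Phi (gap n) c" using zc arc_order(2)[of c n] by simp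
  ultimately have z2: "z < Phi (- gap n) c + 1" by simp
  have "Phi g' z \<le> Phi g' (Phi (- gap n) c + of_int 1)"
    using z2 by (simp add: Phi_mono_le_iff g'_def)
  also have "\<dots> = Phi (g' - gap n) c + 1"
    unfolding g'_def using Phi_plus_int[of "gap (Suc n)" _ 1] Phi_add[of "gap (Suc n)" "- gap n" c] by simp
  finally show "Phi (gap (Suc n)) z \<le> Phi (gap (Suc n) - gap n) c + 1" by (simp add: g'_def)
  have "Phi (g' - gap n) c < c"
    using Phi_less_iff[of "g' - gap n" 0 c] gap_Suc_less[of n] by (simp add: g'_def)
  then have z3: "Phi g' z < c + 1" using \<open>Phi (gap (Suc n)) z \<le> _\<close> unfolding g'_def by linarith
  have Rz: "R = r (Suc n) z" unfolding R_def z_def by (simp only: r_plus_int)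
  have R_pos: "0 < R" unfolding R_def by (rule r_pos)
  have PhiN: "Phi (gap N) z = Phi (gap N) y - \<lfloor>y - c\<rfloor>" unfolding z_def Phi_plus_int[OF Gam_gap] by simp
  have D_eq: "D = min (z - c) (c + 1 - Phi (gap N) z)" unfolding D_def far_dist_def PhiN by (simp add: z_def)
  have "c \<le> Phi (- g') z"
  proof -
    have "Phi g' c \<le> Phi (gap n) c" using gap_Suc_less[of n] by (simp add: Phi_le_iff g'_def)
    then have "Phi g' c \<le> z" using z1 by linarith
    then show ?thesis using Phi_mono_le_iff[of "- g'" "Phi g' c" z] by (simp add: g'_def)
  qed
  moreover have "r (Suc n) z \<le> real_bound * r (Suc n) (Phi (- gap (Suc n)) z)" by (rule r_le_left)
  moreover have "r (Suc n) (Phi (- gap (Suc n)) z) = z - Phi (- g') z" by (simp add: r_def g'_def)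
  ultimately have "R \<le> real_bound * (z - Phi (- g') z)" "z - Phi (- g') z \<le> z - c"
    unfolding Rz by auto
  then have d1: "R \<le> real_bound * (z - c)" using real_bound_ge_1 by (meson mult_left_mono order_trans zero_le_one)
  have rN: "r N z \<le> \<kappa> * R"
  proof -
    have "r N z \<le> r (Suc (Suc (Suc n))) z" using assms(3) by (intro r_antimono) auto
    also have "\<dots> \<le> \<kappa> * r (Suc n) z" by (rule r_add_2)
    finally show ?thesis unfolding Rz .
  qed
  have "R - r N z = Phi g' z - Phi (gap N) z" unfolding Rz r_def g'_def by simp
  moreover have "R - r N z \<ge> (1 - \<kappa>) * R" using rN by (simp add: algebra_simps)
  ultimately have "(1 - \<kappa>) * R \<le> c + 1 - Phi (gap N) z" using z3 by linarith
  then have d2: "R \<le> (real_bound + 1) * (c + 1 - Phi (gap N) z)"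
    unfolding \<kappa>_bounds(3) using real_bound_ge_1 by (simp add: field_simps)
  have pos1: "0 < z - c"
  proof (rule ccontr)
    assume "\<not> ?thesis"
    then have "real_bound * (z - c) \<le> 0" using real_bound_ge_1 by (intro mult_nonneg_nonpos) auto
    then show False using d1 R_pos by linarith
  qed
  have pos2: "0 < c + 1 - Phi (gap N) z"
  proof (rule ccontr)
    assume "\<not> ?thesis"
    then have "(real_bound + 1) * (c + 1 - Phi (gap N) z) \<le> 0" using real_bound_ge_1 by (intro mult_nonneg_nonpos) auto
    then show False using d2 R_pos by linarith
  qed
  show D_pos: "0 < far_dist N y" using D_eq pos1 pos2 unfolding D_def by simp
  show cd: "far_dist N y \<le> cdist c x" if "y \<le> x" "x \<le> Phi (gap N) y" for x
  proof -
    obtain k :: int where k: "cdist c x = \<bar>x - (c + of_int k)\<bar>" by (rule cdist_eq)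
    define j where "j = k - \<lfloor>y - c\<rfloor>"
    define w where "w = x - \<lfloor>y - c\<rfloor>"
    have w: "z \<le> w" "w \<le> Phi (gap N) z" using that unfolding w_def PhiN by (auto simp: z_def)
    have k': "cdist c x = \<bar>w - (c + of_int j)\<bar>" unfolding k w_def j_def by simp
    show ?thesis
    proof (cases "j \<le> 0")
      case True
      then have "of_int j \<le> (0::real)" by simp
      then have "z - c \<le> cdist c x" using k' w pos1 by linarith
      then show ?thesis using D_eq unfolding D_def by linarith
    next
      case False
      then have "of_int j \<ge> (1::real)" by simp
      then have "c + 1 - Phi (gap N) z \<le> cdist c x" using k' w pos2 by linarith
      then show ?thesis using D_eq unfolding D_def by linarith
    qed
  qed
  show "crit_free c y (Phi (gap N) y)"
    unfolding crit_free_def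
  proof (intro allI notI)
    fix k :: int
    assume k: "c + of_int k \<in> {y..Phi (gap N) y}"
    then have "far_dist N y \<le> cdist c (c + of_int k)" using cd by auto
    moreover have "cdist c (c + of_int k) \<le> 0" using cdist_le[of c "c + of_int k" k] by simp
    ultimately show False using D_pos by linarith
  qed
  define P where "P = Phi g' z"
  have PR: "P = z + R" unfolding Rz P_def g'_def r_def by simp
  have W1: "(P - z) / (P - c) \<le> ln (P - c) - ln (z - c)"
    using ln_increment_ge[of "z - c" "P - c"] pos1 R_pos PR by simp
  have W2: "(P - z) / (c + 1 - z) \<le> ln (c + 1 - z) - ln (c + 1 - P)"
    using ln_increment_ge[of "c + 1 - P" "c + 1 - z"] z3 R_pos PR unfolding P_def by simp
  have log_weight: "R / (P - c) + R / (c + 1 - z) \<le> log_weight P - log_weight z"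
    using W1 W2 PR unfolding log_weight_def by simp
  have n1: "0 \<le> R / (P - c)" "0 \<le> R / (c + 1 - z)" using R_pos PR pos1 zc by auto
  have "R / D \<le> (real_bound + 2) * (R / (P - c) + R / (c + 1 - z))"
  proof (cases "D = z - c")
    case True
    have "R \<le> real_bound * D" "P - c = R + D" "0 < D" using d1 PR True pos1 by auto
    then have "P - c \<le> (real_bound + 2) * D" by (simp add: algebra_simps)
    then have "R / D \<le> (real_bound + 2) * (R / (P - c))"
      using D_pos R_pos PR pos1 mult_left_mono[of "P - c" "(real_bound + 2) * D" R] unfolding D_def[symmetric]
      by (simp add: field_simps)
    also have "\<dots> \<le> (real_bound + 2) * (R / (P - c) + R / (c + 1 - z))"
      using n1 real_bound_ge_1 by (intro mult_left_mono) auto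
    finally show ?thesis .
  next
    case False
    then have D: "D = c + 1 - Phi (gap N) z" using D_eq by (auto simp: min_def split: if_splits)
    have "c + 1 - z = D + r N z" unfolding D r_def by simp
    also have "\<dots> \<le> D + R" unfolding Rz using assms(3) by (intro add_left_mono r_antimono) auto
    also have "\<dots> \<le> (real_bound + 2) * D" using d2 unfolding D by (simp add: algebra_simps)
    finally have "R / D \<le> (real_bound + 2) * (R / (c + 1 - z))"
      using D_pos R_pos zc mult_left_mono[of "c + 1 - z" "(real_bound + 2) * D" R] unfolding D_def[symmetric]
      by (simp add: field_simps)
    also have "\<dots> \<le> (real_bound + 2) * (R / (P - c) + R / (c + 1 - z))"
      using n1 real_bound_ge_1 by (intro mult_left_mono) auto
    finally show ?thesis .
  qed
  also have "\<dots> \<le> (real_bound + 2) * (log_weight P - log_weight z)" using log_weight real_bound_ge_1 by (intro mult_left_mono) auto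
  finally show "r (Suc n) y / far_dist N y \<le> (real_bound + 2) * (log_weight (Phi (gap (Suc n)) z) - log_weight z)"
    by (simp add: R_def D_def P_def g'_def)
qed

lemma log_weight_mono: "c < x \<Longrightarrow> x \<le> y \<Longrightarrow> y < c + 1 \<Longrightarrow> log_weight x \<le> log_weight y"
  unfolding log_weight_def by (intro diff_mono) auto

definition log_weight_range :: "nat \<Rightarrow> real"
  where "log_weight_range n = log_weight (Phi (gap (Suc n) - gap n) c + 1) - log_weight (Phi (gap n) c)"

lemma log_weight_sum_block:
  assumes "k \<le> q (Suc (Suc n))" "n + 3 \<le> N" "\<And>j. j < k \<Longrightarrow> away n ((F ^^ j) x)" "0 < k"
  shows "(\<Sum>j<k. r (Suc n) ((F ^^ j) x) / far_dist N ((F ^^ j) x)) \<le> (real_bound + 2) * log_weight_range n"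
proof -
  define l where "l j = - \<lfloor>(F ^^ j) x - c\<rfloor>" for j
  define A E where "A = Phi (gap n) c" and "E = Phi (gap (Suc n) - gap n) c + 1"
  have b: "A \<le> (F ^^ j) x + of_int (l j) \<and> Phi (gap (Suc n)) ((F ^^ j) x + of_int (l j)) \<le> E" if "j < k" for j
    using away_bounds(1,2)[OF assms(3)[OF that] assms(2)] unfolding l_def A_def E_def by blast
  have "c < A" unfolding A_def by (rule arc_order)
  have "E < c + 1"
    unfolding E_def using Phi_less_iff[of "gap (Suc n) - gap n" 0 c] gap_Suc_less[of n] by simp
  have "(F ^^ 0) x + of_int (l 0) < Phi (gap (Suc n)) ((F ^^ 0) x + of_int (l 0))" by (rule arc_order)
  then have AE: "A \<le> E" using b[OF assms(4)] by linarith
  have "(\<Sum>j<k. r (Suc n) ((F ^^ j) x) / far_dist N ((F ^^ j) x)) \<le>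
      (\<Sum>j<k. (real_bound + 2) * (log_weight (Phi (gap (Suc n)) ((F ^^ j) x + of_int (l j))) - log_weight ((F ^^ j) x + of_int (l j))))"
    unfolding l_def by (rule sum_mono) (use away_bounds(6) assms in blast)
  also have "\<dots> = (real_bound + 2) * (\<Sum>j<k. log_weight (Phi (gap (Suc n)) ((F ^^ j) x + of_int (l j))) - log_weight ((F ^^ j) x + of_int (l j)))"
    by (simp only: sum_distrib_left)
  also have "\<dots> \<le> (real_bound + 2) * (log_weight E - log_weight A)"
  proof (intro mult_left_mono arcs_increments[OF assms(1) _ AE b])
    show "mono_on {A..E} log_weight"
      using \<open>c < A\<close> \<open>E < c + 1\<close> by (intro monotone_onI log_weight_mono) auto
  qed (use real_bound_ge_1 in auto)
  finally show ?thesis unfolding log_weight_range_def A_def E_def .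
qed

lemma log_weight_range_linear: obtains C where "0 \<le> C" "\<And>n. log_weight_range n \<le> C * real (n + 1)"
proof -
  obtain m where m: "0 < m" "\<And>n x. m / level_const ^ n \<le> r n x" using r_lower by blast
  define L where "L = ln level_const"
  have L: "0 \<le> L" using level_const_ge_1 by (simp add: L_def)
  have ln_r: "ln m - real n * L \<le> ln (r n x)" for n x
  proof -
    have "ln (m / level_const ^ n) \<le> ln (r n x)" using m level_const_ge_1 r_pos by (subst ln_le_cancel_iff) auto
    then show ?thesis using m level_const_ge_1 by (simp add: ln_div ln_realpow L_def)
  qed
  have "log_weight_range n \<le> (2 * \<bar>ln m\<bar> + 2 * L) * real (n + 1)" for n
  proof -
    define w where "w = Phi (gap (Suc n) - gap n) c"
    have "w < c" unfolding w_def
      using Phi_less_iff[of "gap (Suc n) - gap n" 0 c] gap_Suc_less[of n] by simp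
    have "Phi (gap n - gap (Suc n)) w = c"
      unfolding w_def using Phi_add[of "gap n - gap (Suc n)" "gap (Suc n) - gap n" c] by simp
    moreover have "Phi (gap (Suc (Suc n))) w \<le> Phi (gap n - gap (Suc n)) w"
      using gap_add_le[of n] by (simp add: Phi_le_iff)
    ultimately have "r (Suc (Suc n)) w \<le> c - w" by (simp add: r_def)
    then have "ln (r (Suc (Suc n)) w) \<le> ln (c - w)"
      using r_pos[of "Suc (Suc n)" w] by (subst ln_le_cancel_iff) auto
    then have 1: "ln m - real (Suc (Suc n)) * L \<le> ln (c - w)"
      using ln_r[of "Suc (Suc n)" w] by linarith
    have "w \<ge> c - 1"
    proof -
      have "Phi (of_int (-1)) c \<le> w"
        unfolding w_def using gap_lt_1[of n] gap_pos[of "Suc n"] Gam_int[of "-1"] by (subst Phi_le_iff) auto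
      then show ?thesis unfolding Phi_int by simp
    qed
    then have 2: "ln (w + 1 - c) \<le> 0" using \<open>w < c\<close> by (cases "w + 1 - c = 0") (auto simp: ln_le_zero_iff)
    have "ln (r n c) \<le> ln (Phi (gap n) c - c)" by (simp add: r_def)
    then have 3: "ln m - real n * L \<le> ln (Phi (gap n) c - c)" using ln_r[of n c] by linarith
    have "Phi (gap n) c < c + 1" using r_less_1[of n c] by (simp add: r_def)
    then have 4: "ln (c + 1 - Phi (gap n) c) \<le> 0" using arc_order(2)[of c n] by (simp add: ln_le_zero_iff)
    have "log_weight_range n \<le> 2 * (- ln m) + 2 * real (n + 1) * L"
      using 1 2 3 4 unfolding log_weight_range_def log_weight_def w_def[symmetric] by (simp add: algebra_simps)
    also have "\<dots> \<le> 2 * \<bar>ln m\<bar> * real (n + 1) + 2 * real (n + 1) * L"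
      using mult_left_mono[of 1 "real (n + 1)" "2 * \<bar>ln m\<bar>"] by simp
    finally show ?thesis by (simp add: algebra_simps)
  qed
  then show ?thesis using that[of "2 * \<bar>ln m\<bar> + 2 * L"] L by auto
qed

text \<open>The arcs of level \<open>N\<close> are shorter than those of level \<open>n + 1\<close> at the same point by a factor
  of order \<open>\<mu>\<^sup>N\<^sup>-\<^sup>n\<close>, and the latter are disjoint, so the logarithmic weight bounds the sum. Its range is
  linear in \<open>n\<close> because closest returns are not closer than exponentially.\<close>

lemma entry_distortion:
  obtains D N0 where "0 \<le> D"
    "\<And>n N x k u v u' v'. N0 \<le> N \<Longrightarrow> n + 3 \<le> N \<Longrightarrow> k \<le> q n + q (Suc n) \<Longrightarrow>
      (\<And>j. j < k \<Longrightarrow> away n ((F ^^ j) x)) \<Longrightarrow> x \<le> u \<Longrightarrow> u < v \<Longrightarrow> v \<le> Phi (gap N) x \<Longrightarrow>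
      x \<le> u' \<Longrightarrow> u' < v' \<Longrightarrow> v' \<le> Phi (gap N) x \<Longrightarrow>
      \<bar>ln (((F ^^ k) v - (F ^^ k) u) / (v - u)) - ln (((F ^^ k) v' - (F ^^ k) u') / (v' - u'))\<bar>
        \<le> D * real (n + 1) * \<mu> ^ (N - n)"
proof -
  obtain C where C: "0 \<le> C" "\<And>n. log_weight_range n \<le> C * real (n + 1)" using log_weight_range_linear by blast
  have "(\<lambda>n. \<mu> ^ n / \<mu>) \<longlonglongrightarrow> 0 / \<mu>"
    using \<mu>_bounds by (intro tendsto_divide LIMSEQ_power_zero tendsto_const) auto
  then have "\<forall>\<^sub>F n in sequentially. \<mu> ^ n / \<mu> < \<delta>" using \<delta>_pos by (intro order_tendstoD(2)) auto
  then obtain N0 where N0: "\<And>n. N0 \<le> n \<Longrightarrow> \<mu> ^ n / \<mu> < \<delta>" by (auto simp: eventually_sequentially)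
  define D where "D = K * (1 / \<mu> / \<mu>) * (2 * ((real_bound + 2) * C))"
  show ?thesis
  proof (rule that[of D N0])
    show "0 \<le> D" unfolding D_def using K_ge_1 C(1) real_bound_ge_1 \<mu>_bounds(1)
      by (intro mult_nonneg_nonneg divide_nonneg_nonneg) auto
    fix n N x k u v u' v'
    assume N: "N0 \<le> N" "n + 3 \<le> N" and k: "k \<le> q n + q (Suc n)"
      and away: "\<And>j. j < k \<Longrightarrow> away n ((F ^^ j) x)"
      and uv: "x \<le> u" "u < v" "v \<le> Phi (gap N) x" "x \<le> u'" "u' < v'" "v' \<le> Phi (gap N) x"
    define f where "f y = r (Suc n) y / far_dist N y" for y
    have eq: "(F ^^ j) (Phi (gap N) x) - (F ^^ j) x = r N ((F ^^ j) x)" for j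
      by (simp add: r_def Phi_F)
    have "\<bar>ln (((F ^^ k) v - (F ^^ k) u) / (v - u)) - ln (((F ^^ k) v' - (F ^^ k) u') / (v' - u'))\<bar>
      \<le> (\<Sum>j<k. K * ((F ^^ j) (Phi (gap N) x) - (F ^^ j) x) / far_dist N ((F ^^ j) x))"
    proof (rule slope_distortion[OF uv])
      fix j assume j: "j < k"
      show "(F ^^ j) (Phi (gap N) x) - (F ^^ j) x \<le> \<delta>"
        unfolding eq using r_upper[of N "(F ^^ j) x"] N0[OF N(1)] by linarith
      show "crit_free c ((F ^^ j) x) ((F ^^ j) (Phi (gap N) x))"
        using away_bounds(5)[OF away[OF j] N(2)] by (simp add: Phi_F)
      show "0 < far_dist N ((F ^^ j) x)" using away_bounds(3)[OF away[OF j] N(2)] .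
      show "far_dist N ((F ^^ j) x) \<le> cdist c z" if "(F ^^ j) x \<le> z" "z \<le> (F ^^ j) (Phi (gap N) x)" for z
        using away_bounds(4)[OF away[OF j] N(2)] that by (simp add: Phi_F)
    qed
    also have "\<dots> \<le> (\<Sum>j<k. K * (\<mu> ^ (N - n) / \<mu> / \<mu>) * f ((F ^^ j) x))"
    proof (rule sum_mono)
      fix j assume "j \<in> {..<k}"
      then have pos: "0 < far_dist N ((F ^^ j) x)" using away_bounds(3)[OF away N(2)] by auto
      have "r N ((F ^^ j) x) \<le> \<mu> ^ (N - Suc n) / \<mu> * r (Suc n) ((F ^^ j) x)"
        using r_decay[of "Suc n" "N - Suc n" "(F ^^ j) x"] N by simp
      also have "\<mu> ^ (N - Suc n) = \<mu> ^ (N - n) / \<mu>"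
      proof -
        have "N - n = Suc (N - Suc n)" using N by simp
        then show ?thesis using \<mu>_bounds(1) by simp
      qed
      finally have "K * r N ((F ^^ j) x) / far_dist N ((F ^^ j) x) \<le>
          K * (\<mu> ^ (N - n) / \<mu> / \<mu> * r (Suc n) ((F ^^ j) x)) / far_dist N ((F ^^ j) x)"
        using pos K_ge_1 by (intro divide_right_mono mult_left_mono) auto
      then show "K * ((F ^^ j) (Phi (gap N) x) - (F ^^ j) x) / far_dist N ((F ^^ j) x) \<le>
          K * (\<mu> ^ (N - n) / \<mu> / \<mu>) * f ((F ^^ j) x)"
        unfolding eq f_def by (simp only: times_divide_eq_right times_divide_eq_left mult.assoc)
    qed
    also have "\<dots> = K * (\<mu> ^ (N - n) / \<mu> / \<mu>) * (\<Sum>j<k. f ((F ^^ j) x))"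
      by (simp only: sum_distrib_left)
    also have "\<dots> \<le> K * (\<mu> ^ (N - n) / \<mu> / \<mu>) * (2 * ((real_bound + 2) * (C * real (n + 1))))"
    proof (intro mult_left_mono)
      define Q' where "Q' = q (Suc (Suc n))"
      have block: "(\<Sum>j<i. f ((F ^^ j) y)) \<le> (real_bound + 2) * (C * real (n + 1))"
        if "i \<le> Q'" "\<And>j. j < i \<Longrightarrow> away n ((F ^^ j) y)" for i y
      proof (cases "i = 0")
        case True
        then show ?thesis using C(1) real_bound_ge_1 by simp
      next
        case False
        have "(\<Sum>j<i. f ((F ^^ j) y)) \<le> (real_bound + 2) * log_weight_range n"
          unfolding f_def by (rule log_weight_sum_block) (use that N False in \<open>auto simp: Q'_def\<close>)
        also have "\<dots> \<le> (real_bound + 2) * (C * real (n + 1))" using C(2) real_bound_ge_1 by (intro mult_left_mono) auto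
        finally show ?thesis .
      qed
      have nonneg: "0 \<le> (real_bound + 2) * (C * real (n + 1))" using C(1) real_bound_ge_1 by simp
      show "(\<Sum>j<k. f ((F ^^ j) x)) \<le> 2 * ((real_bound + 2) * (C * real (n + 1)))"
      proof (cases "k \<le> Q'")
        case True
        then show ?thesis using block[OF True away] nonneg by auto
      next
        case False
        have "(\<Sum>j<k. f ((F ^^ j) x)) = (\<Sum>j<Q'. f ((F ^^ j) x)) + (\<Sum>j\<in>{0 + Q'..<k - Q' + Q'}. f ((F ^^ j) x))"
          using False by (simp add: lessThan_atLeast0 sum.atLeastLessThan_concat)
        also have "(\<Sum>j\<in>{0 + Q'..<k - Q' + Q'}. f ((F ^^ j) x)) = (\<Sum>j<k - Q'. f ((F ^^ j) ((F ^^ Q') x)))"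
          by (subst sum.shift_bounds_nat_ivl) (simp add: lessThan_atLeast0 funpow_add)
        also have "(\<Sum>j<Q'. f ((F ^^ j) x)) + \<dots> \<le> 2 * ((real_bound + 2) * (C * real (n + 1)))"
        proof -
          have "(\<Sum>j<Q'. f ((F ^^ j) x)) \<le> (real_bound + 2) * (C * real (n + 1))"
            using away False by (intro block) auto
          moreover have "(\<Sum>j<k - Q'. f ((F ^^ j) ((F ^^ Q') x))) \<le> (real_bound + 2) * (C * real (n + 1))"
          proof (rule block)
            show "k - Q' \<le> Q'" using k q_mono[of n "Suc (Suc n)"] q_mono_Suc[of "Suc n"] unfolding Q'_def by linarith
            show "away n ((F ^^ j) ((F ^^ Q') x))" if "j < k - Q'" for j
              using away[of "j + Q'"] that by (simp add: funpow_add)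
          qed
          ultimately show ?thesis by linarith
        qed
        finally show ?thesis .
      qed
    qed (use K_ge_1 \<mu>_bounds(1) in auto)
    also have "\<dots> = D * real (n + 1) * \<mu> ^ (N - n)" by (simp add: D_def)
    finally show "\<bar>ln (((F ^^ k) v - (F ^^ k) u) / (v - u)) - ln (((F ^^ k) v' - (F ^^ k) u') / (v' - u'))\<bar>
        \<le> D * real (n + 1) * \<mu> ^ (N - n)" .
  qed
qed

end

section \<open>Renormalization coordinates\<close>

context critical_lift
begin

definition signed_len :: "nat \<Rightarrow> real" where "signed_len n = Phi (sgap n) c - c"

definition coord :: "nat \<Rightarrow> real \<Rightarrow> real" where "coord n x = (x - c) / signed_len n"

text \<open>The order of \<open>u\<close> and \<open>v\<close> is left open, since the returns to \<open>c\<close> alternate between its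
  two sides.\<close>

definition between :: "real \<Rightarrow> real \<Rightarrow> real \<Rightarrow> bool"
  where "between u v x \<longleftrightarrow> (Phi u c \<le> x \<and> x \<le> Phi v c) \<or> (Phi v c \<le> x \<and> x \<le> Phi u c)"

abbreviation dyn :: "nat \<Rightarrow> real \<Rightarrow> bool" where "dyn n \<equiv> between 0 (sgap n)"

lemma sgap_nonzero: "sgap n \<noteq> 0"
  using gap_pos[of n] by (simp add: sgap_eq_gap)

lemma sgap_Suc_sign: "0 < sgap n \<Longrightarrow> sgap (Suc n) < 0" "sgap n < 0 \<Longrightarrow> 0 < sgap (Suc n)"
proof -
  have "sgap n * sgap (Suc n) = - (gap n * gap (Suc n))"
    by (simp add: sgap_eq_gap)
  then have "sgap n * sgap (Suc n) < 0" using gap_pos[of n] gap_pos[of "Suc n"] by simp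
  then show "0 < sgap n \<Longrightarrow> sgap (Suc n) < 0" "sgap n < 0 \<Longrightarrow> 0 < sgap (Suc n)"
    by (auto simp: mult_less_0_iff)
qed

lemma abs_sgap: "\<bar>sgap n\<bar> = gap n"
  using gap_pos[of n] by (simp add: sgap_eq_gap abs_mult power_abs)

lemma signed_len_pos_iff: "0 < signed_len n \<longleftrightarrow> 0 < sgap n"
  unfolding signed_len_def using Phi_pos[OF Gam_sgap, of c n] by simp

lemma signed_len_neg_iff: "signed_len n < 0 \<longleftrightarrow> sgap n < 0"
  unfolding signed_len_def using Phi_less_iff[OF Gam_sgap Gam_0, of n c] by simp

lemma signed_len_nonzero [simp]: "signed_len n \<noteq> 0"
  using signed_len_pos_iff[of n] signed_len_neg_iff[of n] sgap_nonzero[of n] by linarith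

lemma signed_len_eq: "signed_len n = (if 0 < sgap n then r n c else - r n (Phi (- gap n) c))"
  using sgap_eq_gap[of n] gap_pos[of n] by (cases "even n") (auto simp: signed_len_def r_def)

lemma signed_len_r: "\<bar>signed_len n\<bar> \<le> real_bound * r n c" "r n c \<le> real_bound * \<bar>signed_len n\<bar>"
proof -
  have "\<bar>signed_len n\<bar> = r n c \<or> \<bar>signed_len n\<bar> = r n (Phi (- gap n) c)"
    using r_pos[of n c] r_pos[of n "Phi (- gap n) c"] by (simp add: signed_len_eq)
  moreover have "r n c \<le> real_bound * r n c" using real_bound_ge_1 r_pos[of n c] by simp
  ultimately show "\<bar>signed_len n\<bar> \<le> real_bound * r n c" "r n c \<le> real_bound * \<bar>signed_len n\<bar>"
    using r_left_le[of n c] r_le_left[of n c] by auto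
qed

lemma dyn_iff: "dyn n x \<longleftrightarrow> 0 \<le> coord n x \<and> coord n x \<le> 1"
proof (cases "0 < sgap n")
  case True
  then have "0 < signed_len n" using signed_len_pos_iff by simp
  then show ?thesis unfolding between_def coord_def by (simp add: divide_simps) (auto simp: signed_len_def)
next
  case False
  then have "signed_len n < 0" using signed_len_neg_iff[of n] sgap_nonzero[of n] by linarith
  then show ?thesis unfolding between_def coord_def by (simp add: divide_simps) (auto simp: signed_len_def)
qed

lemma coord_Suc: "coord n x = (signed_len (Suc n) / signed_len n) * coord (Suc n) x"
  by (simp add: coord_def)

lemma between_Phi:
  assumes "u \<in> Gam" "v \<in> Gam" "w \<in> Gam" "between u v x"
  shows "between (u + w) (v + w) (Phi w x)"
  using assms by (auto simp: between_def Phi_add Phi_commute[of u w] Phi_commute[of v w] Phi_mono_le_iff)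

lemma between_mono:
  assumes "u \<in> Gam" "v \<in> Gam" "u' \<in> Gam" "v' \<in> Gam" "between u v x"
    and "(u' \<le> u \<and> u \<le> v' \<and> u' \<le> v \<and> v \<le> v') \<or> (v' \<le> u \<and> u \<le> u' \<and> v' \<le> v \<and> v \<le> u')"
  shows "between u' v' x"
  using assms(6)
proof
  assume *: "u' \<le> u \<and> u \<le> v' \<and> u' \<le> v \<and> v \<le> v'"
  then have "Phi u' c \<le> Phi u c" "Phi u c \<le> Phi v' c" "Phi u' c \<le> Phi v c" "Phi v c \<le> Phi v' c"
    using assms by (simp_all add: Phi_le_iff)
  then show ?thesis using assms(5) unfolding between_def by linarith
next
  assume *: "v' \<le> u \<and> u \<le> u' \<and> v' \<le> v \<and> v \<le> u'"
  then have "Phi v' c \<le> Phi u c" "Phi u c \<le> Phi u' c" "Phi v' c \<le> Phi v c" "Phi v c \<le> Phi u' c"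
    using assms by (simp_all add: Phi_le_iff)
  then show ?thesis using assms(5) unfolding between_def by linarith
qed

lemma between_split: "between u v x \<Longrightarrow> between u w x \<or> between w v x"
  by (auto simp: between_def)

lemma between_chain:
  assumes "between (s 0) (s k) x" "0 < k"
  shows "\<exists>i<k. between (s i) (s (Suc i)) x"
  using assms
proof (induction k)
  case (Suc k)
  show ?case
  proof (cases "k = 0")
    case False
    from between_split[OF Suc.prems(1), of "s k"] show ?thesis
      using Suc.IH False by (auto intro: less_SucI)
  qed (use Suc in auto)
qed simp

lemma sgap_cases: "(sgap n = gap n \<and> sgap (Suc n) = - gap (Suc n) \<and> sgap (Suc (Suc n)) = gap (Suc (Suc n))) \<or>
    (sgap n = - gap n \<and> sgap (Suc n) = gap (Suc n) \<and> sgap (Suc (Suc n)) = - gap (Suc (Suc n)))"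
  by (cases "even n") (auto simp: sgap_eq_gap)

lemma dyn_Suc_Suc: "dyn (Suc (Suc n)) x \<Longrightarrow> dyn n x"
  by (rule between_mono[of 0 "sgap (Suc (Suc n))"])
     (use sgap_cases[of n] gap_mono[of n "Suc (Suc n)"] gap_pos[of "Suc (Suc n)"] in auto)

lemma dyn_crit: "dyn n c"
  by (simp add: dyn_iff coord_def)

lemma Gam_step: "sgap n + real i * sgap (Suc n) \<in> Gam"
  by simp

lemma dyn_step:
  assumes "dyn (Suc n) y" "i < a (Suc n)"
  shows "dyn n (Phi (sgap n + real i * sgap (Suc n)) y)"
proof -
  define m where "m = real i * gap (Suc n)"
  have 1: "between (0 + (sgap n + real i * sgap (Suc n))) (sgap (Suc n) + (sgap n + real i * sgap (Suc n)))
      (Phi (sgap n + real i * sgap (Suc n)) y)"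
    using assms(1) by (intro between_Phi) auto
  have "real (i + 1) * gap (Suc n) \<le> real (a (Suc n)) * gap (Suc n)"
    using assms(2) gap_pos[of "Suc n"] by (intro mult_right_mono) auto
  then have m1: "m + gap (Suc n) \<le> gap n"
    unfolding m_def using gap_rec[of n] gap_pos[of "Suc (Suc n)"] by (simp add: algebra_simps)
  have m0: "0 \<le> m" "0 < gap (Suc n)" unfolding m_def using gap_pos[of "Suc n"] by simp_all
  have cases: "(sgap n = gap n \<and> sgap (Suc n) = - gap (Suc n) \<and> real i * sgap (Suc n) = - m) \<or>
      (sgap n = - gap n \<and> sgap (Suc n) = gap (Suc n) \<and> real i * sgap (Suc n) = m)"
    using sgap_cases[of n] unfolding m_def by auto
  show ?thesis
    by (rule between_mono[OF _ _ _ _ 1]) (use Gam_step[of n i] in simp, use Gam_step[of n i] in simp, simp, simp,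
        use cases m0 m1 in linarith)
qed

text \<open>The arc of level \<open>n\<close> at the critical point consists of the arc of level \<open>n + 2\<close> and of
  \<open>a (n + 1)\<close> images of the arc of level \<open>n + 1\<close>.\<close>

lemma dyn_decompose:
  assumes "dyn n x"
  shows "dyn (Suc (Suc n)) x \<or>
    (\<exists>i<a (Suc n). dyn (Suc n) (Phi (- (sgap n + real i * sgap (Suc n))) x))"
proof -
  define s where "s i = sgap n + real i * sgap (Suc n)" for i
  have sG: "s i \<in> Gam" for i unfolding s_def by simp
  have s0: "s 0 = sgap n" and sa: "s (a (Suc n)) = sgap (Suc (Suc n))"
    unfolding s_def sgap_rec[of n] by simp_all
  consider "dyn (Suc (Suc n)) x" | "between (s 0) (s (a (Suc n))) x"
    using between_split[OF assms, of "sgap (Suc (Suc n))"] unfolding s0 sa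
    by (auto simp: between_def)
  then show ?thesis
  proof cases
    case 2
    from between_chain[OF 2 a_pos] obtain i where i: "i < a (Suc n)" "between (s i) (s (Suc i)) x" by blast
    have "between (s i + - s i) (s (Suc i) + - s i) (Phi (- s i) x)"
      using i(2) sG by (intro between_Phi) auto
    moreover have "s i + - s i = 0" "s (Suc i) + - s i = sgap (Suc n)"
      by (simp_all add: s_def algebra_simps)
    ultimately have "dyn (Suc n) (Phi (- s i) x)" by simp
    then show ?thesis using i(1) unfolding s_def by blast
  qed simp
qed

definition ratio_const :: real where "ratio_const = real_bound * real_bound"

lemma ratio_const_ge_1: "1 \<le> ratio_const"
  unfolding ratio_const_def using real_bound_ge_1 by (intro mult_ge1_I) auto

lemma signed_len_ratio: "\<bar>signed_len (Suc n) / signed_len n\<bar> \<le> ratio_const"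
proof -
  have "\<bar>signed_len (Suc n)\<bar> \<le> real_bound * r (Suc n) c" by (rule signed_len_r)
  also have "\<dots> \<le> real_bound * r n c" using real_bound_ge_1 by (intro mult_left_mono r_antimono) auto
  also have "\<dots> \<le> real_bound * (real_bound * \<bar>signed_len n\<bar>)" using real_bound_ge_1 by (intro mult_left_mono signed_len_r) auto
  finally show ?thesis by (simp add: ratio_const_def abs_divide divide_le_eq mult_ac)
qed

lemma dyn_near:
  assumes "dyn i x" "i \<in> {n, Suc n}"
  shows "Phi (- gap n) c \<le> x" "x \<le> Phi (gap n) c"
proof -
  have "gap i \<le> gap n" using assms(2) gap_mono[of n i] by auto
  then have "between (- gap n) (gap n) x"
    using abs_sgap[of i] gap_pos[of n]
    by (intro between_mono[OF _ _ _ _ assms(1)]) (auto simp: abs_if split: if_splits)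
  moreover have "Phi (- gap n) c \<le> Phi (gap n) c" using gap_pos[of n] by (simp add: Phi_le_iff)
  ultimately show "Phi (- gap n) c \<le> x" "x \<le> Phi (gap n) c" unfolding between_def by linarith+
qed

lemma r_near:
  assumes "Phi (- gap n) c \<le> x" "x \<le> Phi (gap n) c"
  shows "r n x \<le> (real_bound + 1) * real_bound * \<bar>signed_len n\<bar>" "\<bar>signed_len n\<bar> \<le> (real_bound + 1) * real_bound * r n x"
proof -
  have "r n x \<le> (real_bound + 1) * r n c" by (rule r_comparable[OF assms])
  also have "\<dots> \<le> (real_bound + 1) * (real_bound * \<bar>signed_len n\<bar>)" using real_bound_ge_1 by (intro mult_left_mono signed_len_r) auto
  finally show "r n x \<le> (real_bound + 1) * real_bound * \<bar>signed_len n\<bar>" by (simp add: mult_ac)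
  have "\<bar>signed_len n\<bar> \<le> real_bound * r n c" by (rule signed_len_r)
  also have "\<dots> \<le> real_bound * ((real_bound + 1) * r n x)"
    using real_bound_ge_1 by (intro mult_left_mono r_comparable(2)[OF assms]) auto
  finally show "\<bar>signed_len n\<bar> \<le> (real_bound + 1) * real_bound * r n x" by (simp add: mult_ac)
qed

definition return_lip :: real where "return_lip = lip_const * (real_bound + 1)"

lemma return_lip_ge_1: "1 \<le> return_lip"
  unfolding return_lip_def using real_bound_ge_1 lip_const_ge_1 by (intro mult_ge1_I) auto

lemma return_lipschitz:
  assumes "dyn i x" "dyn i y" "i \<in> {n, Suc n}" "j \<in> {n, Suc n}"
  shows "\<bar>coord n (Phi (sgap j) x) - coord n (Phi (sgap j) y)\<bar> \<le> return_lip * \<bar>coord n x - coord n y\<bar>"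
proof -
  have *: "Phi (sgap j) u - Phi (sgap j) v \<le> return_lip * (u - v)" if "dyn i u" "dyn i v" "v \<le> u" for u v
  proof -
    have sgap_iter: "Phi (sgap j) w = (F ^^ q j) w - of_int (int (cf_num a j))" for w
      using Phi_eq[of "int (q j)" "- int (cf_num a j)" w] by (simp add: sgap_def iter_def)
    have near: "Phi (- gap n) u \<le> v"
    proof -
      have gi: "gap i \<le> gap n" using assms(3) gap_mono[of n i] by auto
      have "Phi (- gap i) u \<le> v"
      proof (cases "0 < sgap i")
        case True
        then have "sgap i = gap i" using abs_sgap[of i] by simp
        then have "u \<le> Phi (gap i) c" "c \<le> v"
          using that Phi_less_iff[of 0 "gap i" c] gap_pos[of i] unfolding between_def by auto
        then have "Phi (- gap i) u \<le> Phi (- gap i) (Phi (gap i) c)" by (subst Phi_mono_le_iff) auto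
        then show ?thesis using \<open>c \<le> v\<close> by simp
      next
        case False
        then have "sgap i = - gap i" using abs_sgap[of i] by simp
        then have "u \<le> c" "Phi (- gap i) c \<le> v"
          using that Phi_less_iff[of "- gap i" 0 c] gap_pos[of i] unfolding between_def by auto
        then show ?thesis using Phi_mono_le_iff[of "- gap i" u c] by simp
      qed
      moreover have "Phi (- gap n) u \<le> Phi (- gap i) u" using gi by (simp add: Phi_le_iff)
      ultimately show ?thesis by linarith
    qed
    have k: "q j \<le> q (Suc n)" using assms(4) q_mono_Suc[of n] by auto
    have gj: "gap j \<le> gap n" using assms(4) gap_mono[of n j] by auto
    define y where "y = Phi (sgap j) u"
    have "Phi (- gap n) u \<le> y" "y \<le> Phi (gap n) u"
      unfolding y_def using abs_sgap[of j] gj by (auto simp: Phi_le_iff)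
    then have ry: "r n y \<le> (real_bound + 1) * r n u" by (rule r_comparable)
    have ry': "r n ((F ^^ q j) u) = r n y"
      unfolding y_def sgap_iter using r_plus_int[of n "(F ^^ q j) u" "- int (cf_num a j)"] by simp
    have "(Phi (sgap j) u - Phi (sgap j) v) * r n u = ((F ^^ q j) u - (F ^^ q j) v) * r n u"
      unfolding sgap_iter by simp
    also have "\<dots> \<le> lip_const * (u - v) * r n y"
      using iterate_lipschitz[OF near that(3) k] unfolding ry' .
    also have "\<dots> \<le> lip_const * (u - v) * ((real_bound + 1) * r n u)"
      using lip_const_ge_1 that ry by (intro mult_left_mono) auto
    finally have "(Phi (sgap j) u - Phi (sgap j) v) * r n u \<le> (return_lip * (u - v)) * r n u"
      by (simp add: return_lip_def mult_ac)
    then show ?thesis using r_pos[of n u] by simp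
  qed
  have "\<bar>Phi (sgap j) x - Phi (sgap j) y\<bar> \<le> return_lip * \<bar>x - y\<bar>"
    using *[of x y] *[of y x] assms Phi_mono_le_iff[OF Gam_sgap, of j x y] Phi_mono_le_iff[OF Gam_sgap, of j y x]
    by (cases "x \<le> y") (auto simp: abs_if)
  then show ?thesis
    by (simp add: coord_def abs_divide divide_right_mono flip: diff_divide_distrib)
qed

definition close_const :: real where "close_const = (real_bound + 1) * ((real_bound + 1) * real_bound) / \<mu>"

lemma coord_close:
  assumes "dyn i x" "i \<in> {n, Suc n}" "Phi (- gap (n + m)) x \<le> x'" "x' \<le> Phi (gap (n + m)) x"
  shows "\<bar>coord n x - coord n x'\<bar> \<le> close_const * \<mu> ^ m"
proof -
  have "\<bar>x - x'\<bar> \<le> r (n + m) x + r (n + m) (Phi (- gap (n + m)) x)"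
    using assms(3,4) arc_order[where n = "n + m" and x = x] by (simp add: r_def abs_if)
  also have "\<dots> \<le> (real_bound + 1) * r (n + m) x" using r_left_le[of "n + m" x] by (simp add: algebra_simps)
  also have "\<dots> \<le> (real_bound + 1) * (\<mu> ^ m / \<mu> * r n x)"
    using real_bound_ge_1 by (intro mult_left_mono r_decay) auto
  also have "\<dots> \<le> (real_bound + 1) * (\<mu> ^ m / \<mu> * ((real_bound + 1) * real_bound * \<bar>signed_len n\<bar>))"
    using real_bound_ge_1 \<mu>_bounds(1) dyn_near[OF assms(1,2)] by (intro mult_left_mono r_near) auto
  finally have "\<bar>x - x'\<bar> \<le> close_const * \<mu> ^ m * \<bar>signed_len n\<bar>" by (simp add: close_const_def mult_ac)
  moreover have "\<bar>coord n x - coord n x'\<bar> = \<bar>x - x'\<bar> / \<bar>signed_len n\<bar>"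
    by (simp add: coord_def abs_divide flip: diff_divide_distrib)
  ultimately show ?thesis by (simp add: divide_le_eq)
qed

lemma close_const_nonneg: "0 \<le> close_const" unfolding close_const_def using real_bound_ge_1 \<mu>_bounds(1) by auto

end

lemma div_power_geometric:
  fixes z :: real
  assumes "0 < z" "z < 1" "0 < P"
  obtains y where "0 < y" "y < 1" "\<And>n. z ^ (n div P) \<le> y ^ n / z"
proof -
  define y where "y = z powr (1 / real P)"
  have y: "0 < y" "y < 1" unfolding y_def using assms powr_less_mono2[of "1 / real P" z 1] by auto
  have "z ^ (n div P) \<le> y ^ n / z" for n
  proof -
    have "n < P * (n div P + 1)" using assms(3) by (metis dividend_less_times_div distrib_left_numeral mult.commute mult_Suc_right Suc_eq_plus1 add.commute)
    then have "real n < real P * real (n div P + 1)" by (metis of_nat_less_iff of_nat_mult)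
    then have "real n / real P - 1 \<le> real (n div P)" using assms(3) by (simp add: field_simps)
    then have "z powr real (n div P) \<le> z powr (real n / real P - 1)"
      using assms by (intro powr_mono') auto
    also have "\<dots> = z powr (real n / real P) / z" using assms by (simp add: powr_diff)
    also have "z powr (real n / real P) = y ^ n"
      unfolding y_def using assms by (simp add: powr_powr flip: powr_realpow)
    finally show ?thesis using assms by (simp add: powr_realpow)
  qed
  then show ?thesis using y that by blast
qed

section \<open>Two conjugate maps with asymptotic renormalizations\<close>

text \<open>The renormalizations are compared in affine coordinates: each point in the domain of a
  renormalized map of \<open>F\<close> has a companion for \<open>G\<close> such that both the points and their images are
  close. The companion need not be the conjugate point.\<close>

locale asymptotic_pair =
  f: critical_lift a \<rho> F F' c\<^sub>f K\<^sub>f e\<^sub>f \<delta>\<^sub>f B + g: critical_lift a \<rho> G G' c\<^sub>g K\<^sub>g e\<^sub>g \<delta>\<^sub>g B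
  for a \<rho> F F' c\<^sub>f K\<^sub>f e\<^sub>f \<delta>\<^sub>f B G G' c\<^sub>g K\<^sub>g e\<^sub>g \<delta>\<^sub>g +
  fixes H :: "real \<Rightarrow> real" and C\<^sub>0 \<theta> :: real
  assumes H_cont: "continuous_on UNIV H" and H_strict_mono: "strict_mono H"
    and H_plus_1: "H (x + 1) = H x + 1" and H_conj: "H (F x) = G (H x)" and H_crit: "H c\<^sub>f = c\<^sub>g"
    and C\<^sub>0_pos: "0 < C\<^sub>0" and \<theta>_bounds: "0 < \<theta>" "\<theta> < 1"
    and ratio_close: "\<bar>f.signed_len (Suc n) / f.signed_len n - g.signed_len (Suc n) / g.signed_len n\<bar> \<le> C\<^sub>0 * \<theta> ^ n"
    and left_close: "f.dyn (Suc n) x \<Longrightarrow> \<exists>y. g.dyn (Suc n) y \<and> \<bar>f.coord n x - g.coord n y\<bar> \<le> C\<^sub>0 * \<theta> ^ n \<and>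
      \<bar>f.coord n (f.Phi (f.sgap n) x) - g.coord n (g.Phi (f.sgap n) y)\<bar> \<le> C\<^sub>0 * \<theta> ^ n"
    and right_close: "f.dyn n x \<Longrightarrow> \<exists>y. g.dyn n y \<and> \<bar>f.coord n x - g.coord n y\<bar> \<le> C\<^sub>0 * \<theta> ^ n \<and>
      \<bar>f.coord n (f.Phi (f.sgap (Suc n)) x) - g.coord n (g.Phi (f.sgap (Suc n)) y)\<bar> \<le> C\<^sub>0 * \<theta> ^ n"
begin

lemma H_less: "H x < H y \<longleftrightarrow> x < y"
  using H_strict_mono strict_mono_less by blast

lemma H_le: "H x \<le> H y \<longleftrightarrow> x \<le> y"
  using H_strict_mono strict_mono_less_eq by blast

lemma H_plus_int: "H (x + of_int k) = H x + of_int k"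
  by (rule integer_shift[of H, OF H_plus_1])

lemma H_iter: "H (f.iter i x) = g.iter i (H x)"
proof (induction i rule: int_induct[where k = 0])
  case base
  then show ?case by (simp add: f.iter_0 g.iter_0)
next
  case (step1 i)
  then show ?case by (simp add: f.iter_succ g.iter_succ H_conj)
next
  case (step2 i)
  have "G (H (f.iter (i - 1) x)) = H (f.iter i x)"
    unfolding H_conj[symmetric] f.iter_pred f.F_inv ..
  then show ?case unfolding step2 g.iter_pred by (metis g.F_inv(2))
qed

lemma H_Phi: assumes "u \<in> f.Gam" shows "H (f.Phi u x) = g.Phi u (H x)"
  using assms by (elim f.GamE) (simp add: f.Phi_eq g.Phi_eq H_plus_int H_iter)

lemma H_funpow: "H ((F ^^ k) x) = (G ^^ k) (H x)"
  by (induction k) (auto simp: H_conj)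

lemma H_between: "u \<in> f.Gam \<Longrightarrow> v \<in> f.Gam \<Longrightarrow> g.between u v (H x) \<longleftrightarrow> f.between u v x"
  using H_le[of "f.Phi u c\<^sub>f" x] H_le[of x "f.Phi u c\<^sub>f"] H_le[of "f.Phi v c\<^sub>f" x] H_le[of x "f.Phi v c\<^sub>f"]
  unfolding f.between_def g.between_def by (simp add: H_Phi H_crit)

lemma H_dyn: "g.dyn n (H x) \<longleftrightarrow> f.dyn n x"
  by (rule H_between) auto

definition mismatch :: "nat \<Rightarrow> real \<Rightarrow> real"
  where "mismatch n x = \<bar>f.coord n x - g.coord n (H x)\<bar>"

lemma mismatch_crit: "mismatch n c\<^sub>f = 0"
  by (simp add: mismatch_def H_crit f.coord_def g.coord_def)

text \<open>Pass from \<open>x\<close> to its companion, apply the renormalized maps, and return to the conjugate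
  point by the Lipschitz estimate for \<open>G\<close>.\<close>

lemma mismatch_return:
  assumes "f.dyn i x" "(i = n \<and> j = Suc n) \<or> (i = Suc n \<and> j = n)"
  shows "mismatch n (f.Phi (f.sgap j) x) \<le> g.return_lip * mismatch n x + (g.return_lip + 1) * (C\<^sub>0 * \<theta> ^ n)"
proof -
  obtain y where y: "g.dyn i y" "\<bar>f.coord n x - g.coord n y\<bar> \<le> C\<^sub>0 * \<theta> ^ n"
      "\<bar>f.coord n (f.Phi (f.sgap j) x) - g.coord n (g.Phi (f.sgap j) y)\<bar> \<le> C\<^sub>0 * \<theta> ^ n"
    using left_close[of n x] right_close[of n x] assms by blast
  have "\<bar>g.coord n (g.Phi (f.sgap j) y) - g.coord n (g.Phi (f.sgap j) (H x))\<bar> \<le> g.return_lip * \<bar>g.coord n y - g.coord n (H x)\<bar>"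
    using assms H_dyn y(1) by (intro g.return_lipschitz[of i]) auto
  also have "\<dots> \<le> g.return_lip * (mismatch n x + C\<^sub>0 * \<theta> ^ n)"
    using g.return_lip_ge_1 y(2) unfolding mismatch_def by (intro mult_left_mono) auto
  finally show ?thesis
    using y(3) unfolding mismatch_def H_Phi[OF f.Gam_sgap] by (simp add: algebra_simps)
qed

lemma mismatch_Suc:
  assumes "\<bar>f.coord (Suc n) x\<bar> \<le> f.ratio_const"
  shows "mismatch n x \<le> g.ratio_const * mismatch (Suc n) x + f.ratio_const * (C\<^sub>0 * \<theta> ^ n)"
proof -
  define lf lg where "lf = f.signed_len (Suc n) / f.signed_len n" and "lg = g.signed_len (Suc n) / g.signed_len n"
  define u v where "u = f.coord (Suc n) x" and "v = g.coord (Suc n) (H x)"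
  have "mismatch n x = \<bar>lf * u - lg * v\<bar>"
    unfolding mismatch_def f.coord_Suc[of n x] g.coord_Suc[of n "H x"] lf_def lg_def u_def v_def ..
  also have "lf * u - lg * v = (lf - lg) * u + lg * (u - v)" by (simp add: algebra_simps)
  also have "\<bar>\<dots>\<bar> \<le> \<bar>lf - lg\<bar> * \<bar>u\<bar> + \<bar>lg\<bar> * \<bar>u - v\<bar>"
    by (metis abs_mult abs_triangle_ineq)
  also have "\<dots> \<le> (C\<^sub>0 * \<theta> ^ n) * f.ratio_const + g.ratio_const * \<bar>u - v\<bar>"
    using assms ratio_close[of n] g.signed_len_ratio[of n] C\<^sub>0_pos \<theta>_bounds f.ratio_const_ge_1 g.ratio_const_ge_1
    unfolding u_def lf_def lg_def by (intro add_mono mult_mono) auto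
  finally show ?thesis by (simp add: mismatch_def u_def v_def mult_ac)
qed

text \<open>The loss of accuracy at one level of renormalization: a change of scale, followed by at most
  \<open>B + 1\<close> applications of the renormalized maps.\<close>

definition A\<^sub>0 :: real where "A\<^sub>0 = (g.ratio_const + f.ratio_const * C\<^sub>0 + 1) * (g.return_lip + (g.return_lip + 1) * C\<^sub>0) ^ (B + 1)"

lemma mismatch_iterate:
  assumes "f.dyn (Suc n) y" "i < a (Suc n)" "mismatch n y \<le> M * \<theta> ^ n" "1 \<le> M"
  shows "mismatch n (f.Phi (f.sgap n + real i * f.sgap (Suc n)) y) \<le>
    (g.return_lip + (g.return_lip + 1) * C\<^sub>0) ^ (i + 1) * M * \<theta> ^ n"
  using assms(2)
proof (induction i)
  case 0
  have "mismatch n (f.Phi (f.sgap n) y) \<le> g.return_lip * mismatch n y + (g.return_lip + 1) * (C\<^sub>0 * \<theta> ^ n)"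
    by (rule mismatch_return[OF assms(1)]) simp
  also have "\<dots> \<le> g.return_lip * (M * \<theta> ^ n) + (g.return_lip + 1) * (C\<^sub>0 * (M * \<theta> ^ n))"
    using g.return_lip_ge_1 assms(3,4) C\<^sub>0_pos \<theta>_bounds by (intro add_mono mult_left_mono) auto
  finally show ?case by (simp add: algebra_simps)
next
  case (Suc i)
  define L where "L = g.return_lip + (g.return_lip + 1) * C\<^sub>0"
  have L: "1 \<le> L" unfolding L_def using g.return_lip_ge_1 C\<^sub>0_pos by (simp add: add_increasing2)
  define x where "x = f.Phi (f.sgap n + real i * f.sgap (Suc n)) y"
  have x: "f.dyn n x" unfolding x_def using assms(1) Suc.prems by (intro f.dyn_step) auto
  have eq: "f.Phi (f.sgap n + real (Suc i) * f.sgap (Suc n)) y = f.Phi (f.sgap (Suc n)) x"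
    unfolding x_def using f.Phi_add[of "f.sgap (Suc n)" "f.sgap n + real i * f.sgap (Suc n)" y]
    by (simp add: algebra_simps)
  have IH: "mismatch n x \<le> L ^ (i + 1) * M * \<theta> ^ n" using Suc unfolding x_def L_def by simp
  have ge: "1 \<le> L ^ (i + 1) * M" using L assms(4) by (intro mult_ge1_I one_le_power) auto
  have "mismatch n (f.Phi (f.sgap (Suc n)) x) \<le> g.return_lip * mismatch n x + (g.return_lip + 1) * (C\<^sub>0 * \<theta> ^ n)"
    by (rule mismatch_return[OF x]) simp
  also have "\<dots> \<le> g.return_lip * (L ^ (i + 1) * M * \<theta> ^ n) + (g.return_lip + 1) * (C\<^sub>0 * (L ^ (i + 1) * M * \<theta> ^ n))"
    using g.return_lip_ge_1 IH ge C\<^sub>0_pos \<theta>_bounds by (intro add_mono mult_left_mono) auto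
  also have "\<dots> = L ^ (Suc i + 1) * M * \<theta> ^ n" by (simp add: L_def algebra_simps)
  finally show ?case unfolding eq L_def .
qed

lemma A\<^sub>0_bounds:
  assumes "i < a (Suc n)" "1 \<le> M"
  shows "(g.return_lip + (g.return_lip + 1) * C\<^sub>0) ^ (i + 1) * ((g.ratio_const + f.ratio_const * C\<^sub>0 + 1) * M) \<le> A\<^sub>0 * M"
    and "(g.ratio_const + f.ratio_const * C\<^sub>0 + 1) * M \<le> A\<^sub>0 * M" and "1 \<le> A\<^sub>0"
proof -
  define L where "L = g.return_lip + (g.return_lip + 1) * C\<^sub>0"
  have L: "1 \<le> L" unfolding L_def using g.return_lip_ge_1 C\<^sub>0_pos by (simp add: add_increasing2)
  have P: "1 \<le> g.ratio_const + f.ratio_const * C\<^sub>0 + 1" using g.ratio_const_ge_1 f.ratio_const_ge_1 C\<^sub>0_pos by simp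
  have "i + 1 \<le> B + 1" using assms f.bounded_type[of "Suc n"] by linarith
  then have "L ^ (i + 1) \<le> L ^ (B + 1)" using L by (intro power_increasing)
  then have "(g.ratio_const + f.ratio_const * C\<^sub>0 + 1) * M * L ^ (i + 1) \<le> (g.ratio_const + f.ratio_const * C\<^sub>0 + 1) * M * L ^ (B + 1)"
    using P assms(2) by (intro mult_left_mono) auto
  then show "(g.return_lip + (g.return_lip + 1) * C\<^sub>0) ^ (i + 1) * ((g.ratio_const + f.ratio_const * C\<^sub>0 + 1) * M) \<le> A\<^sub>0 * M"
    by (simp only: A\<^sub>0_def L_def mult_ac)
  have "1 \<le> L ^ (B + 1)" using L by (rule one_le_power)
  then have "(g.ratio_const + f.ratio_const * C\<^sub>0 + 1) * M * 1 \<le> (g.ratio_const + f.ratio_const * C\<^sub>0 + 1) * M * L ^ (B + 1)"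
    using P assms(2) by (intro mult_left_mono) auto
  then show "(g.ratio_const + f.ratio_const * C\<^sub>0 + 1) * M \<le> A\<^sub>0 * M" by (simp only: A\<^sub>0_def L_def mult_ac mult_1)
  show "1 \<le> A\<^sub>0" unfolding A\<^sub>0_def L_def[symmetric] using P L by (intro mult_ge1_I one_le_power)
qed

text \<open>The approximating points are obtained from the critical point, where the error
  vanishes. Closeness is measured by the action, which is invariant under the maps used to pull
  a point back to the next level.\<close>

lemma close_points:
  assumes "f.dyn i x" "i \<in> {n, Suc n}"
  shows "\<exists>x'. f.dyn i x' \<and> mismatch n x' \<le> A\<^sub>0 ^ m * \<theta> ^ n \<and>
    f.Phi (- f.gap (n + m)) x \<le> x' \<and> x' \<le> f.Phi (f.gap (n + m)) x"
  using assms
proof (induction m arbitrary: n i x)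
  case 0
  have "f.Phi (- f.gap n) c\<^sub>f \<le> x" "x \<le> f.Phi (f.gap n) c\<^sub>f" using f.dyn_near[OF 0] by auto
  then have "f.Phi (- f.gap n) x \<le> c\<^sub>f" "c\<^sub>f \<le> f.Phi (f.gap n) x"
    using f.Phi_mono_le_iff[of "- f.gap n" x "f.Phi (f.gap n) c\<^sub>f"] f.Phi_mono_le_iff[of "f.gap n" "f.Phi (- f.gap n) c\<^sub>f" x]
    by auto
  then show ?case using f.dyn_crit mismatch_crit \<theta>_bounds by (intro exI[of _ "c\<^sub>f"]) auto
next
  case (Suc m)
  define M where "M = A\<^sub>0 ^ m"
  have M: "1 \<le> M" unfolding M_def using A\<^sub>0_bounds(3)[OF f.a_pos order_refl] by (rule one_le_power)
  have gapeq: "Suc n + m = n + Suc m" by simp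
  have down: "mismatch n x' \<le> (g.ratio_const + f.ratio_const * C\<^sub>0 + 1) * M * \<theta> ^ n"
    if "mismatch (Suc n) x' \<le> M * \<theta> ^ Suc n" "f.dyn l x'" "l \<in> {Suc n, Suc (Suc n)}" for l x'
  proof -
    have "\<bar>f.coord (Suc n) x'\<bar> \<le> f.ratio_const"
    proof (cases "l = Suc n")
      case True
      then show ?thesis using that(2) f.ratio_const_ge_1 by (simp add: f.dyn_iff)
    next
      case False
      then have "\<bar>f.coord (Suc (Suc n)) x'\<bar> \<le> 1" using that by (simp add: f.dyn_iff)
      then have "\<bar>f.signed_len (Suc (Suc n)) / f.signed_len (Suc n)\<bar> * \<bar>f.coord (Suc (Suc n)) x'\<bar> \<le> f.ratio_const * 1"
        using f.ratio_const_ge_1 by (intro mult_mono f.signed_len_ratio) auto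
      then show ?thesis unfolding f.coord_Suc[of "Suc n" x'] abs_mult by simp
    qed
    then have "mismatch n x' \<le> g.ratio_const * mismatch (Suc n) x' + f.ratio_const * (C\<^sub>0 * \<theta> ^ n)" by (rule mismatch_Suc)
    also have "\<dots> \<le> g.ratio_const * (M * \<theta> ^ n) + f.ratio_const * (C\<^sub>0 * (M * \<theta> ^ n))"
    proof (intro add_mono mult_left_mono)
      have "M * \<theta> ^ Suc n \<le> M * \<theta> ^ n" using M \<theta>_bounds by (intro mult_left_mono power_decreasing) auto
      then show "mismatch (Suc n) x' \<le> M * \<theta> ^ n" using that(1) by linarith
    qed (use g.ratio_const_ge_1 f.ratio_const_ge_1 C\<^sub>0_pos M \<theta>_bounds in auto)
    also have "\<dots> \<le> (g.ratio_const + f.ratio_const * C\<^sub>0 + 1) * M * \<theta> ^ n"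
      using M \<theta>_bounds by (simp add: algebra_simps)
    finally show ?thesis .
  qed
  have weaken: "mismatch n x' \<le> A\<^sub>0 ^ Suc m * \<theta> ^ n" if "mismatch n x' \<le> (g.ratio_const + f.ratio_const * C\<^sub>0 + 1) * M * \<theta> ^ n" for x'
  proof -
    have "(g.ratio_const + f.ratio_const * C\<^sub>0 + 1) * M * \<theta> ^ n \<le> A\<^sub>0 * M * \<theta> ^ n"
      by (rule mult_right_mono[OF A\<^sub>0_bounds(2)[OF f.a_pos M]]) (use \<theta>_bounds in auto)
    then show ?thesis using that by (simp add: M_def)
  qed
  show ?case
  proof (cases "f.dyn (Suc (Suc n)) x \<or> i = Suc n")
    case True
    define l where "l = (if i = Suc n then Suc n else Suc (Suc n))"
    have l: "f.dyn l x" "l \<in> {Suc n, Suc (Suc n)}" using True Suc.prems unfolding l_def by auto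
    from Suc.IH[OF this] obtain x' where x': "f.dyn l x'" "mismatch (Suc n) x' \<le> M * \<theta> ^ Suc n"
      "f.Phi (- f.gap (n + Suc m)) x \<le> x'" "x' \<le> f.Phi (f.gap (n + Suc m)) x"
      unfolding gapeq M_def by blast
    have "f.dyn i x'" using x'(1) Suc.prems(2) f.dyn_Suc_Suc[of n x'] unfolding l_def by (auto split: if_splits)
    then show ?thesis using weaken[OF down[OF x'(2,1) l(2)]] x' by blast
  next
    case False
    then have i: "i = n" using Suc.prems by auto
    define s where "s j = f.sgap n + real j * f.sgap (Suc n)" for j
    have sG: "s j \<in> f.Gam" for j unfolding s_def by simp
    obtain j where j: "j < a (Suc n)" "f.dyn (Suc n) (f.Phi (- s j) x)"
      using f.dyn_decompose[of n x] Suc.prems False i unfolding s_def by blast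
    define y where "y = f.Phi (- s j) x"
    have xy: "x = f.Phi (s j) y" unfolding y_def using sG by simp
    obtain y' where y': "f.dyn (Suc n) y'" "mismatch (Suc n) y' \<le> M * \<theta> ^ Suc n"
      "f.Phi (- f.gap (n + Suc m)) y \<le> y'" "y' \<le> f.Phi (f.gap (n + Suc m)) y"
      using Suc.IH[OF j(2), of "Suc n"] unfolding gapeq M_def y_def by auto
    define x' where "x' = f.Phi (s j) y'"
    have "mismatch n x' \<le> (g.return_lip + (g.return_lip + 1) * C\<^sub>0) ^ (j + 1) * ((g.ratio_const + f.ratio_const * C\<^sub>0 + 1) * M) * \<theta> ^ n"
      unfolding x'_def s_def
    proof (rule mismatch_iterate[OF y'(1) j(1)])
      show "mismatch n y' \<le> (g.ratio_const + f.ratio_const * C\<^sub>0 + 1) * M * \<theta> ^ n" by (rule down[OF y'(2,1)]) simp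
      show "1 \<le> (g.ratio_const + f.ratio_const * C\<^sub>0 + 1) * M"
        using M g.ratio_const_ge_1 f.ratio_const_ge_1 C\<^sub>0_pos by (intro mult_ge1_I) auto
    qed
    also have "\<dots> \<le> A\<^sub>0 * M * \<theta> ^ n"
      using A\<^sub>0_bounds(1)[OF j(1) M] \<theta>_bounds by (intro mult_right_mono) auto
    finally have "mismatch n x' \<le> A\<^sub>0 ^ Suc m * \<theta> ^ n" by (simp add: M_def)
    moreover have "f.dyn n x'" unfolding x'_def s_def by (rule f.dyn_step[OF y'(1) j(1)])
    moreover have "f.Phi (- f.gap (n + Suc m)) x \<le> x'" "x' \<le> f.Phi (f.gap (n + Suc m)) x"
      unfolding xy x'_def using y'(3,4) sG
      by (simp_all add: f.Phi_commute[of _ "s j"] f.Phi_mono_le_iff del: add_Suc_right)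
    ultimately show ?thesis using i by blast
  qed
qed

text \<open>The number of levels is chosen proportional to \<open>n\<close>, so small that the growth of the error
  is absorbed by \<open>\<theta>\<^sup>n\<close>.\<close>

lemma mismatch_decay:
  obtains C \<eta> where "0 < C" "0 < \<eta>" "\<eta> < 1"
    "\<And>n i x. f.dyn i x \<Longrightarrow> i \<in> {n, Suc n} \<Longrightarrow> mismatch n x \<le> C * \<eta> ^ n"
proof -
  have A: "1 \<le> A\<^sub>0" using A\<^sub>0_bounds(3)[OF f.a_pos order_refl] .
  define z where "z = max (1 / 2) (max f.\<mu> g.\<mu>)"
  have z: "0 < z" "z < 1" "1 / 2 \<le> z" "f.\<mu> \<le> z" "g.\<mu> \<le> z"
    using f.\<mu>_bounds g.\<mu>_bounds by (auto simp: z_def)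
  obtain P where P: "\<theta> ^ P < 1 / (2 * A\<^sub>0)"
    using real_arch_pow_inv[of "1 / (2 * A\<^sub>0)" \<theta>] A \<theta>_bounds by auto
  then have P0: "0 < P" using A by (cases "P = 0") (auto simp: field_simps)
  have AP: "A\<^sub>0 * \<theta> ^ P \<le> 1 / 2" using P A by (simp add: field_simps)
  obtain y where y: "0 < y" "y < 1" "\<And>n. z ^ (n div P) \<le> y ^ n / z"
    using div_power_geometric[OF z(1,2) P0] by blast
  define D where "D = 1 + f.close_const + g.close_const"
  have D: "0 < D" using f.close_const_nonneg g.close_const_nonneg by (simp add: D_def)
  have "mismatch n x \<le> (D / z) * y ^ n" if x: "f.dyn i x" "i \<in> {n, Suc n}" for n i x
  proof -
    define m where "m = n div P"
    obtain x' where x': "f.dyn i x'" "mismatch n x' \<le> A\<^sub>0 ^ m * \<theta> ^ n"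
      "f.Phi (- f.gap (n + m)) x \<le> x'" "x' \<le> f.Phi (f.gap (n + m)) x"
      using close_points[OF x, of m] by blast
    have "A\<^sub>0 ^ m * \<theta> ^ n \<le> A\<^sub>0 ^ m * \<theta> ^ (P * m)"
      using A \<theta>_bounds unfolding m_def by (intro mult_left_mono power_decreasing) auto
    also have "\<dots> = (A\<^sub>0 * \<theta> ^ P) ^ m" by (simp add: power_mult_distrib power_mult)
    also have "\<dots> \<le> z ^ m" using AP A \<theta>_bounds z by (intro power_mono) auto
    finally have 1: "mismatch n x' \<le> z ^ m" using x' by linarith
    have "\<bar>f.coord n x - f.coord n x'\<bar> \<le> f.close_const * f.\<mu> ^ m" by (rule f.coord_close[OF x x'(3,4)])
    also have "\<dots> \<le> f.close_const * z ^ m" using f.close_const_nonneg f.\<mu>_bounds z by (intro mult_left_mono power_mono) auto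
    finally have 2: "\<bar>f.coord n x - f.coord n x'\<bar> \<le> f.close_const * z ^ m" .
    have "H (f.Phi (- f.gap (n + m)) x) \<le> H x'" "H x' \<le> H (f.Phi (f.gap (n + m)) x)"
      using x' by (simp_all add: H_le)
    then have "g.Phi (- f.gap (n + m)) (H x) \<le> H x'" "H x' \<le> g.Phi (f.gap (n + m)) (H x)"
      by (simp_all add: H_Phi)
    then have "\<bar>g.coord n (H x) - g.coord n (H x')\<bar> \<le> g.close_const * g.\<mu> ^ m"
      using x H_dyn by (intro g.coord_close[of i]) auto
    also have "\<dots> \<le> g.close_const * z ^ m" using g.close_const_nonneg g.\<mu>_bounds z by (intro mult_left_mono power_mono) auto
    finally have 3: "\<bar>g.coord n (H x) - g.coord n (H x')\<bar> \<le> g.close_const * z ^ m" .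
    have "mismatch n x \<le> D * z ^ m" using 1 2 3 unfolding mismatch_def D_def by (simp add: algebra_simps)
    also have "\<dots> \<le> D * (y ^ n / z)" unfolding m_def using D y(3) by (intro mult_left_mono) auto
    finally show ?thesis by simp
  qed
  then show ?thesis using that[of "D / z" y] D z y by auto
qed

end

section \<open>Slopes of the conjugacy\<close>

lemma (in critical_lift) near_dyn:
  assumes "Phi (- gap (Suc p)) c \<le> x" "x \<le> Phi (gap (Suc p)) c"
  shows "dyn p x \<or> dyn (Suc p) x"
proof -
  have "Phi (gap (Suc p)) c \<le> Phi (gap p) c" "Phi (- gap p) c \<le> Phi (- gap (Suc p)) c"
    using gap_Suc_less[of p] by (auto simp: Phi_le_iff)
  then show ?thesis using assms sgap_cases[of p] unfolding between_def by (cases "x \<le> c") auto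
qed

lemma abs_ln_le:
  fixes t :: real assumes "\<bar>t - 1\<bar> \<le> 1 / 2" shows "\<bar>ln t\<bar> \<le> 2 * \<bar>t - 1\<bar>"
proof -
  define w d where "w = \<bar>t - 1\<bar>" and "d = ln t - (t - 1)"
  have "\<bar>d\<bar> \<le> 2 * (w * w)"
    using abs_ln_one_plus_x_minus_x_bound[OF assms] by (simp add: w_def d_def power2_eq_square flip: abs_mult)
  also have "w * w \<le> w * (1 / 2)" using assms unfolding w_def by (intro mult_left_mono) auto
  finally have "\<bar>d\<bar> \<le> w" by simp
  moreover have "\<bar>ln t\<bar> \<le> \<bar>d\<bar> + w" unfolding w_def d_def by linarith
  ultimately have "\<bar>ln t\<bar> \<le> 2 * w" by linarith
  then show ?thesis by (simp only: w_def)
qed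

lemma poly_geometric:
  fixes z :: real
  assumes "0 < z" "z < 1" shows "real (w + 1) * z ^ w \<le> (sqrt z) ^ w / (1 - sqrt z)"
proof -
  define y where "y = sqrt z"
  have y: "0 < y" "y < 1" "y * y = z" using assms by (auto simp: y_def)
  have "real (w + 1) * y ^ w = (\<Sum>i\<le>w. y ^ w)" by simp
  also have "\<dots> \<le> (\<Sum>i\<le>w. y ^ i)" using y by (intro sum_mono power_decreasing) auto
  also have "\<dots> \<le> 1 / (1 - y)"
    using y by (simp add: sum_gp0 divide_right_mono)
  finally have "real (w + 1) * y ^ w * y ^ w \<le> 1 / (1 - y) * y ^ w" using y by (intro mult_right_mono) auto
  moreover have "z ^ w = y ^ w * y ^ w" unfolding y(3)[symmetric] by (rule power_mult_distrib)
  ultimately show ?thesis by (simp add: y_def[symmetric] mult_ac)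
qed

context asymptotic_pair
begin

definition slope :: "real \<Rightarrow> real \<Rightarrow> real" where "slope u v = (H v - H u) / (v - u)"

lemma H_away: "g.away n (H x) \<longleftrightarrow> f.away n x"
proof -
  have H1: "H (f.Phi (f.gap n) c\<^sub>f) = g.Phi (f.gap n) c\<^sub>g" "H (f.Phi (- f.gap n) c\<^sub>f) = g.Phi (- f.gap n) c\<^sub>g"
    by (simp_all add: H_Phi H_crit)
  show ?thesis
    unfolding f.away_def g.away_def H1[symmetric] H_plus_int[symmetric] H_le H_less ..
qed

text \<open>Up to the first entry near the critical point, \<open>F\<close> and \<open>G\<close> distort the slope by \<open>\<beta>f\<close> and
  \<open>\<beta>g\<close>. There the slope is that of the nearly identical coordinates, with the error relative to
  the length of the arc, times a factor that is the same for all arcs.\<close>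

lemma slope_at_level:
  assumes n: "n = Suc (Suc p)" "n + 3 \<le> N" and \<epsilon>: "0 < \<epsilon>"
    and \<beta>f: "\<beta>f \<le> 1" "\<And>k u v u' v'. k \<le> f.q n + f.q (Suc n) \<Longrightarrow>
      (\<And>j. j < k \<Longrightarrow> f.away n ((F ^^ j) x)) \<Longrightarrow> x \<le> u \<Longrightarrow> u < v \<Longrightarrow> v \<le> f.Phi (f.gap N) x \<Longrightarrow>
      x \<le> u' \<Longrightarrow> u' < v' \<Longrightarrow> v' \<le> f.Phi (f.gap N) x \<Longrightarrow>
      \<bar>ln (((F ^^ k) v - (F ^^ k) u) / (v - u)) - ln (((F ^^ k) v' - (F ^^ k) u') / (v' - u'))\<bar> \<le> \<beta>f"
    and \<beta>g: "\<And>k u v u' v'. k \<le> f.q n + f.q (Suc n) \<Longrightarrow>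
      (\<And>j. j < k \<Longrightarrow> g.away n ((G ^^ j) (H x))) \<Longrightarrow> H x \<le> u \<Longrightarrow> u < v \<Longrightarrow> v \<le> g.Phi (f.gap N) (H x) \<Longrightarrow>
      H x \<le> u' \<Longrightarrow> u' < v' \<Longrightarrow> v' \<le> g.Phi (f.gap N) (H x) \<Longrightarrow>
      \<bar>ln (((G ^^ k) v - (G ^^ k) u) / (v - u)) - ln (((G ^^ k) v' - (G ^^ k) u') / (v' - u'))\<bar> \<le> \<beta>g"
    and e1: "\<And>i y. f.dyn i y \<Longrightarrow> i \<in> {p, Suc p} \<Longrightarrow> mismatch p y \<le> e1"
    and small: "2 * e1 * (3 * (f.real_bound + 1) * f.real_bound * f.level_const ^ (N - p) / \<epsilon>) \<le> 1 / 2"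
    and uv: "x \<le> u" "u < v" "v \<le> f.Phi (f.gap N) x" "x \<le> u'" "u' < v'" "v' \<le> f.Phi (f.gap N) x"
      "\<epsilon> * f.r N x \<le> v - u" "\<epsilon> * f.r N x \<le> v' - u'"
  shows "\<bar>ln (slope u v) - ln (slope u' v')\<bar> \<le>
    \<beta>f + \<beta>g + 8 * e1 * (3 * (f.real_bound + 1) * f.real_bound * f.level_const ^ (N - p) / \<epsilon>)"
proof -
  define Z where "Z = 3 * (f.real_bound + 1) * f.real_bound * f.level_const ^ (N - p) / \<epsilon>"
  have Z: "0 < Z" unfolding Z_def using f.real_bound_ge_1 f.level_const_ge_1 \<epsilon> by (intro divide_pos_pos mult_pos_pos) auto
  obtain k0 m where k0: "k0 < f.q n + f.q (Suc n)" "f.Phi (- f.gap n) c\<^sub>f \<le> (F ^^ k0) x + of_int m"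
    "(F ^^ k0) x + of_int m < f.Phi (f.gap n) (f.Phi (- f.gap n) c\<^sub>f)"
    using f.covering[of n "f.Phi (- f.gap n) c\<^sub>f" x] by blast
  moreover have "c\<^sub>f < f.Phi (f.gap n) c\<^sub>f" by (rule f.arc_order)
  ultimately have "\<not> f.away n ((F ^^ k0) x)" unfolding f.away_def by auto
  define k where "k = (LEAST k. \<not> f.away n ((F ^^ k) x))"
  have k_entry: "\<not> f.away n ((F ^^ k) x)" unfolding k_def by (rule LeastI) fact
  have k_away: "f.away n ((F ^^ j) x)" if "j < k" for j
    using that not_less_Least[of j "\<lambda>k. \<not> f.away n ((F ^^ k) x)"] unfolding k_def by blast
  have "k \<le> k0" unfolding k_def by (rule Least_le) fact
  then have k: "k \<le> f.q n + f.q (Suc n)" using k0 by linarith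
  obtain l :: int where l: "f.Phi (- f.gap n) c\<^sub>f \<le> (F ^^ k) x + of_int l" "(F ^^ k) x + of_int l < f.Phi (f.gap n) c\<^sub>f"
    using k_entry unfolding f.away_def by blast
  define T where "T z = (F ^^ k) z + of_int l" for z
  define TG where "TG z = (G ^^ k) z + of_int l" for z
  have HT: "H (T z) = TG (H z)" for z unfolding T_def TG_def H_plus_int H_funpow ..
  have T_less: "T z < T z' \<longleftrightarrow> z < z'" for z z' by (simp add: T_def f.iterate_less)
  define y where "y = T x"
  have TPhi: "T (f.Phi (f.gap N) x) = f.Phi (f.gap N) y"
    unfolding y_def T_def f.Phi_plus_int[OF f.Gam_gap] by (simp add: f.Phi_F)
  have gapN: "f.gap n + f.gap N \<le> f.gap (Suc p)"
    using f.gap_add_le[of "Suc p"] f.gap_mono[of "Suc n" N] n by simp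
  have near: "f.Phi (- f.gap (Suc p)) c\<^sub>f \<le> T z \<and> T z \<le> f.Phi (f.gap (Suc p)) c\<^sub>f"
    if "x \<le> z" "z \<le> f.Phi (f.gap N) x" for z
  proof
    have "T x \<le> T z" using that T_less[of z x] by linarith
    moreover have "f.Phi (- f.gap (Suc p)) c\<^sub>f \<le> f.Phi (- f.gap n) c\<^sub>f"
      using gapN f.gap_pos[of N] by (simp add: f.Phi_le_iff)
    ultimately show "f.Phi (- f.gap (Suc p)) c\<^sub>f \<le> T z" using l(1) by (simp add: T_def)
    have "T z \<le> f.Phi (f.gap N) y" unfolding TPhi[symmetric] using that T_less[of "f.Phi (f.gap N) x" z] by linarith
    also have "\<dots> \<le> f.Phi (f.gap N) (f.Phi (f.gap n) c\<^sub>f)"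
      using l(2) by (simp add: f.Phi_mono_le_iff y_def T_def)
    also have "\<dots> = f.Phi (f.gap N + f.gap n) c\<^sub>f" by (simp add: f.Phi_add)
    also have "\<dots> \<le> f.Phi (f.gap (Suc p)) c\<^sub>f" using gapN by (simp add: f.Phi_le_iff)
    finally show "T z \<le> f.Phi (f.gap (Suc p)) c\<^sub>f" .
  qed
  have Ez: "\<bar>f.coord p (T z) - g.coord p (TG (H z))\<bar> \<le> e1" if "x \<le> z" "z \<le> f.Phi (f.gap N) x" for z
    using f.near_dyn[of p "T z"] near[OF that] e1[of p "T z"] e1[of "Suc p" "T z"]
    unfolding mismatch_def HT by auto
  have e1_nonneg: "0 \<le> e1" using Ez[of x] f.arc_order(2)[of x N] by simp
  have y_near: "f.Phi (- f.gap p) c\<^sub>f \<le> y" "y \<le> f.Phi (f.gap p) c\<^sub>f"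
  proof -
    have "f.Phi (- f.gap p) c\<^sub>f \<le> f.Phi (- f.gap (Suc p)) c\<^sub>f" "f.Phi (f.gap (Suc p)) c\<^sub>f \<le> f.Phi (f.gap p) c\<^sub>f"
      using f.gap_Suc_less[of p] by (auto simp: f.Phi_le_iff)
    then show "f.Phi (- f.gap p) c\<^sub>f \<le> y" "y \<le> f.Phi (f.gap p) c\<^sub>f"
      using near[of x] f.arc_order(2)[of x N] unfolding y_def by auto
  qed
  have "\<bar>f.signed_len p\<bar> \<le> (f.real_bound + 1) * f.real_bound * f.r p y" by (rule f.r_near[OF y_near])
  also have "\<dots> \<le> (f.real_bound + 1) * f.real_bound * (f.level_const ^ (N - p) * f.r N y)"
    using f.real_bound_ge_1 f.r_le_power[of p y "N - p"] n by (intro mult_left_mono) auto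
  finally have signed_len_le: "\<bar>f.signed_len p\<bar> \<le> (f.real_bound + 1) * f.real_bound * f.level_const ^ (N - p) * f.r N y" by (simp add: mult_ac)
  have sgn: "0 < g.signed_len p / f.signed_len p"
    using f.signed_len_pos_iff[of p] g.signed_len_pos_iff[of p] f.signed_len_neg_iff[of p] g.signed_len_neg_iff[of p] f.sgap_nonzero[of p]
    by (simp add: zero_less_divide_iff) linarith
  have key: "\<bar>ln ((TG (H v) - TG (H u)) / (T v - T u)) - ln (g.signed_len p / f.signed_len p)\<bar> \<le> 4 * e1 * Z"
    if uv: "x \<le> u" "u < v" "v \<le> f.Phi (f.gap N) x" "\<epsilon> * f.r N x \<le> v - u" for u v
  proof -
    have rx: "0 < f.r N x" "0 < f.r N y" by (rule f.r_pos)+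
    have d: "\<bar>ln (((F ^^ k) v - (F ^^ k) u) / (v - u)) -
        ln (((F ^^ k) (f.Phi (f.gap N) x) - (F ^^ k) x) / (f.Phi (f.gap N) x - x))\<bar> \<le> \<beta>f"
      by (rule \<beta>f(2)[OF k k_away]) (use uv f.arc_order(2)[of x N] in auto)
    have T_diff: "(F ^^ k) v - (F ^^ k) u = T v - T u" by (simp add: T_def)
    have r_y: "(F ^^ k) (f.Phi (f.gap N) x) - (F ^^ k) x = f.r N y"
      using TPhi by (simp add: T_def f.r_def y_def)
    have "ln (f.r N y / f.r N x) - 1 \<le> ln ((T v - T u) / (v - u))"
      using d \<beta>f(1) unfolding T_diff r_y f.r_def[of N x, symmetric] by linarith
    moreover have pos: "0 < (T v - T u) / (v - u)" using uv by (simp add: T_less)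
    ultimately have "exp (ln (f.r N y / f.r N x) - 1) \<le> (T v - T u) / (v - u)"
      using ln_ge_iff by blast
    then have "f.r N y / f.r N x / exp 1 \<le> (T v - T u) / (v - u)"
      using rx by (simp add: exp_diff)
    moreover have "f.r N y / f.r N x / 3 \<le> f.r N y / f.r N x / exp 1"
      using rx exp_le by (intro divide_left_mono) auto
    ultimately have "f.r N y / f.r N x / 3 \<le> (T v - T u) / (v - u)" by linarith
    then have "f.r N y / f.r N x / 3 * (v - u) \<le> T v - T u"
      using uv by (simp add: pos_le_divide_eq)
    moreover have "f.r N y / f.r N x / 3 * (\<epsilon> * f.r N x) \<le> f.r N y / f.r N x / 3 * (v - u)"
      using rx uv by (intro mult_left_mono) auto
    moreover have "f.r N y / f.r N x / 3 * (\<epsilon> * f.r N x) = \<epsilon> * f.r N y / 3" using rx by simp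
    ultimately have Tvu: "\<epsilon> * f.r N y / 3 \<le> T v - T u" by linarith
    define X X' where "X = f.coord p (T v) - f.coord p (T u)" and "X' = g.coord p (TG (H v)) - g.coord p (TG (H u))"
    have X_eq: "X = (T v - T u) / f.signed_len p" and X'_eq: "X' = (TG (H v) - TG (H u)) / g.signed_len p"
      unfolding X_def X'_def f.coord_def g.coord_def by (simp_all flip: diff_divide_distrib)
    have "Z * (\<epsilon> * f.r N y / 3) = (f.real_bound + 1) * f.real_bound * f.level_const ^ (N - p) * f.r N y"
      using \<epsilon> by (simp add: Z_def field_simps)
    then have "\<bar>f.signed_len p\<bar> \<le> Z * (\<epsilon> * f.r N y / 3)" using signed_len_le by linarith
    also have "\<dots> \<le> Z * (T v - T u)" using Tvu Z by (intro mult_left_mono) auto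
    finally have "\<bar>f.signed_len p\<bar> \<le> Z * (T v - T u)" .
    moreover have "\<bar>X\<bar> = (T v - T u) / \<bar>f.signed_len p\<bar>"
      unfolding X_eq using uv T_less[of u v] by (simp add: abs_divide)
    ultimately have "1 \<le> Z * \<bar>X\<bar>" by simp
    then have X0: "0 < \<bar>X\<bar>" using Z by (cases "X = 0") auto
    have "\<bar>X' / X - 1\<bar> = \<bar>X' - X\<bar> / \<bar>X\<bar>" using X0 by (simp add: diff_divide_distrib flip: abs_divide)
    also have "\<dots> \<le> (2 * e1) / \<bar>X\<bar>"
      using Ez[of u] Ez[of v] uv unfolding X_def X'_def by (intro divide_right_mono) auto
    also have "\<dots> \<le> 2 * e1 * Z"
    proof -
      have "2 * e1 * 1 \<le> 2 * e1 * (Z * \<bar>X\<bar>)" using \<open>1 \<le> Z * \<bar>X\<bar>\<close> e1_nonneg by (intro mult_left_mono) auto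
      then show ?thesis using X0 by (simp add: pos_divide_le_eq mult_ac)
    qed
    finally have dev: "\<bar>X' / X - 1\<bar> \<le> 2 * e1 * Z" .
    then have "\<bar>X' / X - 1\<bar> \<le> 1 / 2" using small unfolding Z_def by linarith
    from order_trans[OF abs_ln_le[OF this] mult_left_mono[OF dev]]
    have "\<bar>ln (X' / X)\<bar> \<le> 4 * e1 * Z" by simp
    moreover have "(TG (H v) - TG (H u)) / (T v - T u) = (X' / X) * (g.signed_len p / f.signed_len p)"
      unfolding X_eq X'_eq by simp
    moreover have "0 < X' / X" using \<open>\<bar>X' / X - 1\<bar> \<le> 1 / 2\<close> by linarith
    ultimately show ?thesis using sgn by (simp only: ln_mult_pos)
  qed
  have ln_slope: "ln (slope u v) = ln ((TG (H v) - TG (H u)) / (T v - T u)) +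
      ln (((F ^^ k) v - (F ^^ k) u) / (v - u)) - ln (((G ^^ k) (H v) - (G ^^ k) (H u)) / (H v - H u))"
    if "u < v" for u v
  proof -
    have "0 < T v - T u" "0 < H v - H u" "0 < TG (H v) - TG (H u)" "0 < v - u"
      using that by (simp_all add: T_less H_less TG_def g.iterate_less)
    moreover have "(F ^^ k) v - (F ^^ k) u = T v - T u" "(G ^^ k) (H v) - (G ^^ k) (H u) = TG (H v) - TG (H u)"
      by (simp_all add: T_def TG_def)
    ultimately show ?thesis by (simp add: slope_def ln_div)
  qed
  have f: "\<bar>ln (((F ^^ k) v - (F ^^ k) u) / (v - u)) - ln (((F ^^ k) v' - (F ^^ k) u') / (v' - u'))\<bar> \<le> \<beta>f"
    by (rule \<beta>f(2)[OF k k_away]) (use uv in auto)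
  have HP: "g.Phi (f.gap N) (H x) = H (f.Phi (f.gap N) x)" by (simp add: H_Phi)
  have g: "\<bar>ln (((G ^^ k) (H v) - (G ^^ k) (H u)) / (H v - H u)) -
      ln (((G ^^ k) (H v') - (G ^^ k) (H u')) / (H v' - H u'))\<bar> \<le> \<beta>g"
    by (rule \<beta>g[OF k]) (use uv k_away in \<open>auto simp: HP H_le H_less H_away simp flip: H_funpow\<close>)
  show ?thesis
    using f g key[OF uv(1-3,7)] key[OF uv(4-6,8)]
    unfolding ln_slope[OF uv(2)] ln_slope[OF uv(5)] Z_def[symmetric] by linarith
qed

text \<open>Of the \<open>N\<close> levels a fixed small proportion \<open>w / N\<close> is spent between the size of the arc and
  that of the neighbourhood of the critical point, so that the loss \<open>level_const\<^sup>w\<close> in relative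
  accuracy is outweighed by \<open>\<eta>\<^sup>N\<^sup>-\<^sup>w\<close>.\<close>

lemma slope_decay:
  assumes "0 < \<epsilon>"
  obtains M \<nu> N1 where "0 \<le> M" "0 < \<nu>" "\<nu> < 1"
    "\<And>N x u v u' v'. N1 \<le> N \<Longrightarrow> x \<le> u \<Longrightarrow> u < v \<Longrightarrow> v \<le> f.Phi (f.gap N) x \<Longrightarrow> x \<le> u' \<Longrightarrow> u' < v' \<Longrightarrow>
      v' \<le> f.Phi (f.gap N) x \<Longrightarrow> \<epsilon> * f.r N x \<le> v - u \<Longrightarrow> \<epsilon> * f.r N x \<le> v' - u' \<Longrightarrow>
      \<bar>ln (slope u v) - ln (slope u' v')\<bar> \<le> M * \<nu> ^ N"
proof -
  obtain C1 \<eta> where C1: "0 < C1" "0 < \<eta>" "\<eta> < 1"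
    "\<And>n i x. f.dyn i x \<Longrightarrow> i \<in> {n, Suc n} \<Longrightarrow> mismatch n x \<le> C1 * \<eta> ^ n" using mismatch_decay by blast
  obtain Df Nf where Df: "0 \<le> Df" and Df_dist:
    "\<And>n N x k u v u' v'. Nf \<le> N \<Longrightarrow> n + 3 \<le> N \<Longrightarrow> k \<le> f.q n + f.q (Suc n) \<Longrightarrow>
      (\<And>j. j < k \<Longrightarrow> f.away n ((F ^^ j) x)) \<Longrightarrow> x \<le> u \<Longrightarrow> u < v \<Longrightarrow> v \<le> f.Phi (f.gap N) x \<Longrightarrow>
      x \<le> u' \<Longrightarrow> u' < v' \<Longrightarrow> v' \<le> f.Phi (f.gap N) x \<Longrightarrow>
      \<bar>ln (((F ^^ k) v - (F ^^ k) u) / (v - u)) - ln (((F ^^ k) v' - (F ^^ k) u') / (v' - u'))\<bar>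
        \<le> Df * real (n + 1) * f.\<mu> ^ (N - n)" by (rule f.entry_distortion) blast
  obtain Dg Ng where Dg: "0 \<le> Dg" and Dg_dist:
    "\<And>n N x k u v u' v'. Ng \<le> N \<Longrightarrow> n + 3 \<le> N \<Longrightarrow> k \<le> f.q n + f.q (Suc n) \<Longrightarrow>
      (\<And>j. j < k \<Longrightarrow> g.away n ((G ^^ j) x)) \<Longrightarrow> x \<le> u \<Longrightarrow> u < v \<Longrightarrow> v \<le> g.Phi (f.gap N) x \<Longrightarrow>
      x \<le> u' \<Longrightarrow> u' < v' \<Longrightarrow> v' \<le> g.Phi (f.gap N) x \<Longrightarrow>
      \<bar>ln (((G ^^ k) v - (G ^^ k) u) / (v - u)) - ln (((G ^^ k) v' - (G ^^ k) u') / (v' - u'))\<bar>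
        \<le> Dg * real (n + 1) * g.\<mu> ^ (N - n)" by (rule g.entry_distortion) blast
  define z0 where "z0 = max f.\<mu> g.\<mu>"
  have z0: "0 < z0" "z0 < 1" "f.\<mu> \<le> z0" "g.\<mu> \<le> z0"
    using f.\<mu>_bounds g.\<mu>_bounds by (auto simp: z0_def)
  define z where "z = max (1 / 2) (sqrt z0)"
  have z: "0 < z" "z < 1" "1 / 2 \<le> z" "sqrt z0 \<le> z" using z0 by (auto simp: z_def)
  obtain P' where "\<eta> ^ P' < 1 / (2 * f.level_const)"
    using real_arch_pow_inv[of "1 / (2 * f.level_const)" \<eta>] f.level_const_ge_1 C1 by auto
  then have P': "f.level_const * \<eta> ^ P' \<le> 1 / 2" "0 < P'"
    using f.level_const_ge_1 by (auto simp: field_simps) (cases "P' = 0"; auto simp: field_simps)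
  define P where "P = Suc P'"
  obtain y where y: "0 < y" "y < 1" "\<And>n. z ^ (n div P) \<le> y ^ n / z"
    using div_power_geometric[OF z(1,2), of P] unfolding P_def by blast
  define Z where "Z w = 3 * (f.real_bound + 1) * f.real_bound * f.level_const ^ (w + 2) / \<epsilon>" for w
  define b1 where "b1 = real P / (1 - sqrt z0)"
  define b2 where "b2 = C1 * (3 * (f.real_bound + 1) * f.real_bound * f.level_const\<^sup>2 / \<epsilon>) / \<eta>\<^sup>2"
  have sz: "sqrt z0 < 1" using z0 by simp
  have b1: "0 \<le> b1" unfolding b1_def using sz by simp
  have b2: "0 \<le> b2" unfolding b2_def using C1 f.real_bound_ge_1 f.level_const_ge_1 assms by auto
  define M0 where "M0 = (Df + Dg) * b1 + 8 * b2 + Df * b1 + 2 * b2"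
  have M0: "0 \<le> M0" unfolding M0_def using Df Dg b1 b2 by auto
  have "(\<lambda>N. M0 / z * y ^ N) \<longlonglongrightarrow> M0 / z * 0"
    by (intro tendsto_mult tendsto_const LIMSEQ_power_zero) (use y in auto)
  then have "\<forall>\<^sub>F N in sequentially. M0 / z * y ^ N < 1 / 2" by (intro order_tendstoD(2)) auto
  then obtain N2 where N2: "\<And>N. N2 \<le> N \<Longrightarrow> M0 / z * y ^ N < 1 / 2" by (auto simp: eventually_sequentially)
  define N1 where "N1 = Max {N2, Nf, Ng, 3 * P}"
  show ?thesis
  proof (rule that[of "M0 / z" y N1])
    show "0 \<le> M0 / z" "0 < y" "y < 1" using M0 z y by auto
    fix N x u v u' v'
    assume "N1 \<le> N"
      and uv: "x \<le> u" "u < v" "v \<le> f.Phi (f.gap N) x" "x \<le> u'" "u' < v'" "v' \<le> f.Phi (f.gap N) x"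
        "\<epsilon> * f.r N x \<le> v - u" "\<epsilon> * f.r N x \<le> v' - u'"
    then have N: "N2 \<le> N" "Nf \<le> N" "Ng \<le> N" "3 * P \<le> N" by (auto simp: N1_def)
    define w where "w = N div P"
    define n where "n = N - w"
    define p where "p = n - 2"
    have P2: "2 \<le> P" using P'(2) by (simp add: P_def)
    have w3: "3 \<le> w" unfolding w_def using N(4) P2 by (metis div_le_mono nonzero_mult_div_cancel_right not_numeral_le_zero)
    have wP: "w * P \<le> N" "N < (w + 1) * P"
      unfolding w_def using P2 dividend_less_div_times[of P N] by auto
    have "w * 2 \<le> w * P" using P2 by simp
    then have w2: "2 * w \<le> N" using wP by linarith
    have n: "n = Suc (Suc p)" "n + 3 \<le> N" "N - n = w" "N - p = w + 2"
      using w2 w3 unfolding p_def n_def by auto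
    have lin: "real (n + 1) * m ^ w \<le> b1 * z ^ w" if "0 < m" "m \<le> z0" for m
    proof -
      have "n + 1 \<le> (w + 1) * P" using wP w3 unfolding n_def by linarith
      then have "real (n + 1) \<le> real (w + 1) * real P" by (metis of_nat_le_iff of_nat_mult)
      then have "real (n + 1) * m ^ w \<le> real (w + 1) * real P * z0 ^ w"
        using that by (intro mult_mono power_mono) auto
      also have "\<dots> = real P * (real (w + 1) * z0 ^ w)" by simp
      also have "\<dots> \<le> real P * ((sqrt z0) ^ w / (1 - sqrt z0))"
        by (intro mult_left_mono poly_geometric z0) auto
      also have "\<dots> = b1 * (sqrt z0) ^ w" by (simp add: b1_def)
      also have "\<dots> \<le> b1 * z ^ w" using b1 z z0 by (intro mult_left_mono power_mono) auto
      finally show ?thesis .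
    qed
    have bf: "Df * real (n + 1) * f.\<mu> ^ w \<le> Df * b1 * z ^ w"
      using mult_left_mono[OF lin[OF f.\<mu>_bounds(1) z0(3)] Df] by (simp add: mult_ac)
    have bg: "Dg * real (n + 1) * g.\<mu> ^ w \<le> Dg * b1 * z ^ w"
      using mult_left_mono[OF lin[OF g.\<mu>_bounds(1) z0(4)] Dg] by (simp add: mult_ac)
    have be: "C1 * \<eta> ^ p * Z w \<le> b2 * z ^ w"
    proof -
      have "w * P' \<le> p + 2" using wP n unfolding P_def by auto
      then have "\<eta> ^ (p + 2) \<le> \<eta> ^ (P' * w)" using C1 by (intro power_decreasing) (auto simp: mult.commute)
      then have "f.level_const ^ w * \<eta> ^ (p + 2) \<le> f.level_const ^ w * \<eta> ^ (P' * w)" using f.level_const_ge_1 by (intro mult_left_mono) auto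
      also have "\<dots> = (f.level_const * \<eta> ^ P') ^ w" by (simp add: power_mult_distrib power_mult)
      also have "\<dots> \<le> z ^ w" using P'(1) z f.level_const_ge_1 C1 by (intro power_mono) auto
      finally have "b2 * (f.level_const ^ w * \<eta> ^ (p + 2)) \<le> b2 * z ^ w" using b2 by (intro mult_left_mono) auto
      moreover have "b2 * (f.level_const ^ w * \<eta> ^ (p + 2)) = C1 * \<eta> ^ p * Z w"
        unfolding b2_def Z_def using C1 assms by (simp add: power_add power2_eq_square field_simps)
      ultimately show ?thesis by linarith
    qed
    have zw: "M0 * z ^ w \<le> M0 / z * y ^ N"
      unfolding w_def using mult_left_mono[OF y(3)[of N] M0] by simp
    then have half: "M0 * z ^ w < 1 / 2" using N2[OF N(1)] by linarith
    have parts: "Df * b1 * z ^ w \<le> M0 * z ^ w" "2 * b2 * z ^ w \<le> M0 * z ^ w"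
      "Df * b1 * z ^ w + Dg * b1 * z ^ w + 8 * b2 * z ^ w \<le> M0 * z ^ w"
      unfolding M0_def using Df Dg b1 b2 z by (auto simp: algebra_simps)
    have "\<bar>ln (slope u v) - ln (slope u' v')\<bar> \<le>
      Df * real (n + 1) * f.\<mu> ^ w + Dg * real (n + 1) * g.\<mu> ^ w +
      8 * (C1 * \<eta> ^ p) * (3 * (f.real_bound + 1) * f.real_bound * f.level_const ^ (N - p) / \<epsilon>)"
    proof (rule slope_at_level[OF n(1,2) assms _ _ _ _ _ uv])
      show "Df * real (n + 1) * f.\<mu> ^ w \<le> 1" using bf parts half by linarith
      show "2 * (C1 * \<eta> ^ p) * (3 * (f.real_bound + 1) * f.real_bound * f.level_const ^ (N - p) / \<epsilon>) \<le> 1 / 2"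
        using be parts half unfolding n(4) Z_def[symmetric] by linarith
      show "mismatch p y \<le> C1 * \<eta> ^ p" if "f.dyn i y" "i \<in> {p, Suc p}" for i y
        by (rule C1(4)[OF that])
    qed (use Df_dist[OF N(2) n(2)] Dg_dist[OF N(3) n(2)] in \<open>unfold n(3), blast+\<close>)
    also have "\<dots> \<le> M0 * z ^ w"
      using bf bg be parts unfolding n(4) Z_def[symmetric] by linarith
    finally show "\<bar>ln (slope u v) - ln (slope u' v')\<bar> \<le> M0 / z * y ^ N" using zw by linarith
  qed
qed

end

section \<open>From slopes to a Hoelder derivative\<close>

lemma abs_exp_diff_le:
  fixes x y :: real
  assumes "x \<le> m" "y \<le> m" shows "\<bar>exp x - exp y\<bar> \<le> exp m * \<bar>x - y\<bar>"
proof -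
  have *: "exp y - exp x \<le> exp m * (y - x)" if "x \<le> y" "y \<le> m" for x y :: real
  proof -
    have "1 + (x - y) \<le> exp (x - y)" by (rule exp_ge_add_one_self)
    then have "exp y * (1 + (x - y)) \<le> exp y * exp (x - y)" by (intro mult_left_mono) auto
    also have "exp y * exp (x - y) = exp x" by (simp flip: exp_add)
    finally have "exp y - exp x \<le> exp y * (y - x)" by (simp add: algebra_simps)
    also have "\<dots> \<le> exp m * (y - x)" using that by (intro mult_right_mono) auto
    finally show ?thesis .
  qed
  show ?thesis using *[of x y] *[of y x] assms by (cases "x \<le> y") (auto simp: abs_if)
qed

lemma geometric_cauchy:
  fixes s :: "nat \<Rightarrow> real"
  assumes "0 \<le> b" "b < 1" and step: "\<And>k. \<bar>s (Suc k) - s k\<bar> \<le> A * b ^ k"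
  obtains L where "\<And>k. \<bar>s k - L\<bar> \<le> A * b ^ k / (1 - b)"
proof -
  have bound: "\<bar>s (k + i) - s k\<bar> \<le> A * b ^ k * (1 - b ^ i) / (1 - b)" for k i
  proof (induction i)
    case (Suc i)
    have "\<bar>s (k + Suc i) - s k\<bar> \<le> A * b ^ (k + i) + A * b ^ k * (1 - b ^ i) / (1 - b)"
      using Suc step[of "k + i"] by simp
    also have "\<dots> = A * b ^ k * (1 - b ^ Suc i) / (1 - b)"
      using assms by (simp add: power_add field_simps)
    finally show ?case .
  qed simp
  have A: "0 \<le> A" using step[of 0] by simp
  have bound2: "\<bar>s l - s k\<bar> \<le> A * b ^ k / (1 - b)" if "k \<le> l" for k l
  proof -
    have "A * b ^ k * (1 - b ^ (l - k)) / (1 - b) \<le> A * b ^ k * 1 / (1 - b)"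
      using assms A by (intro divide_right_mono mult_left_mono) auto
    then show ?thesis using bound[of k "l - k"] that by simp
  qed
  have lim: "(\<lambda>k. A * b ^ k / (1 - b)) \<longlonglongrightarrow> A * 0 / (1 - b)"
    by (intro tendsto_intros LIMSEQ_power_zero) (use assms in auto)
  have "Cauchy s"
  proof (rule metric_CauchyI)
    fix e :: real assume "0 < e"
    then have "\<forall>\<^sub>F k in sequentially. A * b ^ k / (1 - b) < e / 2" using lim by (intro order_tendstoD(2)) auto
    then obtain k where k: "A * b ^ k / (1 - b) < e / 2" by (auto simp: eventually_sequentially)
    have "dist (s m) (s n) < e" if "k \<le> m" "k \<le> n" for m n
      using bound2[OF that(1)] bound2[OF that(2)] k unfolding dist_real_def by linarith
    then show "\<exists>M. \<forall>m\<ge>M. \<forall>n\<ge>M. dist (s m) (s n) < e" by blast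
  qed
  then obtain L where L: "s \<longlonglongrightarrow> L" using Cauchy_convergent convergent_def by blast
  have "\<bar>s k - L\<bar> \<le> A * b ^ k / (1 - b)" for k
  proof -
    have "(\<lambda>l. \<bar>s l - s k\<bar>) \<longlonglongrightarrow> \<bar>L - s k\<bar>" by (intro tendsto_intros L)
    then have "\<bar>L - s k\<bar> \<le> A * b ^ k / (1 - b)"
      by (rule LIMSEQ_le_const2) (use bound2 in blast)
    then show ?thesis by (simp add: abs_minus_commute)
  qed
  then show ?thesis using that by blast
qed

text \<open>The logarithms of the slopes over dyadic intervals at \<open>x\<close> form a Cauchy sequence with
  geometric error. Comparing intervals at two nearby points shows that the limit depends on the
  point in a Hoelder continuous way.\<close>

lemma holder_derivative:
  fixes H :: "real \<Rightarrow> real"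
  defines "S \<equiv> \<lambda>u v. (H v - H u) / (v - u)"
  assumes mono: "strict_mono H" and per: "\<And>x. H (x + 1) = H x + 1"
    and r0: "0 < r0" "r0 \<le> 1" and \<alpha>: "0 < \<alpha>" "\<alpha> \<le> 1" and M: "0 \<le> M"
    and close: "\<And>x r u v u' v'. 0 < r \<Longrightarrow> r \<le> r0 \<Longrightarrow> x \<le> u \<Longrightarrow> u < v \<Longrightarrow> v \<le> x + r \<Longrightarrow> x \<le> u' \<Longrightarrow>
      u' < v' \<Longrightarrow> v' \<le> x + r \<Longrightarrow> r / 8 \<le> v - u \<Longrightarrow> r / 8 \<le> v' - u' \<Longrightarrow>
      \<bar>ln (S u v) - ln (S u' v')\<bar> \<le> M * r powr \<alpha>"
  obtains D K where "\<And>x. (H has_real_derivative D x) (at x)" "\<And>x y. \<bar>D x - D y\<bar> \<le> K * \<bar>x - y\<bar> powr \<alpha>"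
proof -
  have H_less: "H x < H y \<longleftrightarrow> x < y" for x y using mono strict_mono_less by blast
  have S_pos: "0 < S u v" if "u < v" for u v using that by (simp add: S_def H_less)
  define b :: real where "b = 2 powr (- \<alpha>)"
  have b: "0 < b" "b < 1" unfolding b_def using \<alpha> by (auto simp: powr_less_one powr_minus inverse_less_1_iff gr_one_powr)
  define M1 where "M1 = M * 2 + M * 2 / (1 - b)"
  have M1: "0 \<le> M1" unfolding M1_def using M b by auto
  have two: "(2 * x) powr \<alpha> \<le> 2 * x powr \<alpha>" if "0 \<le> x" for x :: real
  proof -
    have "(2::real) powr \<alpha> \<le> 2 powr 1" using \<alpha> by (intro powr_mono) auto
    then show ?thesis using that by (simp add: powr_mult mult_right_mono)
  qed
  have "\<exists>L. \<forall>u v r. 0 < r \<longrightarrow> r \<le> r0 \<longrightarrow> x \<le> u \<longrightarrow> u < v \<longrightarrow> v \<le> x + r \<longrightarrow> r / 4 \<le> v - u \<longrightarrow>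
      \<bar>ln (S u v) - L\<bar> \<le> M1 * r powr \<alpha>" for x
  proof -
    define s where "s k = ln (S x (x + r0 / 2 ^ k))" for k :: nat
    have scale: "(r0 / 2 ^ k) powr \<alpha> = r0 powr \<alpha> * b ^ k" for k
      using r0 by (simp add: b_def powr_divide powr_minus powr_power powr_powr field_simps flip: powr_realpow)
    have step: "\<bar>s (Suc k) - s k\<bar> \<le> (M * r0 powr \<alpha>) * b ^ k" for k
    proof -
      have "r0 / 2 ^ k \<le> r0 / 1" using r0 by (intro divide_left_mono) auto
      then have "\<bar>s (Suc k) - s k\<bar> \<le> M * (r0 / 2 ^ k) powr \<alpha>"
        unfolding s_def using r0 by (intro close[of _ x]) (auto simp: field_simps)
      then show ?thesis unfolding scale by simp
    qed
    obtain L where L: "\<And>k. \<bar>s k - L\<bar> \<le> (M * r0 powr \<alpha>) * b ^ k / (1 - b)"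
      using geometric_cauchy[OF less_imp_le[OF b(1)] b(2) step] by blast
    have "\<bar>ln (S u v) - L\<bar> \<le> M1 * r powr \<alpha>"
      if uv: "0 < r" "r \<le> r0" "x \<le> u" "u < v" "v \<le> x + r" "r / 4 \<le> v - u" for u v r
    proof -
      have "\<exists>k. r0 / 2 ^ Suc k < r"
      proof -
        obtain k where "(1 / 2) ^ k < r / r0"
          using real_arch_pow_inv[of "r / r0" "1 / 2 :: real"] uv(1) r0 by auto
        then have "r0 / 2 ^ k < r" using r0 by (simp add: field_simps power_divide)
        moreover have "r0 / 2 ^ Suc k \<le> r0 / 2 ^ k" using r0 by (intro divide_left_mono) auto
        ultimately show ?thesis by (meson le_less_trans)
      qed
      define k where "k = (LEAST k. r0 / 2 ^ Suc k < r)"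
      have k1: "r0 / 2 ^ Suc k < r" unfolding k_def by (rule LeastI_ex) fact
      have k2: "r \<le> r0 / 2 ^ k"
      proof (cases k)
        case (Suc j)
        then show ?thesis using not_less_Least[of j "\<lambda>k. r0 / 2 ^ Suc k < r"] unfolding k_def by force
      qed (use uv in simp)
      define R where "R = r0 / 2 ^ k"
      have R: "0 < R" "R \<le> r0" "r \<le> R" "R \<le> 2 * r"
        using k1 k2 r0 divide_left_mono[of 1 "2 ^ k" r0] unfolding R_def by auto
      have "\<bar>ln (S u v) - s k\<bar> \<le> M * R powr \<alpha>"
        unfolding s_def R_def[symmetric] using uv R by (intro close[of _ x]) auto
      moreover have "\<bar>s k - L\<bar> \<le> M * R powr \<alpha> / (1 - b)"
        using L[of k] unfolding R_def scale by (simp add: mult_ac)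
      moreover have Ra: "R powr \<alpha> \<le> 2 * r powr \<alpha>"
        using powr_mono2[of \<alpha> R "2 * r"] two[of r] R \<alpha> uv by simp
      then have "M * R powr \<alpha> \<le> M * (2 * r powr \<alpha>)" using M by (intro mult_left_mono)
      moreover have "M * R powr \<alpha> / (1 - b) \<le> M * (2 * r powr \<alpha>) / (1 - b)"
        using Ra M b by (intro divide_right_mono mult_left_mono) auto
      ultimately have "\<bar>ln (S u v) - L\<bar> \<le> M * (2 * r powr \<alpha>) + M * (2 * r powr \<alpha>) / (1 - b)" by linarith
      also have "\<dots> = M1 * r powr \<alpha>" by (simp add: M1_def distrib_right)
      finally show ?thesis .
    qed
    then show ?thesis by blast
  qed
  then obtain \<phi> where \<phi>: "\<And>x u v r. 0 < r \<Longrightarrow> r \<le> r0 \<Longrightarrow> x \<le> u \<Longrightarrow> u < v \<Longrightarrow> v \<le> x + r \<Longrightarrow>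
      r / 4 \<le> v - u \<Longrightarrow> \<bar>ln (S u v) - \<phi> x\<bar> \<le> M1 * r powr \<alpha>" by metis
  have \<phi>_holder: "\<bar>\<phi> x - \<phi> y\<bar> \<le> 3 * M1 * (y - x) powr \<alpha>" if "x < y" "y - x \<le> r0 / 2" for x y
  proof -
    define h where "h = y - x"
    have h: "0 < h" "2 * h \<le> r0" using that by (auto simp: h_def)
    have "\<bar>ln (S y (y + h)) - \<phi> x\<bar> \<le> M1 * (2 * h) powr \<alpha>"
      by (rule \<phi>) (use h in \<open>auto simp: h_def\<close>)
    moreover have "M1 * (2 * h) powr \<alpha> \<le> M1 * (2 * h powr \<alpha>)" using M1 h by (intro mult_left_mono two) auto
    moreover have "\<bar>ln (S y (y + h)) - \<phi> y\<bar> \<le> M1 * h powr \<alpha>"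
      by (rule \<phi>) (use h r0 in auto)
    ultimately show ?thesis unfolding h_def by linarith
  qed
  define m where "m = ln (1 / r0) + M1"
  have r0a: "r powr \<alpha> \<le> 1" if "0 < r" "r \<le> r0" for r using that r0 \<alpha> by (intro powr_le1) auto
  have \<phi>_le: "\<phi> x \<le> m" for x
  proof -
    have "H (x + r0) \<le> H (x + 1)" using r0 H_less[of "x + 1" "x + r0"] by linarith
    then have "S x (x + r0) \<le> 1 / r0" using r0 per by (simp add: S_def divide_right_mono)
    then have "ln (S x (x + r0)) \<le> ln (1 / r0)" using S_pos[of x "x + r0"] r0 by simp
    moreover have "\<bar>ln (S x (x + r0)) - \<phi> x\<bar> \<le> M1 * r0 powr \<alpha>" by (rule \<phi>) (use r0 in auto)
    moreover have "M1 * r0 powr \<alpha> \<le> M1 * 1" using M1 r0a r0 by (intro mult_left_mono) auto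
    ultimately show ?thesis unfolding m_def by linarith
  qed
  define D where "D x = exp (\<phi> x)" for x
  define K where "K = exp (m + M1) * (4 * M1)"
  have K: "0 \<le> K" unfolding K_def using M1 by simp
  have D_holder: "\<bar>D x - D y\<bar> \<le> exp (m + M1) * (3 * M1 * (y - x) powr \<alpha>)" if "x < y" "y - x \<le> r0 / 2" for x y
  proof -
    have "\<bar>D x - D y\<bar> \<le> exp (m + M1) * \<bar>\<phi> x - \<phi> y\<bar>"
      unfolding D_def using \<phi>_le[of x] \<phi>_le[of y] M1 by (intro abs_exp_diff_le) auto
    also have "\<dots> \<le> exp (m + M1) * (3 * M1 * (y - x) powr \<alpha>)"
      by (intro mult_left_mono \<phi>_holder that) auto
    finally show ?thesis .
  qed
  have S_close: "\<bar>S x y - D x\<bar> \<le> exp (m + M1) * (M1 * (y - x) powr \<alpha>)" if "x < y" "y - x \<le> r0 / 2" for x y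
  proof -
    have *: "\<bar>ln (S x y) - \<phi> x\<bar> \<le> M1 * (y - x) powr \<alpha>"
      by (rule \<phi>) (use that r0 in auto)
    moreover have "M1 * (y - x) powr \<alpha> \<le> M1 * 1" using M1 that r0 by (intro mult_left_mono r0a) auto
    ultimately have "\<bar>exp (ln (S x y)) - exp (\<phi> x)\<bar> \<le> exp (m + M1) * \<bar>ln (S x y) - \<phi> x\<bar>"
      using \<phi>_le[of x] M1 by (intro abs_exp_diff_le) auto
    also have "\<dots> \<le> exp (m + M1) * (M1 * (y - x) powr \<alpha>)" using * by (intro mult_left_mono) auto
    finally show ?thesis using S_pos[OF that(1)] by (simp add: D_def)
  qed
  have quot: "\<bar>(H y - H x) / (y - x) - D x\<bar> \<le> K * \<bar>y - x\<bar> powr \<alpha>" if "y \<noteq> x" "\<bar>y - x\<bar> \<le> r0 / 2" for x y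
  proof (cases "x < y")
    case True
    then have "\<bar>S x y - D x\<bar> \<le> exp (m + M1) * (M1 * (y - x) powr \<alpha>)" using that by (intro S_close) auto
    also have "\<dots> \<le> exp (m + M1) * (4 * M1 * (y - x) powr \<alpha>)"
      using M1 by (intro mult_left_mono mult_right_mono) auto
    finally show ?thesis using True by (simp add: K_def S_def mult_ac)
  next
    case False
    then have yx: "y < x" "x - y \<le> r0 / 2" using that by auto
    have "(H y - H x) / (y - x) = S y x" using yx by (simp add: S_def divide_simps) (simp add: algebra_simps)
    then have "\<bar>(H y - H x) / (y - x) - D x\<bar> \<le> \<bar>S y x - D y\<bar> + \<bar>D y - D x\<bar>" by linarith
    also have "\<dots> \<le> exp (m + M1) * (M1 * (x - y) powr \<alpha>) + exp (m + M1) * (3 * M1 * (x - y) powr \<alpha>)"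
      by (intro add_mono S_close D_holder yx)
    also have "\<dots> = K * \<bar>y - x\<bar> powr \<alpha>" using yx by (simp add: K_def algebra_simps)
    finally show ?thesis .
  qed
  have deriv: "(H has_real_derivative D x) (at x)" for x
    unfolding has_field_derivative_iff
  proof (rule LIM_zero_cancel, rule Lim_null_comparison)
    have "\<forall>\<^sub>F y in at x. \<bar>y - x\<bar> < r0 / 2"
      using r0 unfolding eventually_at by (intro exI[of _ "r0 / 2"]) (auto simp: dist_real_def)
    moreover have "\<forall>\<^sub>F y in at x. y \<noteq> x" by (rule eventually_neq_at_within)
    ultimately show "\<forall>\<^sub>F y in at x. norm ((H y - H x) / (y - x) - D x) \<le> K * \<bar>y - x\<bar> powr \<alpha>"
      by eventually_elim (use quot in auto)
    have "((\<lambda>y. K * \<bar>y - x\<bar> powr \<alpha>) \<longlongrightarrow> K * \<bar>x - x\<bar> powr \<alpha>) (at x)"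
      by (intro tendsto_mult tendsto_const tendsto_powr' tendsto_intros) (use \<alpha> in auto)
    then show "((\<lambda>y. K * \<bar>y - x\<bar> powr \<alpha>) \<longlongrightarrow> 0) (at x)" using \<alpha> by simp
  qed
  define K' where "K' = K + 2 * exp m / (r0 / 2) powr \<alpha>"
  have holder: "\<bar>D x - D y\<bar> \<le> K' * (y - x) powr \<alpha>" if "x < y" for x y
  proof (cases "y - x \<le> r0 / 2")
    case True
    have "\<bar>D x - D y\<bar> \<le> exp (m + M1) * (3 * M1 * (y - x) powr \<alpha>)" by (rule D_holder[OF that True])
    also have "\<dots> \<le> exp (m + M1) * (4 * M1 * (y - x) powr \<alpha>)"
      using M1 by (intro mult_left_mono mult_right_mono) auto
    also have "\<dots> = K * (y - x) powr \<alpha>" by (simp add: K_def)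
    also have "\<dots> \<le> K' * (y - x) powr \<alpha>" unfolding K'_def using r0 by (intro mult_right_mono) auto
    finally show ?thesis .
  next
    case False
    have D_le: "0 < D z" "D z \<le> exp m" for z unfolding D_def using \<phi>_le by auto
    have "\<bar>D x - D y\<bar> \<le> 2 * exp m" using D_le[of x] D_le[of y] by linarith
    also have "\<dots> \<le> 2 * exp m / (r0 / 2) powr \<alpha> * (y - x) powr \<alpha>"
    proof -
      have "(r0 / 2) powr \<alpha> \<le> (y - x) powr \<alpha>" using False r0 \<alpha> by (intro powr_mono2) auto
      moreover have "0 < (r0 / 2) powr \<alpha>" using r0 by simp
      ultimately have "1 \<le> (y - x) powr \<alpha> / (r0 / 2) powr \<alpha>" by (simp add: pos_le_divide_eq)
      then have "2 * exp m * 1 \<le> 2 * exp m * ((y - x) powr \<alpha> / (r0 / 2) powr \<alpha>)" by (intro mult_left_mono) auto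
      then show ?thesis by simp
    qed
    also have "\<dots> \<le> K' * (y - x) powr \<alpha>" unfolding K'_def using K by (intro mult_right_mono) auto
    finally show ?thesis .
  qed
  have "\<bar>D x - D y\<bar> \<le> K' * \<bar>x - y\<bar> powr \<alpha>" for x y
    using holder[of x y] holder[of y x] \<alpha> by (cases x y rule: linorder_cases) (auto simp: abs_minus_commute)
  then show ?thesis using that deriv by blast
qed

context asymptotic_pair
begin

lemma H_holder_derivative:
  obtains \<alpha> D K where "0 < \<alpha>" "\<And>x. (H has_real_derivative D x) (at x)"
    "\<And>x y. \<bar>D x - D y\<bar> \<le> K * \<bar>x - y\<bar> powr \<alpha>"
proof -
  have level_const: "1 \<le> f.level_const" by (rule f.level_const_ge_1)
  then have eps: "0 < 1 / (8 * f.level_const)" by simp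
  obtain M \<nu> N1 where M: "0 \<le> M" and \<nu>: "0 < \<nu>" "\<nu> < 1" and dec:
    "\<And>N x u v u' v'. N1 \<le> N \<Longrightarrow> x \<le> u \<Longrightarrow> u < v \<Longrightarrow> v \<le> f.Phi (f.gap N) x \<Longrightarrow> x \<le> u' \<Longrightarrow> u' < v' \<Longrightarrow>
      v' \<le> f.Phi (f.gap N) x \<Longrightarrow> 1 / (8 * f.level_const) * f.r N x \<le> v - u \<Longrightarrow> 1 / (8 * f.level_const) * f.r N x \<le> v' - u' \<Longrightarrow>
      \<bar>ln (slope u v) - ln (slope u' v')\<bar> \<le> M * \<nu> ^ N" by (rule slope_decay[OF eps]) blast
  obtain m where m: "0 < m" "\<And>n x. m / f.level_const ^ n \<le> f.r n x" using f.r_lower by blast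
  define c2 where "c2 = max f.level_const 2"
  define \<alpha> where "\<alpha> = min 1 (- ln \<nu> / ln c2)"
  have c2: "f.level_const \<le> c2" "1 < c2" by (auto simp: c2_def)
  have \<alpha>: "0 < \<alpha>" "\<alpha> \<le> 1" using \<nu> c2 unfolding \<alpha>_def by (auto simp: divide_neg_pos)
  have "\<alpha> * ln c2 \<le> - ln \<nu>" using c2 ln_gt_zero[of c2] unfolding \<alpha>_def
    by (metis min.cobounded2 pos_le_divide_eq)
  then have "exp (ln \<nu>) \<le> exp (- (\<alpha> * ln c2))" by simp
  then have \<nu>_le: "\<nu> \<le> c2 powr (- \<alpha>)" using \<nu> c2 by (simp add: powr_def)
  define r0 where "r0 = min 1 (m / f.level_const ^ N1)"
  have r0: "0 < r0" "r0 \<le> 1" using m level_const by (auto simp: r0_def)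
  define M' where "M' = M * (c2 / m) powr \<alpha>"
  have main: "\<bar>ln ((H v - H u) / (v - u)) - ln ((H v' - H u') / (v' - u'))\<bar> \<le> M' * r powr \<alpha>"
    if r: "0 < r" "r \<le> r0" and uv: "x \<le> u" "u < v" "v \<le> x + r" "x \<le> u'" "u' < v'" "v' \<le> x + r"
      "r / 8 \<le> v - u" "r / 8 \<le> v' - u'" for x r u v u' v'
  proof -
    have "\<exists>n. f.r n x < r"
    proof -
      have "(\<lambda>n. f.\<mu> ^ n / f.\<mu>) \<longlonglongrightarrow> 0 / f.\<mu>"
        using f.\<mu>_bounds by (intro tendsto_divide LIMSEQ_power_zero tendsto_const) auto
      then have "\<forall>\<^sub>F n in sequentially. f.\<mu> ^ n / f.\<mu> < r" using r by (intro order_tendstoD(2)) auto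
      then obtain n where "f.\<mu> ^ n / f.\<mu> < r" by (auto simp: eventually_sequentially)
      then show ?thesis using f.r_upper[of n x] by (meson le_less_trans)
    qed
    define n where "n = (LEAST n. f.r n x < r)"
    have n1: "f.r n x < r" unfolding n_def by (rule LeastI_ex) fact
    have "m / f.level_const ^ N1 \<le> f.r N1 x" by (rule m)
    then have "r \<le> f.r N1 x" using r by (simp add: r0_def)
    then have "N1 < n" using n1 f.r_antimono[of n N1 x] by (meson leD le_less_trans not_le order.trans)
    then obtain N where N: "n = Suc N" "N1 \<le> N" by (metis Suc_le_D less_eq_Suc_le Suc_le_mono)
    have "\<not> f.r N x < r" using not_less_Least[of N "\<lambda>n. f.r n x < r"] N unfolding n_def by simp
    then have n2: "x + r \<le> f.Phi (f.gap N) x" by (simp add: f.r_def)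
    have "f.r N x \<le> f.level_const * f.r (Suc N) x" by (rule f.r_le_Suc)
    also have "\<dots> \<le> f.level_const * r" using n1 level_const unfolding N by (intro mult_left_mono) auto
    finally have rN: "1 / (8 * f.level_const) * f.r N x \<le> r / 8" using level_const by (simp add: field_simps)
    have "\<bar>ln (slope u v) - ln (slope u' v')\<bar> \<le> M * \<nu> ^ N"
      by (rule dec[OF N(2)]) (use uv n2 rN in auto)
    also have "\<dots> \<le> M * ((c2 / m) powr \<alpha> * r powr \<alpha>)"
    proof (rule mult_left_mono[OF _ M])
      have "m / c2 ^ Suc N \<le> m / f.level_const ^ Suc N" using c2 level_const m by (intro divide_left_mono power_mono) auto
      also have "\<dots> < r" using m(2)[of "Suc N" x] n1 N by simp
      finally have "1 / c2 ^ N \<le> c2 / m * r" using m c2 by (simp add: field_simps)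
      then have "(1 / c2 ^ N) powr \<alpha> \<le> (c2 / m * r) powr \<alpha>" using \<alpha> c2 by (intro powr_mono2) auto
      moreover have "(1 / c2 ^ N) powr \<alpha> = (c2 powr (- \<alpha>)) ^ N"
        using c2 by (simp add: powr_divide powr_minus powr_powr power_divide field_simps flip: powr_realpow)
      moreover have "\<nu> ^ N \<le> (c2 powr (- \<alpha>)) ^ N" using \<nu> \<nu>_le by (intro power_mono) auto
      moreover have "(c2 / m * r) powr \<alpha> = (c2 / m) powr \<alpha> * r powr \<alpha>"
        by (rule powr_mult)
      ultimately show "\<nu> ^ N \<le> (c2 / m) powr \<alpha> * r powr \<alpha>" by linarith
    qed
    finally show ?thesis by (simp add: slope_def M'_def)
  qed
  obtain D K where "\<And>x. (H has_real_derivative D x) (at x)" "\<And>x y. \<bar>D x - D y\<bar> \<le> K * \<bar>x - y\<bar> powr \<alpha>"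
  proof (rule holder_derivative[OF H_strict_mono H_plus_1 r0 \<alpha>, of M'])
    show "0 \<le> M'" using M by (simp add: M'_def)
  qed (use main in blast)+
  then show ?thesis using that \<alpha> by blast
qed

end

section \<open>Cross-ratio distortion of critical circle maps\<close>

lemma crp_cr: 
  assumes "x1 < x2" "x2 < x3" "x3 < x4" shows "crp x1 x2 x3 x4 = 1 / cr x1 x2 x3 x4 - 1"
proof -
  have "(x3 - x1) * (x4 - x2) - (x2 - x1) * (x4 - x3) = (x3 - x2) * (x4 - x1)" by (simp add: algebra_simps)
  moreover have "1 / cr x1 x2 x3 x4 - 1 =
      ((x3 - x1) * (x4 - x2) - (x2 - x1) * (x4 - x3)) / ((x2 - x1) * (x4 - x3))"
    using assms by (simp add: cr_def diff_divide_distrib)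
  ultimately show ?thesis by (simp add: crp_def)
qed

lemma cr_reflect: "cr (- x4) (- x3) (- x2) (- x1) = cr x1 x2 x3 x4"
  by (simp add: cr_def mult_ac)

lemma crp_reflect: "crp (- x4) (- x3) (- x2) (- x1) = crp x1 x2 x3 x4"
  by (simp add: crp_def mult_ac)

lemma crp_shift: "crp (x1 + m) (x2 + m) (x3 + m) (x4 + m) = crp x1 x2 x3 x4"
  by (simp add: crp_def)

text \<open>That \<open>sinh (p t) / sinh t\<close> is increasing is what makes power maps contract cross-ratios:
  in logarithmic coordinates, the exponential factors of the four differences cancel.\<close>

lemma sinh_ratio_mono:
  fixes p s t :: real
  assumes "1 \<le> p" "0 < s" "s \<le> t"
  shows "sinh (p * s) * sinh t \<le> sinh (p * t) * sinh s"
proof -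
  define k where "k x = p * cosh (p * x) * sinh x - sinh (p * x) * cosh x" for x :: real
  have k_nonneg: "0 \<le> k x" if "0 \<le> x" for x
  proof -
    have "k 0 \<le> k x"
    proof (rule DERIV_nonneg_imp_nondecreasing[OF that])
      fix y assume y: "0 \<le> y" "y \<le> x"
      have "(k has_real_derivative (p\<^sup>2 - 1) * sinh (p * y) * sinh y) (at y)"
        unfolding k_def by (auto intro!: derivative_eq_intros simp: algebra_simps power2_eq_square)
      moreover have "1 \<le> p\<^sup>2" using assms(1) by simp
      then have "0 \<le> (p\<^sup>2 - 1) * sinh (p * y) * sinh y"
        using y assms(1) by (intro mult_nonneg_nonneg) auto
      ultimately show "\<exists>d. (k has_real_derivative d) (at y) \<and> 0 \<le> d" by blast
    qed
    then show ?thesis by (simp add: k_def)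
  qed
  have "sinh (p * s) / sinh s \<le> sinh (p * t) / sinh t"
  proof (rule DERIV_nonneg_imp_nondecreasing[OF assms(3)])
    fix y assume y: "s \<le> y" "y \<le> t"
    then have y0: "0 < y" using assms by linarith
    have "((\<lambda>x. sinh (p * x) / sinh x) has_real_derivative k y / (sinh y)\<^sup>2) (at y)"
      unfolding k_def using y0 by (auto intro!: derivative_eq_intros simp: algebra_simps power2_eq_square)
    moreover have "0 \<le> k y / (sinh y)\<^sup>2" using k_nonneg[of y] y0 by simp
    ultimately show "\<exists>d. ((\<lambda>x. sinh (p * x) / sinh x) has_real_derivative d) (at y) \<and> 0 \<le> d" by blast
  qed
  then show ?thesis using assms by (simp add: field_simps)
qed

lemma exp_diff_sinh: "exp (2 * v) - exp (2 * u) = 2 * exp (u + v) * sinh (v - u)" for u v :: real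
proof -
  have "2 * exp (u + v) * sinh (v - u) = exp (u + v) * exp (v - u) - exp (u + v) * exp (u - v)"
    by (simp add: sinh_def algebra_simps)
  also have "\<dots> = exp (2 * v) - exp (2 * u)" by (simp flip: exp_add)
  finally show ?thesis ..
qed

lemma cr_exp:
  "cr (exp (2 * u1)) (exp (2 * u2)) (exp (2 * u3)) (exp (2 * u4)) =
    (sinh (u2 - u1) * sinh (u4 - u3)) / (sinh (u3 - u1) * sinh (u4 - u2))"
proof -
  have "cr (exp (2 * u1)) (exp (2 * u2)) (exp (2 * u3)) (exp (2 * u4)) =
      ((4 * exp (u1 + u2) * exp (u3 + u4)) * (sinh (u2 - u1) * sinh (u4 - u3))) /
      ((4 * exp (u1 + u2) * exp (u3 + u4)) * (sinh (u3 - u1) * sinh (u4 - u2)))"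
    unfolding cr_def exp_diff_sinh by (simp add: exp_add mult_ac)
  then show ?thesis by (subst (asm) mult_divide_mult_cancel_left) auto
qed

lemma cr_power:
  fixes p y1 :: real
  assumes "1 \<le> p" "0 < y1" "y1 < y2" "y2 < y3" "y3 < y4"
  shows "cr (y1 powr p) (y2 powr p) (y3 powr p) (y4 powr p) \<le> cr y1 y2 y3 y4"
proof -
  define u where "u y = ln y / 2" for y :: real
  have y: "y = exp (2 * u y)" "y powr p = exp (2 * (p * u y))" if "0 < y" for y
    using that by (simp_all add: u_def powr_def)
  define A B C D where "A = u y2 - u y1" and "B = u y4 - u y3" and "C = u y3 - u y1" and "D = u y4 - u y2"
  have ord: "0 < A" "0 < B" "A \<le> C" "B \<le> D" "0 < C" "0 < D"
    using assms unfolding A_def B_def C_def D_def u_def by auto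
  have e: "cr y1 y2 y3 y4 = (sinh A * sinh B) / (sinh C * sinh D)"
    using cr_exp[of "u y1" "u y2" "u y3" "u y4"] y(1)[of y1] y(1)[of y2] y(1)[of y3] y(1)[of y4] assms
    unfolding A_def B_def C_def D_def by simp
  have ep: "cr (y1 powr p) (y2 powr p) (y3 powr p) (y4 powr p) =
      (sinh (p * A) * sinh (p * B)) / (sinh (p * C) * sinh (p * D))"
    using cr_exp[of "p * u y1" "p * u y2" "p * u y3" "p * u y4"] y(2)[of y1] y(2)[of y2] y(2)[of y3] y(2)[of y4] assms
    unfolding A_def B_def C_def D_def by (simp add: right_diff_distrib)
  have "(sinh (p * A) * sinh C) * (sinh (p * B) * sinh D) \<le> (sinh (p * C) * sinh A) * (sinh (p * D) * sinh B)"
    by (rule mult_mono[OF sinh_ratio_mono[OF assms(1) ord(1,3)] sinh_ratio_mono[OF assms(1) ord(2,4)]])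
       (use ord assms(1) in auto)
  moreover have "0 < sinh C * sinh D" "0 < sinh (p * C) * sinh (p * D)" using ord assms(1) by simp_all
  ultimately show ?thesis unfolding e ep by (simp add: frac_le_eq divide_le_eq mult_ac pos_divide_le_eq pos_le_divide_eq)
qed

lemma crp_power:
  fixes p y1 :: real
  assumes "1 \<le> p" "0 < y1" "y1 < y2" "y2 < y3" "y3 < y4"
  shows "crp y1 y2 y3 y4 \<le> crp (y1 powr p) (y2 powr p) (y3 powr p) (y4 powr p)"
proof -
  have P: "y1 powr p < y2 powr p" "y2 powr p < y3 powr p" "y3 powr p < y4 powr p"
    using assms by (auto intro!: powr_less_mono2)
  have "1 / cr y1 y2 y3 y4 \<le> 1 / cr (y1 powr p) (y2 powr p) (y3 powr p) (y4 powr p)"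
    using cr_power[OF assms] cr_pos[OF P] by (intro divide_left_mono) (auto intro!: mult_pos_pos cr_pos assms)
  then show ?thesis using assms P by (simp add: crp_cr)
qed

lemma cr_bilipschitz:
  fixes \<phi> :: "real \<Rightarrow> real"
  assumes x: "x1 < x2" "x2 < x3" "x3 < x4" and "1 \<le> R" "0 < A"
    and bd: "\<And>u v. x1 \<le> u \<Longrightarrow> u < v \<Longrightarrow> v \<le> x4 \<Longrightarrow> A * (v - u) \<le> R * (\<phi> v - \<phi> u) \<and> \<phi> v - \<phi> u \<le> R * (A * (v - u))"
  shows "cr (\<phi> x1) (\<phi> x2) (\<phi> x3) (\<phi> x4) \<le> R ^ 4 * cr x1 x2 x3 x4"
    and "crp x1 x2 x3 x4 \<le> R ^ 4 * crp (\<phi> x1) (\<phi> x2) (\<phi> x3) (\<phi> x4)"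
proof -
  have pos: "0 < \<phi> v - \<phi> u" if "x1 \<le> u" "u < v" "v \<le> x4" for u v
  proof -
    have "0 < A * (v - u)" using that assms(5) by simp
    then have "0 < R * (\<phi> v - \<phi> u)" using bd[OF that] by linarith
    then show ?thesis using assms(4) by (simp add: zero_less_mult_iff)
  qed
  have ratio: "(\<phi> v - \<phi> u) / (\<phi> v' - \<phi> u') \<le> R\<^sup>2 * ((v - u) / (v' - u'))"
    if "x1 \<le> u" "u < v" "v \<le> x4" "x1 \<le> u'" "u' < v'" "v' \<le> x4" for u v u' v'
  proof -
    have "(\<phi> v - \<phi> u) * (A * (v' - u')) \<le> (R * (A * (v - u))) * (R * (\<phi> v' - \<phi> u'))"
      by (rule mult_mono) (use bd[OF that(1-3)] bd[OF that(4-6)] that assms(4,5) in auto)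
    then have "A * ((\<phi> v - \<phi> u) * (v' - u')) \<le> A * (R\<^sup>2 * (v - u) * (\<phi> v' - \<phi> u'))"
      by (simp add: power2_eq_square mult_ac)
    then have "(\<phi> v - \<phi> u) * (v' - u') \<le> R\<^sup>2 * (v - u) * (\<phi> v' - \<phi> u')" using assms(5) by simp
    then show ?thesis using pos[OF that(4-6)] that by (simp add: divide_le_eq pos_le_divide_eq mult_ac)
  qed
  have ratio': "(v - u) / (v' - u') \<le> R\<^sup>2 * ((\<phi> v - \<phi> u) / (\<phi> v' - \<phi> u'))"
    if "x1 \<le> u" "u < v" "v \<le> x4" "x1 \<le> u'" "u' < v'" "v' \<le> x4" for u v u' v'
  proof -
    have "(\<phi> v' - \<phi> u') * (v - u) \<le> R\<^sup>2 * (v' - u') * (\<phi> v - \<phi> u)"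
      using ratio[OF that(4-6) that(1-3)] pos[OF that(1-3)] that by (simp add: divide_simps mult_ac)
    then show ?thesis using pos[OF that(4-6)] that by (simp add: divide_simps mult_ac)
  qed
  have "cr (\<phi> x1) (\<phi> x2) (\<phi> x3) (\<phi> x4) = ((\<phi> x2 - \<phi> x1) / (\<phi> x3 - \<phi> x1)) * ((\<phi> x4 - \<phi> x3) / (\<phi> x4 - \<phi> x2))"
    by (simp add: cr_def)
  also have "\<dots> \<le> (R\<^sup>2 * ((x2 - x1) / (x3 - x1))) * (R\<^sup>2 * ((x4 - x3) / (x4 - x2)))"
    using x assms(4) by (intro mult_mono ratio divide_nonneg_nonneg less_imp_le[OF pos]) auto
  also have "\<dots> = R ^ 4 * cr x1 x2 x3 x4" by (simp add: cr_def power2_eq_square power4_eq_xxxx)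
  finally show "cr (\<phi> x1) (\<phi> x2) (\<phi> x3) (\<phi> x4) \<le> R ^ 4 * cr x1 x2 x3 x4" .
  have "crp x1 x2 x3 x4 = ((x3 - x2) / (x2 - x1)) * ((x4 - x1) / (x4 - x3))" by (simp add: crp_def)
  also have "\<dots> \<le> (R\<^sup>2 * ((\<phi> x3 - \<phi> x2) / (\<phi> x2 - \<phi> x1))) * (R\<^sup>2 * ((\<phi> x4 - \<phi> x1) / (\<phi> x4 - \<phi> x3)))"
    using x assms(4) by (intro mult_mono ratio' mult_nonneg_nonneg divide_nonneg_nonneg less_imp_le[OF pos]) auto
  also have "\<dots> = R ^ 4 * crp (\<phi> x1) (\<phi> x2) (\<phi> x3) (\<phi> x4)" by (simp add: crp_def power2_eq_square power4_eq_xxxx)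
  finally show "crp x1 x2 x3 x4 \<le> R ^ 4 * crp (\<phi> x1) (\<phi> x2) (\<phi> x3) (\<phi> x4)" .
qed

lemma cr_log_lipschitz:
  fixes \<phi> \<phi>' :: "real \<Rightarrow> real"
  assumes x: "x1 < x2" "x2 < x3" "x3 < x4" and L: "0 \<le> L"
    and der: "\<And>x. x1 \<le> x \<Longrightarrow> x \<le> x4 \<Longrightarrow> (\<phi> has_real_derivative \<phi>' x) (at x)"
    and pos: "\<And>x. x1 \<le> x \<Longrightarrow> x \<le> x4 \<Longrightarrow> 0 < \<phi>' x"
    and lip: "\<And>x y. x1 \<le> x \<Longrightarrow> x \<le> y \<Longrightarrow> y \<le> x4 \<Longrightarrow> \<bar>ln (\<phi>' x) - ln (\<phi>' y)\<bar> \<le> L * (y - x)"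
  shows "cr (\<phi> x1) (\<phi> x2) (\<phi> x3) (\<phi> x4) \<le> exp (4 * L * (x4 - x1)) * cr x1 x2 x3 x4"
    and "crp x1 x2 x3 x4 \<le> exp (4 * L * (x4 - x1)) * crp (\<phi> x1) (\<phi> x2) (\<phi> x3) (\<phi> x4)"
proof -
  define R where "R = exp (L * (x4 - x1))"
  have R: "1 \<le> R" unfolding R_def using L x by simp
  have A: "0 < \<phi>' x1" using pos[of x1] x by simp
  have bd: "\<phi>' x1 * (v - u) \<le> R * (\<phi> v - \<phi> u) \<and> \<phi> v - \<phi> u \<le> R * (\<phi>' x1 * (v - u))"
    if uv: "x1 \<le> u" "u < v" "v \<le> x4" for u v
  proof -
    obtain \<xi> where \<xi>: "u < \<xi>" "\<xi> < v" "\<phi> v - \<phi> u = (v - u) * \<phi>' \<xi>"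
      using MVT2[OF uv(2), of \<phi> \<phi>'] der uv by force
    have pos\<xi>: "0 < \<phi>' \<xi>" using pos[of \<xi>] \<xi> uv by simp
    have "\<bar>ln (\<phi>' x1) - ln (\<phi>' \<xi>)\<bar> \<le> L * (\<xi> - x1)" using \<xi> uv by (intro lip) auto
    also have "\<dots> \<le> L * (x4 - x1)" using \<xi> uv L by (intro mult_left_mono) auto
    finally have "ln (\<phi>' x1) \<le> L * (x4 - x1) + ln (\<phi>' \<xi>)" "ln (\<phi>' \<xi>) \<le> L * (x4 - x1) + ln (\<phi>' x1)"
      by linarith+
    then have "exp (ln (\<phi>' x1)) \<le> exp (L * (x4 - x1) + ln (\<phi>' \<xi>))"
      "exp (ln (\<phi>' \<xi>)) \<le> exp (L * (x4 - x1) + ln (\<phi>' x1))" by simp_all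
    then have "\<phi>' x1 \<le> R * \<phi>' \<xi>" "\<phi>' \<xi> \<le> R * \<phi>' x1" using A pos\<xi> by (simp_all add: exp_add R_def)
    then have "(v - u) * \<phi>' x1 \<le> (v - u) * (R * \<phi>' \<xi>)" "(v - u) * \<phi>' \<xi> \<le> (v - u) * (R * \<phi>' x1)"
      using uv by (auto intro!: mult_left_mono)
    then show ?thesis unfolding \<xi>(3) by (simp add: mult_ac)
  qed
  have R4: "R ^ 4 = exp (4 * L * (x4 - x1))" by (simp add: R_def flip: exp_of_nat_mult)
  show "cr (\<phi> x1) (\<phi> x2) (\<phi> x3) (\<phi> x4) \<le> exp (4 * L * (x4 - x1)) * cr x1 x2 x3 x4"
    "crp x1 x2 x3 x4 \<le> exp (4 * L * (x4 - x1)) * crp (\<phi> x1) (\<phi> x2) (\<phi> x3) (\<phi> x4)"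
    using cr_bilipschitz[OF x R A bd] unfolding R4 by auto
qed

lemma cr_power_log_lipschitz:
  fixes \<psi> \<psi>' N :: "real \<Rightarrow> real"
  assumes x: "x1 < x2" "x2 < x3" "x3 < x4" and L: "0 \<le> L" and p: "1 \<le> p"
    and der: "\<And>x. x1 \<le> x \<Longrightarrow> x \<le> x4 \<Longrightarrow> (\<psi> has_real_derivative \<psi>' x) (at x)"
    and pos: "\<And>x. x1 \<le> x \<Longrightarrow> x \<le> x4 \<Longrightarrow> 0 < \<psi>' x"
    and lip: "\<And>x y. x1 \<le> x \<Longrightarrow> x \<le> y \<Longrightarrow> y \<le> x4 \<Longrightarrow> \<bar>ln (\<psi>' x) - ln (\<psi>' y)\<bar> \<le> L * (y - x)"
    and \<psi>_pos: "0 < \<psi> x1" and N: "\<And>x. x1 \<le> x \<Longrightarrow> x \<le> x4 \<Longrightarrow> N x = \<psi> x powr p + b"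
  shows "cr (N x1) (N x2) (N x3) (N x4) \<le> exp (4 * L * (x4 - x1)) * cr x1 x2 x3 x4"
    and "crp x1 x2 x3 x4 \<le> exp (4 * L * (x4 - x1)) * crp (N x1) (N x2) (N x3) (N x4)"
proof -
  have inc: "\<psi> u < \<psi> v" if "x1 \<le> u" "u < v" "v \<le> x4" for u v
  proof (rule DERIV_pos_imp_increasing[OF that(2)])
    fix x assume "u \<le> x" "x \<le> v"
    then show "\<exists>y. (\<psi> has_real_derivative y) (at x) \<and> 0 < y" using der[of x] pos[of x] that by auto
  qed
  have ord: "0 < \<psi> x1" "\<psi> x1 < \<psi> x2" "\<psi> x2 < \<psi> x3" "\<psi> x3 < \<psi> x4"
    using x \<psi>_pos by (auto intro!: inc)
  have N_eq: "N x1 = \<psi> x1 powr p + b" "N x2 = \<psi> x2 powr p + b" "N x3 = \<psi> x3 powr p + b" "N x4 = \<psi> x4 powr p + b"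
    using x N[of x1] N[of x2] N[of x3] N[of x4] by simp_all
  have pw: "cr (N x1) (N x2) (N x3) (N x4) \<le> cr (\<psi> x1) (\<psi> x2) (\<psi> x3) (\<psi> x4)"
    "crp (\<psi> x1) (\<psi> x2) (\<psi> x3) (\<psi> x4) \<le> crp (N x1) (N x2) (N x3) (N x4)"
    unfolding N_eq cr_shift crp_shift by (rule cr_power[OF p ord], rule crp_power[OF p ord])
  note lips = cr_log_lipschitz[OF x L der pos lip]
  show "cr (N x1) (N x2) (N x3) (N x4) \<le> exp (4 * L * (x4 - x1)) * cr x1 x2 x3 x4"
    using pw(1) lips(1) by linarith
  have "exp (4 * L * (x4 - x1)) * crp (\<psi> x1) (\<psi> x2) (\<psi> x3) (\<psi> x4) \<le> exp (4 * L * (x4 - x1)) * crp (N x1) (N x2) (N x3) (N x4)"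
    using pw(2) by (intro mult_left_mono) auto
  then show "crp x1 x2 x3 x4 \<le> exp (4 * L * (x4 - x1)) * crp (N x1) (N x2) (N x3) (N x4)"
    using lips(2) by linarith
qed

text \<open>A critical circle map with explicit constants: in the power-law neighbourhood of
  radius \<open>d\<close> bounds for the coordinate \<open>\<phi>\<close>, and at distance at least \<open>d / 2\<close> bounds for the map itself.
  The two regions overlap, so that a short interval lies in one of them.\<close>

locale critical_profile =
  fixes F F' \<phi> \<phi>' :: "real \<Rightarrow> real" and c p a0 d m1 M1 L m2 M2 L2 :: real
  assumes p: "1 < p" and d: "0 < d" "d \<le> 1 / 4" and m1: "0 < m1" and L: "0 \<le> L"
    and \<phi>_deriv: "x \<in> {c - d..c + d} \<Longrightarrow> (\<phi> has_real_derivative \<phi>' x) (at x)"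
    and \<phi>'_bounds: "x \<in> {c - d..c + d} \<Longrightarrow> m1 \<le> \<phi>' x" "x \<in> {c - d..c + d} \<Longrightarrow> \<phi>' x \<le> M1"
    and \<phi>'_lip: "x \<in> {c - d..c + d} \<Longrightarrow> y \<in> {c - d..c + d} \<Longrightarrow> x \<le> y \<Longrightarrow>
      \<bar>ln (\<phi>' x) - ln (\<phi>' y)\<bar> \<le> L * (y - x)"
    and \<phi>_c: "\<phi> c = 0"
    and F_form: "x \<in> {c - d..c + d} \<Longrightarrow> F x = \<phi> x * \<bar>\<phi> x\<bar> powr (p - 1) + a0"
    and F_periodic: "F (x + 1) = F x + 1"
    and F_der: "(F has_real_derivative F' x) (at x)"
    and F'_c: "F' c = 0"
    and m2: "0 < m2" and L2: "0 \<le> L2"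
    and far_bounds: "d / 2 \<le> cdist c x \<Longrightarrow> m2 \<le> F' x" "d / 2 \<le> cdist c x \<Longrightarrow> F' x \<le> M2"
    and far_lip: "x \<le> y \<Longrightarrow> (\<And>z. x \<le> z \<Longrightarrow> z \<le> y \<Longrightarrow> d / 2 \<le> cdist c z) \<Longrightarrow>
      \<bar>ln (F' x) - ln (F' y)\<bar> \<le> L2 * (y - x)"
begin

lemma M1_pos: "0 < M1"
  using \<phi>'_bounds[of c] m1 d by auto

lemma F_plus_int: "F (x + of_int k) = F x + of_int k"
  by (rule integer_shift[of F, OF F_periodic])

lemma F'_plus_int: "F' (x + of_int k) = F' x"
proof -
  have "((\<lambda>x. F (x + of_int k)) has_real_derivative F' (x + of_int k)) (at x)"
    using F_der[of "x + of_int k"] by (simp add: DERIV_shift)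
  moreover have "((\<lambda>x. F (x + of_int k)) has_real_derivative F' x) (at x)"
    unfolding F_plus_int by (auto intro!: derivative_eq_intros F_der)
  ultimately show ?thesis by (rule DERIV_unique)
qed

lemma \<phi>_growth:
  assumes "c - d \<le> x" "x < y" "y \<le> c + d"
  shows "m1 * (y - x) \<le> \<phi> y - \<phi> x" "\<phi> y - \<phi> x \<le> M1 * (y - x)"
proof -
  obtain \<xi> where \<xi>: "x < \<xi>" "\<xi> < y" "\<phi> y - \<phi> x = (y - x) * \<phi>' \<xi>"
    using MVT2[OF assms(2), of \<phi> \<phi>'] \<phi>_deriv assms by force
  have "m1 \<le> \<phi>' \<xi>" "\<phi>' \<xi> \<le> M1" using \<phi>'_bounds[of \<xi>] \<xi> assms by auto
  then show "m1 * (y - x) \<le> \<phi> y - \<phi> x" "\<phi> y - \<phi> x \<le> M1 * (y - x)"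
    unfolding \<xi>(3) using assms by (auto simp: mult.commute intro!: mult_left_mono)
qed

lemma \<phi>_size:
  assumes "\<bar>x - c\<bar> \<le> d"
  shows "m1 * \<bar>x - c\<bar> \<le> \<bar>\<phi> x\<bar>" "\<bar>\<phi> x\<bar> \<le> M1 * \<bar>x - c\<bar>"
    "c < x \<Longrightarrow> 0 < \<phi> x" "x < c \<Longrightarrow> \<phi> x < 0"
proof -
  have r: "m1 * (x - c) \<le> \<phi> x" "\<phi> x \<le> M1 * (x - c)" if "c < x"
    using \<phi>_growth[of c x] that assms \<phi>_c by auto
  have l: "m1 * (c - x) \<le> - \<phi> x" "- \<phi> x \<le> M1 * (c - x)" if "x < c"
    using \<phi>_growth[of x c] that assms \<phi>_c by auto
  show p: "c < x \<Longrightarrow> 0 < \<phi> x" using r(1) m1 by (meson diff_gt_0_iff_gt less_le_trans mult_pos_pos)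
  show n: "x < c \<Longrightarrow> \<phi> x < 0" using l(1) m1
    by (metis diff_gt_0_iff_gt less_le_trans mult_pos_pos neg_0_less_iff_less)
  show "m1 * \<bar>x - c\<bar> \<le> \<bar>\<phi> x\<bar>" "\<bar>\<phi> x\<bar> \<le> M1 * \<bar>x - c\<bar>"
    using r l p n \<phi>_c by (cases x c rule: linorder_cases; simp)+
qed

lemma F_right: "c < x \<Longrightarrow> x \<le> c + d \<Longrightarrow> F x = \<phi> x powr p + a0"
  using F_form[of x] \<phi>_size(3)[of x] d powr_mult_base[of "\<phi> x" "p - 1"] by auto

lemma F_left: "x < c \<Longrightarrow> c - d \<le> x \<Longrightarrow> F x = - ((- \<phi> x) powr p) + a0"
  using F_form[of x] \<phi>_size(4)[of x] d powr_mult_base[of "- \<phi> x" "p - 1"] by auto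

lemma F'_near:
  assumes "\<bar>x - c\<bar> < d" shows "F' x = p * \<bar>\<phi> x\<bar> powr (p - 1) * \<phi>' x"
proof -
  have x_in: "x \<in> {c - d..c + d}" using assms by auto
  consider "x = c" | "c < x" | "x < c" by linarith
  then show ?thesis
  proof cases
    case 1
    then show ?thesis using F'_c \<phi>_c by simp
  next
    case 2
    have pos: "0 < \<phi> x" using \<phi>_size(3)[of x] assms 2 by simp
    have "((\<lambda>z. \<phi> z powr p + a0) has_real_derivative p * \<phi> x powr (p - 1) * \<phi>' x) (at x)"
      using DERIV_add[OF DERIV_fun_powr[OF \<phi>_deriv[OF x_in] pos, of p] DERIV_const[of a0]] by simp
    then have "(F has_real_derivative p * \<phi> x powr (p - 1) * \<phi>' x) (at x)"
      by (rule has_field_derivative_transform_within_open[of _ _ _ "{c<..<c + d}"]) (use 2 assms F_right in auto)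
    then show ?thesis using DERIV_unique[OF F_der[of x]] pos by simp
  next
    case 3
    have pos: "0 < - \<phi> x" using \<phi>_size(4)[of x] assms 3 by simp
    have "((\<lambda>z. - ((- \<phi> z) powr p) + a0) has_real_derivative - (p * (- \<phi> x) powr (p - 1) * (- \<phi>' x)) + 0) (at x)"
      using DERIV_fun_powr[OF DERIV_minus[OF \<phi>_deriv[OF x_in]] pos, of p]
      by (intro DERIV_add DERIV_minus DERIV_const) simp
    then have "(F has_real_derivative - (p * (- \<phi> x) powr (p - 1) * (- \<phi>' x)) + 0) (at x)"
      by (rule has_field_derivative_transform_within_open[of _ _ _ "{c - d<..<c}"]) (use 3 assms F_left in auto)
    then show ?thesis using DERIV_unique[OF F_der[of x]] pos by simp
  qed
qed

definition expo :: real where "expo = p - 1"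

definition prof_const :: real
  where "prof_const = 1 + 1 / (m1 powr expo * m1) + 1 / m2 + p * M1 powr expo * M1 + M2 / (d / 2) powr expo + 4 * L + 4 * L2 +
    expo * (M1 / m1) + L + L2"

lemma expo_pos: "0 < expo" using p by (simp add: expo_def)

lemma M2_pos: "0 < M2"
proof -
  have "cdist c (c + d) = d" using cdist_near[of "c + d" c 0] d by simp
  then show ?thesis using far_bounds[of "c + d"] m2 d by simp
qed

lemma prof_const_terms: "1 \<le> prof_const" "1 / (m1 powr expo * m1) \<le> prof_const" "1 / m2 \<le> prof_const" "p * M1 powr expo * M1 \<le> prof_const"
  "M2 / (d / 2) powr expo \<le> prof_const" "4 * L \<le> prof_const" "4 * L2 \<le> prof_const" "expo * (M1 / m1) + L \<le> prof_const" "L2 \<le> prof_const"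
proof -
  have "0 \<le> 1 / (m1 powr expo * m1)" "0 \<le> 1 / m2" "0 \<le> p * M1 powr expo * M1" "0 \<le> M2 / (d / 2) powr expo"
    "0 \<le> expo * (M1 / m1)"
    using m1 m2 p M1_pos M2_pos expo_pos by auto
  then show "1 \<le> prof_const" "1 / (m1 powr expo * m1) \<le> prof_const" "1 / m2 \<le> prof_const" "p * M1 powr expo * M1 \<le> prof_const"
    "M2 / (d / 2) powr expo \<le> prof_const" "4 * L \<le> prof_const" "4 * L2 \<le> prof_const" "expo * (M1 / m1) + L \<le> prof_const" "L2 \<le> prof_const"
    using L L2 unfolding prof_const_def by linarith+
qed

lemma shift_near:
  assumes "cdist c x < d"
  obtains k :: int where "\<bar>(x + of_int k) - c\<bar> = cdist c x" "\<bar>(x + of_int k) - c\<bar> < d"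
proof -
  obtain k :: int where "cdist c x = \<bar>x - (c + of_int k)\<bar>" by (rule cdist_eq)
  then show ?thesis using that[of "- k"] assms by (simp add: algebra_simps)
qed

lemma F'_lower: "cdist c x powr expo \<le> prof_const * F' x" and F'_upper: "F' x \<le> prof_const * cdist c x powr expo"
proof -
  have "cdist c x powr expo \<le> prof_const * F' x \<and> F' x \<le> prof_const * cdist c x powr expo"
  proof (cases "cdist c x < d")
    case True
    then obtain k :: int where k: "\<bar>(x + of_int k) - c\<bar> = cdist c x" "\<bar>(x + of_int k) - c\<bar> < d"
      by (rule shift_near)
    define y where "y = x + of_int k"
    define D where "D = cdist c x"
    have D: "0 \<le> D" unfolding D_def by (rule cdist_nonneg)
    have F'y: "F' x = p * \<bar>\<phi> y\<bar> powr expo * \<phi>' y"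
      using F'_near[of y] k F'_plus_int[of x k] unfolding y_def expo_def by simp
    have sz: "m1 * D \<le> \<bar>\<phi> y\<bar>" "\<bar>\<phi> y\<bar> \<le> M1 * D"
      using \<phi>_size(1,2)[of y] k unfolding y_def D_def by auto
    have "y \<in> {c - d..c + d}" using k(2) unfolding y_def atLeastAtMost_iff by linarith
    then have b: "m1 \<le> \<phi>' y" "\<phi>' y \<le> M1" using \<phi>'_bounds by auto
    have "(m1 * D) powr expo \<le> \<bar>\<phi> y\<bar> powr expo" "\<bar>\<phi> y\<bar> powr expo \<le> (M1 * D) powr expo"
      using sz D m1 expo_pos by (auto intro!: powr_mono2)
    then have pw: "m1 powr expo * D powr expo \<le> \<bar>\<phi> y\<bar> powr expo" "\<bar>\<phi> y\<bar> powr expo \<le> M1 powr expo * D powr expo"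
      using D m1 M1_pos by (simp_all add: powr_mult)
    have "1 * (m1 powr expo * D powr expo) * m1 \<le> p * \<bar>\<phi> y\<bar> powr expo * \<phi>' y"
      using pw b p m1 by (intro mult_mono) auto
    then have "D powr expo \<le> 1 / (m1 powr expo * m1) * F' x" using m1 unfolding F'y by (simp add: field_simps)
    also have "\<dots> \<le> prof_const * F' x"
      using F'y p b m1 by (intro mult_right_mono prof_const_terms) auto
    finally have lower: "D powr expo \<le> prof_const * F' x" .
    have "F' x \<le> p * (M1 powr expo * D powr expo) * M1"
      unfolding F'y using pw b p m1 by (intro mult_mono) auto
    also have "\<dots> = (p * M1 powr expo * M1) * D powr expo" by simp
    also have "\<dots> \<le> prof_const * D powr expo" by (intro mult_right_mono prof_const_terms) auto
    finally show ?thesis using lower unfolding D_def by simp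
  next
    case False
    then have far: "d / 2 \<le> cdist c x" using d by simp
    have b: "m2 \<le> F' x" "F' x \<le> M2" using far_bounds[OF far] by auto
    have "cdist c x powr expo \<le> 1" using cdist_le_half[of c x] cdist_nonneg[of c x] expo_pos by (intro powr_le1) auto
    also have "1 \<le> 1 / m2 * F' x" using b m2 by simp
    also have "\<dots> \<le> prof_const * F' x" using b m2 by (intro mult_right_mono prof_const_terms) auto
    finally have lower: "cdist c x powr expo \<le> prof_const * F' x" .
    have "(d / 2) powr expo \<le> cdist c x powr expo" using far d expo_pos by (intro powr_mono2) auto
    moreover have "0 < (d / 2) powr expo" using d by simp
    ultimately have "M2 * 1 \<le> M2 * (cdist c x powr expo / (d / 2) powr expo)"
      using M2_pos by (intro mult_left_mono) (auto simp: pos_le_divide_eq)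
    then have "F' x \<le> M2 / (d / 2) powr expo * cdist c x powr expo" using b by simp
    also have "\<dots> \<le> prof_const * cdist c x powr expo" by (intro mult_right_mono prof_const_terms) auto
    finally show ?thesis using lower by simp
  qed
  then show "cdist c x powr expo \<le> prof_const * F' x" "F' x \<le> prof_const * cdist c x powr expo" by auto
qed

lemma near_or_far:
  assumes "x \<le> y" "y - x \<le> d / 2" "crit_free c x y"
  obtains k :: int where "c < x + of_int k" "y + of_int k < c + d"
  | k :: int where "c - d < x + of_int k" "y + of_int k < c"
  | "\<And>z. x \<le> z \<Longrightarrow> z \<le> y \<Longrightarrow> d / 2 \<le> cdist c z"
proof (cases "\<forall>z. x \<le> z \<and> z \<le> y \<longrightarrow> d / 2 \<le> cdist c z")
  case False
  then obtain z where z: "x \<le> z" "z \<le> y" "cdist c z < d / 2" by auto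
  obtain k :: int where k: "cdist c z = \<bar>z - (c + of_int k)\<bar>" by (rule cdist_eq)
  have nk: "c + of_int k < x \<or> y < c + of_int k" using assms(3) unfolding crit_free_def atLeastAtMost_iff by (meson not_le)
  then show ?thesis
  proof
    assume "c + of_int k < x"
    then show ?thesis using that(1)[of "- k"] k z assms by simp
  next
    assume "y < c + of_int k"
    then show ?thesis using that(2)[of "- k"] k z assms by simp
  qed
qed (use that(3) in blast)

lemma cross_ratio:
  assumes x: "x1 < x2" "x2 < x3" "x3 < x4" and short: "x4 - x1 \<le> d / 2" and free: "crit_free c x1 x4"
  shows "cr (F x1) (F x2) (F x3) (F x4) \<le> exp (prof_const * (x4 - x1)) * cr x1 x2 x3 x4"
    and "crp x1 x2 x3 x4 \<le> exp (prof_const * (x4 - x1)) * crp (F x1) (F x2) (F x3) (F x4)"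
proof -
  define T where "T = x4 - x1"
  have T: "0 < T" using x by (simp add: T_def)
  have cr0: "0 < cr x1 x2 x3 x4" by (rule cr_pos[OF x])
  have enough: "cr (F x1) (F x2) (F x3) (F x4) \<le> exp (prof_const * T) * cr x1 x2 x3 x4 \<and>
      crp x1 x2 x3 x4 \<le> exp (prof_const * T) * crp (F x1) (F x2) (F x3) (F x4)"
    if "cr (F x1) (F x2) (F x3) (F x4) \<le> exp (4 * L' * T) * cr x1 x2 x3 x4"
      "crp x1 x2 x3 x4 \<le> exp (4 * L' * T) * crp (F x1) (F x2) (F x3) (F x4)" "4 * L' \<le> prof_const" for L'
  proof -
    have e: "exp (4 * L' * T) \<le> exp (prof_const * T)" using that(3) T by simp
    have "0 < crp x1 x2 x3 x4" by (rule crp_pos[OF x])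
    then have "0 < exp (4 * L' * T) * crp (F x1) (F x2) (F x3) (F x4)" using that(2) by linarith
    then have "0 < crp (F x1) (F x2) (F x3) (F x4)" by (simp add: zero_less_mult_iff)
    then show ?thesis
      using that(1,2) mult_right_mono[OF e, of "cr x1 x2 x3 x4"] mult_right_mono[OF e, of "crp (F x1) (F x2) (F x3) (F x4)"] cr0
      by linarith
  qed
  have "cr (F x1) (F x2) (F x3) (F x4) \<le> exp (prof_const * T) * cr x1 x2 x3 x4 \<and>
      crp x1 x2 x3 x4 \<le> exp (prof_const * T) * crp (F x1) (F x2) (F x3) (F x4)"
  proof (rule near_or_far[of x1 x4])
    fix k :: int assume k: "c < x1 + of_int k" "x4 + of_int k < c + d"
    have inside: "x + of_int k \<in> {c - d..c + d}" if "x1 \<le> x" "x \<le> x4" for x using k that d by auto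
    have form: "F x = \<phi> (x + of_int k) powr p + (a0 - of_int k)" if "x1 \<le> x" "x \<le> x4" for x
      using F_right[of "x + of_int k"] F_plus_int[of x k] k that by simp
    have der: "((\<lambda>x. \<phi> (x + of_int k)) has_real_derivative \<phi>' (x + of_int k)) (at x)" if "x1 \<le> x" "x \<le> x4" for x
      using \<phi>_deriv[OF inside[OF that]] by (simp add: DERIV_shift)
    have pos: "0 < \<phi>' (x + of_int k)" if "x1 \<le> x" "x \<le> x4" for x
      using \<phi>'_bounds(1)[OF inside[OF that]] m1 by linarith
    have lip: "\<bar>ln (\<phi>' (x + of_int k)) - ln (\<phi>' (y + of_int k))\<bar> \<le> L * (y - x)" if "x1 \<le> x" "x \<le> y" "y \<le> x4" for x y
      using \<phi>'_lip[OF inside inside, of x y] that by simp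
    have start: "0 < \<phi> (x1 + of_int k)" using \<phi>_size(3)[of "x1 + of_int k"] k x by auto
    show ?thesis
      by (rule enough[of L]) (unfold T_def,
          (rule cr_power_log_lipschitz[OF x L less_imp_le[OF p] der pos lip start form]; assumption)+, rule prof_const_terms)
  next
    \<comment> \<open>on the left the power map is reflected in both coordinates\<close>
    fix k :: int assume k: "c - d < x1 + of_int k" "x4 + of_int k < c"
    have inside: "- x + of_int k \<in> {c - d..c + d}" if "- x4 \<le> x" "x \<le> - x1" for x using k that d by auto
    have form: "- F (- x) = (- \<phi> (- x + of_int k)) powr p + (of_int k - a0)" if "- x4 \<le> x" "x \<le> - x1" for x
      using F_left[of "- x + of_int k"] F_plus_int[of "- x" k] k that by simp
    have der: "((\<lambda>x. - \<phi> (- x + of_int k)) has_real_derivative \<phi>' (- x + of_int k)) (at x)" if "- x4 \<le> x" "x \<le> - x1" for x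
    proof -
      have "((\<lambda>x. - x + of_int k) has_real_derivative -1) (at x)" by (auto intro!: derivative_eq_intros)
      from DERIV_minus[OF DERIV_chain2[OF \<phi>_deriv[OF inside[OF that]] this]] show ?thesis by simp
    qed
    have pos: "0 < \<phi>' (- x + of_int k)" if "- x4 \<le> x" "x \<le> - x1" for x
      using \<phi>'_bounds(1)[OF inside[OF that]] m1 by linarith
    have lip: "\<bar>ln (\<phi>' (- x + of_int k)) - ln (\<phi>' (- y + of_int k))\<bar> \<le> L * (y - x)"
      if "- x4 \<le> x" "x \<le> y" "y \<le> - x1" for x y
      using \<phi>'_lip[OF inside inside, of y x] that by (simp add: abs_minus_commute)
    have start: "0 < - \<phi> (- (- x4) + of_int k)" using \<phi>_size(4)[of "x4 + of_int k"] k x by auto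
    have rx: "- x4 < - x3" "- x3 < - x2" "- x2 < - x1" using x by auto
    note refl = cr_power_log_lipschitz[OF rx L less_imp_le[OF p] der pos lip start form]
    show ?thesis
    proof (rule enough[of L])
      show "cr (F x1) (F x2) (F x3) (F x4) \<le> exp (4 * L * T) * cr x1 x2 x3 x4"
        "crp x1 x2 x3 x4 \<le> exp (4 * L * T) * crp (F x1) (F x2) (F x3) (F x4)"
        using refl by (simp_all add: cr_reflect crp_reflect T_def)
    qed (rule prof_const_terms)
  next
    assume far: "\<And>z. x1 \<le> z \<Longrightarrow> z \<le> x4 \<Longrightarrow> d / 2 \<le> cdist c z"
    show ?thesis
    proof (rule enough[of L2])
      show "cr (F x1) (F x2) (F x3) (F x4) \<le> exp (4 * L2 * T) * cr x1 x2 x3 x4"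
        "crp x1 x2 x3 x4 \<le> exp (4 * L2 * T) * crp (F x1) (F x2) (F x3) (F x4)"
        unfolding T_def
        by (auto intro!: cr_log_lipschitz[OF x L2, where \<phi>' = F'] F_der far_lip far less_le_trans[OF m2 far_bounds(1)])
    qed (rule prof_const_terms)
  qed (use x short free in auto)
  then show "cr (F x1) (F x2) (F x3) (F x4) \<le> exp (prof_const * (x4 - x1)) * cr x1 x2 x3 x4"
    "crp x1 x2 x3 x4 \<le> exp (prof_const * (x4 - x1)) * crp (F x1) (F x2) (F x3) (F x4)"
    by (auto simp: T_def)
qed

lemma abs_ln_diff_le:
  fixes u v :: real
  assumes "0 < w" "w \<le> u" "w \<le> v" shows "\<bar>ln u - ln v\<bar> \<le> \<bar>u - v\<bar> / w"
proof -
  have *: "ln v - ln u \<le> (v - u) / w" if "w \<le> u" "u \<le> v" for u v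
  proof -
    have "ln (v / u) \<le> v / u - 1" using that assms(1) by (intro ln_le_minus_one) auto
    then have "ln v - ln u \<le> (v - u) / u" using that assms(1) by (simp add: ln_div diff_divide_distrib)
    also have "\<dots> \<le> (v - u) / w" using that assms(1) by (intro divide_left_mono) auto
    finally show ?thesis .
  qed
  show ?thesis using *[of u v] *[of v u] assms by (cases "u \<le> v") (auto simp: abs_if)
qed

lemma distortion:
  assumes "x \<le> y" "y - x \<le> d / 2" "crit_free c x y" "0 < m" "m \<le> cdist c x" "m \<le> cdist c y"
  shows "\<bar>ln (F' x) - ln (F' y)\<bar> \<le> prof_const * (y - x) / m"
proof -
  have m_half: "m \<le> 1" using assms(5) cdist_le_half[of c x] by linarith
  have near: ?thesis
    if k: "c - d < x + of_int k" "y + of_int k < c + d" "c < x + of_int k \<or> y + of_int k < c" for k :: int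
  proof -
    define u v where "u = x + of_int k" and "v = y + of_int k"
    have uv: "u \<le> v" "\<bar>u - c\<bar> < d" "\<bar>v - c\<bar> < d" "v - u = y - x"
      using k assms(1) unfolding u_def v_def by auto
    have mu: "m \<le> \<bar>u - c\<bar>" "m \<le> \<bar>v - c\<bar>"
      using assms(5,6) cdist_le[of c x "- k"] cdist_le[of c y "- k"] unfolding u_def v_def by (auto simp: algebra_simps)
    have "m1 * m \<le> m1 * \<bar>u - c\<bar>" "m1 * m \<le> m1 * \<bar>v - c\<bar>" using mu m1 by auto
    then have lowb: "m1 * m \<le> \<bar>\<phi> u\<bar>" "m1 * m \<le> \<bar>\<phi> v\<bar>" using \<phi>_size(1)[of u] \<phi>_size(1)[of v] uv by auto
    have w: "0 < m1 * m" using m1 assms(4) by simp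
    have sub: "\<bar>\<bar>\<phi> u\<bar> - \<bar>\<phi> v\<bar>\<bar> \<le> M1 * (v - u)"
    proof (cases "u = v")
      case False
      then show ?thesis using \<phi>_growth[of u v] uv m1 by (smt (verit) mult_pos_pos)
    qed simp
    have "\<bar>ln \<bar>\<phi> u\<bar> - ln \<bar>\<phi> v\<bar>\<bar> \<le> \<bar>\<bar>\<phi> u\<bar> - \<bar>\<phi> v\<bar>\<bar> / (m1 * m)" by (rule abs_ln_diff_le[OF w lowb])
    also have "\<dots> \<le> M1 * (v - u) / (m1 * m)" using sub w by (intro divide_right_mono) auto
    finally have l1: "\<bar>ln \<bar>\<phi> u\<bar> - ln \<bar>\<phi> v\<bar>\<bar> \<le> M1 / m1 * ((v - u) / m)" by simp
    have "\<bar>ln (\<phi>' u) - ln (\<phi>' v)\<bar> \<le> L * (v - u)" using uv by (intro \<phi>'_lip) auto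
    also have "\<dots> \<le> L * ((v - u) / m)"
    proof (rule mult_left_mono[OF _ L])
      have "(v - u) * m \<le> (v - u) * 1" using uv m_half by (intro mult_left_mono) auto
      then show "v - u \<le> (v - u) / m" using assms(4) by (simp add: pos_le_divide_eq)
    qed
    finally have l2: "\<bar>ln (\<phi>' u) - ln (\<phi>' v)\<bar> \<le> L * ((v - u) / m)" .
    have lnF': "ln (F' z) = ln p + expo * ln \<bar>\<phi> z\<bar> + ln (\<phi>' z)" if "\<bar>z - c\<bar> < d" "m1 * m \<le> \<bar>\<phi> z\<bar>" for z
    proof -
      have "0 < \<phi>' z" using \<phi>'_bounds(1)[of z] m1 that(1) by (auto simp: abs_less_iff)
      moreover have "0 < \<bar>\<phi> z\<bar>" using that(2) w by linarith
      ultimately show ?thesis unfolding F'_near[OF that(1)] using p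
        by (simp add: ln_mult ln_powr expo_def)
    qed
    have "F' x = F' u" "F' y = F' v" unfolding u_def v_def F'_plus_int by simp_all
    then have "ln (F' x) - ln (F' y) = expo * (ln \<bar>\<phi> u\<bar> - ln \<bar>\<phi> v\<bar>) + (ln (\<phi>' u) - ln (\<phi>' v))"
      using lnF'[OF uv(2) lowb(1)] lnF'[OF uv(3) lowb(2)] by (simp add: algebra_simps)
    also have "\<bar>\<dots>\<bar> \<le> expo * \<bar>ln \<bar>\<phi> u\<bar> - ln \<bar>\<phi> v\<bar>\<bar> + \<bar>ln (\<phi>' u) - ln (\<phi>' v)\<bar>"
      using expo_pos by (metis abs_mult abs_of_pos abs_triangle_ineq)
    also have "\<dots> \<le> expo * (M1 / m1 * ((v - u) / m)) + L * ((v - u) / m)"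
      using l1 l2 expo_pos by (intro add_mono mult_left_mono) auto
    also have "\<dots> = (expo * (M1 / m1) + L) * ((v - u) / m)" by (simp add: algebra_simps)
    also have "\<dots> \<le> prof_const * ((v - u) / m)" using uv assms(4) by (intro mult_right_mono prof_const_terms) auto
    finally show ?thesis unfolding uv(4) by simp
  qed
  show ?thesis
  proof (rule near_or_far[OF assms(1-3)])
    fix k :: int assume "c < x + of_int k" "y + of_int k < c + d"
    then show ?thesis using near[of k] d by auto
  next
    fix k :: int assume "c - d < x + of_int k" "y + of_int k < c"
    then show ?thesis using near[of k] d by auto
  next
    assume "\<And>z. x \<le> z \<Longrightarrow> z \<le> y \<Longrightarrow> d / 2 \<le> cdist c z"
    then have "\<bar>ln (F' x) - ln (F' y)\<bar> \<le> L2 * (y - x)" by (rule far_lip[OF assms(1)])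
    also have "\<dots> \<le> prof_const * (y - x)" using assms(1) by (intro mult_right_mono prof_const_terms) auto
    also have "\<dots> \<le> prof_const * (y - x) / m"
    proof -
      have "prof_const * (y - x) * m \<le> prof_const * (y - x) * 1" using assms(1) m_half prof_const_terms(1) by (intro mult_left_mono) auto
      then show ?thesis using assms(4) by (simp add: pos_le_divide_eq)
    qed
    finally show ?thesis .
  qed
qed

end

section \<open>Extracting the distortion bounds from smoothness\<close>

lemma C_diff_on_3:
  assumes "C_diff_on 3 F S" "x \<in> S"
  shows "(F has_real_derivative deriv F x) (at x)"
    and "(deriv F has_real_derivative deriv (deriv F) x) (at x)"
    and "isCont (deriv (deriv F)) x"
proof -
  have d: "(deriv ^^ j) F field_differentiable at x" if "j < 3" for j
    using assms that unfolding C_diff_on_def by auto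
  show "(F has_real_derivative deriv F x) (at x)"
    using d[of 0] by (simp add: DERIV_deriv_iff_field_differentiable)
  show "(deriv F has_real_derivative deriv (deriv F) x) (at x)"
    using d[of 1] by (simp add: DERIV_deriv_iff_field_differentiable)
  show "isCont (deriv (deriv F)) x"
    using d[of 2] by (simp add: numeral_2_eq_2 field_differentiable_imp_continuous_at)
qed

lemma ln_deriv_lipschitz:
  fixes \<psi> \<psi>' :: "real \<Rightarrow> real"
  assumes "x \<le> y" "0 < m"
    and "\<And>z. x \<le> z \<Longrightarrow> z \<le> y \<Longrightarrow> (\<psi> has_real_derivative \<psi>' z) (at z) \<and> m \<le> \<psi> z \<and> \<bar>\<psi>' z\<bar> \<le> M"
  shows "\<bar>ln (\<psi> x) - ln (\<psi> y)\<bar> \<le> M / m * (y - x)"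
proof (cases "x = y")
  case False
  then have xy: "x < y" using assms by simp
  have der: "((\<lambda>z. ln (\<psi> z)) has_real_derivative \<psi>' z / \<psi> z) (at z)" if "x \<le> z" "z \<le> y" for z
    using assms(3)[OF that] assms(2) by (auto intro!: derivative_eq_intros)
  obtain \<xi> where \<xi>: "x < \<xi>" "\<xi> < y" "ln (\<psi> y) - ln (\<psi> x) = (y - x) * (\<psi>' \<xi> / \<psi> \<xi>)"
    using MVT2[OF xy der] by blast
  have b: "m \<le> \<psi> \<xi>" "\<bar>\<psi>' \<xi>\<bar> \<le> M" using assms(3)[of \<xi>] \<xi> by auto
  have "\<bar>ln (\<psi> x) - ln (\<psi> y)\<bar> = (y - x) * (\<bar>\<psi>' \<xi>\<bar> / \<psi> \<xi>)"
    using \<xi> b assms(2) xy by (simp add: abs_minus_commute[of "ln (\<psi> x)"] abs_mult abs_divide)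
  also have "\<dots> \<le> (y - x) * (M / m)" using b assms(2) xy by (intro mult_left_mono frac_le) auto
  finally show ?thesis by (simp add: mult.commute)
qed simp

lemma compact_bounds:
  fixes \<psi> :: "real \<Rightarrow> real"
  assumes "l \<le> u" "\<And>z. z \<in> {l..u} \<Longrightarrow> isCont \<psi> z"
  obtains m M where "m \<in> \<psi> ` {l..u}" "\<And>z. z \<in> {l..u} \<Longrightarrow> m \<le> \<psi> z" "\<And>z. z \<in> {l..u} \<Longrightarrow> \<psi> z \<le> M"
    "\<And>z. z \<in> {l..u} \<Longrightarrow> \<bar>\<psi> z\<bar> \<le> max \<bar>m\<bar> \<bar>M\<bar>"
proof -
  have c: "continuous_on {l..u} \<psi>" using assms(2) by (simp add: continuous_at_imp_continuous_on)
  obtain x1 where x1: "x1 \<in> {l..u}" "\<And>z. z \<in> {l..u} \<Longrightarrow> \<psi> x1 \<le> \<psi> z"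
    using continuous_attains_inf[OF compact_Icc _ c] assms(1) by force
  obtain x2 where x2: "\<And>z. z \<in> {l..u} \<Longrightarrow> \<psi> z \<le> \<psi> x2"
    using continuous_attains_sup[OF compact_Icc _ c] assms(1) by force
  have "\<bar>\<psi> z\<bar> \<le> max \<bar>\<psi> x1\<bar> \<bar>\<psi> x2\<bar>" if "z \<in> {l..u}" for z
    using x1(2)[OF that] x2[OF that] by (auto simp: abs_if max_def)
  then show ?thesis using that[of "\<psi> x1" "\<psi> x2"] x1 x2 by blast
qed

lemma critical_profile_exists:
  assumes F: "C_diff_on 3 F UNIV" "strict_mono F" "\<And>x. F (x + 1) = F x + 1"
    and F': "\<And>x. deriv F x = 0 \<longleftrightarrow> (\<exists>k::int. x = c + of_int k)"
    and p: "1 < p" and \<delta>: "0 < \<delta>" and \<phi>: "C_diff_on 3 \<phi> {c - \<delta><..<c + \<delta>}" "\<phi> c = 0"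
    and form: "\<And>x. x \<in> {c - \<delta><..<c + \<delta>} \<Longrightarrow> deriv \<phi> x \<noteq> 0 \<and> F x = \<phi> x * \<bar>\<phi> x\<bar> powr (p - 1) + a0"
  obtains d m1 M1 L m2 M2 L2 where "critical_profile F (deriv F) \<phi> (deriv \<phi>) c p a0 d m1 M1 L m2 M2 L2"
proof -
  define d where "d = min (\<delta> / 2) (1 / 4)"
  have d: "0 < d" "d \<le> 1 / 4" "d < \<delta>" using \<delta> by (auto simp: d_def)
  have in_\<delta>: "x \<in> {c - \<delta><..<c + \<delta>}" if "x \<in> {c - d..c + d}" for x using that d by auto
  note \<phi>D = C_diff_on_3[OF \<phi>(1) in_\<delta>]
  note FD = C_diff_on_3[OF F(1) UNIV_I]
  have \<phi>'_cont: "isCont (deriv \<phi>) x" if "x \<in> {c - d..c + d}" for x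
    using \<phi>D(2)[OF that] by (rule DERIV_isCont)
  have F_less: "F x < F y" if "x < y" for x y using F(2) that by (simp add: strict_monoD)
  obtain \<xi> where \<xi>: "c < \<xi>" "\<xi> < c + d" "\<phi> (c + d) - \<phi> c = ((c + d) - c) * deriv \<phi> \<xi>"
  proof -
    have "c < c + d" using d by simp
    then show ?thesis using MVT2[of c "c + d" \<phi> "deriv \<phi>"] \<phi>D(1) d that by auto
  qed
  have "\<phi> (c + d) * \<bar>\<phi> (c + d)\<bar> powr (p - 1) > 0"
    using F_less[of c "c + d"] form[of c] form[of "c + d"] \<phi>(2) d by auto
  then have "0 < \<phi> (c + d)" by (simp add: zero_less_mult_iff)
  then have \<xi>_pos: "0 < deriv \<phi> \<xi>" using \<xi>(3) \<phi>(2) d by (simp add: zero_less_mult_iff)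
  have \<phi>'_pos: "0 < deriv \<phi> x" if x: "x \<in> {c - d..c + d}" for x
  proof (rule ccontr)
    assume "\<not> 0 < deriv \<phi> x"
    then have neg: "deriv \<phi> x \<le> 0" by simp
    have "continuous_on {c - d..c + d} (deriv \<phi>)" using \<phi>'_cont by (simp add: continuous_at_imp_continuous_on)
    then have "connected (deriv \<phi> ` {c - d..c + d})" by (rule connected_continuous_image) simp
    then have "0 \<in> deriv \<phi> ` {c - d..c + d}"
    proof (rule connectedD_interval)
      show "deriv \<phi> x \<in> deriv \<phi> ` {c - d..c + d}" using x by blast
      show "deriv \<phi> \<xi> \<in> deriv \<phi> ` {c - d..c + d}" using \<xi> d by auto
    qed (use neg \<xi>_pos in auto)
    then obtain z where "z \<in> {c - d..c + d}" "deriv \<phi> z = 0" by auto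
    then show False using form in_\<delta> by blast
  qed
  obtain m1 M1 where m1: "m1 \<in> deriv \<phi> ` {c - d..c + d}"
    "\<And>z. z \<in> {c - d..c + d} \<Longrightarrow> m1 \<le> deriv \<phi> z" "\<And>z. z \<in> {c - d..c + d} \<Longrightarrow> deriv \<phi> z \<le> M1"
  proof (rule compact_bounds[of "c - d" "c + d" "deriv \<phi>"])
    show "c - d \<le> c + d" using d by simp
    show "isCont (deriv \<phi>) z" if "z \<in> {c - d..c + d}" for z by (rule \<phi>'_cont[OF that])
  qed (use that in blast)
  have m1_pos: "0 < m1" using m1(1) \<phi>'_pos by auto
  obtain M3 where M3: "\<And>z. z \<in> {c - d..c + d} \<Longrightarrow> \<bar>deriv (deriv \<phi>) z\<bar> \<le> M3"
  proof (rule compact_bounds[of "c - d" "c + d" "deriv (deriv \<phi>)"])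
    show "c - d \<le> c + d" using d by simp
    show "isCont (deriv (deriv \<phi>)) z" if "z \<in> {c - d..c + d}" for z by (rule \<phi>D(3)[OF that])
  qed (use that in blast)
  have M3_nonneg: "0 \<le> M3" using M3[of c] d by force
  define l u where "l = c + d / 2" and "u = c + 1 - d / 2"
  have lu: "l \<le> u" using d by (simp add: l_def u_def)
  have F'_cont: "isCont (deriv F) x" for x using FD(2) by (rule DERIV_isCont)
  have F'_nonneg: "0 \<le> deriv F x" for x
    by (rule mono_on_imp_deriv_nonneg[of UNIV F, OF _ FD(1)])
       (use strict_mono_mono[OF F(2)] in auto)
  have F'_pos: "0 < deriv F x" if "x \<in> {l..u}" for x
  proof -
    have "x \<noteq> c + of_int k" for k :: int
    proof
      assume "x = c + of_int k"
      then have "0 < (of_int k :: real)" "of_int k < (1 :: real)" using that d by (auto simp: l_def u_def)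
      then show False by simp
    qed
    then show ?thesis using F'[of x] F'_nonneg[of x] by (auto simp: less_le)
  qed
  obtain m2 M2 where m2: "m2 \<in> deriv F ` {l..u}" "\<And>z. z \<in> {l..u} \<Longrightarrow> m2 \<le> deriv F z"
    "\<And>z. z \<in> {l..u} \<Longrightarrow> deriv F z \<le> M2"
    by (rule compact_bounds[OF lu F'_cont]) (rule that)
  have m2_pos: "0 < m2" using m2(1) F'_pos by auto
  obtain M4 where M4: "\<And>z. z \<in> {l..u} \<Longrightarrow> \<bar>deriv (deriv F) z\<bar> \<le> M4"
    by (rule compact_bounds[OF lu FD(3)]) (rule that)
  have M4_nonneg: "0 \<le> M4" using M4[of l] lu by force
  have F_int: "F (x + of_int k) = F x + of_int k" for x k by (rule integer_shift[of F, OF F(3)])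
  have F'_int: "deriv F (x + of_int k) = deriv F x" for x k
  proof -
    have "((\<lambda>x. F (x + of_int k)) has_real_derivative deriv F (x + of_int k)) (at x)"
      using FD(1)[of "x + of_int k"] by (simp add: DERIV_shift)
    moreover have "((\<lambda>x. F (x + of_int k)) has_real_derivative deriv F x) (at x)"
      unfolding F_int by (auto intro!: derivative_eq_intros FD(1))
    ultimately show ?thesis by (rule DERIV_unique)
  qed
  have far: "x + of_int (- \<lfloor>x - c\<rfloor>) \<in> {l..u}" if "d / 2 \<le> cdist c x" for x
  proof -
    have "d / 2 \<le> \<bar>x - c - of_int \<lfloor>x - c\<rfloor>\<bar>" "d / 2 \<le> \<bar>x - c - of_int (\<lfloor>x - c\<rfloor> + 1)\<bar>"
      using that cdist_le order_trans by blast+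
    moreover have "of_int \<lfloor>x - c\<rfloor> \<le> x - c" "x - c < of_int \<lfloor>x - c\<rfloor> + 1" by linarith+
    ultimately show ?thesis unfolding l_def u_def by (simp add: abs_if split: if_splits)
  qed
  show ?thesis
  proof (rule that, unfold_locales)
    show "1 < p" "0 < d" "d \<le> 1 / 4" "0 < m1" "\<phi> c = 0" "0 < m2" by fact+
    show "0 \<le> M3 / m1" "0 \<le> M4 / m2" using M3_nonneg m1_pos M4_nonneg m2_pos by auto
    show "(\<phi> has_real_derivative deriv \<phi> x) (at x)" if "x \<in> {c - d..c + d}" for x by (rule \<phi>D(1)[OF that])
    show "m1 \<le> deriv \<phi> x" "deriv \<phi> x \<le> M1" if "x \<in> {c - d..c + d}" for x using m1 that by auto
    show "\<bar>ln (deriv \<phi> x) - ln (deriv \<phi> y)\<bar> \<le> M3 / m1 * (y - x)"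
      if "x \<in> {c - d..c + d}" "y \<in> {c - d..c + d}" "x \<le> y" for x y
      using that m1(2) m1_pos M3 by (intro ln_deriv_lipschitz[of _ _ _ _ "deriv (deriv \<phi>)"] conjI \<phi>D(2)) auto
    show "F x = \<phi> x * \<bar>\<phi> x\<bar> powr (p - 1) + a0" if "x \<in> {c - d..c + d}" for x using form in_\<delta> that by blast
    show "F (x + 1) = F x + 1" for x by (rule F(3))
    show "(F has_real_derivative deriv F x) (at x)" for x by (rule FD(1))
    show "deriv F c = 0" using F'[of c] by (auto intro: exI[of _ 0])
    show "m2 \<le> deriv F x" "deriv F x \<le> M2" if "d / 2 \<le> cdist c x" for x
      using m2(2,3)[OF far[OF that]] unfolding F'_int by auto
    show "\<bar>ln (deriv F x) - ln (deriv F y)\<bar> \<le> M4 / m2 * (y - x)"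
      if xy: "x \<le> y" and away: "\<And>z. x \<le> z \<Longrightarrow> z \<le> y \<Longrightarrow> d / 2 \<le> cdist c z" for x y
    proof -
      define k where "k = - \<lfloor>x - c\<rfloor>"
      have x: "x + of_int k \<in> {l..u}" unfolding k_def by (rule far[OF away]) (use xy in auto)
      have "y + of_int k < c + 1"
      proof (rule ccontr)
        assume "\<not> y + of_int k < c + 1"
        then have "d / 2 \<le> cdist c (c + of_int (1 - k))"
          using x d by (intro away) (auto simp: u_def)
        moreover have "cdist c (c + of_int (1 - k)) \<le> 0" using cdist_le[of c "c + of_int (1 - k)" "1 - k"] by simp
        ultimately show False using d by simp
      qed
      moreover have "d / 2 \<le> \<bar>y - c - of_int (1 - k)\<bar>" using away[of y] xy cdist_le[of c y "1 - k"] by simp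
      ultimately have y: "y + of_int k \<le> u" unfolding u_def by simp
      have "\<bar>ln (deriv F (x + of_int k)) - ln (deriv F (y + of_int k))\<bar> \<le> M4 / m2 * ((y + of_int k) - (x + of_int k))"
      proof (rule ln_deriv_lipschitz[of _ _ _ _ "deriv (deriv F)"])
        fix z assume "x + of_int k \<le> z" "z \<le> y + of_int k"
        then have "z \<in> {l..u}" using x y by auto
        then show "(deriv F has_real_derivative deriv (deriv F) z) (at z) \<and> m2 \<le> deriv F z \<and> \<bar>deriv (deriv F) z\<bar> \<le> M4"
          using FD(2) m2(2) M4 by blast
      qed (use xy m2_pos in auto)
      then show ?thesis unfolding F'_int by simp
    qed
  qed
qed

lemma critical_lift_exists:
  assumes "circle_lift a \<rho> F" "critical_profile F F' \<phi> \<phi>' c p a0 d m1 M1 L m2 M2 L2" "\<And>n. a n \<le> B"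
  obtains K e \<delta> where "critical_lift a \<rho> F F' c K e \<delta> B"
proof -
  interpret circle_lift a \<rho> F by fact
  interpret P: critical_profile F F' \<phi> \<phi>' c p a0 d m1 M1 L m2 M2 L2 by fact
  have "critical_lift a \<rho> F F' c P.prof_const P.expo (d / 2) B"
  proof unfold_locales
    show "(F has_real_derivative F' x) (at x)" for x by (rule P.F_der)
    show "1 \<le> P.prof_const" "0 < P.expo" "0 < d / 2" using P.prof_const_terms P.expo_pos P.d by auto
  qed (use P.F'_lower P.F'_upper P.cross_ratio P.distortion assms(3) in auto)
  then show ?thesis using that by blast
qed

section \<open>Lifts of circle maps\<close>

lemma proj_plus_int [simp]: "proj (x + of_int k) = proj x"
  by (simp add: proj_eq_iff)

lemma proj_eqE:
  assumes "proj x = proj y" obtains k :: int where "x = y + of_int k"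
proof -
  from assms obtain k :: int where "x - y = of_int k" by (auto simp: proj_eq_iff elim: Ints_cases)
  then show ?thesis using that[of k] by simp
qed

lemma proj_rep: "proj (rep_circle u) = u"
  by (rule Quotient_abs_rep [OF Quotient_circle])

lemma proj_cont: "continuous_on UNIV proj"
  by (simp add: continuous_on_open_vimage open_circle_def)

lemma int_valued_constant:
  fixes D :: "real \<Rightarrow> real"
  assumes "continuous_on UNIV D" "\<And>x. D x \<in> \<int>"
  obtains k :: int where "\<And>x. D x = of_int k"
proof -
  have "D constant_on UNIV"
  proof (rule continuous_discrete_range_constant[OF _ assms(1)])
    fix x :: real
    have "1 \<le> norm (D y - D x)" if "D y \<noteq> D x" for y
      using assms(2)[of x] assms(2)[of y] that by (auto elim!: Ints_cases)
    then show "\<exists>e>0. \<forall>y. y \<in> UNIV \<and> D y \<noteq> D x \<longrightarrow> e \<le> norm (D y - D x)" by (intro exI[of _ 1]) auto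
  qed simp
  then obtain v where v: "\<And>x. D x = v" by (auto simp: constant_on_def)
  then obtain k :: int where "v = of_int k" using assms(2)[of 0] by (auto elim: Ints_cases)
  then show ?thesis using that v by blast
qed

lemma lift_cont: "is_lift F f \<Longrightarrow> continuous_on UNIV F"
  by (simp add: is_lift_def)

lemma lift_proj: "is_lift F f \<Longrightarrow> proj (F x) = f (proj x)"
  by (simp add: is_lift_def)

lemma lift_unique:
  assumes "is_lift F f" "is_lift G f" obtains k :: int where "\<And>x. G x = F x + of_int k"
proof -
  have "G x - F x \<in> \<int>" for x
    using lift_proj[OF assms(1), of x] lift_proj[OF assms(2), of x] by (metis proj_eq_iff)
  then obtain k :: int where "\<And>x. G x - F x = of_int k"
    using int_valued_constant[of "\<lambda>x. G x - F x"] assms by (metis continuous_on_diff lift_cont)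
  then show ?thesis using that[of k] by (metis add.commute diff_add_cancel)
qed

lemma lift_shift:
  assumes "is_lift F f" shows "is_lift (\<lambda>x. F (x + 1)) f" "is_lift (\<lambda>x. F x + of_int k) f"
proof -
  have "continuous_on UNIV (\<lambda>x. F (x + 1))"
    by (intro continuous_on_compose2[OF lift_cont[OF assms]] continuous_intros) auto
  then show "is_lift (\<lambda>x. F (x + 1)) f"
    using lift_proj[OF assms] proj_plus_int[of _ 1] by (simp add: is_lift_def)
  show "is_lift (\<lambda>x. F x + of_int k) f"
    using assms by (auto simp: is_lift_def intro!: continuous_intros)
qed

lemma lift_comp:
  assumes "is_lift F f" "is_lift G g" shows "is_lift (\<lambda>x. G (F x)) (g \<circ> f)"
  using assms continuous_on_compose2[OF lift_cont[OF assms(2)] lift_cont[OF assms(1)]]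
  by (auto simp: is_lift_def)

lemma lift_funpow:
  assumes "is_lift F f" shows "proj ((F ^^ k) x) = (f ^^ k) (proj x)"
  by (induction k) (auto simp: lift_proj[OF assms])

text \<open>Injectivity on the circle forces the lift to be injective, hence monotone, and excludes
  a translation of its values by more than one unit over a period.\<close>

lemma lift_monotone:
  assumes "is_lift F f" "inj f"
  shows "(strict_mono F \<and> (\<forall>x. F (x + 1) = F x + 1)) \<or> ((\<forall>x y. x < y \<longrightarrow> F y < F x) \<and> (\<forall>x. F (x + 1) = F x - 1))"
proof -
  obtain d :: int where d: "\<And>x. F (x + 1) = F x + of_int d"
    using lift_unique[OF assms(1) lift_shift(1)[OF assms(1)]] by blast
  have dn: "F (x + real n) = F x + real n * of_int d" for x n
  proof (induction n)
    case (Suc n)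
    have "F (x + real (Suc n)) = F ((x + real n) + 1)" by (simp add: algebra_simps)
    then show ?case unfolding d Suc by (simp add: algebra_simps)
  qed simp
  have close: "\<exists>k::int. x = y + of_int k" if "F x - F y \<in> \<int>" for x y
  proof -
    have "proj (F x) = proj (F y)" using that by (simp add: proj_eq_iff)
    then have "proj x = proj y" using lift_proj[OF assms(1)] assms(2) by (simp add: inj_eq)
    then show ?thesis by (metis proj_eqE)
  qed
  have no_int: False if xy: "F x - F y \<in> \<int>" "y < x" "x < y + 1" for x y
  proof -
    obtain k :: int where "x = y + of_int k" using close[OF xy(1)] by blast
    then have "0 < (of_int k :: real)" "of_int k < (1 :: real)" using xy by auto
    then show False by simp
  qed
  have cont: "continuous_on S F" for S using lift_cont[OF assms(1)] continuous_on_subset by blast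
  have hits: "\<exists>z\<in>{x..y}. F z = v" if "x \<le> y" "(F x \<le> v \<and> v \<le> F y) \<or> (F y \<le> v \<and> v \<le> F x)" for x y v
    using that IVT'[of F x v y] IVT2'[of F y v x] cont by (metis atLeastAtMost_iff)
  have "d \<noteq> 0"
  proof
    assume "d = 0"
    then have F1: "F 1 = F 0" using d[of 0] by simp
    define v where "v = (F 0 + F (1 / 2)) / 2"
    have ne: "F (1 / 2) \<noteq> F 0" using no_int[of "1 / 2" 0] by auto
    have v: "(F 0 \<le> v \<and> v \<le> F (1 / 2)) \<or> (F (1 / 2) \<le> v \<and> v \<le> F 0)" unfolding v_def by (cases "F 0 \<le> F (1 / 2)") (auto simp: field_simps)
    obtain z1 where z1: "z1 \<in> {0..1 / 2}" "F z1 = v" using hits[of 0 "1 / 2" v] v by auto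
    obtain z2 where z2: "z2 \<in> {1 / 2..1}" "F z2 = v" using hits[of "1 / 2" 1 v] v F1 by auto
    have "v \<noteq> F 0" "v \<noteq> F (1 / 2)" using ne unfolding v_def by auto
    then have "z1 \<noteq> 0" "z1 \<noteq> 1 / 2" "z2 \<noteq> 1" using z1 z2 F1 by metis+
    then show False using no_int[of z2 z1] z1 z2 by auto
  qed
  have inj: "inj F"
  proof (rule injI)
    have *: False if xy: "F x = F y" "y < x" for x y
    proof -
      obtain k :: int where k: "x = y + of_int k" using close[of x y] xy by auto
      then have "F x = F y + real (nat k) * of_int d" using dn[of y "nat k"] xy by simp
      then show False using xy k \<open>d \<noteq> 0\<close> by auto
    qed
    fix x y assume "F x = F y"
    then show "x = y" using *[of x y] *[of y x] by (cases x y rule: linorder_cases) auto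
  qed
  have abs_d: False if big: "F 0 + 1 < F 1 \<or> F 1 < F 0 - 1"
  proof -
    define \<sigma> :: real where "\<sigma> = (if F 0 + 1 < F 1 then 1 else -1)"
    obtain z where z: "z \<in> {0..1}" "F z = F 0 + \<sigma>"
      using hits[of 0 1 "F 0 + \<sigma>"] big unfolding \<sigma>_def by (auto split: if_splits)
    have "z \<noteq> 0" "z \<noteq> 1" using z big unfolding \<sigma>_def by (auto split: if_splits)
    moreover have "F z - F 0 \<in> \<int>" using z unfolding \<sigma>_def by auto
    ultimately show False using no_int[of z 0] z by auto
  qed
  have d1: "F 1 = F 0 + of_int d" using d[of 0] by simp
  have "strict_mono F \<or> (\<forall>x y. x < y \<longrightarrow> F y < F x)"
    using injective_eq_monotone_map[of UNIV F] inj cont by (simp add: monotone_on_def)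
  then show ?thesis
  proof
    assume "strict_mono F"
    then have "F 0 < F 1" by (simp add: strict_monoD)
    then have "0 < d" using d1 by simp
    moreover have "\<not> 1 < d" using abs_d d1 by auto
    ultimately have "d = 1" by simp
    then show ?thesis using d \<open>strict_mono F\<close> by simp
  next
    assume anti: "\<forall>x y. x < y \<longrightarrow> F y < F x"
    then have "F 1 < F 0" by simp
    then have "d < 0" using d1 by simp
    moreover have "\<not> d < -1"
    proof
      assume "d < -1"
      then have "of_int d < (-1 :: real)" by simp
      then show False using abs_d d1 by auto
    qed
    ultimately have "d = -1" by simp
    then show ?thesis using d anti by simp
  qed
qed

text \<open>The circle is mapped to the unit circle of the complex plane, where a continuous
  logarithm on the real line provides the lift.\<close>

lemma lift_exists:
  assumes "continuous_on UNIV h" obtains H where "is_lift H h"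
proof -
  define e where "e u = exp (\<i> * of_real (2 * pi * rep_circle u))" for u
  have e_proj: "e (proj x) = exp (\<i> * of_real (2 * pi * x))" for x
  proof -
    obtain k :: int where "rep_circle (proj x) = x + of_int k" using proj_rep[of "proj x"] by (metis proj_eqE)
    then have "\<i> * of_real (2 * pi * rep_circle (proj x)) = \<i> * of_real (2 * pi * x) + (of_int (2 * k) * pi) * \<i>"
      by (simp add: algebra_simps)
    then show ?thesis unfolding e_def exp_eq by blast
  qed
  have "open (e -` S)" if "open S" for S
  proof -
    have "continuous_on UNIV (\<lambda>x::real. exp (\<i> * of_real (2 * pi * x)))" by (intro continuous_intros)
    then have "open ((\<lambda>x::real. exp (\<i> * of_real (2 * pi * x))) -` S)"
      by (rule open_vimage[OF that])
    moreover have "(\<lambda>x::real. exp (\<i> * of_real (2 * pi * x))) -` S = proj -` (e -` S)" by (auto simp: e_proj)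
    ultimately show ?thesis by (simp add: open_circle_def)
  qed
  then have e_cont: "continuous_on UNIV e" by (simp add: continuous_on_open_vimage)
  have "continuous_on UNIV (\<lambda>x. e (h (proj x)))"
    by (intro continuous_on_compose2[OF e_cont] continuous_on_compose2[OF assms] proj_cont) auto
  moreover have "contractible (UNIV :: real set)" by (rule convex_imp_contractible) simp
  moreover have "e u \<noteq> 0" for u unfolding e_def by simp
  ultimately obtain \<psi> where \<psi>: "continuous_on UNIV \<psi>" "\<And>x. e (h (proj x)) = exp (\<psi> x)"
    using continuous_logarithm_on_contractible[of UNIV "\<lambda>x. e (h (proj x))"] by auto
  define H where "H x = Im (\<psi> x) / (2 * pi)" for x
  have "proj (H x) = h (proj x)" for x
  proof -
    define u where "u = rep_circle (h (proj x))"
    have "exp (\<i> * of_real (2 * pi * u)) = exp (\<psi> x)" using \<psi>(2)[of x] by (simp add: e_def u_def)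
    then obtain n :: int where "\<i> * of_real (2 * pi * u) = \<psi> x + (of_int (2 * n) * pi) * \<i>"
      unfolding exp_eq by blast
    then have "Im (\<i> * of_real (2 * pi * u)) = Im (\<psi> x + (of_int (2 * n) * pi) * \<i>)" by simp
    then have "2 * pi * u = Im (\<psi> x) + 2 * of_int n * pi" by simp
    then have "u = H x + of_int n" unfolding H_def by (simp add: field_simps)
    then have "proj u = proj (H x)" by simp
    then show ?thesis by (simp add: u_def proj_rep)
  qed
  moreover have "continuous_on UNIV H" unfolding H_def by (intro continuous_intros \<psi>) simp
  ultimately have "is_lift H h" by (simp add: is_lift_def)
  then show ?thesis by (rule that)
qed

lemma homeo_inj: "homeo f \<Longrightarrow> inj f"
  unfolding homeo_def homeomorphism_def by (metis UNIV_I injI)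

lemma homeo_cont: "homeo f \<Longrightarrow> continuous_on UNIV f"
  unfolding homeo_def homeomorphism_def by blast

section \<open>The order of an orbit\<close>

text \<open>A coincidence \<open>F\<^sup>k z = z + m\<close> would make the rotation number rational. So the sign
  of \<open>F\<^sup>k x - x - m\<close> does not depend on \<open>x\<close>, and iterating the inequality identifies it.\<close>

lemma rotation_number_order:
  fixes F :: "real \<Rightarrow> real"
  assumes cont: "continuous_on UNIV F" and mono: "strict_mono F" and per: "\<And>x. F (x + 1) = F x + 1"
    and lim: "\<And>x. (\<lambda>n. ((F ^^ n) x - x) / real n) \<longlonglongrightarrow> \<rho>" and irr: "\<rho> \<notin> \<rat>"
  shows "(F ^^ k) x < x + of_int m \<longleftrightarrow> real k * \<rho> < of_int m"
    and "(F ^^ k) x > x + of_int m \<longleftrightarrow> real k * \<rho> > of_int m"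
proof -
  have "((F ^^ k) x < x + of_int m \<longleftrightarrow> real k * \<rho> < of_int m) \<and>
      ((F ^^ k) x > x + of_int m \<longleftrightarrow> real k * \<rho> > of_int m)"
  proof (cases "k = 0")
    case False
    define P where "P = F ^^ k"
    have less: "F x < F y \<longleftrightarrow> x < y" for x y using mono strict_mono_less by blast
    have P_le: "P x \<le> P y" if "x \<le> y" for x y
      unfolding P_def using that
    proof (induction k)
      case (Suc k)
      then show ?case using less[of "(F ^^ k) y" "(F ^^ k) x"] by auto
    qed simp
    have F_int: "F (x + of_int m) = F x + of_int m" for x m by (rule integer_shift[of F, OF per])
    have P_int: "P (x + of_int m) = P x + of_int m" for x m
      unfolding P_def by (induction k) (auto simp: F_int)
    have P_cont: "continuous_on UNIV P"
      unfolding P_def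
    proof (induction k)
      case (Suc k)
      then show ?case using continuous_on_compose[OF Suc continuous_on_subset[OF cont]] by simp
    qed (simp add: id_def)
    have sub: "(\<lambda>j. ((P ^^ j) x - x) / real (j * k)) \<longlonglongrightarrow> \<rho>" for x
    proof -
      have "strict_mono (\<lambda>j. j * k)" using False by (simp add: strict_mono_def)
      from LIMSEQ_subseq_LIMSEQ[OF lim[of x] this] show ?thesis
        by (simp add: comp_def P_def funpow_mult mult.commute)
    qed
    have ne_\<rho>: "\<rho> \<noteq> of_int m / real k" using irr by (metis Rats_divide Rats_of_int Rats_of_nat)
    have up: "\<rho> \<ge> of_int m / real k" if "\<And>x. P x \<ge> x + of_int m"
    proof -
      have "(P ^^ j) x \<ge> x + real j * of_int m" for j x
      proof (induction j)
        case (Suc j)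
        have "P ((P ^^ j) x) \<ge> (P ^^ j) x + of_int m" by (rule that)
        then show ?case using Suc by (simp add: algebra_simps)
      qed simp
      then have "real j * of_int m / real (j * k) \<le> ((P ^^ j) x - x) / real (j * k)" for j x
        by (intro divide_right_mono) (auto simp: algebra_simps)
      then have "of_int m / real k \<le> ((P ^^ j) x - x) / real (j * k)" if "1 \<le> j" for j x
        using that False by (metis (no_types, opaque_lifting) mult_divide_mult_cancel_left not_one_le_zero of_nat_eq_0_iff of_nat_mult)
      then show ?thesis by (intro LIMSEQ_le_const[OF sub[of 0]]) blast
    qed
    have down: "\<rho> \<le> of_int m / real k" if "\<And>x. P x \<le> x + of_int m"
    proof -
      have "(P ^^ j) x \<le> x + real j * of_int m" for j x
      proof (induction j)
        case (Suc j)
        have "P ((P ^^ j) x) \<le> (P ^^ j) x + of_int m" by (rule that)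
        then show ?case using Suc by (simp add: algebra_simps)
      qed simp
      then have "((P ^^ j) x - x) / real (j * k) \<le> real j * of_int m / real (j * k)" for j x
        by (intro divide_right_mono) (auto simp: algebra_simps)
      then have "((P ^^ j) x - x) / real (j * k) \<le> of_int m / real k" if "1 \<le> j" for j x
        using that False by (metis (no_types, opaque_lifting) mult_divide_mult_cancel_left not_one_le_zero of_nat_eq_0_iff of_nat_mult)
      then show ?thesis by (intro LIMSEQ_le_const2[OF sub[of 0]]) blast
    qed
    have nz: "P z \<noteq> z + of_int m" for z
    proof
      assume z: "P z = z + of_int m"
      have "(P ^^ j) z = z + real j * of_int m" for j
      proof (induction j)
        case (Suc j)
        have "P (z + of_int (int j * m)) = P z + of_int (int j * m)" by (rule P_int)
        then show ?case using Suc z by (simp add: algebra_simps)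
      qed simp
      then have eq: "((P ^^ j) z - z) / real (j * k) = of_int m / real k" if "1 \<le> j" for j
        using that False by simp
      have "\<rho> = of_int m / real k"
      proof (rule antisym)
        show "\<rho> \<le> of_int m / real k" by (rule LIMSEQ_le_const2[OF sub[of z]]) (use eq in \<open>metis order_refl\<close>)
        show "of_int m / real k \<le> \<rho>" by (rule LIMSEQ_le_const[OF sub[of z]]) (use eq in \<open>metis order_refl\<close>)
      qed
      then show False using ne_\<rho> by simp
    qed
    have same: "P y < y + of_int m" if "P x < x + of_int m" for x y
    proof (rule ccontr)
      assume "\<not> P y < y + of_int m"
      then have y: "0 < P y - y - of_int m" using nz[of y] by linarith
      have c: "connected ((\<lambda>z. P z - z - of_int m) ` UNIV)"
        by (intro connected_continuous_image continuous_intros P_cont) simp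
      have "0 \<in> (\<lambda>z. P z - z - of_int m) ` UNIV"
        by (rule connectedD_interval[OF c, of "P x - x - of_int m" "P y - y - of_int m"]) (use that y in auto)
      then obtain z where "0 = P z - z - of_int m" by (elim imageE)
      then have "P z = z + of_int m" by linarith
      then show False using nz by blast
    qed
    show ?thesis
    proof (cases "P x < x + of_int m")
      case True
      then have "\<rho> \<le> of_int m / real k" using same by (intro down less_imp_le) blast
      then have "\<rho> < of_int m / real k" using ne_\<rho> by simp
      then have "real k * \<rho> < of_int m" using False by (simp add: field_simps)
      then show ?thesis using True unfolding P_def[symmetric] by auto
    next
      case False': False
      then have "x + of_int m < P x" using nz[of x] by linarith
      have "y + of_int m \<le> P y" for y using same[of y x] False' by (meson not_le)
      then have "\<rho> \<ge> of_int m / real k" by (rule up)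
      then have "\<rho> > of_int m / real k" using ne_\<rho> by simp
      then have "real k * \<rho> > of_int m" using False by (simp add: field_simps)
      then show ?thesis using \<open>x + of_int m < P x\<close> unfolding P_def[symmetric] by auto
    qed
  qed simp
  then show "(F ^^ k) x < x + of_int m \<longleftrightarrow> real k * \<rho> < of_int m"
    and "(F ^^ k) x > x + of_int m \<longleftrightarrow> real k * \<rho> > of_int m" by auto
qed

text \<open>The lifts of both sides of the conjugacy equation differ by an integer, which the common
  rotation number forces to vanish. The same comparison shows that an orientation-reversing \<open>h\<close> would
  require \<open>2 \<rho> = 1\<close>.\<close>

lemma conjugacy_lift:
  assumes f: "circle_lift a \<rho> F" "is_lift F f" and g: "circle_lift a \<rho> G" "is_lift G g"
    and h: "homeo h" "h \<circ> f = g \<circ> h"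
  obtains H where "is_lift H h" "strict_mono H" "\<And>x. H (x + 1) = H x + 1" "\<And>x. H (F x) = G (H x)"
proof -
  interpret F: circle_lift a \<rho> F by fact
  interpret G: circle_lift a \<rho> G by fact
  obtain H where H: "is_lift H h" using lift_exists homeo_cont h(1) by blast
  have "is_lift (\<lambda>x. G (H x)) (h \<circ> f)" unfolding h(2) by (rule lift_comp[OF H g(2)])
  moreover have "is_lift (\<lambda>x. H (F x)) (h \<circ> f)" by (rule lift_comp[OF f(2) H])
  ultimately obtain k :: int where k: "\<And>x. H (F x) = G (H x) + of_int k" using lift_unique by blast
  have F1: "F x < x + of_int m \<longleftrightarrow> \<rho> < of_int m" for x m using F.F_order(1)[where k = 1 and x = x and m = m] by simp
  have G1: "G x < x + of_int m \<longleftrightarrow> \<rho> < of_int m" "G x > x + of_int m \<longleftrightarrow> \<rho> > of_int m" for x m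
    using G.F_order[where k = 1 and x = x and m = m] by simp_all
  from lift_monotone[OF H homeo_inj[OF h(1)]] show ?thesis
  proof
    assume H': "strict_mono H \<and> (\<forall>x. H (x + 1) = H x + 1)"
    have less: "H x < H y \<longleftrightarrow> x < y" for x y using H' strict_mono_less by blast
    have shift: "\<rho> < of_int m \<longleftrightarrow> \<rho> < of_int (m - k)" if "m = 0 \<or> m = 1" for m
    proof -
      have "\<rho> < of_int m \<longleftrightarrow> H (F 0) < H (0 + of_int m)" unfolding less by (rule F1[symmetric])
      also have "H (0 + of_int m) = H 0 + of_int m" using that H'[THEN conjunct2, rule_format, of 0] by auto
      also have "H (F 0) < H 0 + of_int m \<longleftrightarrow> G (H 0) < H 0 + of_int (m - k)" unfolding k by auto
      finally show ?thesis unfolding G1 .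
    qed
    have "k = 0"
    proof -
      have "\<rho> < of_int (1 - k)" using shift[of 1] F.rho_bounds by simp
      moreover have "\<not> \<rho> < of_int (0 - k)" using shift[of 0] F.rho_bounds by simp
      ultimately have "(0::real) < of_int (1 - k)" "of_int (- k) < (1::real)" using F.rho_bounds by linarith+
      then have "0 < 1 - k" "- k < 1" by linarith+
      then show ?thesis by simp
    qed
    then show ?thesis using that H H' k by simp
  next
    assume H': "(\<forall>x y. x < y \<longrightarrow> H y < H x) \<and> (\<forall>x. H (x + 1) = H x - 1)"
    have less: "H x < H y \<longleftrightarrow> y < x" for x y
      using H' by (metis linorder_less_linear order_less_asym)
    have H1: "H (x + 1) = H x - 1" for x using H' by blast
    have shift: "\<rho> < of_int m \<longleftrightarrow> \<rho> > of_int (- m - k)" if "m = 0 \<or> m = 1" for m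
    proof -
      have "\<rho> < of_int m \<longleftrightarrow> H (0 + of_int m) < H (F 0)" unfolding less by (rule F1[symmetric])
      also have "H (0 + of_int m) = H 0 - of_int m" using that H1[of 0] by auto
      also have "H 0 - of_int m < H (F 0) \<longleftrightarrow> G (H 0) > H 0 + of_int (- m - k)" unfolding k by auto
      finally show ?thesis unfolding G1 .
    qed
    have "k = -1"
    proof -
      have "\<rho> > of_int (- 1 - k)" using shift[of 1] F.rho_bounds by simp
      moreover have "\<not> \<rho> > of_int (- k)" using shift[of 0] F.rho_bounds by simp
      ultimately have "of_int (- 1 - k) < (1::real)" "(0::real) < of_int (- k)" using F.rho_bounds by linarith+
      then have "- 1 - k < 1" "0 < - k" by linarith+
      then show ?thesis by simp
    qed
    then have k1: "H (F x) = G (H x) - 1" for x using k[of x] by simp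
    \<comment> \<open>two steps: \<open>2 \<rho> < 1\<close> and \<open>2 \<rho> > 1\<close> would be equivalent\<close>
    have G_minus: "G (z - 1) = G z - 1" for z using G.F_plus_1[of "z - 1"] by simp
    have "(F ^^ 2) 0 < 0 + of_int 1 \<longleftrightarrow> H (0 + 1) < H (F (F 0))" unfolding less by (simp add: numeral_2_eq_2)
    also have "H (F (F 0)) = G (G (H 0)) - 1 - 1" unfolding k1 G_minus ..
    also have "H (0 + 1) < G (G (H 0)) - 1 - 1 \<longleftrightarrow> H 0 + of_int 1 < (G ^^ 2) (H 0)"
      using H1[of 0] by (auto simp: numeral_2_eq_2)
    finally have "real 2 * \<rho> < of_int 1 \<longleftrightarrow> real 2 * \<rho> > of_int 1" unfolding F.F_order G.F_order .
    then have "\<rho> = 1 / 2" by auto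
    moreover have "(1 / 2 :: real) \<in> \<rat>" by (intro Rats_divide) auto
    ultimately show ?thesis using F.irrational by metis
  qed
qed

lemma critical_circle_map_lift:
  assumes crit: "critical_circle_map 3 f cc" and rot: "has_rotation_number f \<rho>"
    and irr: "\<rho> \<notin> \<rat>" and cf: "is_continued_fraction a \<rho>" and B: "\<And>n. a n \<le> B"
  obtains F where "is_lift F f" "circle_lift a \<rho> F"
    "\<And>c. proj c = cc \<Longrightarrow> \<exists>K e \<delta>. critical_lift a \<rho> F (deriv F) c K e \<delta> B"
proof -
  obtain F0 where F0: "is_lift F0 f" "\<And>x. (\<lambda>n. ((F0 ^^ n) x - x) / real n) \<longlonglongrightarrow> \<rho>"
    using rot unfolding has_rotation_number_def by blast
  obtain F1 where F1: "is_lift F1 f" "C_diff_on 3 F1 UNIV" "\<And>x. deriv F1 x = 0 \<longleftrightarrow> proj x = cc"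
    "\<And>x\<^sub>0. proj x\<^sub>0 = cc \<Longrightarrow> \<exists>p a \<phi> \<delta>. p > 1 \<and> \<delta> > 0 \<and>
          C_diff_on 3 \<phi> {x\<^sub>0 - \<delta><..<x\<^sub>0 + \<delta>} \<and> \<phi> x\<^sub>0 = 0 \<and>
          (\<forall>x\<in>{x\<^sub>0 - \<delta><..<x\<^sub>0 + \<delta>}. deriv \<phi> x \<noteq> 0 \<and>
             F1 x = \<phi> x * \<bar>\<phi> x\<bar> powr (p - 1) + a)"
    using crit unfolding critical_circle_map_def by blast
  obtain F2 where F2: "is_lift F2 f" "strict_mono F2"
    using crit unfolding critical_circle_map_def orientation_preserving_def by blast
  have inj: "inj f" using crit homeo_inj unfolding critical_circle_map_def by blast
  obtain k2 :: int where k2: "\<And>x. F0 x = F2 x + of_int k2" using lift_unique[OF F2(1) F0(1)] by blast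
  obtain k1 :: int where k1: "\<And>x. F0 x = F1 x + of_int k1" using lift_unique[OF F1(1) F0(1)] by blast
  have mono: "strict_mono F0" using F2(2) k2 by (simp add: strict_mono_def)
  have "\<not> (\<forall>x y. x < y \<longrightarrow> F0 y < F0 x)"
  proof
    assume "\<forall>x y. x < y \<longrightarrow> F0 y < F0 x"
    then have "F0 1 < F0 0" by simp
    moreover have "F0 0 < F0 1" using mono by (simp add: strict_monoD)
    ultimately show False by simp
  qed
  then have per: "F0 (x + 1) = F0 x + 1" for x using lift_monotone[OF F0(1) inj] by blast
  have CL: "circle_lift a \<rho> F0"
  proof
    show "\<rho> \<notin> \<rat>" "is_continued_fraction a \<rho>" by fact+
    show "continuous_on UNIV F0" "strict_mono F0" using lift_cont[OF F0(1)] mono by auto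
    show "F0 (x + 1) = F0 x + 1" for x by (rule per)
    show "((F0 ^^ k) x < x + of_int m) = (real k * \<rho> < of_int m)"
      "(x + of_int m < (F0 ^^ k) x) = (of_int m < real k * \<rho>)" for k x m
      using rotation_number_order[OF lift_cont[OF F0(1)] mono per F0(2) irr] by auto
  qed
  have F0_eq: "F0 = (\<lambda>x. F1 x + of_int k1)" using k1 by auto
  have dF1: "(F1 has_real_derivative deriv F1 x) (at x)" for x by (rule C_diff_on_3(1)[OF F1(2) UNIV_I])
  have deriv_eq: "deriv F0 = deriv F1"
  proof
    fix x
    have "(F0 has_real_derivative deriv F1 x) (at x)"
      unfolding F0_eq by (auto intro!: derivative_eq_intros dF1)
    then show "deriv F0 x = deriv F1 x" by (rule DERIV_imp_deriv)
  qed
  have pow: "(deriv ^^ Suc j) F0 = (deriv ^^ Suc j) F1" for j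
    by (simp only: funpow_Suc_right comp_apply deriv_eq)
  have smooth: "C_diff_on 3 F0 UNIV"
    unfolding C_diff_on_def
  proof (intro conjI allI impI ballI)
    fix j x assume "j < (3::nat)"
    show "(deriv ^^ j) F0 field_differentiable at x"
    proof (cases j)
      case 0
      then show ?thesis unfolding F0_eq using dF1[of x]
        by (auto intro!: derivative_intros simp: field_differentiable_def)
    next
      case (Suc i)
      have "(deriv ^^ j) F1 field_differentiable at x"
        using F1(2) \<open>j < 3\<close> unfolding C_diff_on_def by blast
      then show ?thesis unfolding Suc pow .
    qed
  next
    show "continuous_on UNIV ((deriv ^^ 3) F0)"
      using F1(2) pow[of 2] unfolding C_diff_on_def by (simp add: numeral_3_eq_3)
  qed
  have "\<exists>K e \<delta>. critical_lift a \<rho> F0 (deriv F0) c K e \<delta> B" if c: "proj c = cc" for c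
  proof -
    obtain p a0 \<phi> \<delta> where \<phi>: "p > 1" "\<delta> > 0" "C_diff_on 3 \<phi> {c - \<delta><..<c + \<delta>}" "\<phi> c = 0"
      "\<forall>x\<in>{c - \<delta><..<c + \<delta>}. deriv \<phi> x \<noteq> 0 \<and> F1 x = \<phi> x * \<bar>\<phi> x\<bar> powr (p - 1) + a0"
      using F1(4)[OF c] by blast
    have zero: "deriv F0 x = 0 \<longleftrightarrow> (\<exists>k::int. x = c + of_int k)" for x
      unfolding deriv_eq F1(3) c[symmetric] by (metis proj_eqE proj_plus_int)
    have form: "deriv \<phi> x \<noteq> 0 \<and> F0 x = \<phi> x * \<bar>\<phi> x\<bar> powr (p - 1) + (a0 + of_int k1)"
      if "x \<in> {c - \<delta><..<c + \<delta>}" for x using \<phi>(5) that by (simp add: k1)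
    obtain d m1 M1 L m2 M2 L2 where
      "critical_profile F0 (deriv F0) \<phi> (deriv \<phi>) c p (a0 + of_int k1) d m1 M1 L m2 M2 L2"
      using critical_profile_exists[OF smooth mono per zero \<phi>(1-4) form] by blast
    then show ?thesis using critical_lift_exists[OF CL _ B] by blast
  qed
  then show ?thesis using that F0(1) CL by blast
qed

section \<open>Dynamical arcs and renormalizations on the line\<close>

lemma proj_image_shift: "proj ` {x + of_int k..y + of_int k} = proj ` {x..y}"
proof -
  have "proj ` {x + of_int k..y + of_int k} = proj ` ((\<lambda>z. z + of_int k) ` {x..y})"
    by (simp only: image_add_atLeastAtMost')
  also have "\<dots> = (\<lambda>z. proj (z + of_int k)) ` {x..y}" by (simp only: image_image)
  also have "\<dots> = proj ` {x..y}" by simp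
  finally show ?thesis .
qed

lemma arc_length_proj:
  assumes "\<alpha> \<le> \<beta>" "\<beta> < \<alpha> + 1" shows "arc_length (proj ` {\<alpha>..\<beta>}) = \<beta> - \<alpha>"
proof -
  define k where "k = \<lfloor>\<alpha>\<rfloor>"
  define u v where "u = \<alpha> - of_int k" and "v = \<beta> - of_int k"
  have uv: "0 \<le> u" "u < 1" "u \<le> v" "v < u + 1" "v - u = \<beta> - \<alpha>"
    using assms unfolding u_def v_def k_def by linarith+
  have img: "proj ` {\<alpha>..\<beta>} = proj ` {u..v}"
    using proj_image_shift[of u k v] by (simp add: u_def v_def)
  have mem: "proj x \<in> proj ` {u..v} \<longleftrightarrow> (u \<le> x \<and> x \<le> v) \<or> x \<le> v - 1" if "0 \<le> x" "x < 1" for x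
  proof
    assume "proj x \<in> proj ` {u..v}"
    then obtain y where y: "u \<le> y" "y \<le> v" "proj x = proj y" by auto
    obtain j :: int where j: "x = y + of_int j" using y(3) by (rule proj_eqE)
    have "of_int j < (1 :: real)" "(- 2 :: real) < of_int j" using j y uv that by auto
    then have "j = 0 \<or> j = -1" by linarith
    then show "(u \<le> x \<and> x \<le> v) \<or> x \<le> v - 1" using j y by auto
  next
    assume "(u \<le> x \<and> x \<le> v) \<or> x \<le> v - 1"
    then show "proj x \<in> proj ` {u..v}"
    proof
      assume "x \<le> v - 1"
      then have "x + of_int 1 \<in> {u..v}" using that uv by auto
      then show ?thesis by (metis imageI proj_plus_int)
    qed auto
  qed
  show ?thesis
  proof (cases "v < 1")
    case True
    have "{x \<in> {0..<1}. proj x \<in> proj ` {u..v}} = {u..v}"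
    proof (rule set_eqI)
      fix x show "x \<in> {x \<in> {0..<1}. proj x \<in> proj ` {u..v}} \<longleftrightarrow> x \<in> {u..v}"
        using mem[of x] True uv by (cases "0 \<le> x \<and> x < 1") auto
    qed
    then show ?thesis unfolding arc_length_def img using uv by simp
  next
    case False
    have "{x \<in> {0..<1}. proj x \<in> proj ` {u..v}} = {u..<1} \<union> {0..v - 1}"
    proof (rule set_eqI)
      fix x show "x \<in> {x \<in> {0..<1}. proj x \<in> proj ` {u..v}} \<longleftrightarrow> x \<in> {u..<1} \<union> {0..v - 1}"
        using mem[of x] False uv by (cases "0 \<le> x \<and> x < 1") auto
    qed
    moreover have "measure lebesgue ({u..<1} \<union> {0..v - 1}) = measure lebesgue {u..<1} + measure lebesgue {0..v - 1}"
      using uv by (intro measure_Un_AE AE_I2 bounded_set_imp_lmeasurable) auto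
    ultimately show ?thesis unfolding arc_length_def img using uv False by simp
  qed
qed

locale critical_circle_lift = critical_lift a \<rho> F F' c K e \<delta> B for a \<rho> F F' c K e \<delta> B +
  fixes f :: "circle \<Rightarrow> circle"
  assumes f_lift: "is_lift F f"
begin

abbreviation pt :: "nat \<Rightarrow> real" where "pt n \<equiv> Phi (sgap n) c"

lemma proj_sgap: "(f ^^ q n) (proj x) = proj (Phi (sgap n) x)"
proof -
  have "Phi (sgap n) x = (F ^^ q n) x + of_int (- int (cf_num a n))"
    using Phi_eq[of "int (q n)" "- int (cf_num a n)" x] by (simp add: sgap_def iter_def)
  then show ?thesis using lift_funpow[OF f_lift] by (metis proj_plus_int)
qed

definition arc :: "nat \<Rightarrow> circle set" where "arc n = proj ` {min c (pt n)..max c (pt n)}"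

lemma pt_cases:
  obtains "0 < signed_len n" "c < pt n" "pt n < c + 1" "c < pt (n + 2)" "pt (n + 2) < pt n"
  | "signed_len n < 0" "pt n < c" "c - 1 < pt n" "pt (n + 2) < c" "pt n < pt (n + 2)"
proof -
  have g: "gap (Suc (Suc n)) < gap n" "0 < gap (Suc (Suc n))" "gap n < 1" "0 < gap n"
    using gap_Suc_less[of n] gap_Suc_less[of "Suc n"] gap_pos gap_lt_1 by auto
  have c0: "Phi 0 c = c" "Phi 1 c = c + 1" "Phi (- 1) c = c - 1"
    using Phi_int[of 1 c] Phi_int[of "-1" c] by simp_all
  have G1: "1 \<in> Gam" "- 1 \<in> Gam" using Gam_int[of 1] Gam_int[of "-1"] by simp_all
  show ?thesis
  proof (cases "0 < sgap n")
    case True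
    then have s: "sgap n = gap n" "sgap (n + 2) = gap (Suc (Suc n))"
      using sgap_cases[of n] gap_pos[of n] by auto
    show ?thesis
      using that(1) True signed_len_pos_iff[of n] s g G1 Phi_less_iff[of 0 "gap n" c] Phi_less_iff[of "gap n" 1 c]
        Phi_less_iff[of 0 "gap (Suc (Suc n))" c] Phi_less_iff[of "gap (Suc (Suc n))" "gap n" c] c0 by simp
  next
    case False
    then have s: "sgap n = - gap n" "sgap (n + 2) = - gap (Suc (Suc n))"
      using sgap_cases[of n] gap_pos[of n] by auto
    show ?thesis
      using that(2) False signed_len_neg_iff[of n] s g G1 Phi_less_iff[of "- gap n" 0 c] Phi_less_iff[of "- 1" "- gap n" c]
        Phi_less_iff[of "- gap (Suc (Suc n))" 0 c] Phi_less_iff[of "- gap n" "- gap (Suc (Suc n))" c] c0 by simp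
  qed
qed

lemma pt_sig: "pt n = c + signed_len n"
  by (simp add: signed_len_def)

lemma proj_in_arc:
  assumes "proj z \<in> proj ` {x..y}" obtains k :: int where "x \<le> z + of_int k" "z + of_int k \<le> y"
proof -
  obtain w where w: "x \<le> w" "w \<le> y" "proj w = proj z" using assms by auto
  obtain k :: int where "w = z + of_int k" using w(3) by (rule proj_eqE)
  then show ?thesis using that w by blast
qed

lemma closed_arc_arc: "closed_arc (proj c) ((f ^^ q n) (proj c)) (arc n)"
  unfolding closed_arc_def proj_sgap arc_def
proof (intro exI conjI)
  show "min c (pt n) < max c (pt n)" "max c (pt n) < min c (pt n) + 1"
    by (rule pt_cases[of n]; auto)+
  show "{proj (min c (pt n)), proj (max c (pt n))} = {proj c, proj (pt n)}"
    by (cases "c \<le> pt n") (auto simp: min_def max_def)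
qed simp

lemma return_in_arc: "(f ^^ q (n + 2)) (proj c) \<in> arc n"
  unfolding proj_sgap arc_def by (rule pt_cases[of n]) auto

text \<open>Of the two arcs with the given endpoints, the complementary one misses the later
  return, which lies strictly between \<open>c\<close> and \<open>pt n\<close>.\<close>

lemma closed_arc_unique:
  assumes S: "closed_arc (proj c) ((f ^^ q n) (proj c)) S" "(f ^^ q (n + 2)) (proj c) \<in> S"
  shows "S = arc n"
proof -
  obtain x y where xy: "x < y" "y < x + 1" "{proj x, proj y} = {proj c, proj (pt n)}" "S = proj ` {x..y}"
    using S(1) unfolding closed_arc_def proj_sgap by blast
  have shift: "proj ` {x..y} = proj ` {x + of_int k..y + of_int k}" for k :: int
    by (rule proj_image_shift[symmetric])
  have w: "proj (pt (n + 2)) \<in> S" using S(2) unfolding proj_sgap .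
  have "(proj x = proj c \<and> proj y = proj (pt n)) \<or> (proj y = proj c \<and> proj x = proj (pt n))"
    using xy(3) by (metis doubleton_eq_iff)
  then show ?thesis
  proof
    assume *: "proj x = proj c \<and> proj y = proj (pt n)"
    obtain k :: int where k: "c = x + of_int k" using * by (metis proj_eqE)
    obtain j :: int where j: "y + of_int k = pt n + of_int j" using * by (metis proj_eqE proj_plus_int)
    have S_eq: "S = proj ` {c..pt n + of_int j}" unfolding xy(4) shift[of k] k j ..
    obtain l :: int where l: "c \<le> pt (n + 2) + of_int l" "pt (n + 2) + of_int l \<le> pt n + of_int j"
      using w unfolding S_eq by (rule proj_in_arc)
    have b: "c < pt n + of_int j" "pt n + of_int j < c + 1" using xy k j by linarith+
    show ?thesis
    proof (rule pt_cases[of n])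
      assume p: "c < pt n" "pt n < c + 1"
      have "of_int j < (1::real)" "(- 1::real) < of_int j" using b p by linarith+
      then have "j = 0" by linarith
      then show ?thesis using S_eq p by (simp add: arc_def)
    next
      assume p: "pt n < c" "c - 1 < pt n" "pt (n + 2) < c" "pt n < pt (n + 2)"
      have "(0::real) < of_int j" "of_int j < (2::real)" "(0::real) < of_int l" using b p l by linarith+
      then have "j = 1" "1 \<le> l" by linarith+
      then have "(1::real) \<le> of_int l" "of_int j = (1::real)" by simp_all
      then have False using l p by linarith
      then show ?thesis ..
    qed
  next
    assume *: "proj y = proj c \<and> proj x = proj (pt n)"
    obtain k :: int where k: "c = y + of_int k" using * by (metis proj_eqE)
    obtain j :: int where j: "x + of_int k = pt n + of_int j" using * by (metis proj_eqE proj_plus_int)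
    have S_eq: "S = proj ` {pt n + of_int j..c}" unfolding xy(4) shift[of k] k j ..
    obtain l :: int where l: "pt n + of_int j \<le> pt (n + 2) + of_int l" "pt (n + 2) + of_int l \<le> c"
      using w unfolding S_eq by (rule proj_in_arc)
    have b: "pt n + of_int j < c" "c < pt n + of_int j + 1" using xy k j by linarith+
    show ?thesis
    proof (rule pt_cases[of n])
      assume p: "c < pt n" "pt n < c + 1" "c < pt (n + 2)" "pt (n + 2) < pt n"
      have "of_int j < (0::real)" "(- 2::real) < of_int j" "of_int l < (0::real)" using b p l by linarith+
      then have "j = -1" "l \<le> -1" by linarith+
      then have "of_int l \<le> (- 1::real)" "of_int j = (- 1::real)" by linarith+
      then have False using l p by linarith
      then show ?thesis ..
    next
      assume p: "pt n < c" "c - 1 < pt n"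
      have "(- 1::real) < of_int j" "of_int j < (1::real)" using b p by linarith+
      then have "j = 0" by linarith
      then show ?thesis using S_eq p by (simp add: arc_def)
    qed
  qed
qed

lemma dyn_arc_eq: "dyn_arc f (proj c) a n = arc n"
  unfolding dyn_arc_def by (rule the_equality) (use closed_arc_arc return_in_arc closed_arc_unique in auto)

lemma arc_length_arc: "arc_length (arc n) = \<bar>signed_len n\<bar>"
  unfolding arc_def
  by (subst arc_length_proj) (rule pt_cases[of n]; auto simp: signed_len_def)+

lemma signed_len_Suc_ratio_neg: "signed_len (Suc n) / signed_len n < 0"
  using sgap_Suc_sign[of n] signed_len_pos_iff[of n] signed_len_neg_iff[of n] signed_len_pos_iff[of "Suc n"] signed_len_neg_iff[of "Suc n"] sgap_nonzero[of n]
  by (simp add: divide_less_0_iff) linarith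

lemma ren_ratio_eq: "ren_ratio f (proj c) a (Suc n) = signed_len (Suc n) / signed_len n"
proof -
  have "ren_ratio f (proj c) a (Suc n) = - \<bar>signed_len (Suc n) / signed_len n\<bar>"
    by (simp add: ren_ratio_def dyn_arc_eq arc_length_arc abs_divide)
  then show ?thesis unfolding abs_of_neg[OF signed_len_Suc_ratio_neg] by simp
qed

definition cover :: "nat \<Rightarrow> real \<Rightarrow> circle" where "cover n t = proj (c + signed_len n * t)"

lemma cover_image: "cover n ` {0..1} = arc n"
proof -
  have "(\<lambda>t. c + signed_len n * t) ` {0..1} = {min c (pt n)..max c (pt n)}"
  proof -
    have "(\<lambda>t. c + signed_len n * t) = (\<lambda>t. signed_len n * t + c)" by (simp add: add.commute)
    then show ?thesis using image_affinity_atLeastAtMost[of "signed_len n" c 0 1]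
      by (cases "0 \<le> signed_len n") (auto simp: pt_sig add.commute)
  qed
  then show ?thesis unfolding arc_def cover_def by (simp add: image_image flip: image_comp) (metis image_image)
qed

text \<open>The endpoints determine the slope of the covering only modulo one. Any other admissible
  slope covers the midpoint of the complementary arc.\<close>

lemma affine_cover_eq: "affine_cover f (proj c) a n = cover n"
  unfolding affine_cover_def dyn_arc_eq proj_sgap
proof (rule the_equality)
  show "(\<exists>x s. s \<noteq> 0 \<and> cover n = (\<lambda>t. proj (x + s * t))) \<and> cover n ` {0..1} = arc n \<and>
      cover n 0 = proj c \<and> cover n 1 = proj (pt n)"
  proof (intro conjI exI)
    show "cover n = (\<lambda>t. proj (c + signed_len n * t))" by (simp add: fun_eq_iff cover_def)
  qed (use cover_image in \<open>auto simp: cover_def pt_sig\<close>)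
next
  fix A assume "(\<exists>x s. s \<noteq> 0 \<and> A = (\<lambda>t. proj (x + s * t))) \<and> A ` {0..1} = arc n \<and> A 0 = proj c \<and> A 1 = proj (pt n)"
  then obtain x s where A: "A = (\<lambda>t. proj (x + s * t))" "s \<noteq> 0" "A ` {0..1} = arc n" "A 0 = proj c" "A 1 = proj (pt n)"
    by blast
  have "proj x = proj c" using A(1,4) by simp
  then obtain k :: int where k: "x = c + of_int k" by (rule proj_eqE)
  have A': "A t = proj (c + s * t)" for t
    unfolding A(1) k using proj_plus_int[of "c + s * t" k] by (simp add: add_ac)
  have "proj (c + s) = proj (pt n)" using A(5) A'[of 1] by simp
  then obtain l :: int where "c + s = pt n + of_int l" by (rule proj_eqE)
  then have l: "s = signed_len n + of_int l" by (simp add: signed_len_def)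
  have out: False if t: "0 \<le> t" "t \<le> 1" "c + s * t = z + of_int i" and z: "\<And>j::int. \<not> (min c (pt n) \<le> z + of_int j \<and> z + of_int j \<le> max c (pt n))"
    for t z i
  proof -
    have "A t \<in> arc n" using t A(3) by auto
    then have "proj z \<in> arc n" unfolding A' t(3) by simp
    then obtain j :: int where "min c (pt n) \<le> z + of_int j" "z + of_int j \<le> max c (pt n)"
      unfolding arc_def by (rule proj_in_arc)
    then show False using z by blast
  qed
  have "l = 0"
  proof (rule ccontr)
    assume "l \<noteq> 0"
    show False
    proof (rule pt_cases[of n])
      assume p: "0 < signed_len n" "c < pt n" "pt n < c + 1"
      define z where "z = c + (signed_len n + 1) / 2"
      have sz: "pt n < z" "z < c + 1" "0 < signed_len n" "signed_len n < 1" using p unfolding z_def pt_sig by (auto simp: field_simps)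
      have zout: "\<not> (min c (pt n) \<le> z + of_int j \<and> z + of_int j \<le> max c (pt n))" for j :: int
      proof
        assume "min c (pt n) \<le> z + of_int j \<and> z + of_int j \<le> max c (pt n)"
        then have "of_int j < (0::real)" "(- 1::real) < of_int j" using sz p by linarith+
        then have "j < 0" "- 1 < j" by linarith+
        then show False by simp
      qed
      show False
      proof (cases "0 < l")
        case True
        then have s1: "signed_len n + 1 \<le> s" unfolding l by simp
        show False
          by (rule out[of "((signed_len n + 1) / 2) / s" z 0, OF _ _ _ zout])
             (use s1 sz in \<open>auto simp: z_def divide_le_eq_1\<close>)
      next
        case False
        then have "of_int l \<le> (- 1::real)" using \<open>l \<noteq> 0\<close> by linarith
        then have s1: "s \<le> signed_len n - 1" unfolding l by simp
        show False
          by (rule out[of "((signed_len n - 1) / 2) / s" z "-1", OF _ _ _ zout])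
             (use s1 sz in \<open>auto simp: z_def divide_le_eq_1 zero_le_divide_iff field_simps\<close>)
      qed
    next
      assume p: "signed_len n < 0" "pt n < c" "c - 1 < pt n"
      define z where "z = c + (signed_len n - 1) / 2"
      have sz: "z < pt n" "c - 1 < z" "signed_len n < 0" "- 1 < signed_len n" using p unfolding z_def pt_sig by (auto simp: field_simps)
      have zout: "\<not> (min c (pt n) \<le> z + of_int j \<and> z + of_int j \<le> max c (pt n))" for j :: int
      proof
        assume "min c (pt n) \<le> z + of_int j \<and> z + of_int j \<le> max c (pt n)"
        then have "(0::real) < of_int j" "of_int j < (1::real)" using sz p by linarith+
        then have "0 < j" "j < 1" by linarith+
        then show False by simp
      qed
      show False
      proof (cases "0 < l")
        case True
        then have s1: "signed_len n + 1 \<le> s" unfolding l by simp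
        show False
          by (rule out[of "((signed_len n + 1) / 2) / s" z 1, OF _ _ _ zout])
             (use s1 sz in \<open>auto simp: z_def divide_le_eq_1 zero_le_divide_iff field_simps\<close>)
      next
        case False
        then have "of_int l \<le> (- 1::real)" using \<open>l \<noteq> 0\<close> by linarith
        then have s1: "s \<le> signed_len n - 1" unfolding l by simp
        show False
          by (rule out[of "((signed_len n - 1) / 2) / s" z 0, OF _ _ _ zout])
             (use s1 sz in \<open>auto simp: z_def divide_le_eq_1 zero_le_divide_iff field_simps\<close>)
      qed
    qed
  qed
  then show "A = cover n" using A' l by (auto simp: cover_def)
qed

lemma cover_crd: "cover n (coord n y) = proj y"
  by (simp add: cover_def coord_def)

lemma signed_len_sum_le_1: "\<bar>signed_len n\<bar> + \<bar>signed_len (Suc n)\<bar> \<le> 1"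
proof -
  have le: "gap n + gap (Suc n) \<le> 1"
    using gap_0_1 gap_mono[of 0 n] gap_mono[of 1 "Suc n"] by simp
  have P1: "Phi (x + of_int 1) c = Phi x c + 1" if "x \<in> Gam" for x
    using Phi_add[of "of_int 1" x c] that by (simp only: Gam_int Phi_int add.commute)
  consider "sgap n = gap n" "sgap (Suc n) = - gap (Suc n)" | "sgap n = - gap n" "sgap (Suc n) = gap (Suc n)"
    using sgap_cases[of n] by auto
  then show ?thesis
  proof cases
    case 1
    then have s: "0 < signed_len n" "signed_len (Suc n) < 0" using signed_len_pos_iff signed_len_neg_iff gap_pos by auto
    have "Phi (gap n) c \<le> Phi (- gap (Suc n) + of_int 1) c"
      using le Gam_add[OF Gam_minus[OF Gam_gap] Gam_int[of 1]] by (subst Phi_le_iff) auto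
    also have "\<dots> = Phi (- gap (Suc n)) c + 1" by (rule P1) simp
    finally show ?thesis using s 1 by (simp add: signed_len_def)
  next
    case 2
    then have s: "signed_len n < 0" "0 < signed_len (Suc n)" using signed_len_pos_iff signed_len_neg_iff gap_pos by auto
    have "Phi (gap (Suc n)) c \<le> Phi (- gap n + of_int 1) c"
      using le Gam_add[OF Gam_minus[OF Gam_gap] Gam_int[of 1]] by (subst Phi_le_iff) auto
    also have "\<dots> = Phi (- gap n) c + 1" by (rule P1) simp
    finally show ?thesis using s 2 by (simp add: signed_len_def)
  qed
qed

lemma cover_inj:
  assumes "cover n t = cover n u" "\<bar>t - u\<bar> < 1 - signed_len (Suc n) / signed_len n"
  shows "t = u"
proof -
  obtain k :: int where k: "c + signed_len n * t = c + signed_len n * u + of_int k"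
    using assms(1) unfolding cover_def by (rule proj_eqE)
  have "\<bar>signed_len n\<bar> * \<bar>t - u\<bar> < \<bar>signed_len n\<bar> * (1 - signed_len (Suc n) / signed_len n)"
    using assms(2) by (intro mult_strict_left_mono) auto
  also have "\<dots> = \<bar>signed_len n\<bar> + \<bar>signed_len (Suc n)\<bar>"
  proof -
    have "- (signed_len (Suc n) / signed_len n) = \<bar>signed_len (Suc n)\<bar> / \<bar>signed_len n\<bar>"
      using signed_len_Suc_ratio_neg[of n] by (simp flip: abs_divide)
    then have "1 - signed_len (Suc n) / signed_len n = 1 + \<bar>signed_len (Suc n)\<bar> / \<bar>signed_len n\<bar>" by linarith
    then show ?thesis by (simp only: distrib_left) simp
  qed
  also have "\<dots> \<le> 1" by (rule signed_len_sum_le_1)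
  finally have "\<bar>signed_len n * (t - u)\<bar> < 1" by (simp add: abs_mult)
  then have "\<bar>of_int k :: real\<bar> < 1" using k by (simp add: algebra_simps)
  then have "k = 0" by linarith
  then show ?thesis using k by simp
qed

lemma ren_left_eq:
  assumes "dyn (Suc n) y"
  shows "ren_left f (proj c) a (Suc n) (coord n y) = coord n (Phi (sgap n) y)"
proof -
  define l where "l = signed_len (Suc n) / signed_len n"
  have l: "l < 0" unfolding l_def by (rule signed_len_Suc_ratio_neg)
  have inj: "inj_on (cover n) {l<..1}"
    by (rule inj_onI, rule cover_inj) (auto simp: l_def[symmetric] abs_if)
  have "dyn n (Phi (sgap n) y)" using dyn_step[OF assms a_pos] by simp
  then have mem: "coord n (Phi (sgap n) y) \<in> {l<..1}" using l unfolding dyn_iff by auto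
  show ?thesis
    unfolding ren_left_def ren_ratio_eq l_def[symmetric] diff_Suc_1 affine_cover_eq cover_crd proj_sgap
    by (rule the_inv_into_f_eq[OF inj _ mem]) (rule cover_crd)
qed

lemma right_range:
  assumes "dyn n y"
  shows "signed_len (Suc n) / signed_len n \<le> coord n (Phi (sgap (Suc n)) y)" "coord n (Phi (sgap (Suc n)) y) < 1"
proof -
  define z where "z = Phi (sgap (Suc n)) y"
  have b: "between (0 + sgap (Suc n)) (sgap n + sgap (Suc n)) z"
    unfolding z_def using assms by (intro between_Phi) auto
  have "signed_len (Suc n) / signed_len n \<le> coord n z \<and> coord n z < 1"
  proof (cases "0 < sgap n")
    case True
    then have s: "0 < signed_len n" "sgap (Suc n) < 0" using signed_len_pos_iff sgap_Suc_sign by auto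
    have "Phi (sgap (Suc n)) c \<le> Phi (sgap n + sgap (Suc n)) c" "Phi (sgap n + sgap (Suc n)) c < Phi (sgap n) c"
      using True s by (auto simp: Phi_le_iff Phi_less_iff)
    then have "signed_len (Suc n) \<le> z - c" "z - c < signed_len n" using b unfolding between_def signed_len_def by auto
    then show ?thesis unfolding coord_def using s by (simp add: divide_right_mono)
  next
    case False
    then have "sgap n < 0" using sgap_nonzero[of n] by linarith
    then have s: "signed_len n < 0" "0 < sgap (Suc n)" using signed_len_neg_iff sgap_Suc_sign by auto
    have "Phi (sgap n + sgap (Suc n)) c \<le> Phi (sgap (Suc n)) c" "Phi (sgap n) c < Phi (sgap n + sgap (Suc n)) c"
      using \<open>sgap n < 0\<close> s by (auto simp: Phi_le_iff Phi_less_iff)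
    then have "z - c \<le> signed_len (Suc n)" "signed_len n < z - c" using b unfolding between_def signed_len_def by auto
    then show ?thesis unfolding coord_def using s by (simp add: divide_right_mono_neg)
  qed
  then show "signed_len (Suc n) / signed_len n \<le> coord n (Phi (sgap (Suc n)) y)" "coord n (Phi (sgap (Suc n)) y) < 1"
    unfolding z_def by auto
qed

lemma ren_right_eq:
  assumes "dyn n y"
  shows "ren_right f (proj c) a (Suc n) (coord n y) = coord n (Phi (sgap (Suc n)) y)"
proof -
  define l where "l = signed_len (Suc n) / signed_len n"
  have l: "l < 0" unfolding l_def by (rule signed_len_Suc_ratio_neg)
  have inj: "inj_on (cover n) {l..<1}"
    by (rule inj_onI, rule cover_inj) (auto simp: l_def[symmetric] abs_if)
  have mem: "coord n (Phi (sgap (Suc n)) y) \<in> {l..<1}" using right_range[OF assms] unfolding l_def by auto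
  show ?thesis
    unfolding ren_right_def ren_ratio_eq l_def[symmetric] diff_Suc_1 affine_cover_eq cover_crd proj_sgap
    by (rule the_inv_into_f_eq[OF inj _ mem]) (rule cover_crd)
qed

lemma coord_point: "coord n (c + signed_len n * t) = t"
  by (simp add: coord_def)

lemma dyn_Suc_iff: "dyn (Suc n) y \<longleftrightarrow> signed_len (Suc n) / signed_len n \<le> coord n y \<and> coord n y \<le> 0"
proof -
  define l where "l = signed_len (Suc n) / signed_len n"
  have l: "l < 0" unfolding l_def by (rule signed_len_Suc_ratio_neg)
  have "coord n y = l * coord (Suc n) y" unfolding l_def by (rule coord_Suc)
  then show ?thesis unfolding dyn_iff l_def[symmetric] using l
    by (auto simp: mult_le_0_iff mult_le_cancel_left1 mult_le_cancel_left2)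
qed

lemma ren_left_bounds:
  assumes "ren_ratio f (proj c) a (Suc n) \<le> t" "t \<le> 0"
  shows "0 \<le> ren_left f (proj c) a (Suc n) t" "ren_left f (proj c) a (Suc n) t \<le> 1"
proof -
  define y where "y = c + signed_len n * t"
  have y: "coord n y = t" unfolding y_def by (rule coord_point)
  then have d: "dyn (Suc n) y" using assms by (simp add: dyn_Suc_iff ren_ratio_eq)
  have "dyn n (Phi (sgap n) y)" using dyn_step[OF d a_pos] by simp
  then show "0 \<le> ren_left f (proj c) a (Suc n) t" "ren_left f (proj c) a (Suc n) t \<le> 1"
    using ren_left_eq[OF d] unfolding y dyn_iff by auto
qed

lemma ren_right_bounds:
  assumes "0 \<le> t" "t \<le> 1"
  shows "ren_ratio f (proj c) a (Suc n) \<le> ren_right f (proj c) a (Suc n) t" "ren_right f (proj c) a (Suc n) t \<le> 1"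
proof -
  define y where "y = c + signed_len n * t"
  have y: "coord n y = t" unfolding y_def by (rule coord_point)
  then have d: "dyn n y" using assms by (simp add: dyn_iff)
  show "ren_ratio f (proj c) a (Suc n) \<le> ren_right f (proj c) a (Suc n) t" "ren_right f (proj c) a (Suc n) t \<le> 1"
    using right_range[OF d] ren_right_eq[OF d] unfolding y ren_ratio_eq by auto
qed

definition lam_min :: real where "lam_min = 1 / (real_bound * real_bound * level_const)"

lemma lam_bounds: "0 < lam_min" "lam_min \<le> 1" "lam_min \<le> - (signed_len (Suc n) / signed_len n)" "- (signed_len (Suc n) / signed_len n) \<le> ratio_const"
proof -
  have 1: "1 \<le> real_bound * real_bound * level_const" using real_bound_ge_1 level_const_ge_1 by (intro mult_ge1_I) auto
  show "0 < lam_min" "lam_min \<le> 1" unfolding lam_min_def using 1 by auto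
  have "\<bar>signed_len n\<bar> \<le> real_bound * r n c" by (rule signed_len_r)
  also have "\<dots> \<le> real_bound * (level_const * r (Suc n) c)" using real_bound_ge_1 by (intro mult_left_mono r_le_Suc) auto
  also have "\<dots> \<le> real_bound * (level_const * (real_bound * \<bar>signed_len (Suc n)\<bar>))" using real_bound_ge_1 level_const_ge_1 by (intro mult_left_mono signed_len_r) auto
  finally have "\<bar>signed_len n\<bar> \<le> (real_bound * real_bound * level_const) * \<bar>signed_len (Suc n)\<bar>" by (simp add: mult_ac)
  then have "lam_min \<le> \<bar>signed_len (Suc n) / signed_len n\<bar>" unfolding lam_min_def using 1
    by (simp add: abs_divide field_simps)
  then show "lam_min \<le> - (signed_len (Suc n) / signed_len n)" using signed_len_Suc_ratio_neg[of n] by simp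
  show "- (signed_len (Suc n) / signed_len n) \<le> ratio_const" using signed_len_ratio[of n] by linarith
qed

end

section \<open>Closeness in the renormalization distance\<close>

definition frac_inv :: "real \<Rightarrow> real \<Rightarrow> real"
  where "frac_inv l z = l * (1 - 2 * z) / (1 - (1 + l) * z)"

lemma frac_inv_denom:
  fixes l z :: real
  assumes "\<beta> \<le> 1" "\<beta> \<le> - l" "0 \<le> z" "z \<le> 1" shows "\<beta> \<le> 1 - (1 + l) * z"
proof -
  have "\<beta> * (1 - z) \<le> 1 * (1 - z)" "\<beta> * z \<le> - l * z" using assms by (intro mult_right_mono; simp)+
  then show ?thesis by (simp add: algebra_simps)
qed

lemma frac_inv_denom_pos:
  fixes l z :: real
  assumes "l < 0" "0 \<le> z" "z \<le> 1" shows "0 < 1 - (1 + l) * z"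
proof -
  have "min 1 (- l) \<le> 1 - (1 + l) * z" by (rule frac_inv_denom) (use assms in auto)
  moreover have "0 < min 1 (- l)" using assms by simp
  ultimately show ?thesis by linarith
qed

lemma frac_lin_range:
  assumes "l < 0" "l \<le> y" "y \<le> 1"
  shows "0 \<le> frac_lin l y" "frac_lin l y \<le> 1" "y \<le> 0 \<Longrightarrow> frac_lin l y \<le> 1 / 2" "0 \<le> y \<Longrightarrow> 1 / 2 \<le> frac_lin l y"
proof -
  define N where "N = (1 + l) * y - 2 * l"
  have N: "0 < N" unfolding N_def using frac_lin_denom_pos[of l y] assms by simp
  have eq: "frac_lin l y = (y - l) / N" by (simp add: frac_lin_def N_def)
  have "0 \<le> - l * (1 - y)" using assms by (intro mult_nonneg_nonneg) auto
  then have "y - l \<le> N" by (simp add: N_def algebra_simps)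
  then show "0 \<le> frac_lin l y" "frac_lin l y \<le> 1" unfolding eq using N assms by auto
  have half: "N - 2 * (y - l) = (l - 1) * y" by (simp add: N_def algebra_simps)
  show "frac_lin l y \<le> 1 / 2" if "y \<le> 0"
  proof -
    have "0 \<le> (l - 1) * y" using assms that by (intro mult_nonpos_nonpos) auto
    then show ?thesis unfolding eq using N half by (simp add: pos_divide_le_eq)
  qed
  show "1 / 2 \<le> frac_lin l y" if "0 \<le> y"
  proof -
    have "(l - 1) * y \<le> 0" using assms that by (intro mult_nonpos_nonneg) auto
    then show ?thesis unfolding eq using N half by (simp add: pos_le_divide_eq)
  qed
qed

lemma frac_inv_lin:
  assumes "l < 0" "l \<le> y" "y \<le> 1" shows "frac_inv l (frac_lin l y) = y"
proof -
  define N where "N = (1 + l) * y - 2 * l"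
  have N: "0 < N" unfolding N_def using frac_lin_denom_pos[of l y] assms by simp
  have "1 - 2 * ((y - l) / N) = (l - 1) * y / N" "1 - (1 + l) * ((y - l) / N) = l * (l - 1) / N"
    using N by (simp_all add: N_def field_simps)
  then have "frac_inv l (frac_lin l y) = l * ((l - 1) * y / N) / (l * (l - 1) / N)"
    by (simp add: frac_inv_def frac_lin_def N_def)
  then show ?thesis using N assms by simp
qed

lemma frac_lin_inv_eq:
  assumes "l < 0" "0 \<le> z" "z \<le> 1"
  shows "frac_lin l (frac_inv l z) = z" "l \<le> frac_inv l z" "frac_inv l z \<le> 1"
    "z \<le> 1 / 2 \<Longrightarrow> frac_inv l z \<le> 0" "1 / 2 \<le> z \<Longrightarrow> 0 \<le> frac_inv l z"
proof -
  define D where "D = 1 - (1 + l) * z"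
  have D: "0 < D" unfolding D_def by (rule frac_inv_denom_pos[OF assms])
  have eq: "frac_inv l z = l * (1 - 2 * z) / D" by (simp add: frac_inv_def D_def)
  have "frac_inv l z - l = l * z * (l - 1) / D" "(1 + l) * frac_inv l z - 2 * l = l * (l - 1) / D"
    unfolding eq using D by (simp_all add: D_def field_simps)
  then have "frac_lin l (frac_inv l z) = (l * z * (l - 1) / D) / (l * (l - 1) / D)" by (simp add: frac_lin_def)
  then show "frac_lin l (frac_inv l z) = z" using D assms by simp
  have "l * z \<le> z" using assms mult_nonpos_nonneg[of l z] by linarith
  then have "1 - 2 * z \<le> D" by (simp add: D_def algebra_simps)
  then have "l * D \<le> l * (1 - 2 * z)" using assms by (intro mult_left_mono_neg) auto
  then show "l \<le> frac_inv l z" unfolding eq using D by (simp add: pos_le_divide_eq)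
  have "(l - 1) * (1 - z) \<le> 0" using assms by (intro mult_nonpos_nonneg) auto
  then have "l * (1 - 2 * z) \<le> D" by (simp add: D_def algebra_simps)
  then show "frac_inv l z \<le> 1" unfolding eq using D by simp
  show "frac_inv l z \<le> 0" if "z \<le> 1 / 2"
    unfolding eq using D assms that by (intro divide_nonpos_pos mult_nonpos_nonneg) auto
  show "0 \<le> frac_inv l z" if "1 / 2 \<le> z"
    unfolding eq using D assms that by (intro divide_nonneg_pos mult_nonpos_nonpos) auto
qed

lemma frac_lin_inv_frac_inv:
  assumes "l < 0" "0 \<le> z" "z \<le> 1" shows "frac_lin_inv l z = frac_inv l z"
  unfolding frac_lin_inv_def
proof (rule the_inv_into_f_eq)
  show "inj_on (frac_lin l) {l..1}"
    by (rule inj_on_inverseI[of _ "frac_inv l"]) (use frac_inv_lin assms in auto)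
qed (use frac_lin_inv_eq[OF assms] in auto)

lemma frac_inv_diff_parameter:
  assumes "0 < \<beta>" "\<beta> \<le> 1" "\<beta> \<le> - l" "\<beta> \<le> - m" "0 \<le> z" "z \<le> 1"
  shows "\<bar>frac_inv l z - frac_inv m z\<bar> \<le> \<bar>l - m\<bar> / \<beta>\<^sup>2"
proof -
  define D E where "D = 1 - (1 + l) * z" and "E = 1 - (1 + m) * z"
  have DE: "\<beta> \<le> D" "\<beta> \<le> E" unfolding D_def E_def using assms by (auto intro!: frac_inv_denom)
  then have pos: "0 < D" "0 < E" using assms by auto
  have "l * E - m * D = (l - m) * (1 - z)" by (simp add: D_def E_def algebra_simps)
  then have "(1 - 2 * z) * (l * E - m * D) = (l - m) * ((1 - 2 * z) * (1 - z))" by simp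
  then have "frac_inv l z - frac_inv m z = (l - m) * ((1 - 2 * z) * (1 - z)) / (D * E)"
    unfolding frac_inv_def D_def[symmetric] E_def[symmetric] using pos
    by (simp add: diff_frac_eq algebra_simps)
  then have "\<bar>frac_inv l z - frac_inv m z\<bar> = \<bar>l - m\<bar> * (\<bar>1 - 2 * z\<bar> * \<bar>1 - z\<bar>) / (D * E)"
    using pos by (simp add: abs_mult)
  also have "\<dots> \<le> \<bar>l - m\<bar> * (1 * 1) / (\<beta> * \<beta>)"
    using assms DE pos by (intro frac_le mult_left_mono mult_mono mult_nonneg_nonneg mult_pos_pos) auto
  finally show ?thesis by (simp add: power2_eq_square)
qed

lemma frac_inv_lipschitz:
  assumes "0 < \<beta>" "\<beta> \<le> 1" "\<beta> \<le> - m" "- m \<le> \<Lambda>" "0 \<le> u" "u \<le> 1" "0 \<le> v" "v \<le> 1"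
  shows "\<bar>frac_inv m u - frac_inv m v\<bar> \<le> \<Lambda> * (\<Lambda> + 1) / \<beta>\<^sup>2 * \<bar>u - v\<bar>"
proof -
  define D E where "D = 1 - (1 + m) * u" and "E = 1 - (1 + m) * v"
  have DE: "\<beta> \<le> D" "\<beta> \<le> E" unfolding D_def E_def using assms by (auto intro!: frac_inv_denom)
  then have pos: "0 < D" "0 < E" using assms by auto
  have "m * (1 - 2 * u) * E - m * (1 - 2 * v) * D = m * (m - 1) * (u - v)" by (simp add: D_def E_def algebra_simps)
  then have "frac_inv m u - frac_inv m v = m * (m - 1) * (u - v) / (D * E)"
    unfolding frac_inv_def D_def[symmetric] E_def[symmetric] using pos by (simp add: diff_frac_eq)
  then have "\<bar>frac_inv m u - frac_inv m v\<bar> = (\<bar>m\<bar> * \<bar>m - 1\<bar>) * \<bar>u - v\<bar> / (D * E)"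
    using pos by (simp add: abs_mult)
  also have "\<dots> \<le> (\<Lambda> * (\<Lambda> + 1)) * \<bar>u - v\<bar> / (\<beta> * \<beta>)"
    using assms DE pos by (intro frac_le mult_right_mono mult_mono mult_nonneg_nonneg mult_pos_pos) auto
  finally show ?thesis by (simp add: power2_eq_square)
qed

lemma cSUP_upper_bounded:
  fixes \<psi> :: "real \<Rightarrow> real"
  assumes "x \<in> S" "\<And>z. z \<in> S \<Longrightarrow> \<psi> z \<le> M" shows "\<psi> x \<le> (SUP z\<in>S. \<psi> z)"
  by (rule cSUP_upper[OF assms(1)]) (use assms(2) in \<open>auto simp: bdd_above_def\<close>)

text \<open>The distance compares both maps after the fractional linear changes of coordinates;
  undoing them moves the base point and costs a constant factor as long as the two ratios
  stay in a compact set.\<close>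

lemma dist0_close:
  assumes \<beta>: "0 < \<beta>" "\<beta> \<le> 1" "\<beta> \<le> - l" "\<beta> \<le> - m" and \<Lambda>: "- m \<le> \<Lambda>" "0 \<le> \<Lambda>"
    and fl: "\<And>t. l \<le> t \<Longrightarrow> t \<le> 0 \<Longrightarrow> l \<le> fl t \<and> fl t \<le> 1" and fr: "\<And>t. 0 \<le> t \<Longrightarrow> t \<le> 1 \<Longrightarrow> l \<le> fr t \<and> fr t \<le> 1"
    and gl: "\<And>t. m \<le> t \<Longrightarrow> t \<le> 0 \<Longrightarrow> m \<le> gl t \<and> gl t \<le> 1" and gr: "\<And>t. 0 \<le> t \<Longrightarrow> t \<le> 1 \<Longrightarrow> m \<le> gr t \<and> gr t \<le> 1"
    and dist: "dist0 (l, fl, fr) (m, gl, gr) \<le> D"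
    and C: "C = 1 + 1 / \<beta>\<^sup>2 + \<Lambda> * (\<Lambda> + 1) / \<beta>\<^sup>2"
  shows "\<bar>l - m\<bar> \<le> C * D"
    and "\<And>t. l \<le> t \<Longrightarrow> t \<le> 0 \<Longrightarrow> \<exists>t'. m \<le> t' \<and> t' \<le> 0 \<and> \<bar>t - t'\<bar> \<le> C * D \<and> \<bar>fl t - gl t'\<bar> \<le> C * D"
    and "\<And>t. 0 \<le> t \<Longrightarrow> t \<le> 1 \<Longrightarrow> \<exists>t'. 0 \<le> t' \<and> t' \<le> 1 \<and> \<bar>t - t'\<bar> \<le> C * D \<and> \<bar>fr t - gr t'\<bar> \<le> C * D"
proof -
  have neg: "l < 0" "m < 0" using \<beta> by auto
  define dl where "dl x = \<bar>frac_lin l (fl (frac_lin_inv l x)) - frac_lin m (gl (frac_lin_inv m x))\<bar>" for x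
  define dr where "dr x = \<bar>frac_lin l (fr (frac_lin_inv l x)) - frac_lin m (gr (frac_lin_inv m x))\<bar>" for x
  have lm: "\<bar>l - m\<bar> \<le> D" and sl: "(SUP x\<in>{0..1/2}. dl x) \<le> D" and sr: "(SUP x\<in>{1/2..1}. dr x) \<le> D"
    using dist unfolding dl_def dr_def by simp_all
  have D: "0 \<le> D" using lm by linarith
  have fl': "l \<le> fl (frac_lin_inv l x) \<and> fl (frac_lin_inv l x) \<le> 1"
    and gl': "m \<le> gl (frac_lin_inv m x) \<and> gl (frac_lin_inv m x) \<le> 1" if "x \<in> {0..1/2}" for x
    using that frac_lin_inv_eq(2,4)[of l x] frac_lin_inv_eq(2,4)[of m x] neg fl gl
    by (simp_all add: frac_lin_inv_frac_inv)
  have fr': "l \<le> fr (frac_lin_inv l x) \<and> fr (frac_lin_inv l x) \<le> 1"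
    and gr': "m \<le> gr (frac_lin_inv m x) \<and> gr (frac_lin_inv m x) \<le> 1" if "x \<in> {1/2..1}" for x
    using that frac_lin_inv_eq(3,5)[of l x] frac_lin_inv_eq(3,5)[of m x] neg fr gr
    by (simp_all add: frac_lin_inv_frac_inv)
  have unit: "\<bar>u - v\<bar> \<le> 1" if "0 \<le> u" "u \<le> 1" "0 \<le> v" "v \<le> 1" for u v :: real using that by linarith
  have dl_le: "dl x \<le> D" if "x \<in> {0..1/2}" for x
  proof -
    have "dl x \<le> (SUP x\<in>{0..1/2}. dl x)"
      by (rule cSUP_upper_bounded[OF that, of dl 1], unfold dl_def, intro unit frac_lin_range(1,2))
         (use neg fl' gl' in auto)
    then show ?thesis using sl by linarith
  qed
  have dr_le: "dr x \<le> D" if "x \<in> {1/2..1}" for x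
  proof -
    have "dr x \<le> (SUP x\<in>{1/2..1}. dr x)"
      by (rule cSUP_upper_bounded[OF that, of dr 1], unfold dr_def, intro unit frac_lin_range(1,2))
         (use neg fr' gr' in auto)
    then show ?thesis using sr by linarith
  qed
  have terms: "0 \<le> 1 / \<beta>\<^sup>2" "0 \<le> \<Lambda> * (\<Lambda> + 1) / \<beta>\<^sup>2" using \<Lambda> by auto
  have C1: "1 \<le> C" "1 / \<beta>\<^sup>2 \<le> C" using terms unfolding C by linarith+
  have close_const: "D \<le> C * D" using mult_right_mono[OF C1(1) D] by simp
  then show "\<bar>l - m\<bar> \<le> C * D" using lm by linarith
  have par: "\<bar>frac_inv l z - frac_inv m z\<bar> \<le> 1 / \<beta>\<^sup>2 * D" if "0 \<le> z" "z \<le> 1" for z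
  proof -
    have "\<bar>frac_inv l z - frac_inv m z\<bar> \<le> \<bar>l - m\<bar> / \<beta>\<^sup>2" by (rule frac_inv_diff_parameter) (use \<beta> that in auto)
    also have "\<dots> \<le> D / \<beta>\<^sup>2" using lm by (intro divide_right_mono) auto
    finally show ?thesis by simp
  qed
  have par': "\<bar>frac_inv l z - frac_inv m z\<bar> \<le> C * D" if "0 \<le> z" "z \<le> 1" for z
    using par[OF that] mult_right_mono[OF C1(2) D] by linarith
  have val_close: "\<bar>y - y'\<bar> \<le> C * D"
    if y: "l \<le> y" "y \<le> 1" "m \<le> y'" "y' \<le> 1" "\<bar>frac_lin l y - frac_lin m y'\<bar> \<le> D" for y y'
  proof -
    define u v where "u = frac_lin l y" and "v = frac_lin m y'"
    have uv: "0 \<le> u" "u \<le> 1" "0 \<le> v" "v \<le> 1" unfolding u_def v_def using frac_lin_range(1,2) neg y by auto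
    have yu: "y = frac_inv l u" "y' = frac_inv m v" unfolding u_def v_def using frac_inv_lin neg y by auto
    have "\<bar>frac_inv m u - frac_inv m v\<bar> \<le> \<Lambda> * (\<Lambda> + 1) / \<beta>\<^sup>2 * \<bar>u - v\<bar>"
      by (rule frac_inv_lipschitz) (use \<beta> \<Lambda> uv in auto)
    also have "\<dots> \<le> \<Lambda> * (\<Lambda> + 1) / \<beta>\<^sup>2 * D" using y(5) terms unfolding u_def v_def by (intro mult_left_mono) auto
    finally have "\<bar>y - y'\<bar> \<le> 1 / \<beta>\<^sup>2 * D + \<Lambda> * (\<Lambda> + 1) / \<beta>\<^sup>2 * D"
      using par[OF uv(1,2)] unfolding yu by linarith
    also have "\<dots> \<le> C * D" using D unfolding C by (simp add: distrib_right)
    finally show ?thesis .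
  qed
  show "\<exists>t'. m \<le> t' \<and> t' \<le> 0 \<and> \<bar>t - t'\<bar> \<le> C * D \<and> \<bar>fl t - gl t'\<bar> \<le> C * D" if t: "l \<le> t" "t \<le> 0" for t
  proof -
    define z where "z = frac_lin l t"
    have z: "0 \<le> z" "z \<le> 1 / 2" unfolding z_def using frac_lin_range[of l t] neg t by auto
    have tz: "t = frac_inv l z" unfolding z_def using frac_inv_lin neg t by auto
    define t' where "t' = frac_inv m z"
    have t': "m \<le> t'" "t' \<le> 0" unfolding t'_def using frac_lin_inv_eq(2,4)[of m z] neg z by auto
    have "\<bar>frac_lin l (fl t) - frac_lin m (gl t')\<bar> \<le> D"
      using dl_le[of z] z neg unfolding dl_def by (simp add: frac_lin_inv_frac_inv tz t'_def)
    then have "\<bar>fl t - gl t'\<bar> \<le> C * D" using fl t gl t' by (intro val_close) auto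
    moreover have "\<bar>t - t'\<bar> \<le> C * D" unfolding tz t'_def using z by (intro par') auto
    ultimately show ?thesis using t' by blast
  qed
  show "\<exists>t'. 0 \<le> t' \<and> t' \<le> 1 \<and> \<bar>t - t'\<bar> \<le> C * D \<and> \<bar>fr t - gr t'\<bar> \<le> C * D" if t: "0 \<le> t" "t \<le> 1" for t
  proof -
    define z where "z = frac_lin l t"
    have z: "1 / 2 \<le> z" "z \<le> 1" unfolding z_def using frac_lin_range[of l t] neg t by auto
    have tz: "t = frac_inv l z" unfolding z_def using frac_inv_lin neg t by auto
    define t' where "t' = frac_inv m z"
    have t': "0 \<le> t'" "t' \<le> 1" unfolding t'_def using frac_lin_inv_eq(3,5)[of m z] neg z by auto
    have "\<bar>frac_lin l (fr t) - frac_lin m (gr t')\<bar> \<le> D"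
      using dr_le[of z] z neg unfolding dr_def by (simp add: frac_lin_inv_frac_inv tz t'_def)
    then have "\<bar>fr t - gr t'\<bar> \<le> C * D" using fr t gr t' by (intro val_close) auto
    moreover have "\<bar>t - t'\<bar> \<le> C * D" unfolding tz t'_def using z by (intro par') auto
    ultimately show ?thesis using t' by blast
  qed
qed

lemma asymptotic_pair_exists:
  assumes f: "critical_circle_lift a \<rho> F F' cf Kf ef \<delta>f B f" and g: "critical_circle_lift a \<rho> G G' cg Kg eg \<delta>g B g"
    and H: "continuous_on UNIV H" "strict_mono H" "\<And>x. H (x + 1) = H x + 1" "\<And>x. H (F x) = G (H x)" "H cf = cg"
    and C: "0 < C" and \<theta>: "0 < \<theta>" "\<theta> < 1"
    and dist: "\<And>n. 1 \<le> n \<Longrightarrow> dist0 (renormalization f (proj cf) a n) (renormalization g (proj cg) a n) \<le> C * \<theta> ^ n"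
  obtains C\<^sub>0 where "asymptotic_pair a \<rho> F F' cf Kf ef \<delta>f B G G' cg Kg eg \<delta>g H C\<^sub>0 \<theta>"
proof -
  interpret f: critical_circle_lift a \<rho> F F' cf Kf ef \<delta>f B f by fact
  interpret g: critical_circle_lift a \<rho> G G' cg Kg eg \<delta>g B g by fact
  define \<beta> where "\<beta> = min f.lam_min g.lam_min"
  define A where "A = 1 + 1 / \<beta>\<^sup>2 + g.ratio_const * (g.ratio_const + 1) / \<beta>\<^sup>2"
  have \<beta>: "0 < \<beta>" "\<beta> \<le> 1" "\<beta> \<le> f.lam_min" "\<beta> \<le> g.lam_min"
    using f.lam_bounds g.lam_bounds by (auto simp: \<beta>_def)
  have A: "1 \<le> A" unfolding A_def using g.ratio_const_ge_1 by simp
  define C\<^sub>0 where "C\<^sub>0 = A * C"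
  have C\<^sub>0: "0 < C\<^sub>0" unfolding C\<^sub>0_def using A C by simp
  define lf where "lf n = f.signed_len (Suc n) / f.signed_len n" for n
  define lg where "lg n = g.signed_len (Suc n) / g.signed_len n" for n
  have lf_neg: "lf n < 0" and lg_neg: "lg n < 0" for n
    unfolding lf_def lg_def by (rule f.signed_len_Suc_ratio_neg, rule g.signed_len_Suc_ratio_neg)
  have bounds: "\<beta> \<le> - lf n" "\<beta> \<le> - lg n" "- lg n \<le> g.ratio_const" for n
    unfolding lf_def lg_def using \<beta> f.lam_bounds(3)[of n] g.lam_bounds(3,4)[of n] by linarith+
  have d: "dist0 (lf n, ren_left f (proj cf) a (Suc n), ren_right f (proj cf) a (Suc n))
      (lg n, ren_left g (proj cg) a (Suc n), ren_right g (proj cg) a (Suc n)) \<le> C * \<theta> ^ n" for n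
  proof -
    have "dist0 (lf n, ren_left f (proj cf) a (Suc n), ren_right f (proj cf) a (Suc n))
      (lg n, ren_left g (proj cg) a (Suc n), ren_right g (proj cg) a (Suc n)) \<le> C * \<theta> ^ Suc n"
      using dist[of "Suc n"] unfolding renormalization_def f.ren_ratio_eq g.ren_ratio_eq lf_def lg_def by simp
    also have "\<dots> \<le> C * \<theta> ^ n" using C \<theta> by (intro mult_left_mono power_decreasing) auto
    finally show ?thesis .
  qed
  have fl: "lf n \<le> ren_left f (proj cf) a (Suc n) t \<and> ren_left f (proj cf) a (Suc n) t \<le> 1" if "lf n \<le> t" "t \<le> 0" for n t
    using f.ren_left_bounds[of n t] that lf_neg[of n] unfolding f.ren_ratio_eq lf_def[symmetric] by auto
  have gl: "lg n \<le> ren_left g (proj cg) a (Suc n) t \<and> ren_left g (proj cg) a (Suc n) t \<le> 1" if "lg n \<le> t" "t \<le> 0" for n t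
    using g.ren_left_bounds[of n t] that lg_neg[of n] unfolding g.ren_ratio_eq lg_def[symmetric] by auto
  have fr: "lf n \<le> ren_right f (proj cf) a (Suc n) t \<and> ren_right f (proj cf) a (Suc n) t \<le> 1" if "0 \<le> t" "t \<le> 1" for n t
    using f.ren_right_bounds[OF that, of n] unfolding f.ren_ratio_eq lf_def[symmetric] by auto
  have gr: "lg n \<le> ren_right g (proj cg) a (Suc n) t \<and> ren_right g (proj cg) a (Suc n) t \<le> 1" if "0 \<le> t" "t \<le> 1" for n t
    using g.ren_right_bounds[OF that, of n] unfolding g.ren_ratio_eq lg_def[symmetric] by auto
  have Lam0: "0 \<le> g.ratio_const" using g.ratio_const_ge_1 by simp
  have scale: "A * (C * \<theta> ^ n) = C\<^sub>0 * \<theta> ^ n" for n by (simp add: C\<^sub>0_def)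
  have close1: "\<bar>lf n - lg n\<bar> \<le> C\<^sub>0 * \<theta> ^ n" for n
    unfolding scale[symmetric]
    by (rule dist0_close(1)[OF \<beta>(1,2) bounds Lam0 _ _ _ _ d A_def]) (use fl fr gl gr in auto)
  have close2: "\<exists>t'. lg n \<le> t' \<and> t' \<le> 0 \<and> \<bar>t - t'\<bar> \<le> C\<^sub>0 * \<theta> ^ n \<and>
      \<bar>ren_left f (proj cf) a (Suc n) t - ren_left g (proj cg) a (Suc n) t'\<bar> \<le> C\<^sub>0 * \<theta> ^ n"
    if "lf n \<le> t" "t \<le> 0" for n t
    unfolding scale[symmetric]
    by (rule dist0_close(2)[OF \<beta>(1,2) bounds Lam0 _ _ _ _ d A_def]) (use fl fr gl gr that in auto)
  have close3: "\<exists>t'. 0 \<le> t' \<and> t' \<le> 1 \<and> \<bar>t - t'\<bar> \<le> C\<^sub>0 * \<theta> ^ n \<and>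
      \<bar>ren_right f (proj cf) a (Suc n) t - ren_right g (proj cg) a (Suc n) t'\<bar> \<le> C\<^sub>0 * \<theta> ^ n"
    if "0 \<le> t" "t \<le> 1" for n t
    unfolding scale[symmetric]
    by (rule dist0_close(3)[OF \<beta>(1,2) bounds Lam0 _ _ _ _ d A_def]) (use fl fr gl gr that in auto)
  have "asymptotic_pair a \<rho> F F' cf Kf ef \<delta>f B G G' cg Kg eg \<delta>g H C\<^sub>0 \<theta>"
  proof unfold_locales
    show "continuous_on UNIV H" "strict_mono H" "H cf = cg" "0 < C\<^sub>0" "0 < \<theta>" "\<theta> < 1" by fact+
    show "H (x + 1) = H x + 1" "H (F x) = G (H x)" for x by fact+
    show "\<bar>f.signed_len (Suc n) / f.signed_len n - g.signed_len (Suc n) / g.signed_len n\<bar> \<le> C\<^sub>0 * \<theta> ^ n" for n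
      using close1[of n] unfolding lf_def lg_def .
    show "\<exists>y. g.dyn (Suc n) y \<and> \<bar>f.coord n x - g.coord n y\<bar> \<le> C\<^sub>0 * \<theta> ^ n \<and>
      \<bar>f.coord n (f.Phi (f.sgap n) x) - g.coord n (g.Phi (f.sgap n) y)\<bar> \<le> C\<^sub>0 * \<theta> ^ n" if x: "f.dyn (Suc n) x" for n x
    proof -
      have "lf n \<le> f.coord n x" "f.coord n x \<le> 0" using x unfolding f.dyn_Suc_iff lf_def by auto
      from close2[OF this] obtain t' where t': "lg n \<le> t'" "t' \<le> 0" "\<bar>f.coord n x - t'\<bar> \<le> C\<^sub>0 * \<theta> ^ n"
        "\<bar>ren_left f (proj cf) a (Suc n) (f.coord n x) - ren_left g (proj cg) a (Suc n) t'\<bar> \<le> C\<^sub>0 * \<theta> ^ n"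
        by blast
      define y where "y = cg + g.signed_len n * t'"
      have y: "g.coord n y = t'" unfolding y_def by (rule g.coord_point)
      have dy: "g.dyn (Suc n) y" unfolding g.dyn_Suc_iff y lg_def[symmetric] using t' by simp
      show ?thesis using t' dy f.ren_left_eq[OF x] g.ren_left_eq[OF dy] unfolding y by (metis y)
    qed
    show "\<exists>y. g.dyn n y \<and> \<bar>f.coord n x - g.coord n y\<bar> \<le> C\<^sub>0 * \<theta> ^ n \<and>
      \<bar>f.coord n (f.Phi (f.sgap (Suc n)) x) - g.coord n (g.Phi (f.sgap (Suc n)) y)\<bar> \<le> C\<^sub>0 * \<theta> ^ n" if x: "f.dyn n x" for n x
    proof -
      have "0 \<le> f.coord n x" "f.coord n x \<le> 1" using x unfolding f.dyn_iff by auto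
      from close3[OF this] obtain t' where t': "0 \<le> t'" "t' \<le> 1" "\<bar>f.coord n x - t'\<bar> \<le> C\<^sub>0 * \<theta> ^ n"
        "\<bar>ren_right f (proj cf) a (Suc n) (f.coord n x) - ren_right g (proj cg) a (Suc n) t'\<bar> \<le> C\<^sub>0 * \<theta> ^ n"
        by blast
      define y where "y = cg + g.signed_len n * t'"
      have y: "g.coord n y = t'" unfolding y_def by (rule g.coord_point)
      have dy: "g.dyn n y" unfolding g.dyn_iff y using t' by simp
      show ?thesis using t' dy f.ren_right_eq[OF x] g.ren_right_eq[OF dy] unfolding y by (metis y)
    qed
  qed
  then show ?thesis by (rule that)
qed

theorem mainTheorem1:
  fixes f g h :: "circle \<Rightarrow> circle" and c\<^sub>f c\<^sub>g :: circle
    and \<rho> :: real and a :: "nat \<Rightarrow> nat"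
  assumes "critical_circle_map 3 f c\<^sub>f" and "critical_circle_map 3 g c\<^sub>g"
    and "has_rotation_number f \<rho>" and "has_rotation_number g \<rho>" and "\<rho> \<notin> \<rat>"
    and "homeo h" and "h \<circ> f = g \<circ> h" and "h c\<^sub>f = c\<^sub>g"
    and "is_continued_fraction a \<rho>" and "\<exists>B. \<forall>n. a n \<le> B"
    and "\<exists>C>0. \<exists>\<theta>. 0 < \<theta> \<and> \<theta> < 1 \<and>
      (\<forall>n\<ge>1. dist0 (renormalization f c\<^sub>f a n) (renormalization g c\<^sub>g a n) \<le> C * \<theta> ^ n)"
  shows "\<exists>\<alpha>>0. C1_Holder \<alpha> h"
proof -
  obtain B where B: "\<And>n. a n \<le> B" using assms(10) by blast
  obtain C \<theta> where C: "0 < C" "0 < \<theta>" "\<theta> < 1"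
    "\<And>n. 1 \<le> n \<Longrightarrow> dist0 (renormalization f c\<^sub>f a n) (renormalization g c\<^sub>g a n) \<le> C * \<theta> ^ n"
    using assms(11) by blast
  obtain F where F: "is_lift F f" "circle_lift a \<rho> F"
    "\<And>c. proj c = c\<^sub>f \<Longrightarrow> \<exists>K e \<delta>. critical_lift a \<rho> F (deriv F) c K e \<delta> B"
    using critical_circle_map_lift[OF assms(1,3,5,9) B] by blast
  obtain G where G: "is_lift G g" "circle_lift a \<rho> G"
    "\<And>c. proj c = c\<^sub>g \<Longrightarrow> \<exists>K e \<delta>. critical_lift a \<rho> G (deriv G) c K e \<delta> B"
    using critical_circle_map_lift[OF assms(2,4,5,9) B] by blast
  obtain H where H: "is_lift H h" "strict_mono H" "\<And>x. H (x + 1) = H x + 1" "\<And>x. H (F x) = G (H x)"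
    using conjugacy_lift[OF F(2,1) G(2,1) assms(6,7)] by blast
  define x where "x = rep_circle c\<^sub>f"
  have x: "proj x = c\<^sub>f" "proj (H x) = c\<^sub>g"
    using lift_proj[OF H(1), of x] assms(8) by (simp_all add: x_def proj_rep)
  obtain Kf ef \<delta>f where f: "critical_lift a \<rho> F (deriv F) x Kf ef \<delta>f B" using F(3)[OF x(1)] by blast
  obtain Kg eg \<delta>g where g: "critical_lift a \<rho> G (deriv G) (H x) Kg eg \<delta>g B" using G(3)[OF x(2)] by blast
  have f': "critical_circle_lift a \<rho> F (deriv F) x Kf ef \<delta>f B f"
    using f F(1) by (simp add: critical_circle_lift_def critical_circle_lift_axioms_def)
  have g': "critical_circle_lift a \<rho> G (deriv G) (H x) Kg eg \<delta>g B g"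
    using g G(1) by (simp add: critical_circle_lift_def critical_circle_lift_axioms_def)
  have C': "dist0 (renormalization f (proj x) a n) (renormalization g (proj (H x)) a n) \<le> C * \<theta> ^ n" if "1 \<le> n" for n
    using C(4)[OF that] unfolding x .
  obtain C\<^sub>0 where "asymptotic_pair a \<rho> F (deriv F) x Kf ef \<delta>f B G (deriv G) (H x) Kg eg \<delta>g H C\<^sub>0 \<theta>"
    using asymptotic_pair_exists[OF f' g' lift_cont[OF H(1)] H(2-4) refl C(1-3) C'] by blast
  then interpret asymptotic_pair a \<rho> F "deriv F" x Kf ef \<delta>f B G "deriv G" "H x" Kg eg \<delta>g H C\<^sub>0 \<theta> .
  obtain \<alpha> D K where D: "0 < \<alpha>" "\<And>x. (H has_real_derivative D x) (at x)"
    "\<And>x y. \<bar>D x - D y\<bar> \<le> K * \<bar>x - y\<bar> powr \<alpha>" using H_holder_derivative by blast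
  have deriv: "deriv H = D" using D(2) DERIV_imp_deriv by blast
  have "isCont D y" for y
    unfolding isCont_def
  proof (rule LIM_zero_cancel, rule Lim_null_comparison)
    show "\<forall>\<^sub>F z in at y. norm (D z - D y) \<le> K * \<bar>z - y\<bar> powr \<alpha>" using D(3) by simp
    have "((\<lambda>z. K * \<bar>z - y\<bar> powr \<alpha>) \<longlongrightarrow> K * \<bar>y - y\<bar> powr \<alpha>) (at y)"
      by (intro tendsto_mult tendsto_const tendsto_powr' tendsto_intros) (use D(1) in auto)
    then show "((\<lambda>z. K * \<bar>z - y\<bar> powr \<alpha>) \<longlongrightarrow> 0) (at y)" using D(1) by simp
  qed
  then have "continuous_on UNIV (deriv H)" unfolding deriv by (simp add: continuous_at_imp_continuous_on)
  then have "C_diff_on 1 H UNIV"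
    unfolding C_diff_on_def using D(2) by (auto simp: field_differentiable_def)
  then have "C1_Holder \<alpha> h"
    unfolding C1_Holder_def using H(1) D(3) deriv by auto
  then show ?thesis using D(1) by blast
qed

end
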